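(* If $D$ and $D'$ are connected oriented planar diagrams of the same oriented link, then there exist $l,m\in\mathbb{Z}$ and a sign $\epsilon\in\{1,-1\}$ such that $\Delta(D')=\epsilon\, x^l y^m\,\Delta(D)$. That is, up to a multiple of $\pm x^l y^m$, $\Delta(D)$ is a link invariant.
   Context: Let $D$ be an oriented link diagram in the plane, connected as a planar curve; it divides the plane into regions (connected components of the complement of the underlying curve). Assign a generator to each region. Each crossing of $D$ has four corners, cut out by the over-strand and the under-strand; let $a$ be the generator of the region at the corner lying to the left of the oriented over-strand and to the right of the oriented under-strand, $b$ the one left of the over-strand and left of the under-strand, $c$ the one right of the over-strand and left of the under-strand, and $d$ the one right of the over-strand and right of the under-strand (two corners may belong to the same region). The crossing contributes the relation $a+xb+xyc+yd=0$. The presentation matrix $M(D)$ is the matrix over $\mathbb{Z}[x,x^{-1},y,y^{-1}]$ with one column for each region and one row for each crossing (in any chosen orders), whose entry in a given row and column is the coefficient of that region's generator in that crossing's relation; coefficients are added if a region occupies several corners at the crossing. If $D$ has $n$ crossings, $M(D)$ is an $n\times(n+2)$ matrix, so it has $(n+1)(n+2)/2$ square submatrices of size $n\times n$ obtained by deleting two columns. $\Delta(D)$ denotes the greatest common divisor, in $\mathbb{Z}[x,x^{-1},y,y^{-1}]$, of the determinants of these submatrices; it is defined up to multiplication by units $\pm x^l y^m$ (the gcd is $0$ if all these determinants are $0$, and the determinant of a $0\times 0$ matrix is $1$). *)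

theory Defs
  imports
    "HOL-Analysis.Analysis"
    "HOL-Library.Poly_Mapping"
    "HOL-Library.Product_Plus"
    "Jordan_Normal_Form.Determinant"
    "Jordan_Normal_Form.DL_Submatrix"
begin

section \<open>Laurent polynomials\<close>

text \<open>
  Finitely supported functions on \<open>\<int> \<times> \<int>\<close> with the convolution product, i.e. the group ring
  \<open>\<int>[\<int> \<times> \<int>] = \<int>[x, x\<inverse>, y, y\<inverse>]\<close>; the exponent pair \<open>(l, m)\<close> stands for \<open>x\<^sup>l y\<^sup>m\<close>.
\<close>

type_synonym laurent = "(int \<times> int) \<Rightarrow>\<^sub>0 int"

definition laurent_monom :: "int \<Rightarrow> int \<Rightarrow> laurent" where
  "laurent_monom l m = Poly_Mapping.single (l, m) 1"

abbreviation x_gen :: laurent where "x_gen \<equiv> laurent_monom 1 0"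
abbreviation y_gen :: laurent where "y_gen \<equiv> laurent_monom 0 1"

definition is_gcd_of :: "'a::comm_semiring_1 set \<Rightarrow> 'a \<Rightarrow> bool" where
  "is_gcd_of S g \<longleftrightarrow> (\<forall>s\<in>S. g dvd s) \<and> (\<forall>h. (\<forall>s\<in>S. h dvd s) \<longrightarrow> h dvd g)"


section \<open>Oriented polygonal links\<close>

text \<open>
  An edge \<open>(a, b)\<close> is the segment from \<open>a\<close> to \<open>b\<close>, oriented in this direction. A finite family of
  oriented closed polygons is given by the set of its edges.
\<close>

type_synonym 'a edge = "'a \<times> 'a"

definition ends :: "'a edge \<Rightarrow> 'a set" where
  "ends e = {fst e, snd e}"

definition seg :: "'a::real_vector edge \<Rightarrow> 'a set" where
  "seg e = closed_segment (fst e) (snd e)"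

definition carrier_of :: "'a::real_vector edge set \<Rightarrow> 'a set" where
  "carrier_of E = (\<Union>e\<in>E. seg e)"

definition closed_polygons :: "'a edge set \<Rightarrow> bool" where
  "closed_polygons E \<longleftrightarrow> finite E \<and> E \<noteq> {} \<and>
     (\<forall>(a, b)\<in>E. a \<noteq> b \<and> (\<exists>!c. (b, c) \<in> E) \<and> (\<exists>!c. (c, a) \<in> E))"

text \<open>
  Space is \<open>\<complex> \<times> \<real>\<close>, the second component being the height above the plane of projection \<open>\<complex>\<close>.
\<close>

type_synonym space = "complex \<times> real"
type_synonym link = "space edge set"

definition oriented_link :: "link \<Rightarrow> bool" where
  "oriented_link L \<longleftrightarrow> closed_polygons L \<and>
     (\<forall>e\<in>L. \<forall>f\<in>L. e \<noteq> f \<longrightarrow> seg e \<inter> seg f \<subseteq> ends e \<inter> ends f)"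

text \<open>
  Replace an edge \<open>AB\<close> by \<open>AC\<close>, \<open>CB\<close>, if the triangle \<open>ABC\<close> meets the link in \<open>AB\<close> only.
  The triangle may be degenerate with \<open>C\<close> between \<open>A\<close> and \<open>B\<close> (subdivision of an edge).
\<close>

definition delta_move :: "link \<Rightarrow> link \<Rightarrow> bool" where
  "delta_move L L' \<longleftrightarrow> oriented_link L \<and> oriented_link L' \<and>
     (\<exists>A B C. (A, B) \<in> L \<and>
        convex hull {A, B, C} \<inter> carrier_of L = closed_segment A B \<and>
        L' = (L - {(A, B)}) \<union> {(A, C), (C, B)})"

text \<open>
  Isotopy of oriented polygonal links in the sense of Reidemeister: two such sets of edges
  represent the same oriented link iff they are joined by triangle moves and their inverses.
\<close>

definition same_oriented_link :: "link \<Rightarrow> link \<Rightarrow> bool" where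
  "same_oriented_link L L' \<longleftrightarrow>
     oriented_link L \<and> oriented_link L' \<and> equivclp delta_move L L'"


section \<open>Oriented link diagrams\<close>

text \<open>
  The second component consists of the crossings, each recorded as the pair of the edge
  containing the over-strand and the edge containing the under-strand.
\<close>

datatype diagram = Diagram (strands: "complex edge set") (crossings: "(complex edge \<times> complex edge) set")

definition cross :: "complex edge \<Rightarrow> complex edge \<Rightarrow> bool" where
  "cross e f \<longleftrightarrow> (\<exists>p. seg e \<inter> seg f = {p} \<and> p \<notin> ends e \<union> ends f)"

text \<open>
  Two edges meeting in a single point that is interior to both cross transversally there.
\<close>

definition link_diagram :: "diagram \<Rightarrow> bool" where
  "link_diagram D \<longleftrightarrow> closed_polygons (strands D) \<and>
     (\<forall>e\<in>strands D. \<forall>f\<in>strands D. e \<noteq> f \<longrightarrow>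
        seg e \<inter> seg f \<subseteq> ends e \<inter> ends f \<or> cross e f) \<and>
     (\<forall>e\<in>strands D. \<forall>f\<in>strands D. \<forall>g\<in>strands D. e \<noteq> f \<and> e \<noteq> g \<and> f \<noteq> g \<longrightarrow>
        seg e \<inter> seg f \<inter> seg g = {}) \<and>
     crossings D \<subseteq> {(e, f). e \<in> strands D \<and> f \<in> strands D \<and> cross e f} \<and>
     (\<forall>e\<in>strands D. \<forall>f\<in>strands D. cross e f \<longrightarrow>
        ((e, f) \<in> crossings D) \<noteq> ((f, e) \<in> crossings D))"

definition project_edge :: "space edge \<Rightarrow> complex edge" where
  "project_edge e = (fst (fst e), fst (snd e))"

definition project :: "link \<Rightarrow> diagram" where
  "project L = Diagram (project_edge ` L)
     {(project_edge e, project_edge f) | e f. e \<in> L \<and> f \<in> L \<and>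
        cross (project_edge e) (project_edge f) \<and>
        (\<exists>p s t. (p, s) \<in> seg e \<and> (p, t) \<in> seg f \<and> t < s)}"

text \<open>
  Injectivity on edges rules out that two strands lie above each other; that the projection is
  otherwise regular is part of \<open>link_diagram\<close>.
\<close>

definition is_diagram_of :: "diagram \<Rightarrow> link \<Rightarrow> bool" where
  "is_diagram_of D L \<longleftrightarrow>
     oriented_link L \<and> inj_on project_edge L \<and> D = project L \<and> link_diagram D"

definition connected_diagram :: "diagram \<Rightarrow> bool" where
  "connected_diagram D \<longleftrightarrow> connected (carrier_of (strands D))"

definition regions :: "diagram \<Rightarrow> complex set set" where
  "regions D = components (- carrier_of (strands D))"


section \<open>Presentation matrix and \<open>\<Delta>\<close>\<close>

definition left_of :: "complex edge \<Rightarrow> complex set" where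
  "left_of e = {q. Im (cnj (snd e - fst e) * (q - fst e)) > 0}"

definition right_of :: "complex edge \<Rightarrow> complex set" where
  "right_of e = {q. Im (cnj (snd e - fst e) * (q - fst e)) < 0}"

text \<open>
  \<open>corner e f C R\<close>: near the crossing of \<open>e\<close> and \<open>f\<close>, the sector \<open>C\<close> belongs to the region \<open>R\<close>.
\<close>

definition corner :: "complex edge \<Rightarrow> complex edge \<Rightarrow> complex set \<Rightarrow> complex set \<Rightarrow> bool" where
  "corner e f C R \<longleftrightarrow> (\<exists>p \<in> seg e \<inter> seg f. \<exists>r>0. ball p r \<inter> C \<subseteq> R)"

text \<open>
  The coefficient of the generator of \<open>R\<close> in \<open>a + x b + x y c + y d = 0\<close>, where \<open>e\<close> is the
  over-strand and \<open>f\<close> the under-strand.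
\<close>

definition coefficient :: "complex edge \<times> complex edge \<Rightarrow> complex set \<Rightarrow> laurent" where
  "coefficient = (\<lambda>(e, f) R.
     of_bool (corner e f (left_of e \<inter> right_of f) R)
     + x_gen * of_bool (corner e f (left_of e \<inter> left_of f) R)
     + x_gen * y_gen * of_bool (corner e f (right_of e \<inter> left_of f) R)
     + y_gen * of_bool (corner e f (right_of e \<inter> right_of f) R))"

definition presentation_matrix :: "diagram \<Rightarrow> laurent mat \<Rightarrow> bool" where
  "presentation_matrix D M \<longleftrightarrow> (\<exists>cs rs.
     distinct cs \<and> set cs = crossings D \<and> distinct rs \<and> set rs = regions D \<and>
     M = mat (length cs) (length rs) (\<lambda>(i, j). coefficient (cs ! i) (rs ! j)))"

definition two_column_minors :: "'a::comm_ring_1 mat \<Rightarrow> 'a set" where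
  "two_column_minors M =
     {Determinant.det (submatrix M UNIV (- {p, q})) | p q. p < q \<and> q < dim_col M}"

text \<open>
  Some greatest common divisor; neither the order of rows and columns nor the choice of the gcd
  matters up to units.
\<close>

definition Delta :: "diagram \<Rightarrow> laurent" where
  "Delta D = (SOME g. \<exists>M. presentation_matrix D M \<and> is_gcd_of (two_column_minors M) g)"

end

theory Submission
  imports Defs
begin

text \<open>
  Write \<open>ind\<close> for the winding number of the diagram around a region. Replacing the label \<open>c\<close> of a region by
  the affine map \<open>C = (v \<mapsto> (xy)\<^sup>i\<^sup>n\<^sup>d v + (-x)\<^sup>i\<^sup>n\<^sup>d c)\<close> turns \<open>a + xb + xyc + yd = 0\<close> into the relation
  \<open>C\<^sub>a C\<^sub>d\<inverse> = C\<^sub>b C\<^sub>c\<inverse>\<close>, which makes sense in every group \<open>G\<close>. It is the relation of the Dehn presentation: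
  labellings of the regions by \<open>G\<close> that satisfy it are the same as flat \<open>G\<close>-bundles on the complement of
  the link with a framing at a point high above and a point far below the plane, the label of a region
  being the holonomy along the path that pierces the plane there.

  A triangle move is realised by a homeomorphism of space that is the identity far away, so it carries flat
  bundles to flat bundles; it also respects the linking numbers with small meridians, hence it carries the
  index of one diagram to that of the other. Thus, without Reidemeister moves, the solutions of the relations
  of the two diagrams with values in a module correspond to each other naturally, and the modules presented by \<open>M(D)\<close>
  and \<open>M(D')\<close> are isomorphic. As both diagrams have two more regions than crossings, their matrices
  of coefficients have maximal minors with the same common divisors.
\<close>

section \<open>Flat structures\<close>

text \<open>A cocycle made of germs pulls back along a homeomorphism by mere substitution, and its
  holonomy is defined along straight segments; convex sets then do the work of homotopies of paths.
  That bundles and labellings determine each other rests on one local fact: from a point off the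
  link, the way up depends only on the side of the strand above it, the way down only on the side of
  the strand below it, and the two sides can be chosen independently. The affine maps need the
  index, and among the integer solutions of the group relation the index has to be recognised in
  space, after a homeomorphism that is only piecewise linear. Therefore the condition that every
  meridian has value 1 is expressed by a polar angle that exists near each edge, a notion that
  survives such maps. The passage from solutions to matrices is a Yoneda argument: the
  correspondence is applied to the tautological solution, where each region is labelled by its own
  generator in the presented module. For this the modules of both diagrams must live in one
  type.\<close>

text \<open>Local systems with a structure group \<open>'g\<close>, written additively but not assumed commutative: a flat
  structure is an Alexander-Spanier cocycle, a frame is a local trivialisation of it.\<close>

definition flat :: "'a::euclidean_space set \<Rightarrow> ('a \<Rightarrow> 'a \<Rightarrow> 'g::group_add) \<Rightarrow> bool" where
  "flat X f \<longleftrightarrow> (\<forall>x\<in>X. \<forall>\<^sub>F y in nhds x. \<forall>\<^sub>F p in nhds y. f x p = f x y + f y p)"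

definition frame :: "('a::euclidean_space \<Rightarrow> 'a \<Rightarrow> 'g::group_add) \<Rightarrow> ('a \<Rightarrow> 'g) \<Rightarrow> 'a set \<Rightarrow> bool" where
  "frame f F K \<longleftrightarrow> (\<forall>x\<in>K. \<forall>\<^sub>F p in nhds x. F p = F x + f x p)"

text \<open>The choice of the frame is harmless: two frames on a segment differ by a left
  translation (\<open>frame_const\<close>), which cancels in \<open>- F p + F q\<close>.\<close>

definition hol :: "('a::euclidean_space \<Rightarrow> 'a \<Rightarrow> 'g::group_add) \<Rightarrow> 'a \<Rightarrow> 'a \<Rightarrow> 'g" where
  "hol f p q = (let F = SOME F. frame f F (closed_segment p q) in - F p + F q)"

lemma frame_subset: "frame f F K \<Longrightarrow> K' \<subseteq> K \<Longrightarrow> frame f F K'"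
  unfolding frame_def by blast

lemma frame_translate: "frame f F K \<Longrightarrow> frame f (\<lambda>p. g + F p) K"
  unfolding frame_def by (simp add: add.assoc)

lemma compact_seg [simp]: "compact (seg (e :: 'a::euclidean_space edge))"
  by (simp add: seg_def)

lemma closed_seg [simp]: "closed (seg (e :: 'a::euclidean_space edge))"
  by (simp add: seg_def)

text \<open>Brings words in an additively written, not necessarily commutative group into a
  right-nested form in which neighbouring inverses cancel.\<close>

lemmas group_normal = diff_conv_add_uminus minus_add add.assoc minus_minus minus_add_cancel add_minus_cancel
  left_minus right_minus add_0_left add_0_right minus_zero

lemma openI_sub: "(\<And>x. x \<in> S \<Longrightarrow> \<exists>T. open T \<and> x \<in> T \<and> T \<subseteq> S) \<Longrightarrow> open S"
  by (metis open_subopen)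

lemma flat_refl:
  assumes "flat X f" "x \<in> X"
  shows "f x x = 0"
proof -
  have "\<forall>\<^sub>F p in nhds x. f x p = f x x + f x p"
    using assms unfolding flat_def by (meson eventually_nhds_x_imp_x)
  then have "f x x = f x x + f x x"
    by (rule eventually_nhds_x_imp_x)
  then have "f x x + f x x = f x x + 0" by simp
  then show ?thesis by (simp only: add_left_cancel)
qed

text \<open>The nested germs in \<open>flat\<close> allow the cocycle law to be used at every base
  point close to \<open>x\<close>, so being a frame is an open condition.\<close>

lemma frame_near:
  assumes "flat X f" "x \<in> X" "frame f F {x}"
  shows "\<forall>\<^sub>F y in nhds x. frame f F {y}"
proof -
  have "\<forall>\<^sub>F y in nhds x. F y = F x + f x y"
    using assms(3) by (simp add: frame_def)
  moreover from this have "\<forall>\<^sub>F y in nhds x. \<forall>\<^sub>F p in nhds y. F p = F x + f x p"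
    by (simp add: eventually_eventually)
  moreover have "\<forall>\<^sub>F y in nhds x. \<forall>\<^sub>F p in nhds y. f x p = f x y + f y p"
    using assms by (simp add: flat_def)
  ultimately show ?thesis
  proof eventually_elim
    case (elim y)
    from elim(2,3) have "\<forall>\<^sub>F p in nhds y. F p = F y + f y p"
      by eventually_elim (simp add: elim(1) add.assoc)
    then show ?case by (simp add: frame_def)
  qed
qed

lemma frame_at_base:
  assumes "flat X f" "x \<in> X"
  shows "frame f (f x) {x}"
  by (simp add: frame_def flat_refl[OF assms])

text \<open>Near a point both frames grow by the same right factor \<open>f a p\<close>; their
  quotient, formed on the left, is locally constant and hence constant on a connected set.\<close>

lemma frame_const:
  assumes "connected K" "frame f F K" "frame f F' K" "p \<in> K" "q \<in> K"
  shows "F' p - F p = F' q - F q"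
proof -
  have "(\<lambda>p. F' p - F p) constant_on K"
  proof (rule locally_constant_imp_constant[OF assms(1)])
    fix a assume a: "a \<in> K"
    have "\<forall>\<^sub>F p in nhds a. F p = F a + f a p" "\<forall>\<^sub>F p in nhds a. F' p = F' a + f a p"
      using assms a by (auto simp: frame_def)
    then have "\<forall>\<^sub>F p in nhds a. F' p - F p = F' a - F a"
      by eventually_elim (simp add: diff_conv_add_uminus minus_add add.assoc del: add_uminus_conv_diff)
    then obtain S where S: "open S" "a \<in> S" "\<forall>p\<in>S. F' p - F p = F' a - F a"
      unfolding eventually_nhds by blast
    show "\<exists>T. openin (top_of_set K) T \<and> a \<in> T \<and> (\<forall>x\<in>T. F' x - F x = F' a - F a)"
    proof (intro exI conjI)
      show "openin (top_of_set K) (K \<inter> S)" using S(1) by (rule openin_open_Int)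
      show "\<forall>x\<in>K \<inter> S. F' x - F x = F' a - F a" using S(3) by blast
    qed (use a S(2) in blast)
  qed
  with assms(4,5) show ?thesis unfolding constant_on_def by auto
qed

text \<open>Bisection: short pieces have frames, and frames on two adjacent pieces can be made to
  agree at the common point and glued there.\<close>

lemma frame_segment_exists:
  assumes "flat X f" and seg: "closed_segment p q \<subseteq> X"
  shows "\<exists>F. frame f F (closed_segment p q)"
proof -
  define l where "l = (\<lambda>t::real. p + t *\<^sub>R (q - p))"
  have l_img: "l ` {0..1} = closed_segment p q"
    unfolding l_def closed_segment_image_interval by (auto simp: algebra_simps image_def)
  have cont: "isCont l t" for t unfolding l_def by (intro continuous_intros)
  define P where "P = (\<lambda>a b. 0 \<le> a \<longrightarrow> b \<le> 1 \<longrightarrow> (\<exists>F. frame f F (l ` {a..b})))"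
  have "(0::real) \<le> 1" by simp
  then have "P 0 1"
  proof (induction rule: Bolzano)
    case (trans a b c)
    show ?case unfolding P_def
    proof (intro impI)
      assume "0 \<le> a" "c \<le> 1"
      with trans obtain F1 F2 where F1: "frame f F1 (l ` {a..b})" and F2': "frame f F2 (l ` {b..c})"
        unfolding P_def by force
      \<comment> \<open>Left translations preserve frames; this one makes the second frame agree
        with the first at the junction \<open>l b\<close>.\<close>
      define F3 where "F3 = (\<lambda>x. (F1 (l b) - F2 (l b)) + F2 x)"
      have F3: "frame f F3 (l ` {b..c})" unfolding F3_def by (rule frame_translate[OF F2'])
      have b3: "F3 (l b) = F1 (l b)" by (simp add: F3_def)
      show "\<exists>F. frame f F (l ` {a..c})"
      proof (cases "p = q")
        case True
        then have "l ` {a..c} = l ` {a..b}" using trans(3,4) by (force simp: l_def)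
        with F1 show ?thesis by auto
      next
        case False
        then have pos: "inner (q - p) (q - p) > 0" by simp
        \<comment> \<open>Frames are compared in full neighbourhoods, so the gluing needs a rule off
          the segment too: the hyperplane through \<open>l b\<close> orthogonal to the segment
          separates the two pieces.\<close>
        define s where "s = (\<lambda>x. inner (x - l b) (q - p))"
        have s_l: "s (l t) = (t - b) * (inner (q - p) (q - p))" for t
        proof -
          have "l t - l b = (t - b) *\<^sub>R (q - p)" by (simp add: l_def algebra_simps)
          then show ?thesis unfolding s_def by simp
        qed
        have s_lim: "(s \<longlongrightarrow> s x) (nhds x)" for x unfolding s_def by (intro tendsto_intros filterlim_ident)
        define F where "F = (\<lambda>x. if s x \<le> 0 then F1 x else F3 x)"
        have "frame f F (l ` {a..c})"
          unfolding frame_def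
        proof (intro ballI)
          fix x assume "x \<in> l ` {a..c}"
          then obtain t where t: "x = l t" "a \<le> t" "t \<le> c" by auto
          consider "t < b" | "t = b" | "t > b" by linarith
          then show "\<forall>\<^sub>F p in nhds x. F p = F x + f x p"
          proof cases
            case 1
            then have "s x < 0" using pos by (simp add: t s_l mult_neg_pos)
            then have "\<forall>\<^sub>F p in nhds x. s p < 0"
              using order_tendstoD(2)[OF s_lim] by blast
            moreover have "\<forall>\<^sub>F p in nhds x. F1 p = F1 x + f x p"
              using F1 t 1 by (auto simp: frame_def)
            ultimately show ?thesis
              by eventually_elim (use \<open>s x < 0\<close> in \<open>simp add: F_def\<close>)
          next
            case 2
            have "\<forall>\<^sub>F p in nhds x. F1 p = F1 x + f x p" "\<forall>\<^sub>F p in nhds x. F3 p = F3 x + f x p"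
              using F1 F3 t 2 trans(3,4) by (auto simp: frame_def)
            then show ?thesis
              by eventually_elim (use b3 t 2 in \<open>simp add: F_def\<close>)
          next
            case 3
            then have "s x > 0" using pos by (simp add: t s_l)
            then have "\<forall>\<^sub>F p in nhds x. s p > 0"
              using order_tendstoD(1)[OF s_lim] by blast
            moreover have "\<forall>\<^sub>F p in nhds x. F3 p = F3 x + f x p"
              using F3 t 3 by (auto simp: frame_def)
            ultimately show ?thesis
              by eventually_elim (use \<open>s x > 0\<close> in \<open>simp add: F_def\<close>)
          qed
        qed
        then show ?thesis by blast
      qed
    qed
  next
    case (local t)
    then have lX: "l t \<in> X" using seg l_img by auto
    have "\<forall>\<^sub>F y in nhds (l t). frame f (f (l t)) {y}"
      by (rule frame_near[OF assms(1) lX frame_at_base[OF assms(1) lX]])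
    then have "\<forall>\<^sub>F u in nhds t. frame f (f (l t)) {l u}"
      using cont[of t] unfolding isCont_def tendsto_at_iff_tendsto_nhds by (rule eventually_compose_filterlim)
    then obtain d where d: "d > 0" "\<And>u. dist u t < d \<Longrightarrow> frame f (f (l t)) {l u}"
      unfolding eventually_nhds_metric by blast
    show ?case
    proof (intro exI[of _ d] conjI allI impI)
      fix a b :: real assume ab: "a \<le> t \<and> t \<le> b \<and> b - a < d"
      have "frame f (f (l t)) (l ` {a..b})"
        using d(2) ab unfolding frame_def by (force simp: dist_real_def)
      then show "P a b" unfolding P_def by blast
    qed (use d in auto)
  qed
  then show ?thesis unfolding P_def l_img by simp
qed

lemma hol_eq:
  assumes "flat X f" "closed_segment p q \<subseteq> X" "frame f F (closed_segment p q)"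
  shows "hol f p q = - F p + F q"
proof -
  define F0 where "F0 = (SOME F. frame f F (closed_segment p q))"
  have "frame f F0 (closed_segment p q)"
    unfolding F0_def by (rule someI_ex[OF frame_segment_exists[OF assms(1,2)]])
  from frame_const[OF _ this assms(3), of p q] have c: "F p - F0 p = F q - F0 q" by simp
  have "F p = (F p - F0 p) + F0 p" "F q = (F p - F0 p) + F0 q"
    by (simp, simp add: c)
  then have "- F p + F q = - ((F p - F0 p) + F0 p) + ((F p - F0 p) + F0 q)" by metis
  then have "- F0 p + F0 q = - F p + F q"
    unfolding minus_add add.assoc by (simp only: minus_add_cancel)
  then show ?thesis by (simp add: hol_def Let_def F0_def)
qed

lemma hol_refl [simp]: "hol f p p = 0"
  by (simp add: hol_def Let_def)

text \<open>By compactness a frame along the segment to \<open>p\<close> is still a frame along the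
  segments to all points near \<open>p\<close>. The holonomies to these points are thus read off
  from a single frame and vary as it does.\<close>

lemma frame_star:
  assumes "flat X f" "open X" and C: "\<And>p. p \<in> C \<Longrightarrow> closed_segment x0 p \<subseteq> X"
  shows "frame f (hol f x0) C"
  unfolding frame_def
proof
  fix p assume "p \<in> C"
  then have sX: "closed_segment x0 p \<subseteq> X" by (rule C)
  obtain F where F: "frame f F (closed_segment x0 p)"
    using frame_segment_exists[OF assms(1) sX] by blast
  define U where "U = {y\<in>X. frame f F {y}}"
  have "open U"
  proof (rule openI_sub)
    fix y assume "y \<in> U"
    then have y: "y \<in> X" "frame f F {y}" by (simp_all add: U_def)
    have "\<forall>\<^sub>F z in nhds y. z \<in> X" using y \<open>open X\<close> by (simp add: eventually_nhds_in_open)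
    with frame_near[OF assms(1) y] have "\<forall>\<^sub>F z in nhds y. z \<in> U"
      by eventually_elim (simp add: U_def)
    then show "\<exists>T. open T \<and> y \<in> T \<and> T \<subseteq> U" by (auto simp: eventually_nhds)
  qed
  moreover have "closed_segment x0 p \<subseteq> U"
    using sX F by (auto simp: U_def frame_def)
  ultimately obtain e where e: "e > 0" "(\<Union>x\<in>closed_segment x0 p. ball x e) \<subseteq> U"
    using compact_subset_open_imp_ball_epsilon_subset[of "closed_segment x0 p" U] by auto
  have seg: "closed_segment x0 q \<subseteq> U" if "dist p q < e" for q
  proof
    fix y assume "y \<in> closed_segment x0 q"
    then obtain t where t: "0 \<le> t" "t \<le> 1" "y = (1 - t) *\<^sub>R x0 + t *\<^sub>R q"
      by (auto simp: in_segment)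
    define y' where "y' = (1 - t) *\<^sub>R x0 + t *\<^sub>R p"
    have "y' - y = t *\<^sub>R (p - q)" by (simp add: y'_def t(3) algebra_simps)
    then have "dist y' y \<le> dist p q"
      using t(1,2) by (simp add: dist_norm mult_left_le_one_le)
    moreover have "y' \<in> closed_segment x0 p" using t by (auto simp: in_segment y'_def)
    ultimately have "y \<in> (\<Union>x\<in>closed_segment x0 p. ball x e)" using that by (intro UN_I[of y']) auto
    then show "y \<in> U" using e(2) by blast
  qed
  have hol: "hol f x0 q = - F x0 + F q" if "dist p q < e" for q
  proof (rule hol_eq[OF assms(1)])
    show "closed_segment x0 q \<subseteq> X" using seg[OF that] by (auto simp: U_def)
    show "frame f F (closed_segment x0 q)" using seg[OF that] by (auto simp: U_def frame_def)
  qed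
  have "\<forall>\<^sub>F q in nhds p. F q = F p + f p q"
    using F by (auto simp: frame_def)
  moreover have "\<forall>\<^sub>F q in nhds p. dist p q < e"
    using e(1) by (auto simp: eventually_nhds_metric dist_commute intro!: exI[of _ e])
  ultimately show "\<forall>\<^sub>F q in nhds p. hol f x0 q = hol f x0 p + f p q"
    by eventually_elim (simp add: hol e(1) add.assoc)
qed

text \<open>In a convex set the frame \<open>hol f p\<close> serves all three sides at once. This is
  the form in which homotopy invariance of the holonomy enters.\<close>

lemma hol_triangle:
  assumes "flat X f" "open X" "convex C" "C \<subseteq> X" "p \<in> C" "q \<in> C" "r \<in> C"
  shows "hol f p q + hol f q r = hol f p r"
proof -
  have seg: "closed_segment u v \<subseteq> C" if "u \<in> C" "v \<in> C" for u v
    using that assms(3) by (simp add: convex_contains_segment)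
  have fr: "frame f (hol f p) C"
    using seg assms by (intro frame_star[OF assms(1,2)]) blast
  have "hol f q r = - hol f p q + hol f p r"
    using hol_eq[OF assms(1) _ frame_subset[OF fr seg[of q r]]] seg assms by blast
  then show ?thesis by (simp add: add.assoc[symmetric])
qed

lemma hol_reverse:
  assumes "flat X f" "open X" "closed_segment p q \<subseteq> X"
  shows "hol f q p = - hol f p q"
proof -
  have "hol f p q + hol f q p = hol f p p"
    by (rule hol_triangle[OF assms(1,2) convex_closed_segment assms(3)]) auto
  then show ?thesis by (simp add: minus_unique)
qed

lemma hol_near:
  assumes "flat X f" "open X" "x \<in> X"
  shows "\<forall>\<^sub>F p in nhds x. hol f x p = f x p"
proof -
  have "frame f (hol f x) {x}" by (rule frame_star[OF assms(1,2)]) (use assms in auto)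
  then show ?thesis by (simp add: frame_def)
qed

text \<open>Here \<gamma> may be any function: a cocycle compares framings chosen point by point, so
  the framing of each fibre can be changed independently.\<close>

lemma flat_gauge:
  assumes "flat X f1" and rel: "\<And>x. x \<in> X \<Longrightarrow> \<forall>\<^sub>F p in nhds x. f2 x p = - \<gamma> x + f1 x p + \<gamma> p" and "open X"
  shows "flat X f2"
  unfolding flat_def
proof
  fix x assume x: "x \<in> X"
  have "\<forall>\<^sub>F y in nhds x. \<forall>\<^sub>F p in nhds y. f1 x p = f1 x y + f1 y p"
    using assms x by (simp add: flat_def)
  moreover have "\<forall>\<^sub>F y in nhds x. y \<in> X" using \<open>open X\<close> x by (simp add: eventually_nhds_in_open)
  moreover have "\<forall>\<^sub>F y in nhds x. \<forall>\<^sub>F p in nhds y. f2 x p = - \<gamma> x + f1 x p + \<gamma> p"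
    using rel[OF x] by (simp add: eventually_eventually)
  moreover note rel[OF x]
  ultimately show "\<forall>\<^sub>F y in nhds x. \<forall>\<^sub>F p in nhds y. f2 x p = f2 x y + f2 y p"
  proof eventually_elim
    case (elim y)
    from elim(1,3) rel[OF elim(2)] show ?case
      by eventually_elim (simp add: elim(4) add.assoc)
  qed
qed

lemma hol_gauge:
  assumes "flat X f1" and rel: "\<And>x. x \<in> X \<Longrightarrow> \<forall>\<^sub>F p in nhds x. f2 x p = - \<gamma> x + f1 x p + \<gamma> p"
    and "open X" and "closed_segment p q \<subseteq> X"
  shows "hol f2 p q = - \<gamma> p + hol f1 p q + \<gamma> q"
proof -
  obtain F where F: "frame f1 F (closed_segment p q)"
    using frame_segment_exists[OF assms(1,4)] by blast
  have "frame f2 (\<lambda>x. F x + \<gamma> x) (closed_segment p q)"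
    unfolding frame_def
  proof
    fix x assume x: "x \<in> closed_segment p q"
    have "\<forall>\<^sub>F p in nhds x. F p = F x + f1 x p" using F x by (auto simp: frame_def)
    moreover have "\<forall>\<^sub>F p in nhds x. f2 x p = - \<gamma> x + f1 x p + \<gamma> p" using rel x assms by blast
    ultimately show "\<forall>\<^sub>F p in nhds x. F p + \<gamma> p = F x + \<gamma> x + f2 x p"
      by eventually_elim (simp add: add.assoc)
  qed
  then show ?thesis
    using hol_eq[OF flat_gauge[OF assms(1) rel assms(3)] assms(4), where F="\<lambda>x. F x + \<gamma> x"]
      hol_eq[OF assms(1,4) F]
    by (simp only: group_normal)
qed

lemma flat_pullback:
  assumes "flat X f" "h ` X' \<subseteq> X" "\<And>x. isCont h x"
  shows "flat X' (\<lambda>x p. f (h x) (h p))"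
  unfolding flat_def
proof
  fix x assume x: "x \<in> X'"
  have ev: "\<forall>\<^sub>F p in nhds (h x). Q p \<Longrightarrow> \<forall>\<^sub>F p in nhds x. Q (h p)" for Q x
    using assms(3)[of x] unfolding isCont_def tendsto_at_iff_tendsto_nhds
    by (rule eventually_compose_filterlim[rotated])
  have "\<forall>\<^sub>F y in nhds (h x). \<forall>\<^sub>F p in nhds y. f (h x) p = f (h x) y + f y p"
    using assms x by (auto simp: flat_def)
  from ev[OF this]
  show "\<forall>\<^sub>F y in nhds x. \<forall>\<^sub>F p in nhds y. f (h x) (h p) = f (h x) (h y) + f (h y) (h p)"
    by eventually_elim (rule ev)
qed

lemma flat_hom:
  assumes "flat X f" "\<And>a b. \<phi> (a + b) = \<phi> a + \<phi> b"
  shows "flat X (\<lambda>x p. \<phi> (f x p))"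
  unfolding flat_def
proof
  fix x assume "x \<in> X"
  then have "\<forall>\<^sub>F y in nhds x. \<forall>\<^sub>F p in nhds y. f x p = f x y + f y p"
    using assms(1) by (simp add: flat_def)
  then show "\<forall>\<^sub>F y in nhds x. \<forall>\<^sub>F p in nhds y. \<phi> (f x p) = \<phi> (f x y) + \<phi> (f y p)"
  proof eventually_elim
    case (elim y)
    then show ?case by eventually_elim (simp add: assms(2))
  qed
qed

lemma additive_minus:
  fixes \<phi> :: "'g::group_add \<Rightarrow> 'k::group_add"
  assumes "\<And>a b. \<phi> (a + b) = \<phi> a + \<phi> b"
  shows "\<phi> (- a) = - \<phi> a" "\<phi> 0 = 0" "\<phi> (a - b) = \<phi> a - \<phi> b"
proof -
  have "\<phi> 0 + 0 = \<phi> 0 + \<phi> 0" using assms[of 0 0] by simp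
  then show z: "\<phi> 0 = 0" by (simp only: add_left_cancel)
  show m: "\<phi> (- a) = - \<phi> a" for a using assms[of a "- a"] z by (simp add: minus_unique)
  show "\<phi> (a - b) = \<phi> a - \<phi> b" using assms[of a "- b"] m by simp
qed

lemma hol_hom:
  assumes "flat X f" and add: "\<And>a b. \<phi> (a + b) = \<phi> a + \<phi> b" and "closed_segment p q \<subseteq> X"
  shows "hol (\<lambda>x p. \<phi> (f x p)) p q = \<phi> (hol f p q)"
proof -
  obtain F where F: "frame f F (closed_segment p q)"
    using frame_segment_exists[OF assms(1,3)] by blast
  have "frame (\<lambda>x p. \<phi> (f x p)) (\<lambda>x. \<phi> (F x)) (closed_segment p q)"
    unfolding frame_def
  proof
    fix x assume x: "x \<in> closed_segment p q"
    have "\<forall>\<^sub>F p in nhds x. F p = F x + f x p" using F x by (auto simp: frame_def)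
    then show "\<forall>\<^sub>F p in nhds x. \<phi> (F p) = \<phi> (F x) + \<phi> (f x p)"
      by eventually_elim (simp add: add)
  qed
  from hol_eq[OF flat_hom[OF assms(1,2)] assms(3) this] hol_eq[OF assms(1,3) F]
  show ?thesis by (simp add: add additive_minus[OF add])
qed

section \<open>The position of a link over its diagram\<close>

locale projected_link =
  fixes L :: link and D :: diagram
  assumes diagram_of: "is_diagram_of D L"
begin

definition X :: "space set" where "X = - carrier_of L"
definition K :: "complex set" where "K = carrier_of (strands D)"

lemma link: "oriented_link L" and inj: "inj_on project_edge L" and D: "D = project L"
  and link_diagram: "link_diagram D"
  using diagram_of by (auto simp: is_diagram_of_def)

lemma finite_L [simp]: "finite L"
  using link by (simp add: oriented_link_def closed_polygons_def)

lemma strands_eq: "strands D = project_edge ` L"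
  by (simp add: D project_def)

lemma finite_strands [simp]: "finite (strands D)"
  by (simp add: strands_eq)

lemma project_edge_nondegenerate: "e \<in> L \<Longrightarrow> fst (project_edge e) \<noteq> snd (project_edge e)"
proof -
  assume "e \<in> L"
  then have "project_edge e \<in> strands D" by (simp add: strands_eq)
  moreover have "\<forall>(a, b)\<in>strands D. a \<noteq> b"
    using link_diagram unfolding link_diagram_def closed_polygons_def by blast
  ultimately show ?thesis by (cases "project_edge e") auto
qed

end

lemma fst_seg: "fst ` seg e = seg (project_edge e)"
proof -
  have "linear (fst :: space \<Rightarrow> complex)" by (rule linear_fst)
  then show ?thesis unfolding seg_def project_edge_def by (simp add: closed_segment_linear_image)
qed

lemma seg_projectI: "(z, h) \<in> seg e \<Longrightarrow> z \<in> seg (project_edge e)"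
  by (metis fst_conv fst_seg image_eqI)

lemma seg_height_unique:
  assumes "fst (project_edge e) \<noteq> snd (project_edge e)" "(z, h) \<in> seg e" "(z, h') \<in> seg e"
  shows "h = h'"
proof -
  obtain a b where e: "e = (a, b)" by (cases e)
  obtain t t' where t: "(z, h) = (1 - t) *\<^sub>R a + t *\<^sub>R b" "(z, h') = (1 - t') *\<^sub>R a + t' *\<^sub>R b"
    using assms(2,3) by (auto simp: seg_def e in_segment)
  have "(1 - t) *\<^sub>R fst a + t *\<^sub>R fst b = (1 - t') *\<^sub>R fst a + t' *\<^sub>R fst b"
    using arg_cong[OF t(1), of fst] arg_cong[OF t(2), of fst] by simp
  then have "(t - t') *\<^sub>R (fst b - fst a) = 0" by (simp add: algebra_simps)
  moreover have "fst b - fst a \<noteq> 0" using assms(1) by (simp add: project_edge_def e)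
  ultimately have "t = t'" by simp
  then have "(z, h) = (z, h')" by (simp only: t)
  then show ?thesis by simp
qed

context projected_link
begin

lemma K_eq: "K = fst ` carrier_of L"
  by (auto simp: K_def carrier_of_def strands_eq fst_seg[symmetric])

lemma closed_K [simp]: "closed K"
  unfolding K_def carrier_of_def by (intro closed_UN) auto

lemma open_X [simp]: "open X"
  unfolding X_def carrier_of_def by (intro open_Compl closed_UN) auto

lemma generic_in_X: "fst p \<notin> K \<Longrightarrow> p \<in> X"
  by (auto simp: X_def K_eq)

text \<open>The edge passes above \<open>x\<close> for \<open>s = 1\<close> and below it for
  \<open>s = -1\<close>; encoding the direction as a sign lets one argument treat both.\<close>

definition side :: "real \<Rightarrow> space \<Rightarrow> space edge \<Rightarrow> bool" where
  "side s x e \<longleftrightarrow> (\<exists>h. s * h > s * snd x \<and> (fst x, h) \<in> seg e)"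

text \<open>Within the cylinder of radius \<open>r\<close> around the vertical line through
  \<open>x\<close>, the edge stays more than \<open>r\<close> above or more than \<open>r\<close>
  below \<open>x\<close>, and only on a side on which it also passes \<open>x\<close> itself. So
  points of the ball see no strands above or below them that \<open>x\<close> does not see
  there.\<close>

definition local_radius_at :: "space edge \<Rightarrow> space \<Rightarrow> real \<Rightarrow> bool" where
  "local_radius_at e x r \<longleftrightarrow> (\<forall>p\<in>seg e. dist (fst p) (fst x) < r \<longrightarrow>
     (\<exists>s\<in>{1,-1}. side s x e \<and> s * snd p > s * snd x + r))"

definition local_radius :: "space \<Rightarrow> real \<Rightarrow> bool" where
  "local_radius x r \<longleftrightarrow> r > 0 \<and> (\<forall>e\<in>L. local_radius_at e x r)"

lemma side_sign: "e \<in> L \<Longrightarrow> s \<in> {1, -1} \<Longrightarrow> s' \<in> {1, -1} \<Longrightarrow> side s x e \<Longrightarrow> side s' x e \<Longrightarrow> s = s'"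
proof -
  assume e: "e \<in> L" and s: "s \<in> {1, -1}" "s' \<in> {1, -1}" and sd: "side s x e" "side s' x e"
  obtain h where h: "s * h > s * snd x" "(fst x, h) \<in> seg e" using sd(1) unfolding side_def by blast
  obtain h' where h': "s' * h' > s' * snd x" "(fst x, h') \<in> seg e" using sd(2) unfolding side_def by blast
  have "h = h'" using seg_height_unique[OF project_edge_nondegenerate[OF e] h(2) h'(2)] .
  then show ?thesis using h(1) h'(1) s by auto
qed

lemma local_radius_at_mono:
  assumes "local_radius_at e x r" "r' \<le> r"
  shows "local_radius_at e x r'"
  unfolding local_radius_at_def
proof (intro ballI impI)
  fix p assume p: "p \<in> seg e" "dist (fst p) (fst x) < r'"
  then have "dist (fst p) (fst x) < r" using assms(2) by simp
  then obtain s where "s \<in> {1,-1}" "side s x e" "s * snd p > s * snd x + r"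
    using assms(1) p(1) unfolding local_radius_at_def by blast
  then show "\<exists>s\<in>{1,-1}. side s x e \<and> s * snd p > s * snd x + r'"
    using assms(2) by (intro bexI[of _ s]) auto
qed

lemma local_radius_mono: "local_radius x r \<Longrightarrow> 0 < r' \<Longrightarrow> r' \<le> r \<Longrightarrow> local_radius x r'"
  unfolding local_radius_def using local_radius_at_mono by blast

lemma local_radiusD:
  assumes "local_radius x r" "e \<in> L" "p \<in> seg e" "dist (fst p) (fst x) < r"
  obtains s where "s \<in> {1, -1}" "side s x e" "s * snd p > s * snd x + r"
  using assms unfolding local_radius_def local_radius_at_def by blast

lemma local_radius_edge:
  assumes x: "x \<in> X" and e: "e \<in> L"
  shows "\<exists>r>0. local_radius_at e x r"
proof -
  have far: "\<exists>d>0. \<forall>p\<in>S. dist (fst p) (fst x) \<ge> d" if "closed S" "S \<subseteq> seg e" "\<And>p. p \<in> S \<Longrightarrow> fst p \<noteq> fst x" for S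
  proof -
    have "compact S" using that compact_seg by (metis closed_Int_compact inf.absorb1)
    then have "compact (fst ` S)" by (intro compact_continuous_image continuous_intros)
    moreover have "fst x \<notin> fst ` S" using that(3) by force
    ultimately obtain d where "d > 0" "\<forall>z\<in>fst ` S. d \<le> dist (fst x) z"
      using separate_point_closed[of "fst ` S" "fst x"] compact_imp_closed by blast
    then show ?thesis by (metis dist_commute imageI)
  qed
  show ?thesis
  proof (cases "\<exists>h. (fst x, h) \<in> seg e")
    case False
    then have "\<And>p. p \<in> seg e \<Longrightarrow> fst p \<noteq> fst x" by (metis prod.collapse)
    then obtain d where d: "d > 0" "\<forall>p\<in>seg e. dist (fst p) (fst x) \<ge> d"
      using far[OF closed_seg subset_refl] by blast
    then have "local_radius_at e x d" unfolding local_radius_at_def by (meson not_less)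
    then show ?thesis using d(1) by blast
  next
    case True
    then obtain h where h: "(fst x, h) \<in> seg e" by blast
    have "h \<noteq> snd x" using x e h by (auto simp: X_def carrier_of_def)
    define s :: real where "s = sgn (h - snd x)"
    have s: "s \<in> {1, -1}" using \<open>h \<noteq> snd x\<close> by (auto simp: s_def sgn_if)
    \<comment> \<open>Half of the vertical gap. The part of the edge that fails to clear
      \<open>x\<close> by \<delta> is compact and misses the vertical line through \<open>x\<close>,
      so it stays at a positive horizontal distance.\<close>
    define \<delta> where "\<delta> = \<bar>h - snd x\<bar> / 2"
    have \<delta>: "\<delta> > 0" using \<open>h \<noteq> snd x\<close> by (simp add: \<delta>_def)
    have sh: "s * h = s * snd x + 2 * \<delta>"
    proof -
      have "s * (h - snd x) = 2 * \<delta>" by (auto simp: s_def \<delta>_def sgn_if)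
      then show ?thesis by (simp add: algebra_simps)
    qed
    then have side: "side s x e" unfolding side_def using h \<delta> by (intro exI[of _ h]) simp
    let ?S = "seg e \<inter> {p. s * snd p \<le> s * snd x + \<delta>}"
    have "closed ?S" by (intro closed_Int closed_Collect_le continuous_intros) auto
    moreover have "fst p \<noteq> fst x" if "p \<in> ?S" for p
    proof
      assume "fst p = fst x"
      then have "(fst x, snd p) \<in> seg e" using that by (metis IntD1 prod.collapse)
      then have "snd p = h" using seg_height_unique[OF project_edge_nondegenerate[OF e]] h by blast
      then show False using that sh \<delta> by auto
    qed
    ultimately obtain d where d: "d > 0" "\<forall>p\<in>?S. dist (fst p) (fst x) \<ge> d"
      using far[of ?S] by auto
    have "local_radius_at e x (min d \<delta>)"
      unfolding local_radius_at_def
    proof (intro ballI impI)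
      fix p assume p: "p \<in> seg e" "dist (fst p) (fst x) < min d \<delta>"
      then have "p \<notin> ?S" using d(2) by (meson min_less_iff_conj not_less)
      then have "s * snd p > s * snd x + min d \<delta>" using p by auto
      then show "\<exists>s\<in>{1, - 1}. side s x e \<and> s * snd x + min d \<delta> < s * snd p" using s side by blast
    qed
    then show ?thesis using d(1) \<delta> by (intro exI[of _ "min d \<delta>"]) simp
  qed
qed

lemma local_radius_exists:
  assumes x: "x \<in> X"
  shows "\<exists>r. local_radius x r"
proof -
  have "\<forall>e\<in>L. \<exists>r. r > 0 \<and> local_radius_at e x r"
    using local_radius_edge[OF x] by blast
  then obtain R where R: "\<And>e. e \<in> L \<Longrightarrow> R e > 0" "\<And>e. e \<in> L \<Longrightarrow> local_radius_at e x (R e)"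
    by metis
  define r where "r = Min (insert 1 (R ` L))"
  have r: "r > 0" "\<And>e. e \<in> L \<Longrightarrow> r \<le> R e" unfolding r_def using R(1) by (auto intro!: Min_le)
  have "local_radius x r"
    unfolding local_radius_def using r R(2) local_radius_at_mono by blast
  then show ?thesis ..
qed

lemma ball_subset_X:
  assumes "local_radius x r"
  shows "ball x r \<subseteq> X"
proof
  fix p assume p: "p \<in> ball x r"
  show "p \<in> X"
  proof (rule ccontr)
    assume "p \<notin> X"
    then obtain e where e: "e \<in> L" "p \<in> seg e" by (auto simp: X_def carrier_of_def)
    have "dist (fst p) (fst x) < r" "\<bar>snd p - snd x\<bar> < r"
      using p dist_fst_le[of p x] dist_snd_le[of p x] by (auto simp: dist_commute dist_real_def)
    moreover from this obtain s where "s \<in> {1, -1}" "s * snd p > s * snd x + r"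
      using local_radiusD[OF assms e(1) e(2)] by blast
    ultimately show False by auto
  qed
qed

text \<open>The half-strip swept out by the segment in direction \<open>s\<close> avoids the link,
  so the vertical ways out from its two ends are homotopic.\<close>

definition adjacent :: "real \<Rightarrow> space \<Rightarrow> space \<Rightarrow> bool" where
  "adjacent s q1 q2 \<longleftrightarrow> (\<forall>p\<in>closed_segment q1 q2. \<forall>t\<ge>0. p + (0, s * t) \<in> X)"

lemma adjacentI:
  assumes r: "local_radius x r" and q: "q1 \<in> ball x r" "q2 \<in> ball x r" and s: "s \<in> {1, -1}"
    and free: "\<And>e. e \<in> L \<Longrightarrow> side s x e \<Longrightarrow> closed_segment (fst q1) (fst q2) \<inter> seg (project_edge e) = {}"
  shows "adjacent s q1 q2"
  unfolding adjacent_def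
proof (intro ballI allI impI)
  fix p and t :: real assume p: "p \<in> closed_segment q1 q2" and t: "t \<ge> 0"
  have "p \<in> ball x r" using p q by (meson convex_ball convex_contains_segment subsetD)
  then have near: "dist (fst p) (fst x) < r" "\<bar>snd p - snd x\<bar> < r"
    using dist_fst_le[of p x] dist_snd_le[of p x] by (auto simp: dist_commute dist_real_def)
  have fstp: "fst p \<in> closed_segment (fst q1) (fst q2)"
    using p closed_segment_linear_image[OF linear_fst, of q1 q2] by blast
  show "p + (0, s * t) \<in> X"
  proof (rule ccontr)
    assume "p + (0, s * t) \<notin> X"
    then obtain e where e: "e \<in> L" "(fst p, snd p + s * t) \<in> seg e"
      by (auto simp: X_def carrier_of_def plus_prod_def)
    then obtain s' where s': "s' \<in> {1, -1}" "side s' x e" "s' * (snd p + s * t) > s' * snd x + r"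
      using local_radiusD[OF r e] near(1) by (metis fst_conv snd_conv)
    have "s' = s" using s' s near t by auto
    moreover have "fst p \<in> seg (project_edge e)" using e(2) seg_projectI by blast
    ultimately show False using free[OF e(1)] s'(2) fstp by blast
  qed
qed

lemma strand_pair:
  assumes "e \<in> strands D" "f \<in> strands D" "e \<noteq> f"
  shows "seg e \<inter> seg f \<subseteq> ends e \<inter> ends f \<or> cross e f"
proof -
  have "\<forall>e\<in>strands D. \<forall>f\<in>strands D. e \<noteq> f \<longrightarrow> seg e \<inter> seg f \<subseteq> ends e \<inter> ends f \<or> cross e f"
    using link_diagram unfolding link_diagram_def by (elim conjE)
  then show ?thesis using assms by blast
qed

lemma strand_triple:
  assumes "e \<in> strands D" "f \<in> strands D" "g \<in> strands D" "e \<noteq> f" "e \<noteq> g" "f \<noteq> g"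
  shows "seg e \<inter> seg f \<inter> seg g = {}"
proof -
  have "\<forall>e\<in>strands D. \<forall>f\<in>strands D. \<forall>g\<in>strands D. e \<noteq> f \<and> e \<noteq> g \<and> f \<noteq> g \<longrightarrow>
      seg e \<inter> seg f \<inter> seg g = {}"
    using link_diagram unfolding link_diagram_def by (elim conjE)
  then show ?thesis using assms by blast
qed

text \<open>Prevents two strands that meet at a vertex of the diagram from lying at different
  heights there, so that in \<open>sides_cross\<close> only a genuine crossing remains.\<close>

lemma strand_vertex_unique:
  assumes e: "e \<in> L" "f \<in> L" and z: "z \<in> ends (project_edge e) \<inter> ends (project_edge f)"
    and h: "(z, h) \<in> seg e" "(z, h') \<in> seg f"
  shows "h = h'"
proof -
  have cp: "closed_polygons L" "closed_polygons (strands D)"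
    using link link_diagram by (auto simp: oriented_link_def link_diagram_def)
  have succ: "\<exists>!c. (b, c) \<in> E" and pred: "\<exists>!c. (c, a) \<in> E" if "closed_polygons E" "(a, b) \<in> E"
    for E :: "'b edge set" and a b
    using that unfolding closed_polygons_def by auto
    have uniq: "h = k" if "g \<in> L" "(z, h) \<in> seg g" "(z, k) \<in> seg g" for g h k
    using seg_height_unique[OF project_edge_nondegenerate[OF that(1)] that(2,3)] .
  have in_seg: "fst g \<in> seg g" "snd g \<in> seg g" for g :: "space edge" by (auto simp: seg_def)
  text \<open>It suffices to treat an edge ending and an edge starting over \<open>z\<close>, since over each vertex
    of the diagram there is only one of each kind.\<close>
  have out: "g = g'" if g: "g \<in> L" "g' \<in> L" "fst (fst g) = z" "fst (fst g') = z" for g g'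
  proof -
    obtain w where "(w, fst g) \<in> L" using pred[OF cp(1), of "fst g" "snd g"] g by auto
    then have "(fst w, z) \<in> strands D" using g by (force simp: strands_eq project_edge_def image_iff)
    moreover have "(z, fst (snd g)) \<in> strands D" "(z, fst (snd g')) \<in> strands D"
      using imageI[OF g(1), of project_edge] imageI[OF g(2), of project_edge] g(3,4)
      by (simp_all add: strands_eq project_edge_def)
    ultimately have "fst (snd g) = fst (snd g')" using succ[OF cp(2), of "fst w" z] by (metis (no_types))
    then have "project_edge g = project_edge g'" using g by (simp add: project_edge_def)
    then show ?thesis using inj g by (auto simp: inj_on_def)
  qed
  have into: "g = g'" if g: "g \<in> L" "g' \<in> L" "fst (snd g) = z" "fst (snd g') = z" for g g'
  proof -
    obtain w where "(snd g, w) \<in> L" using succ[OF cp(1), of "fst g" "snd g"] g by auto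
    then have "(z, fst w) \<in> strands D" using g by (force simp: strands_eq project_edge_def image_iff)
    moreover have "(fst (fst g), z) \<in> strands D" "(fst (fst g'), z) \<in> strands D"
      using imageI[OF g(1), of project_edge] imageI[OF g(2), of project_edge] g(3,4)
      by (simp_all add: strands_eq project_edge_def)
    ultimately have "fst (fst g) = fst (fst g')" using pred[OF cp(2), of z "fst w"] by (metis (no_types))
    then have "project_edge g = project_edge g'" using g by (simp add: project_edge_def)
    then show ?thesis using inj g by (auto simp: inj_on_def)
  qed
  have mixed: "h = k" if g: "g \<in> L" "g' \<in> L" "fst (snd g) = z" "fst (fst g') = z"
    "(z, h) \<in> seg g" "(z, k) \<in> seg g'" for g g' h k
  proof -
    obtain w where w: "(snd g, w) \<in> L" using succ[OF cp(1), of "fst g" "snd g"] g by auto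
    then have "(snd g, w) = g'" using out[of "(snd g, w)" g'] g by simp
    then have "snd g = fst g'" by auto
    then have "snd g \<in> seg g \<and> snd g \<in> seg g'" using in_seg by metis
    moreover have "snd g = (z, snd (snd g))" using g by (simp add: prod_eq_iff)
    ultimately show ?thesis using uniq g by metis
  qed
  have "z = fst (fst e) \<or> z = fst (snd e)" "z = fst (fst f) \<or> z = fst (snd f)"
    using z by (simp_all add: ends_def project_edge_def)
  then consider "fst (fst e) = z" "fst (fst f) = z" | "fst (snd e) = z" "fst (snd f) = z"
    | "fst (snd e) = z" "fst (fst f) = z" | "fst (fst e) = z" "fst (snd f) = z"
    by metis
  then show ?thesis
  proof cases
    case 1 show ?thesis using out[OF e 1] uniq[OF e(1) h(1)] h(2) by simp
  next
    case 2 show ?thesis using into[OF e 2] uniq[OF e(1) h(1)] h(2) by simp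
  next
    case 3 show ?thesis by (rule mixed[OF e 3 h])
  next
    case 4 show ?thesis by (rule mixed[OF e(2,1) 4(2,1) h(2,1), symmetric])
  qed
qed

text \<open>Different heights exclude a common vertex, so the two strands must cross; and as no
  three strands of a diagram meet, there is no further strand above or below
  \<open>x\<close>.\<close>

lemma sides_cross:
  assumes e: "e \<in> L" "side 1 x e" and f: "f \<in> L" "side (-1) x f"
  shows "e \<noteq> f" "cross (project_edge e) (project_edge f)" "(project_edge e, project_edge f) \<in> crossings D"
    "seg (project_edge e) \<inter> seg (project_edge f) = {fst x}"
    "fst x \<notin> ends (project_edge e) \<union> ends (project_edge f)"
    "\<And>g s. g \<in> L \<Longrightarrow> s \<in> {1, -1} \<Longrightarrow> side s x g \<Longrightarrow> g = (if s = 1 then e else f)"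
proof -
  let ?e = "project_edge e" and ?f = "project_edge f"
  obtain ho where ho: "ho > snd x" "(fst x, ho) \<in> seg e" using e by (auto simp: side_def)
  obtain hu where hu: "hu < snd x" "(fst x, hu) \<in> seg f" using f by (auto simp: side_def)
  have xo: "fst x \<in> seg ?e" using ho(2) seg_projectI by blast
  have xu: "fst x \<in> seg ?f" using hu(2) seg_projectI by blast
  show ne: "e \<noteq> f" using side_sign[OF e(1), of 1 "-1" x] e f by auto
  have ne': "?e \<noteq> ?f" using inj e f ne by (auto simp: inj_on_def)
  have st: "?e \<in> strands D" "?f \<in> strands D" using e f by (auto simp: strands_eq)
  have ld: "seg ?e \<inter> seg ?f \<subseteq> ends ?e \<inter> ends ?f \<or> cross ?e ?f"
    using strand_pair[OF st ne'] .
  have "\<not> (fst x \<in> ends ?e \<inter> ends ?f)"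
    using strand_vertex_unique[OF e(1) f(1) _ ho(2) hu(2)] ho hu by auto
  then show cr: "cross ?e ?f" using ld xo xu by blast
  then obtain p where p: "seg ?e \<inter> seg ?f = {p}" "p \<notin> ends ?e \<union> ends ?f" unfolding cross_def by blast
  have "fst x = p" using p(1) xo xu by blast
  then show "seg ?e \<inter> seg ?f = {fst x}" "fst x \<notin> ends ?e \<union> ends ?f" using p by simp_all
  show "(?e, ?f) \<in> crossings D"
  proof -
    have "\<exists>p s t. (p, s) \<in> seg e \<and> (p, t) \<in> seg f \<and> t < s"
      using ho hu by (intro exI[of _ "fst x"] exI[of _ ho] exI[of _ hu]) auto
    with e(1) f(1) cr show ?thesis unfolding D project_def diagram.sel by blast
  qed
  fix g s assume g: "g \<in> L" "s \<in> {1, -1::real}" "side s x g"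
  have xe: "fst x \<in> seg (project_edge g)" using g(3) seg_projectI unfolding side_def by blast
  have gs: "project_edge g \<in> strands D" using g(1) by (simp add: strands_eq)
  have "project_edge g = ?e \<or> project_edge g = ?f"
  proof (rule ccontr)
    assume "\<not> ?thesis"
    then have "seg ?e \<inter> seg ?f \<inter> seg (project_edge g) = {}"
      by (intro strand_triple[OF st gs ne']) auto
    then show False using xe xo xu by blast
  qed
  then have "g = e \<or> g = f" using inj_onD[OF inj _ g(1)] e(1) f(1) by metis
  then show "g = (if s = 1 then e else f)"
    using side_sign[OF e(1), of 1 "-1" x] side_sign[OF f(1), of "-1" 1 x] e f g by auto
qed

end

section \<open>Colourings from flat structures\<close>

text \<open>Twice the signed area of the triangle spanned by \<open>e\<close> and \<open>z\<close>:
  affine in \<open>z\<close>, zero on the line of \<open>e\<close>, positive on its left.\<close>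

definition lft :: "complex edge \<Rightarrow> complex \<Rightarrow> real" where
  "lft e z = Im (cnj (snd e - fst e) * (z - fst e))"

lemma left_of_eq: "left_of e = {z. lft e z > 0}" and right_of_eq: "right_of e = {z. lft e z < 0}"
  by (auto simp: left_of_def right_of_def lft_def)

lemma lft_add: "lft e (z + w) = lft e z + Im (cnj (snd e - fst e) * w)"
  by (simp add: lft_def algebra_simps)

lemma convex_left_of: "convex (left_of e)" and convex_right_of: "convex (right_of e)"
proof -
  have lin: "lft e (u *\<^sub>R z + v *\<^sub>R w) = u * lft e z + v * lft e w" if "u + v = 1" for u v z w
  proof -
    have "lft e (u *\<^sub>R z + v *\<^sub>R w) = lft e (u *\<^sub>R z + v *\<^sub>R w) + (u + v - 1) * lft e 0" using that by simp
    then show ?thesis by (simp add: lft_def algebra_simps)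
  qed
  show "convex (left_of e)"
    unfolding convex_def left_of_eq
  proof (clarsimp simp: lin)
    fix z w u v :: real and a b assume "0 \<le> u" "0 \<le> v" "u + v = 1" "0 < lft e a" "0 < lft e b"
    then show "0 < u * lft e a + v * lft e b"
      by (cases "u = 0") (auto intro: add_pos_nonneg)
  qed
  show "convex (right_of e)"
    unfolding convex_def right_of_eq using lin convex_bound_lt[of _ 0] by auto
qed

lemma Im_cnj_scaleR [simp]: "Im (cnj d * (t *\<^sub>R d)) = 0"
  by simp

lemma continuous_lft [continuous_intros]: "continuous_on S (lft e)"
  unfolding lft_def by (intro continuous_intros)

lemma lft_seg: "z \<in> seg e \<Longrightarrow> lft e z = 0"
proof -
  assume "z \<in> seg e"
  then obtain t where "z = (1 - t) *\<^sub>R fst e + t *\<^sub>R snd e" by (auto simp: seg_def in_segment)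
  then have "z - fst e = t *\<^sub>R (snd e - fst e)" by (simp add: algebra_simps)
  then show ?thesis unfolding lft_def by (simp only: Im_cnj_scaleR)
qed

text \<open>The coordinate \<tau> along \<open>e\<close> lies strictly between 0 and 1 at
  \<open>p\<close>, hence also nearby; there only the distance from the line decides.\<close>

lemma seg_near_interior:
  assumes p: "p \<in> seg e" "p \<notin> ends e"
  shows "\<exists>r>0. \<forall>z\<in>ball p r. z \<in> seg e \<longleftrightarrow> lft e z = 0"
proof -
  define d where "d = snd e - fst e"
  obtain t where t: "0 \<le> t" "t \<le> 1" "p = (1 - t) *\<^sub>R fst e + t *\<^sub>R snd e"
    using p(1) by (auto simp: seg_def in_segment)
  have "t \<noteq> 0" "t \<noteq> 1" using t(3) p(2) by (auto simp: ends_def)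
  then have t01: "0 < t" "t < 1" using t by auto
  have d: "d \<noteq> 0" using p t by (auto simp: d_def ends_def algebra_simps)
  define \<tau> where "\<tau> = (\<lambda>z. Re (cnj d * (z - fst e)) / (norm d)\<^sup>2)"
  have pd: "p - fst e = t *\<^sub>R d" by (simp add: t(3) d_def algebra_simps)
  have "Re (cnj d * (t *\<^sub>R d)) = t * (norm d)\<^sup>2"
    unfolding cmod_power2 by (simp add: power2_eq_square algebra_simps)
  moreover have "\<tau> p = Re (cnj d * (t *\<^sub>R d)) / (norm d)\<^sup>2" by (simp only: \<tau>_def pd)
  ultimately have "\<tau> p = t * (norm d)\<^sup>2 / (norm d)\<^sup>2" by presburger
  then have "\<tau> p = t" using d by simp
  moreover have lim: "(\<tau> \<longlongrightarrow> \<tau> p) (nhds p)" unfolding \<tau>_def using d by (intro tendsto_intros filterlim_ident) auto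
  ultimately have "\<forall>\<^sub>F z in nhds p. 0 < \<tau> z \<and> \<tau> z < 1"
    using t01 order_tendstoD(1)[OF lim, of 0] order_tendstoD(2)[OF lim, of 1] by (simp add: eventually_conj_iff)
  then obtain r where r: "r > 0" "\<And>z. dist z p < r \<Longrightarrow> 0 < \<tau> z \<and> \<tau> z < 1"
    unfolding eventually_nhds_metric by blast
  have "z \<in> seg e" if z: "z \<in> ball p r" "lft e z = 0" for z
  proof -
    have "cnj d * (z - fst e) = of_real (\<tau> z * (norm d)\<^sup>2)"
      using z(2) d by (simp add: complex_eq_iff \<tau>_def lft_def d_def)
    then have "d * cnj d * (z - fst e) = d * of_real (\<tau> z * (norm d)\<^sup>2)" by simp
    then have "of_real ((norm d)\<^sup>2) * (z - fst e) = of_real ((norm d)\<^sup>2) * (of_real (\<tau> z) * d)"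
      by (simp only: complex_norm_square[symmetric] of_real_mult mult_ac)
    then have "z - fst e = \<tau> z *\<^sub>R d" using d by (simp add: scaleR_conv_of_real)
    then have "z = (1 - \<tau> z) *\<^sub>R fst e + \<tau> z *\<^sub>R snd e" by (simp add: d_def algebra_simps)
    moreover have "0 < \<tau> z" "\<tau> z < 1" using r(2)[of z] z(1) by (auto simp: dist_commute)
    ultimately show ?thesis unfolding seg_def in_segment by (intro exI[of _ "\<tau> z"]) auto
  qed
  then show ?thesis using r(1) lft_seg by blast
qed

text \<open>If the directions were parallel, a small step along \<open>e\<close> from the common
  point would stay on both edges.\<close>

lemma cross_transversal:
  assumes "cross e f"
  shows "Im (cnj (snd e - fst e) * (snd f - fst f)) \<noteq> 0"
proof
  assume z: "Im (cnj (snd e - fst e) * (snd f - fst f)) = 0"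
  obtain p where p: "seg e \<inter> seg f = {p}" "p \<notin> ends e" "p \<notin> ends f"
    using assms by (auto simp: cross_def)
  then have pe: "p \<in> seg e" "p \<in> seg f" by auto
  obtain r1 where r1: "r1 > 0" "\<forall>z\<in>ball p r1. z \<in> seg e \<longleftrightarrow> lft e z = 0"
    using seg_near_interior[OF pe(1) p(2)] by blast
  obtain r2 where r2: "r2 > 0" "\<forall>z\<in>ball p r2. z \<in> seg f \<longleftrightarrow> lft f z = 0"
    using seg_near_interior[OF pe(2) p(3)] by blast
  define d where "d = snd e - fst e"
  have d: "d \<noteq> 0" using pe(1) p(2) by (auto simp: d_def seg_def ends_def)
  define w where "w = p + (min r1 r2 / 2 / norm d) *\<^sub>R d"
  have "dist p w = min r1 r2 / 2" using d r1 r2 by (simp add: w_def dist_norm)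
  then have "w \<in> ball p r1" "w \<in> ball p r2" using r1 r2 by auto
  moreover have "lft e w = 0"
    using lft_seg[OF pe(1)] unfolding w_def lft_add d_def[symmetric] by (simp only: Im_cnj_scaleR)
  moreover have "lft f w = 0"
  proof -
    have "Im (cnj (snd f - fst f) * d) = - Im (cnj (snd e - fst e) * (snd f - fst f))"
      by (simp add: d_def algebra_simps)
    then show ?thesis using lft_seg[OF pe(2)] z unfolding w_def lft_add by simp
  qed
  ultimately have "w \<in> seg e \<inter> seg f" using r1 r2 by blast
  moreover have "w \<noteq> p" using d r1 r2 by (simp add: w_def)
  ultimately show False using p(1) by blast
qed

lemma sector_point:
  assumes p: "lft e p = 0" "lft f p = 0" and t: "Im (cnj (snd e - fst e) * (snd f - fst f)) \<noteq> 0"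
    and "r > 0"
  shows "\<exists>z\<in>ball p r. sgn (lft e z) = sgn \<sigma> \<and> sgn (lft f z) = sgn \<tau>"
proof -
  define d d' where "d = snd e - fst e" and "d' = snd f - fst f"
  define \<Delta> where "\<Delta> = Im (cnj d * d')"
  have \<Delta>: "\<Delta> \<noteq> 0" using t by (simp add: \<Delta>_def d_def d'_def)
  \<comment> \<open>Solves the linear system that prescribes both oriented areas: paired with
    \<open>d\<close> it gives \<open>sgn \<sigma> * \<bar>\<Delta>\<bar>\<close>, paired with
    \<open>d'\<close> it gives \<open>sgn \<tau> * \<bar>\<Delta>\<bar>\<close>.\<close>
  define v where "v = (- sgn \<tau> * sgn \<Delta>) *\<^sub>R d + (sgn \<sigma> * sgn \<Delta>) *\<^sub>R d'"
  define k where "k = r / 2 / (norm v + 1)"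
  have k: "k > 0" using assms(4) by (simp add: k_def add_nonneg_pos)
  have "norm (k *\<^sub>R v) < r"
  proof -
    have "norm (k *\<^sub>R v) = k * norm v" using k by simp
    also have "\<dots> = r / 2 * (norm v / (norm v + 1))" by (simp add: k_def)
    also have "\<dots> \<le> r / 2 * 1" using assms(4) by (intro mult_left_mono) (auto simp: divide_le_eq_1 add_nonneg_pos)
    finally show ?thesis using assms(4) by simp
  qed
  then have "p + k *\<^sub>R v \<in> ball p r" by (simp add: dist_norm)
  moreover have "Im (cnj d * v) = sgn \<sigma> * \<bar>\<Delta>\<bar>"
    by (simp add: v_def \<Delta>_def abs_sgn algebra_simps)
  then have "lft e (p + k *\<^sub>R v) = k * \<bar>\<Delta>\<bar> * sgn \<sigma>"
    using p by (simp add: lft_add d_def[symmetric] algebra_simps)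
  moreover have "Im (cnj d' * v) = sgn \<tau> * \<bar>\<Delta>\<bar>"
    by (simp add: v_def \<Delta>_def abs_sgn algebra_simps)
  then have "lft f (p + k *\<^sub>R v) = k * \<bar>\<Delta>\<bar> * sgn \<tau>"
    using p by (simp add: lft_add d'_def[symmetric] algebra_simps)
  ultimately show ?thesis using k \<Delta> by (intro bexI[of _ "p + k *\<^sub>R v"]) (auto simp: sgn_mult)
qed

lemma same_side_segment:
  assumes "sgn (lft e z) = sgn (lft e w)" "lft e z \<noteq> 0"
  shows "closed_segment z w \<inter> seg e = {}"
proof -
  have "closed_segment z w \<subseteq> left_of e \<or> closed_segment z w \<subseteq> right_of e"
    using assms convex_left_of[of e] convex_right_of[of e]
    unfolding convex_contains_segment left_of_eq right_of_eq by (auto simp: sgn_if split: if_splits)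
  then show ?thesis using lft_seg[of _ e] unfolding left_of_eq right_of_eq by force
qed

definition sector :: "complex edge \<Rightarrow> complex edge \<Rightarrow> complex \<Rightarrow> real \<Rightarrow> real \<Rightarrow> real \<Rightarrow> complex set" where
  "sector e f p r \<sigma> \<tau> = ball p r \<inter> {z. \<sigma> * lft e z > 0} \<inter> {z. \<tau> * lft f z > 0}"

lemma convex_sector:
  assumes "\<sigma> \<in> {1, -1}" "\<tau> \<in> {1, -1}"
  shows "convex (sector e f p r \<sigma> \<tau>)"
proof -
  have "convex {z. \<sigma> * lft e z > 0}" if "\<sigma> \<in> {1, -1}" for \<sigma> e
    using that convex_left_of[of e] convex_right_of[of e] by (auto simp: left_of_eq right_of_eq)
  then show ?thesis unfolding sector_def using assms by (intro convex_Int convex_ball) auto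
qed

context projected_link
begin

lemma locally_constant_on:
  assumes "\<And>z. z \<notin> K \<Longrightarrow> \<forall>\<^sub>F w in nhds z. k w = k z" and S: "connected S" "S \<inter> K = {}" "z \<in> S" "w \<in> S"
  shows "k z = k w"
proof -
  have "k constant_on S"
  proof (rule locally_constant_imp_constant[OF S(1)])
    fix a assume a: "a \<in> S"
    then have "\<forall>\<^sub>F w in nhds a. k w = k a" using assms(1) S(2) by blast
    then obtain T where T: "open T" "a \<in> T" "\<forall>w\<in>T. k w = k a" unfolding eventually_nhds by blast
    show "\<exists>T. openin (top_of_set S) T \<and> a \<in> T \<and> (\<forall>x\<in>T. k x = k a)"
    proof (intro exI conjI)
      show "openin (top_of_set S) (S \<inter> T)" using T(1) by (rule openin_open_Int)
      show "\<forall>x\<in>S \<inter> T. k x = k a" using T(3) by blast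
    qed (use a T(2) in blast)
  qed
  then show ?thesis using S by (auto simp: constant_on_def)
qed

lemma generic_seg: "z \<notin> K \<Longrightarrow> e \<in> L \<Longrightarrow> z \<notin> seg (project_edge e)"
  by (auto simp: K_def carrier_of_def strands_eq)

text \<open>Between an over-strand and an under-strand all four sectors are present, so some generic
  \<open>q\<close> lies on the side of the over-strand where \<open>q1\<close> is and on the side of
  the under-strand where \<open>q2\<close> is. If nothing is above \<open>x\<close>, take
  \<open>q = q2\<close>; if nothing is below, take \<open>q = q1\<close>.\<close>

lemma local_connect:
  assumes x: "x \<in> X"
  shows "\<exists>r0>0. \<forall>r. 0 < r \<longrightarrow> r \<le> r0 \<longrightarrow> local_radius x r \<and>
    (\<forall>q1\<in>ball x r. \<forall>q2\<in>ball x r. fst q1 \<notin> K \<longrightarrow> fst q2 \<notin> K \<longrightarrow>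
      (\<exists>q\<in>ball x r. fst q \<notin> K \<and> adjacent 1 q1 q \<and> adjacent (-1) q q2))"
proof -
  obtain r1 where r1: "local_radius x r1" using local_radius_exists[OF x] by blast
  have r1pos: "r1 > 0" using r1 by (simp add: local_radius_def)
  have fst_ball: "fst q \<in> ball (fst x) r" if "q \<in> ball x r" for q r
    using that dist_fst_le[of x q] by auto
  consider (above) "\<not> (\<exists>e\<in>L. side 1 x e)" | (below) "\<not> (\<exists>f\<in>L. side (-1) x f)"
    | (between) e f where "e \<in> L" "side 1 x e" "f \<in> L" "side (-1) x f" by blast
  then show ?thesis
  proof cases
    case above
    have "adjacent 1 q1 q2 \<and> adjacent (-1) q2 q2"
      if r: "0 < r" "r \<le> r1" and q: "q1 \<in> ball x r" "q2 \<in> ball x r" "fst q2 \<notin> K" for r q1 q2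
    proof
      have lr: "local_radius x r" using local_radius_mono[OF r1] r by blast
      show "adjacent 1 q1 q2" using above by (intro adjacentI[OF lr q(1,2)]) auto
      show "adjacent (-1) q2 q2"
        by (intro adjacentI[OF lr q(2,2)]) (use q(3) generic_seg in \<open>simp_all add: closed_segment_idem\<close>)
    qed
    then show ?thesis using r1pos local_radius_mono[OF r1] by (intro exI[of _ r1]) blast
  next
    case below
    have "adjacent (-1) q1 q2 \<and> adjacent 1 q1 q1"
      if r: "0 < r" "r \<le> r1" and q: "q1 \<in> ball x r" "q2 \<in> ball x r" "fst q1 \<notin> K" for r q1 q2
    proof
      have lr: "local_radius x r" using local_radius_mono[OF r1] r by blast
      show "adjacent (-1) q1 q2" using below by (intro adjacentI[OF lr q(1,2)]) auto
      show "adjacent 1 q1 q1"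
        by (intro adjacentI[OF lr q(1,1)]) (use q(3) generic_seg in \<open>simp_all add: closed_segment_idem\<close>)
    qed
    then show ?thesis using r1pos local_radius_mono[OF r1] by (intro exI[of _ r1]) blast
  next
    case between
    let ?e = "project_edge e" and ?f = "project_edge f"
    note c = sides_cross[OF between]
    have xe: "fst x \<in> seg ?e" "fst x \<in> seg ?f" "fst x \<notin> ends ?e" "fst x \<notin> ends ?f" using c(4,5) by auto
    obtain r2 where r2: "r2 > 0" "\<forall>z\<in>ball (fst x) r2. z \<in> seg ?e \<longleftrightarrow> lft ?e z = 0"
      using seg_near_interior[OF xe(1,3)] by blast
    obtain r3 where r3: "r3 > 0" "\<forall>z\<in>ball (fst x) r3. z \<in> seg ?f \<longleftrightarrow> lft ?f z = 0"
      using seg_near_interior[OF xe(2,4)] by blast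
    define r0 where "r0 = min r1 (min r2 r3)"
    have inK: "seg ?e \<subseteq> K" "seg ?f \<subseteq> K"
      using between by (auto simp: K_def carrier_of_def strands_eq)
    have "\<exists>q\<in>ball x r. fst q \<notin> K \<and> adjacent 1 q1 q \<and> adjacent (-1) q q2"
      if r: "0 < r" "r \<le> r0" and q1: "q1 \<in> ball x r" "fst q1 \<notin> K" and q2: "q2 \<in> ball x r" "fst q2 \<notin> K" for r q1 q2
    proof -
      have lr: "local_radius x r" using local_radius_mono[OF r1] r by (auto simp: r0_def)
      have b: "z \<in> ball (fst x) r2" "z \<in> ball (fst x) r3" if "z \<in> ball (fst x) r" for z
        using that r by (auto simp: r0_def)
      have "lft ?e (fst q1) \<noteq> 0" "lft ?f (fst q2) \<noteq> 0"
        using r2(2) r3(2) b fst_ball[OF q1(1)] fst_ball[OF q2(1)] q1(2) q2(2) inK by blast+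
      note nz = this
      obtain z where z: "z \<in> ball (fst x) r" "sgn (lft ?e z) = sgn (lft ?e (fst q1))"
        "sgn (lft ?f z) = sgn (lft ?f (fst q2))"
        using sector_point[OF lft_seg[OF xe(1)] lft_seg[OF xe(2)] cross_transversal[OF c(2)] r(1)] by blast
      have nz': "lft ?e z \<noteq> 0" "lft ?f z \<noteq> 0" using nz z by (auto simp: sgn_if split: if_splits)
      define q where "q = (z, snd x)"
      have q: "q \<in> ball x r" using z(1) by (cases x) (simp add: q_def dist_Pair_Pair)
      have side_edge: "g = e \<or> g = f" if "g \<in> L" "side s x g" "s \<in> {1, -1}" for g s
        using c(6)[OF that(1,3,2)] by (auto split: if_splits)
      have "z \<notin> K"
      proof
        assume "z \<in> K"
        then obtain p where p: "p \<in> carrier_of L" "fst p = z" by (auto simp: K_eq)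
        then obtain g where g: "g \<in> L" "p \<in> seg g" by (auto simp: carrier_of_def)
        then obtain s where "s \<in> {1, -1}" "side s x g"
          using local_radiusD[OF lr g] z(1) p(2) by (metis dist_commute mem_ball)
        then have "g = e \<or> g = f" using side_edge g(1) by blast
        then have "z \<in> seg ?e \<or> z \<in> seg ?f" using g(2) p(2) seg_projectI by (metis prod.collapse)
        then show False using nz' lft_seg by blast
      qed
      moreover have "adjacent 1 q1 q"
      proof (rule adjacentI[OF lr q1(1) q])
        fix g assume "g \<in> L" "side 1 x g"
        then have "g = e" using c(6)[of g 1] by simp
        then show "closed_segment (fst q1) (fst q) \<inter> seg (project_edge g) = {}"
          using same_side_segment z(2) nz(1) by (simp add: q_def)
      qed simp
      moreover have "adjacent (-1) q q2"
      proof (rule adjacentI[OF lr q q2(1)])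
        fix g assume "g \<in> L" "side (-1) x g"
        then have "g = f" using c(6)[of g "-1"] by simp
        then show "closed_segment (fst q) (fst q2) \<inter> seg (project_edge g) = {}"
          using same_side_segment z(3) nz'(2) by (simp add: q_def)
      qed simp
      ultimately show ?thesis using q by (intro bexI[of _ q]) (auto simp: q_def)
    qed
    moreover have "local_radius x r" if "0 < r" "r \<le> r0" for r
      using local_radius_mono[OF r1] that by (auto simp: r0_def)
    ultimately show ?thesis using r1pos r2(1) r3(1) by (intro exI[of _ r0]) (auto simp: r0_def)
  qed
qed

end

section \<open>Holonomy along vertical paths\<close>

definition vertical :: "(space \<Rightarrow> space \<Rightarrow> 'g::group_add) \<Rightarrow> real \<Rightarrow> real \<Rightarrow> space \<Rightarrow> 'g" where
  "vertical f H s q = hol f q (fst q, s * H) + hol f (fst q, s * H) (0, s * H)"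

text \<open>The holonomy of the loop that starts high above the plane, pierces it at \<open>z\<close> and returns far
  below; these loops generate the group of the link as in the Dehn presentation.\<close>

definition colour :: "(space \<Rightarrow> space \<Rightarrow> 'g::group_add) \<Rightarrow> real \<Rightarrow> complex \<Rightarrow> 'g" where
  "colour f H z = hol f (0, H) (z, H) + hol f (z, H) (z, - H) + hol f (z, - H) (0, - H)"

text \<open>Stated with germs of sectors at the crossing instead of regions, so it applies to any
  function on the plane and ignores its values on the curve.\<close>

definition colouring :: "diagram \<Rightarrow> (complex \<Rightarrow> 'g::group_add) \<Rightarrow> bool" where
  "colouring D C \<longleftrightarrow>
     (\<forall>z. z \<notin> carrier_of (strands D) \<longrightarrow> (\<forall>\<^sub>F w in nhds z. C w = C z)) \<and>
     (\<forall>(e, f)\<in>crossings D. \<forall>p\<in>seg e \<inter> seg f. \<exists>r>0.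
        \<forall>a\<in>ball p r \<inter> (left_of e \<inter> right_of f). \<forall>b\<in>ball p r \<inter> (left_of e \<inter> left_of f).
        \<forall>c\<in>ball p r \<inter> (right_of e \<inter> left_of f). \<forall>d\<in>ball p r \<inter> (right_of e \<inter> right_of f).
        C a - C d = C b - C c)"

lemma flat_pair_group:
  fixes a b c d :: "'g::group_add"
  assumes "- a + b = - c + d"
  shows "c - a = d - b"
proof -
  have "b = a + (- c + d)" using assms by (metis add_minus_cancel)
  then have "d - b = d - (a + (- c + d))" by simp
  then show ?thesis by (simp only: group_normal)
qed

locale bounded_projected_link = projected_link +
  fixes H0 H :: real
  assumes heights: "\<And>p. p \<in> carrier_of L \<Longrightarrow> \<bar>snd p\<bar> \<le> H0" and H0: "H0 < H"
begin

definition cap :: "real \<Rightarrow> space set" where "cap s = {p. s * snd p > H0}"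

lemma cap_subset: "s \<in> {1, -1} \<Longrightarrow> cap s \<subseteq> X"
  using heights unfolding cap_def X_def by fastforce

lemma convex_cap: "convex (cap s)"
proof -
  have "cap s = {p. inner (0, s) p > H0}" by (simp add: cap_def inner_prod_def)
  then show ?thesis by (simp add: convex_halfspace_gt)
qed

text \<open>The paths bound a vertical half-strip, which is convex as the sum of a segment and a
  ray, together with a triangle in the cap. The condition \<open>pos\<close> says that the vertical
  paths really leave in direction \<open>s\<close>, or else that everything happens inside the cap,
  which is convex and free of the link.\<close>

lemma vertical_adjacent:
  assumes f: "flat X f" and s: "s \<in> {1, -1}" and adj: "adjacent s q1 q2"
    and pos: "s * snd q1 < H \<and> s * snd q2 < H \<or> q1 \<in> cap s \<and> q2 \<in> cap s"
  shows "vertical f H s q1 = hol f q1 q2 + vertical f H s q2"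
proof -
  note tri = hol_triangle[OF f open_X]
  have ss: "s * s = 1" using s by auto
  have topc: "(z, s * H) \<in> cap s" for z :: complex using H0 ss by (simp add: cap_def mult.assoc[symmetric])
  note ctri = tri[OF convex_cap cap_subset[OF s]]
  from pos show ?thesis
  proof
    assume q: "q1 \<in> cap s \<and> q2 \<in> cap s"
    show ?thesis
      unfolding vertical_def using ctri[of q1 "(fst q1, s * H)" "(0, s * H)"] ctri[of q2 "(fst q2, s * H)" "(0, s * H)"]
        ctri[of q1 q2 "(0, s * H)"] q topc by simp
  next
    assume q: "s * snd q1 < H \<and> s * snd q2 < H"
    define S where "S = (\<Union>p\<in>closed_segment q1 q2. \<Union>y\<in>{0} \<times> {t. 0 \<le> s * t}. {p + y})"
    have "convex ({0 :: complex} \<times> {t. 0 \<le> s * t})"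
      using convex_halfspace_ge[of 0 s] by (intro convex_Times) auto
    then have convS: "convex S" unfolding S_def by (intro convex_sums convex_closed_segment)
    have SX: "S \<subseteq> X"
    proof
      fix y assume "y \<in> S"
      then obtain p t where p: "p \<in> closed_segment q1 q2" "0 \<le> s * t" "y = p + (0, t)"
        by (auto simp: S_def)
      moreover have "s * (s * t) = t" using ss by (simp add: mult.assoc[symmetric])
      ultimately show "y \<in> X" using adj unfolding adjacent_def by metis
    qed
    have inS: "q + (0, t) \<in> S" if "q \<in> {q1, q2}" "0 \<le> s * t" for q t
      using that by (force simp: S_def)
    have top: "(fst q, s * H) \<in> S" if "q \<in> {q1, q2}" for q
    proof -
      have "(fst q, s * H) = q + (0, s * H - snd q)" by (simp add: prod_eq_iff)
      moreover have "0 \<le> s * (s * H - snd q)" using q that ss by (auto simp: right_diff_distrib mult.assoc[symmetric])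
      ultimately show ?thesis using inS[OF that] by metis
    qed
    have qS: "q1 \<in> S" "q2 \<in> S" using inS[of q1 0] inS[of q2 0] by (simp_all add: zero_prod_def[symmetric])
    note stri = tri[OF convS SX]
    define T :: "space \<Rightarrow> space" where "T = (\<lambda>q. (fst q, s * H))"
    define O' :: space where "O' = (0, s * H)"
    have 1: "hol f q1 q2 + hol f q2 (T q2) = hol f q1 (T q2)"
      unfolding T_def by (rule stri[OF qS top]) simp
    have 2: "hol f q1 (T q1) + hol f (T q1) (T q2) = hol f q1 (T q2)"
      unfolding T_def by (rule stri[OF qS(1) top top]) simp_all
    have 3: "hol f (T q1) (T q2) + hol f (T q2) O' = hol f (T q1) O'"
      unfolding T_def O'_def by (rule ctri[OF topc topc topc])
    have "hol f q1 (T q1) + hol f (T q1) O' = hol f q1 (T q1) + hol f (T q1) (T q2) + hol f (T q2) O'"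
      by (simp only: 3[symmetric] add.assoc)
    also have "\<dots> = hol f q1 q2 + (hol f q2 (T q2) + hol f (T q2) O')"
      by (simp only: 2 1[symmetric] add.assoc)
    finally show ?thesis by (simp only: vertical_def T_def O'_def)
  qed
qed

lemma colour_vertical:
  assumes f: "flat X f" and q: "fst q \<notin> K"
  shows "colour f H (fst q) = - vertical f H 1 q + vertical f H (-1) q"
proof -
  let ?A = "(fst q, H)" and ?B = "(fst q, - H)"
  have line: "{fst q} \<times> (UNIV :: real set) \<subseteq> X" using generic_in_X q by auto
  have conv: "convex ({fst q} \<times> (UNIV :: real set))" by (intro convex_Times) auto
  have qin: "q \<in> {fst q} \<times> UNIV" by (cases q) auto
  have AB: "hol f ?A ?B = - hol f q ?A + hol f q ?B"
  proof -
    have "hol f q ?A + hol f ?A ?B = hol f q ?B"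
      by (rule hol_triangle[OF f open_X conv line qin]) auto
    then show ?thesis by (metis minus_add_cancel)
  qed
  have "hol f (0, H) ?A = - hol f ?A (0, H)"
  proof (rule hol_reverse[OF f open_X])
    have "?A \<in> cap 1" "(0, H) \<in> cap 1" using H0 by (auto simp: cap_def)
    then show "closed_segment ?A (0, H) \<subseteq> X" using convex_cap[of 1] cap_subset[of 1]
      by (meson convex_contains_segment insertI1 subset_trans)
  qed
  then show ?thesis unfolding colour_def vertical_def using AB by (simp only: group_normal mult_1 mult_minus1)
qed

text \<open>The way from \<open>x\<close> via a nearby point \<open>q\<close> to the far base point
  in direction \<open>s\<close>. As a function of \<open>q\<close> it shows how the bundle near
  \<open>x\<close> looks from above or from below.\<close>

definition sheet :: "(space \<Rightarrow> space \<Rightarrow> 'g::group_add) \<Rightarrow> space \<Rightarrow> real \<Rightarrow> space \<Rightarrow> 'g" where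
  "sheet f x s q = hol f x q + vertical f H s q"

lemma colour_sheet:
  assumes "flat X f" "fst q \<notin> K"
  shows "colour f H (fst q) = - sheet f x 1 q + sheet f x (-1) q"
  unfolding colour_vertical[OF assms] sheet_def by (simp only: group_normal)

text \<open>In each direction one of the two alternatives of \<open>vertical_adjacent\<close> holds
  uniformly on the ball.\<close>

definition level :: "space \<Rightarrow> real \<Rightarrow> bool" where
  "level x r \<longleftrightarrow> (\<forall>s\<in>{1,-1}. (\<forall>q\<in>ball x r. s * snd q < H) \<or> ball x r \<subseteq> cap s)"

lemma level_exists: "\<exists>r0>0. \<forall>r. 0 < r \<longrightarrow> r \<le> r0 \<longrightarrow> level x r"
proof -
  \<comment> \<open>Half the margin between \<open>H0\<close> and \<open>H\<close>: the position of
    the centre relative to the middle height then settles the alternative for the whole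
    ball.\<close>
  define r0 where "r0 = (H - H0) / 2"
  have "level x r" if r: "0 < r" "r \<le> r0" for r
    unfolding level_def
  proof
    fix s :: real assume s: "s \<in> {1, -1}"
    have near: "\<bar>s * snd q - s * snd x\<bar> < r" if "q \<in> ball x r" for q
      using that s dist_snd_le[of x q] by (auto simp: dist_real_def)
    show "(\<forall>q\<in>ball x r. s * snd q < H) \<or> ball x r \<subseteq> cap s"
    proof (cases "s * snd x < (H + H0) / 2")
      case True
      then have "s * snd q < H" if "q \<in> ball x r" for q
        using near[OF that] r(2) by (simp add: r0_def field_simps)
      then show ?thesis by blast
    next
      case False
      then have "H0 < s * snd q" if "q \<in> ball x r" for q
        using near[OF that] r(2) by (simp add: r0_def field_simps)
      then show ?thesis by (auto simp: cap_def)
    qed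
  qed
  then show ?thesis using H0 by (intro exI[of _ r0]) (simp add: r0_def)
qed

lemma sheet_adjacent:
  assumes f: "flat X f" and s: "s \<in> {1, -1}" and adj: "adjacent s q1 q2"
    and r: "local_radius x r" "level x r" and q: "q1 \<in> ball x r" "q2 \<in> ball x r"
  shows "sheet f x s q1 = sheet f x s q2"
proof -
  have "s * snd q1 < H \<and> s * snd q2 < H \<or> q1 \<in> cap s \<and> q2 \<in> cap s"
    using r(2) s q unfolding level_def by blast
  note v = vertical_adjacent[OF f s adj this]
  have "x \<in> ball x r" using r(1) by (simp add: local_radius_def)
  then have "hol f x q1 + hol f q1 q2 = hol f x q2"
    using hol_triangle[OF f open_X convex_ball ball_subset_X[OF r(1)]] q by blast
  then show ?thesis unfolding sheet_def v by (metis add.assoc)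
qed

text \<open>Seen from a point between the strands of a crossing, a colour is \<open>- U + V\<close>,
  where the upward sheet \<open>U\<close> depends only on the side of the over-strand and the
  downward sheet \<open>V\<close> only on the side of the under-strand. In each difference of the
  crossing relation \<open>V\<close> cancels, and the same two values of \<open>U\<close>
  remain.\<close>

lemma colour_colouring:
  assumes f: "flat X f"
  shows "colouring D (colour f H)"
  unfolding colouring_def
proof (intro conjI allI impI ballI, safe)
  fix z assume "z \<notin> carrier_of (strands D)"
  then have z: "z \<notin> K" by (simp add: K_def)
  define x where "x = (z, 0 :: real)"
  have x: "x \<in> X" using z by (intro generic_in_X) (simp add: x_def)
  obtain r1 where r1: "r1 > 0" "\<And>r. 0 < r \<Longrightarrow> r \<le> r1 \<Longrightarrow> local_radius x r" using local_connect[OF x] by blast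
  obtain r2 where r2: "r2 > 0" "\<And>r. 0 < r \<Longrightarrow> r \<le> r2 \<Longrightarrow> level x r" using level_exists by blast
  obtain r3 where r3: "r3 > 0" "ball z r3 \<subseteq> - K" using closed_K z by (metis Compl_iff open_Compl open_contains_ball)
  define r where "r = min r1 (min r2 r3)"
  have r: "r > 0" "local_radius x r" "level x r" "ball z r \<subseteq> - K"
    using r1 r2 r3 by (auto simp: r_def)
  have "colour f H w = colour f H z" if w: "w \<in> ball z r" for w
  proof -
    define q where "q = (w, 0 :: real)"
    have q: "q \<in> ball x r" using w by (simp add: q_def x_def dist_Pair_Pair)
    have xb: "x \<in> ball x r" using r(1) by simp
    have "closed_segment w z \<subseteq> ball z r" using w r(1) by (intro closed_segment_subset) auto
    then have free: "closed_segment w z \<inter> K = {}" using r(4) by blast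
    have "sheet f x s q = sheet f x s x" if s: "s \<in> {1, -1}" for s
    proof (rule sheet_adjacent[OF f s _ r(2,3) q xb], rule adjacentI[OF r(2) q xb s])
      fix e assume "e \<in> L"
      then have "seg (project_edge e) \<subseteq> K" by (auto simp: K_def carrier_of_def strands_eq)
      then show "closed_segment (fst q) (fst x) \<inter> seg (project_edge e) = {}" using free by (auto simp: q_def x_def)
    qed
    then show ?thesis using colour_sheet[OF f, of q x] colour_sheet[OF f, of x x] w r(4) z
      by (auto simp: q_def x_def)
  qed
  moreover have "\<forall>\<^sub>F w in nhds z. w \<in> ball z r" using r(1) by (intro eventually_nhds_in_open) auto
  ultimately show "\<forall>\<^sub>F w in nhds z. colour f H w = colour f H z" by (rule eventually_mono[rotated])
next
  fix e1 e2 f1 f2 p assume cr: "((e1, e2), (f1, f2)) \<in> crossings D" and p: "p \<in> seg (e1, e2)" "p \<in> seg (f1, f2)"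
  obtain e g where eg: "e \<in> L" "g \<in> L" "(e1, e2) = project_edge e" "(f1, f2) = project_edge g"
     "cross (project_edge e) (project_edge g)"
    "\<exists>p s t. (p, s) \<in> seg e \<and> (p, t) \<in> seg g \<and> t < s"
    using cr unfolding D project_def diagram.sel by blast
  obtain p' s t where st: "(p', s) \<in> seg e" "(p', t) \<in> seg g" "t < s" using eg(6) by blast
  have "p' \<in> seg (project_edge e) \<inter> seg (project_edge g)" using st seg_projectI by blast
  moreover have "p \<in> seg (project_edge e) \<inter> seg (project_edge g)" using p eg(3,4) by simp
  moreover obtain w where "seg (project_edge e) \<inter> seg (project_edge g) = {w}" using eg(5) unfolding cross_def by blast
  ultimately have p': "p' = p" by simp
  define x where "x = (p, (s + t) / 2)"
  have sides: "side 1 x e" "side (-1) x g"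
    unfolding side_def using st by (auto simp: x_def p' intro: exI[of _ s] exI[of _ t])
  note sc = sides_cross[OF eg(1) sides(1) eg(2) sides(2)]
  have x: "x \<in> X"
  proof (rule ccontr)
    assume "x \<notin> X"
    then obtain k where k: "k \<in> L" "x \<in> seg k" by (auto simp: X_def carrier_of_def)
    have "p \<in> seg (project_edge k)" using k(2) seg_projectI by (simp add: x_def)
    have ne: "project_edge e \<noteq> project_edge g" using sc(1) inj eg(1,2) by (auto simp: inj_on_def)
    have "k = e \<or> k = g"
    proof (rule ccontr)
      assume "\<not> ?thesis"
      then have "project_edge e \<noteq> project_edge k" "project_edge g \<noteq> project_edge k"
        using inj eg(1,2) k(1) by (auto simp: inj_on_def)
      then have "seg (project_edge e) \<inter> seg (project_edge g) \<inter> seg (project_edge k) = {}"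
        using strand_triple ne eg(1,2) k(1) by (simp add: strands_eq)
      then show False using \<open>p \<in> seg (project_edge k)\<close> p eg(3,4) by auto
    qed
    then have "(s + t) / 2 = s \<or> (s + t) / 2 = t"
      using k(2) st seg_height_unique[OF project_edge_nondegenerate] eg(1,2) unfolding x_def p' by metis
    then show False using st(3) by auto
  qed
  obtain r1 where r1: "r1 > 0" "\<And>r. 0 < r \<Longrightarrow> r \<le> r1 \<Longrightarrow> local_radius x r" using local_connect[OF x] by blast
  obtain r2 where r2: "r2 > 0" "\<And>r. 0 < r \<Longrightarrow> r \<le> r2 \<Longrightarrow> level x r" using level_exists by blast
  define r where "r = min r1 r2"
  have r: "r > 0" "local_radius x r" "level x r" using r1 r2 by (auto simp: r_def)
  let ?e = "(e1, e2)" and ?f = "(f1, f2)"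
  have inb: "(z, snd x) \<in> ball x r" if "z \<in> ball p r" for z
    using that by (simp add: x_def dist_Pair_Pair)
  have same: "sheet f x \<sigma> (z, snd x) = sheet f x \<sigma> (w, snd x)"
    if "\<sigma> \<in> {1, -1}" "z \<in> ball p r" "w \<in> ball p r" 
      and sg: "sgn (lft (if \<sigma> = 1 then ?e else ?f) z) = sgn (lft (if \<sigma> = 1 then ?e else ?f) w)"
        "lft (if \<sigma> = 1 then ?e else ?f) z \<noteq> 0" for \<sigma> z w
  proof (rule sheet_adjacent[OF f that(1) _ r(2,3)], rule adjacentI[OF r(2) _ _ that(1)])
    fix k assume "k \<in> L" "side \<sigma> x k"
    then have "k = (if \<sigma> = 1 then e else g)" using sc(6)[of k \<sigma>] that(1) by blast
    then have "project_edge k = (if \<sigma> = 1 then ?e else ?f)" using eg(3,4) by auto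
    then show "closed_segment (fst (z, snd x)) (fst (w, snd x)) \<inter> seg (project_edge k) = {}"
      using same_side_segment[OF sg] by simp
  qed (use inb that in auto)
  have generic: "z \<notin> K" if "z \<in> ball p r" "lft ?e z \<noteq> 0" "lft ?f z \<noteq> 0" for z
  proof
    assume "z \<in> K"
    then obtain k h where k: "k \<in> L" "(z, h) \<in> seg k" by (auto simp: K_eq carrier_of_def)
    have near: "dist (fst (z, h)) (fst x) < r" using that(1) by (simp add: x_def dist_commute)
    obtain \<sigma> where "\<sigma> \<in> {1, -1}" "side \<sigma> x k"
      using local_radiusD[OF r(2) k near] by blast
    then have "k = e \<or> k = g" using sc(6) k(1) by (metis (full_types))
    then have "z \<in> seg ?e \<or> z \<in> seg ?f" using seg_projectI[OF k(2)] eg(3,4) by auto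
    then show False using that lft_seg by blast
  qed
  have col: "colour f H z = - sheet f x 1 (z, snd x) + sheet f x (-1) (z, snd x)"
    if "z \<in> ball p r" "lft ?e z \<noteq> 0" "lft ?f z \<noteq> 0" for z
    using colour_sheet[OF f, of "(z, snd x)" x] generic[OF that] by simp
  show "\<exists>r>0.
        \<forall>a\<in>ball p r \<inter> (left_of ?e \<inter> right_of ?f). \<forall>b\<in>ball p r \<inter> (left_of ?e \<inter> left_of ?f).
        \<forall>c\<in>ball p r \<inter> (right_of ?e \<inter> left_of ?f). \<forall>d\<in>ball p r \<inter> (right_of ?e \<inter> right_of ?f).
        colour f H a - colour f H d = colour f H b - colour f H c"
  proof (intro exI[of _ r] conjI ballI)
    fix a b c d
    assume "a \<in> ball p r \<inter> (left_of ?e \<inter> right_of ?f)" "b \<in> ball p r \<inter> (left_of ?e \<inter> left_of ?f)"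
      "c \<in> ball p r \<inter> (right_of ?e \<inter> left_of ?f)" "d \<in> ball p r \<inter> (right_of ?e \<inter> right_of ?f)"
    then have a: "a \<in> ball p r" "lft ?e a > 0" "lft ?f a < 0" and b: "b \<in> ball p r" "lft ?e b > 0" "lft ?f b > 0"
      and c: "c \<in> ball p r" "lft ?e c < 0" "lft ?f c > 0" and d: "d \<in> ball p r" "lft ?e d < 0" "lft ?f d < 0"
      by (auto simp: left_of_eq right_of_eq)
    have "sheet f x 1 (a, snd x) = sheet f x 1 (b, snd x)" "sheet f x 1 (c, snd x) = sheet f x 1 (d, snd x)"
      using a b c d by (auto intro!: same simp: sgn_if)
    moreover have "sheet f x (-1) (a, snd x) = sheet f x (-1) (d, snd x)" "sheet f x (-1) (b, snd x) = sheet f x (-1) (c, snd x)"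
      using a b c d by (auto intro!: same simp: sgn_if)
    ultimately show "colour f H a - colour f H d = colour f H b - colour f H c"
      using col a b c d by (simp add: group_normal del: add_uminus_conv_diff)
  qed (fact r)
qed

lemma interior_K: "interior K = {}"
proof -
  have "interior (\<Union>e\<in>A. seg (project_edge e)) = {} \<and> closed (\<Union>e\<in>A. seg (project_edge e))" if "finite A" for A
    using that
  proof (induction A)
    case (insert a A)
    have "interior (seg (project_edge a)) = {}" by (simp add: seg_def interior_closed_segment_ge2)
    then have "interior (seg (project_edge a) \<union> (\<Union>e\<in>A. seg (project_edge e))) = {}"
      using insert by (subst interior_closed_Un_empty_interior) auto
    then show ?case using insert by (simp add: closed_Un)
  qed simp
  from this[OF finite_L] show ?thesis by (simp add: K_def carrier_of_def strands_eq)
qed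

lemma generic_dense:
  assumes "r > 0"
  shows "\<exists>q\<in>ball x r. fst q \<notin> K"
proof -
  have "\<not> ball (fst x) r \<subseteq> K" using interior_K assms
    by (metis centre_in_ball empty_iff interior_maximal open_ball subsetD)
  then obtain z where z: "z \<in> ball (fst x) r" "z \<notin> K" by blast
  then have "(z, snd x) \<in> ball x r" by (cases x) (simp add: dist_Pair_Pair)
  then show ?thesis using z by force
qed

text \<open>The quotient \<open>\<Gamma> x s q\<close> of the sheets of the two bundles is
  independent of \<open>s\<close> because the colours agree; going from \<open>q1\<close> to
  \<open>q2\<close> by one strip upwards and one downwards shows that it is independent of
  \<open>q\<close>. Its inverse is the gauge transformation, trivial at the base points because near
  them the sheet loops within the cap.\<close>

lemma colour_injective:
  assumes f: "flat X f1" "flat X f2" and eq: "\<And>z. z \<notin> K \<Longrightarrow> colour f1 H z = colour f2 H z"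
  shows "\<exists>\<gamma>. (\<forall>x\<in>X. \<forall>\<^sub>F p in nhds x. f2 x p = - \<gamma> x + f1 x p + \<gamma> p) \<and> \<gamma> (0, H) = 0 \<and> \<gamma> (0, - H) = 0"
proof -
  define \<Gamma> where "\<Gamma> = (\<lambda>x s q. sheet f2 x s q - sheet f1 x s q)"
  have \<Gamma>_s: "\<Gamma> x 1 q = \<Gamma> x (-1) q" if "fst q \<notin> K" for x q
  proof -
    have "- sheet f1 x 1 q + sheet f1 x (-1) q = - sheet f2 x 1 q + sheet f2 x (-1) q"
      using eq[OF that] colour_sheet[OF f(1) that, of x] colour_sheet[OF f(2) that, of x] by simp
    from flat_pair_group[OF this] show ?thesis by (simp add: \<Gamma>_def)
  qed
  have "\<exists>c. \<exists>r>0. \<forall>q\<in>ball x r. fst q \<notin> K \<longrightarrow> \<Gamma> x 1 q = c" if x: "x \<in> X" for x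
  proof -
    obtain r1 where r1: "r1 > 0" "\<And>r. 0 < r \<Longrightarrow> r \<le> r1 \<Longrightarrow> local_radius x r \<and>
      (\<forall>q1\<in>ball x r. \<forall>q2\<in>ball x r. fst q1 \<notin> K \<longrightarrow> fst q2 \<notin> K \<longrightarrow>
      (\<exists>q\<in>ball x r. fst q \<notin> K \<and> adjacent 1 q1 q \<and> adjacent (-1) q q2))" using local_connect[OF x] by blast
    obtain r2 where r2: "r2 > 0" "\<And>r. 0 < r \<Longrightarrow> r \<le> r2 \<Longrightarrow> level x r" using level_exists by blast
    define r where "r = min r1 r2"
    have r: "r > 0" "local_radius x r" "level x r" using r1 r2 by (auto simp: r_def)
    have const: "\<Gamma> x 1 q1 = \<Gamma> x 1 q2" if q: "q1 \<in> ball x r" "q2 \<in> ball x r" "fst q1 \<notin> K" "fst q2 \<notin> K" for q1 q2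
    proof -
      obtain q where q': "q \<in> ball x r" "fst q \<notin> K" "adjacent 1 q1 q" "adjacent (-1) q q2"
        using r1(2)[of r] r(1) q unfolding r_def by (metis min.cobounded1)
      have "\<Gamma> x 1 q1 = \<Gamma> x 1 q"
        unfolding \<Gamma>_def using sheet_adjacent[OF f(1) _ q'(3) r(2,3) q(1) q'(1)]
          sheet_adjacent[OF f(2) _ q'(3) r(2,3) q(1) q'(1)] by simp
      moreover have "\<Gamma> x (-1) q = \<Gamma> x (-1) q2"
        unfolding \<Gamma>_def using sheet_adjacent[OF f(1) _ q'(4) r(2,3) q'(1) q(2)]
          sheet_adjacent[OF f(2) _ q'(4) r(2,3) q'(1) q(2)] by simp
      ultimately show ?thesis using \<Gamma>_s q'(2) q(4) by metis
    qed
    obtain q0 where "q0 \<in> ball x r" "fst q0 \<notin> K" using generic_dense[OF r(1)] by blast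
    then show ?thesis using const r(1) by blast
  qed
  then obtain c where c: "\<And>x. x \<in> X \<Longrightarrow> \<exists>r>0. \<forall>q\<in>ball x r. fst q \<notin> K \<longrightarrow> \<Gamma> x 1 q = c x" by metis
  have rel: "\<forall>\<^sub>F p in nhds x. f2 x p = c x + f1 x p - c p" if x: "x \<in> X" for x
  proof -
    obtain r where r: "r > 0" "\<And>q. q \<in> ball x r \<Longrightarrow> fst q \<notin> K \<Longrightarrow> \<Gamma> x 1 q = c x" using c[OF x] by blast
    have "\<forall>\<^sub>F p in nhds x. dist p x < r" using r(1) by (auto simp: eventually_nhds_metric)
    moreover have "\<forall>\<^sub>F p in nhds x. p \<in> X" using x by (simp add: eventually_nhds_in_open)
    moreover have "\<forall>\<^sub>F y in nhds x. \<forall>\<^sub>F p in nhds y. hol f1 x p = f1 x p" "\<forall>\<^sub>F y in nhds x. \<forall>\<^sub>F p in nhds y. hol f2 x p = f2 x p"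
      using hol_near[OF f(1) open_X x] hol_near[OF f(2) open_X x] by (simp_all add: eventually_eventually)
    moreover have "\<forall>\<^sub>F y in nhds x. \<forall>\<^sub>F p in nhds y. f1 x p = f1 x y + f1 y p" "\<forall>\<^sub>F y in nhds x. \<forall>\<^sub>F p in nhds y. f2 x p = f2 x y + f2 y p"
      using f x by (simp_all add: flat_def)
    ultimately show ?thesis
    proof eventually_elim
      case (elim y)
      obtain r' where r': "r' > 0" "\<And>q. q \<in> ball y r' \<Longrightarrow> fst q \<notin> K \<Longrightarrow> \<Gamma> y 1 q = c y" using c[OF elim(2)] by blast
      have "\<forall>\<^sub>F p in nhds y. p \<in> ball y r' \<inter> ball x r"
        using r'(1) elim(1) by (intro eventually_nhds_in_open) (auto simp: dist_commute)
      moreover note elim(3-6) hol_near[OF f(1) open_X elim(2)] hol_near[OF f(2) open_X elim(2)]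
      \<comment> \<open>The quotients at \<open>x\<close> and at \<open>y\<close> are evaluated at
        the same generic \<open>p\<close>; what lies beyond \<open>p\<close> cancels.\<close>
      ultimately have "\<forall>\<^sub>F p in nhds y. fst p \<notin> K \<longrightarrow> f2 x y = c x + f1 x y - c y"
      proof eventually_elim
        case (elim p)
        show ?case
        proof
          assume p: "fst p \<notin> K"
          have 1: "f2 x y + f2 y p + vertical f2 H 1 p - (f1 x y + f1 y p + vertical f1 H 1 p) = c x"
            using r(2)[of p] elim p by (simp add: \<Gamma>_def sheet_def)
          have "f2 y p + vertical f2 H 1 p - (f1 y p + vertical f1 H 1 p) = c y"
            using r'(2)[of p] elim p by (simp add: \<Gamma>_def sheet_def)
          then have 2: "f2 y p + vertical f2 H 1 p = c y + (f1 y p + vertical f1 H 1 p)"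
            by (metis diff_add_cancel)
          have "c x = f2 x y + (f2 y p + vertical f2 H 1 p) - (f1 x y + f1 y p + vertical f1 H 1 p)"
            using 1 by (simp only: add.assoc)
          also have "\<dots> = f2 x y + c y - f1 x y" unfolding 2 by (simp only: group_normal)
          finally show "f2 x y = c x + f1 x y - c y" by (simp only: group_normal)
        qed
      qed
      then obtain d where d: "d > 0" "\<And>p. dist p y < d \<Longrightarrow> fst p \<notin> K \<Longrightarrow> f2 x y = c x + f1 x y - c y"
        unfolding eventually_nhds_metric by blast
      obtain p where "p \<in> ball y d" "fst p \<notin> K" using generic_dense[OF d(1)] by blast
      then show ?case using d(2)[of p] by (simp add: dist_commute)
    qed
  qed
  have "c (0, s * H) = 0" if s: "s \<in> {1, -1}" for s
  proof -
    let ?x = "(0, s * H) :: space"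
    have ss: "s * s = 1" using s by auto
    have xc: "?x \<in> cap s" using H0 ss by (simp add: cap_def mult.assoc[symmetric])
    then have x: "?x \<in> X" using cap_subset[OF s] by blast
    obtain r where r: "r > 0" "\<And>q. q \<in> ball ?x r \<Longrightarrow> fst q \<notin> K \<Longrightarrow> \<Gamma> ?x 1 q = c ?x" using c[OF x] by blast
    have "open (cap s)" unfolding cap_def by (intro open_Collect_less continuous_intros)
    then obtain d where d: "d > 0" "ball ?x d \<subseteq> cap s" using xc by (meson open_contains_ball)
    obtain q where q: "q \<in> ball ?x (min r d)" "fst q \<notin> K" using generic_dense[of "min r d" ?x] r(1) d(1) by auto
    have qc: "q \<in> cap s" using q d(2) by auto
    have t: "(fst q, s * H) \<in> cap s" using H0 ss by (simp add: cap_def mult.assoc[symmetric])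
    have "sheet f ?x s q = 0" if f: "flat X f" for f :: "space \<Rightarrow> space \<Rightarrow> 'a"
    proof -
      note tri = hol_triangle[OF f open_X convex_cap cap_subset[OF s]]
      have "hol f ?x q + (hol f q (fst q, s * H) + hol f (fst q, s * H) ?x) = hol f ?x ?x"
        using tri[OF qc t xc] tri[OF xc qc xc] by simp
      then show ?thesis by (simp add: sheet_def vertical_def)
    qed
    then have "\<Gamma> ?x s q = 0" using f by (simp add: \<Gamma>_def)
    then have "\<Gamma> ?x 1 q = 0" using \<Gamma>_s[OF q(2), of ?x] s by auto
    then show ?thesis using r(2)[of q] q by simp
  qed
  from this[of 1] this[of "-1"] have "c (0, H) = 0" "c (0, - H) = 0" by simp_all
  then show ?thesis using rel by (intro exI[of _ "\<lambda>x. - c x"]) simp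
qed

end

section \<open>Flat structures from colourings\<close>

context bounded_projected_link
begin

lemma seg_K: "e \<in> L \<Longrightarrow> seg (project_edge e) \<subseteq> K"
  by (auto simp: K_def carrier_of_def strands_eq)

lemma cap_segment: "s \<in> {1, -1} \<Longrightarrow> p \<in> cap s \<Longrightarrow> q \<in> cap s \<Longrightarrow> closed_segment p q \<subseteq> X"
  using convex_cap[of s] cap_subset[of s] by (meson convex_contains_segment subset_trans)

lemma colour_segments:
  assumes "z \<notin> K"
  shows "closed_segment (0, H) (z, H) \<subseteq> X" "closed_segment (z, H) (z, - H) \<subseteq> X"
    "closed_segment (z, - H) (0, - H) \<subseteq> X"
proof -
  show "closed_segment (0, H) (z, H) \<subseteq> X" using H0 by (intro cap_segment[of 1]) (auto simp: cap_def)
  show "closed_segment (z, - H) (0, - H) \<subseteq> X" using H0 by (intro cap_segment[of "-1"]) (auto simp: cap_def)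
  have "{z} \<times> (UNIV :: real set) \<subseteq> X" using generic_in_X assms by auto
  moreover have "convex ({z} \<times> (UNIV :: real set))" by (intro convex_Times) auto
  ultimately show "closed_segment (z, H) (z, - H) \<subseteq> X"
    by (meson UNIV_I SigmaI convex_contains_segment singletonI subset_trans)
qed

lemma colour_gauge:
  assumes "flat X f1" and rel: "\<And>x. x \<in> X \<Longrightarrow> \<forall>\<^sub>F p in nhds x. f2 x p = - \<gamma> x + f1 x p + \<gamma> p" and "z \<notin> K"
  shows "colour f2 H z = - \<gamma> (0, H) + colour f1 H z + \<gamma> (0, - H)"
  unfolding colour_def
  using hol_gauge[OF assms(1) rel open_X colour_segments(1)[OF assms(3)]]
    hol_gauge[OF assms(1) rel open_X colour_segments(2)[OF assms(3)]]
    hol_gauge[OF assms(1) rel open_X colour_segments(3)[OF assms(3)]]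
  by (simp only: group_normal)

text \<open>A small displacement can lose strands above or below the point but cannot gain
  any.\<close>

lemma side_near:
  assumes "local_radius x r" "y \<in> ball x r" "e \<in> L" "s \<in> {1, -1}" "side s y e"
  shows "side s x e"
proof -
  obtain h where h: "s * h > s * snd y" "(fst y, h) \<in> seg e" using assms(5) by (auto simp: side_def)
  have near: "dist (fst y) (fst x) < r" "\<bar>snd y - snd x\<bar> < r"
    using assms(2) dist_fst_le[of y x] dist_snd_le[of y x] by (auto simp: dist_commute dist_real_def)
  obtain s' where s': "s' \<in> {1, -1}" "side s' x e" "s' * h > s' * snd x + r"
    using local_radiusD[OF assms(1,3) h(2)] near(1) by auto
  have "s' = s" using s' assms(4) near(2) h(1) by auto
  then show ?thesis using s'(2) by simp
qed

lemma side_over: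
  assumes "y \<in> X" "e \<in> L" "fst y \<in> seg (project_edge e)"
  shows "side 1 y e \<or> side (-1) y e"
proof -
  obtain h where h: "(fst y, h) \<in> seg e" using assms(3) fst_seg[of e] by force
  have "h \<noteq> snd y" using h assms(1,2) by (auto simp: X_def carrier_of_def)
  then have "h > snd y \<or> h < snd y" by linarith
  then show ?thesis using h unfolding side_def by force
qed

lemma colouring_constant:
  assumes "colouring D C" and S: "connected S" "S \<inter> K = {}" "z \<in> S" "w \<in> S"
  shows "C z = C w"
  by (rule locally_constant_on[OF _ S]) (use assms(1) in \<open>auto simp: colouring_def K_def\<close>)

lemma sector_values:
  assumes C: "colouring D C" and e: "e \<in> L" "side 1 x e" and f: "f \<in> L" "side (-1) x f" and x: "x \<in> X"
  shows "\<exists>r>0. \<exists>v. (\<forall>\<sigma>\<in>{1,-1}. \<forall>\<tau>\<in>{1,-1}. \<forall>z\<in>sector (project_edge e) (project_edge f) (fst x) r \<sigma> \<tau>. C z = v \<sigma> \<tau>)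
     \<and> v 1 (-1) - v (-1) (-1) = v 1 1 - v (-1) 1
     \<and> (\<forall>z\<in>ball (fst x) r. z \<in> seg (project_edge e) \<longleftrightarrow> lft (project_edge e) z = 0)
     \<and> (\<forall>z\<in>ball (fst x) r. z \<in> seg (project_edge f) \<longleftrightarrow> lft (project_edge f) z = 0)"
proof -
  let ?e = "project_edge e" and ?f = "project_edge f"
  note c = sides_cross[OF e f]
  have xe: "fst x \<in> seg ?e" "fst x \<in> seg ?f" "fst x \<notin> ends ?e" "fst x \<notin> ends ?f" using c(4,5) by auto
  obtain r1 where r1: "local_radius x r1" using local_radius_exists[OF x] by blast
  then have r1pos: "r1 > 0" by (simp add: local_radius_def)
  obtain r2 where r2: "r2 > 0" "\<forall>z\<in>ball (fst x) r2. z \<in> seg ?e \<longleftrightarrow> lft ?e z = 0"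
    using seg_near_interior[OF xe(1,3)] by blast
  obtain r3 where r3: "r3 > 0" "\<forall>z\<in>ball (fst x) r3. z \<in> seg ?f \<longleftrightarrow> lft ?f z = 0"
    using seg_near_interior[OF xe(2,4)] by blast
  obtain r4 where r4: "r4 > 0"
    "\<forall>a\<in>ball (fst x) r4 \<inter> (left_of ?e \<inter> right_of ?f). \<forall>b\<in>ball (fst x) r4 \<inter> (left_of ?e \<inter> left_of ?f).
     \<forall>c\<in>ball (fst x) r4 \<inter> (right_of ?e \<inter> left_of ?f). \<forall>d\<in>ball (fst x) r4 \<inter> (right_of ?e \<inter> right_of ?f).
        C a - C d = C b - C c"
  proof -
    have "\<forall>(e, f)\<in>crossings D. \<forall>p\<in>seg e \<inter> seg f. \<exists>r>0.
        \<forall>a\<in>ball p r \<inter> (left_of e \<inter> right_of f). \<forall>b\<in>ball p r \<inter> (left_of e \<inter> left_of f).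
        \<forall>c\<in>ball p r \<inter> (right_of e \<inter> left_of f). \<forall>d\<in>ball p r \<inter> (right_of e \<inter> right_of f).
        C a - C d = C b - C c" using C unfolding colouring_def by blast
    from bspec[OF bspec[OF this c(3), simplified], of "fst x"] show ?thesis
      using xe(1,2) that by auto
  qed
  define r where "r = min (min r1 r2) (min r3 r4)"
  have r: "r > 0" "r \<le> r1" "r \<le> r2" "r \<le> r3" "r \<le> r4" using r1pos r2 r3 r4 by (auto simp: r_def)
  let ?S = "sector ?e ?f (fst x) r"
  have avoid: "?S \<sigma> \<tau> \<inter> K = {}" for \<sigma> \<tau>
  proof (rule ccontr)
    assume "?S \<sigma> \<tau> \<inter> K \<noteq> {}"
    then obtain z where z: "z \<in> ?S \<sigma> \<tau>" "z \<in> K" by blast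
    then obtain k h where k: "k \<in> L" "(z, h) \<in> seg k" by (auto simp: K_eq carrier_of_def)
    have near: "dist (fst (z, h)) (fst x) < r1" using z(1) r by (auto simp: sector_def dist_commute)
    obtain s where "s \<in> {1, -1}" "side s x k" using local_radiusD[OF r1 k near] by blast
    then have "k = e \<or> k = f" using c(6)[OF k(1)] by (metis (full_types))
    then have "z \<in> seg ?e \<or> z \<in> seg ?f" using seg_projectI[OF k(2)] by auto
    then have "lft ?e z = 0 \<or> lft ?f z = 0" using lft_seg by blast
    then show False using z(1) by (auto simp: sector_def)
  qed
  have ne: "\<exists>z. z \<in> ?S \<sigma> \<tau>" if "\<sigma> \<in> {1, -1}" "\<tau> \<in> {1, -1}" for \<sigma> \<tau>
  proof -
    obtain z where "z \<in> ball (fst x) r" "sgn (lft ?e z) = sgn \<sigma>" "sgn (lft ?f z) = sgn \<tau>"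
      using sector_point[OF lft_seg[OF xe(1)] lft_seg[OF xe(2)] cross_transversal[OF c(2)] r(1)] by blast
    then show ?thesis using that by (intro exI[of _ z]) (auto simp: sector_def sgn_if split: if_splits)
  qed
  define v where "v = (\<lambda>\<sigma> \<tau>. C (SOME z. z \<in> ?S \<sigma> \<tau>))"
  have some: "(SOME z. z \<in> ?S \<sigma> \<tau>) \<in> ?S \<sigma> \<tau>" if "\<sigma> \<in> {1, -1}" "\<tau> \<in> {1, -1}" for \<sigma> \<tau>
    using ne[OF that] by (rule someI_ex)
  have "C z = v \<sigma> \<tau>" if "\<sigma> \<in> {1, -1}" "\<tau> \<in> {1, -1}" "z \<in> ?S \<sigma> \<tau>" for \<sigma> \<tau> z
    unfolding v_def
    by (rule colouring_constant[OF C convex_connected[OF convex_sector[OF that(1,2)]] avoid that(3) some[OF that(1,2)]])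
  moreover have "v 1 (-1) - v (-1) (-1) = v 1 1 - v (-1) 1"
  proof -
    have sub: "?S 1 (-1) \<subseteq> ball (fst x) r4 \<inter> (left_of ?e \<inter> right_of ?f)" "?S 1 1 \<subseteq> ball (fst x) r4 \<inter> (left_of ?e \<inter> left_of ?f)"
      "?S (-1) 1 \<subseteq> ball (fst x) r4 \<inter> (right_of ?e \<inter> left_of ?f)" "?S (-1) (-1) \<subseteq> ball (fst x) r4 \<inter> (right_of ?e \<inter> right_of ?f)"
      using r(5) by (auto simp: sector_def left_of_eq right_of_eq)
    show ?thesis unfolding v_def
      using r4(2) some[of 1 "-1"] some[of 1 1] some[of "-1" 1] some[of "-1" "-1"] sub by (meson insertI1 insertI2 subsetD)
  qed
  ultimately show ?thesis using r r2 r3 by (intro exI[of _ r] conjI exI[of _ v]) auto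
qed

section \<open>Local trivialisations built from a colouring\<close>

definition over :: "space \<Rightarrow> space edge" where "over x = (SOME e. e \<in> L \<and> side 1 x e)"
definition under :: "space \<Rightarrow> space edge" where "under x = (SOME e. e \<in> L \<and> side (-1) x e)"

text \<open>The value on side \<sigma> of the over-strand and to the left of the under-strand.
  Taking the left is a normalisation: by the crossing relation the right would change the
  trivialisation below by a left factor common to both \<sigma>.\<close>

definition corner_value :: "(complex \<Rightarrow> 'g) \<Rightarrow> space edge \<Rightarrow> space edge \<Rightarrow> complex \<Rightarrow> real \<Rightarrow> 'g" where
  "corner_value C e f p \<sigma> = (SOME v. \<exists>r>0. \<forall>z\<in>sector (project_edge e) (project_edge f) p r \<sigma> 1. C z = v)"

text \<open>
  The value at \<open>q\<close> of the local trivialisation at \<open>x\<close>, when the fibre over \<open>q\<close> is identified with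
  the fibre at the top by going straight up.
\<close>

definition local_triv :: "(complex \<Rightarrow> 'g::group_add) \<Rightarrow> space \<Rightarrow> space \<Rightarrow> 'g" where
  "local_triv C x q =
    (if \<not> (\<exists>e\<in>L. side 1 x e) then 0
     else if \<not> (\<exists>e\<in>L. side (-1) x e) then - C (fst q)
     else - corner_value C (over x) (under x) (fst x)
       (if lft (project_edge (over x)) (fst q) > 0 then 1 else - 1))"

text \<open>A germ tested only at points over no strand. Such points are dense, so a constant is
  still determined by it (\<open>generic_near_unique\<close>).\<close>

definition generic_near :: "space \<Rightarrow> (space \<Rightarrow> bool) \<Rightarrow> bool" where
  "generic_near y P \<longleftrightarrow> (\<forall>\<^sub>F q in nhds y. fst q \<notin> K \<longrightarrow> P q)"

lemma generic_near_unique: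
  assumes "generic_near y (\<lambda>q. a q = b + c q)" "generic_near y (\<lambda>q. a q = b' + c q)"
  shows "b = (b' :: 'g::group_add)"
proof -
  have "generic_near y (\<lambda>q. b = b')"
    using assms unfolding generic_near_def by eventually_elim auto
  then obtain r where r: "r > 0" "\<And>q. dist q y < r \<Longrightarrow> fst q \<notin> K \<Longrightarrow> b = b'"
    unfolding generic_near_def eventually_nhds_metric by blast
  obtain q where "q \<in> ball y r" "fst q \<notin> K" using generic_dense[OF r(1)] by blast
  then show ?thesis using r(2)[of q] by (simp add: dist_commute)
qed

lemma eventually_fst:
  assumes "\<forall>\<^sub>F z in nhds (fst y). P z"
  shows "\<forall>\<^sub>F q in nhds y. P (fst q)"
proof -
  have "(fst \<longlongrightarrow> fst y) (nhds y)" by (intro tendsto_intros filterlim_ident)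
  then show ?thesis using assms by (rule eventually_compose_filterlim[rotated])
qed

lemma lft_sign_near:
  assumes "lft e z \<noteq> 0"
  shows "\<forall>\<^sub>F w in nhds z. sgn (lft e w) = sgn (lft e z)"
proof -
  have "(lft e \<longlongrightarrow> lft e z) (nhds z)" unfolding lft_def by (intro tendsto_intros filterlim_ident)
  from order_tendstoD[OF this, of 0] show ?thesis
    using assms by (cases "lft e z > 0") (auto elim!: eventually_mono)
qed

text \<open>The trivialisation at a point is normalised by a free way out: upwards if nothing is
  above, downwards if nothing is below, and between two strands downwards on the left of the lower
  one. Passing to a nearby point one or both strands can disappear. The crossing relation enters
  where \<open>y\<close> is still under the upper strand but to the right of the lower one.\<close>

lemma local_triv_compatible:
  assumes C: "colouring D C" and x: "x \<in> X"
  shows "\<forall>\<^sub>F y in nhds x. \<exists>g. generic_near y (\<lambda>q. local_triv C x q = g + local_triv C y q)"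
proof -
  obtain r1 where r1: "local_radius x r1" using local_radius_exists[OF x] by blast
  then have r1pos: "r1 > 0" by (simp add: local_radius_def)
  have near_C: "\<forall>\<^sub>F q in nhds y. C (fst q) = C (fst y)" if "fst y \<notin> K" for y
    using C that unfolding colouring_def K_def by (intro eventually_fst) blast
  have yX: "y \<in> X" if "y \<in> ball x r1" for y using ball_subset_X[OF r1] that by blast
  consider (above) "\<not> (\<exists>e\<in>L. side 1 x e)" | (below) "\<exists>e\<in>L. side 1 x e" "\<not> (\<exists>f\<in>L. side (-1) x f)"
    | (between) e f where "e \<in> L" "side 1 x e" "f \<in> L" "side (-1) x f" by blast
  then have "\<exists>r>0. \<forall>y\<in>ball x r. \<exists>g. generic_near y (\<lambda>q. local_triv C x q = g + local_triv C y q)"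
  proof cases
    case above
    have "generic_near y (\<lambda>q. local_triv C x q = 0 + local_triv C y q)" if y: "y \<in> ball x r1" for y
    proof -
      have "\<not> (\<exists>e\<in>L. side 1 y e)" using above side_near[OF r1 y] by blast
      then show ?thesis using above by (simp add: local_triv_def generic_near_def)
    qed
    then show ?thesis using r1pos by blast
  next
    case below
    have "\<exists>g. generic_near y (\<lambda>q. local_triv C x q = g + local_triv C y q)" if y: "y \<in> ball x r1" for y
    proof -
      have nb: "\<not> (\<exists>e\<in>L. side (-1) y e)" using below side_near[OF r1 y] by blast
      show ?thesis
      proof (cases "\<exists>e\<in>L. side 1 y e")
        case True
        then have "generic_near y (\<lambda>q. local_triv C x q = 0 + local_triv C y q)"
          using below nb by (simp add: local_triv_def generic_near_def)
        then show ?thesis by blast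
      next
        case False
        have "fst y \<notin> K"
        proof
          assume "fst y \<in> K"
          then obtain e where "e \<in> L" "fst y \<in> seg (project_edge e)" by (auto simp: K_def carrier_of_def strands_eq)
          then show False using side_over[OF yX[OF y]] False nb by blast
        qed
        then have "\<forall>\<^sub>F q in nhds y. C (fst q) = C (fst y)" by (rule near_C)
        then have "generic_near y (\<lambda>q. local_triv C x q = - C (fst y) + local_triv C y q)"
          unfolding generic_near_def
          by (rule eventually_mono) (use below False in \<open>simp add: local_triv_def\<close>)
        then show ?thesis by blast
      qed
    qed
    then show ?thesis using r1pos by blast
  next
    case between
    let ?e = "project_edge e" and ?f = "project_edge f"
    note c = sides_cross[OF between]
    have ov: "over y = e" if "side 1 y e" "\<And>g. g \<in> L \<Longrightarrow> side 1 y g \<Longrightarrow> g = e" for y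
      unfolding over_def using that between(1) by (intro some_equality) blast+
    have un: "under y = f" if "side (-1) y f" "\<And>g. g \<in> L \<Longrightarrow> side (-1) y g \<Longrightarrow> g = f" for y
      unfolding under_def using that between(3) by (intro some_equality) blast+
    have only: "g \<in> L \<Longrightarrow> side 1 x g \<Longrightarrow> g = e" "g \<in> L \<Longrightarrow> side (-1) x g \<Longrightarrow> g = f" for g
      using c(6)[of g 1] c(6)[of g "-1"] by simp_all
    obtain r2 v where r2: "r2 > 0" and v0: "\<forall>\<sigma>\<in>{1,-1}. \<forall>\<tau>\<in>{1,-1}. \<forall>z\<in>sector ?e ?f (fst x) r2 \<sigma> \<tau>. C z = v \<sigma> \<tau>"
      and rel: "v 1 (-1) - v (-1) (-1) = v 1 1 - v (-1) 1"
      and line0: "\<forall>z\<in>ball (fst x) r2. z \<in> seg ?e \<longleftrightarrow> lft ?e z = 0" "\<forall>z\<in>ball (fst x) r2. z \<in> seg ?f \<longleftrightarrow> lft ?f z = 0"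
      using sector_values[OF C between x] by (elim exE conjE) (rule that)
    have v: "\<sigma> \<in> {1,-1} \<Longrightarrow> \<tau> \<in> {1,-1} \<Longrightarrow> z \<in> sector ?e ?f (fst x) r2 \<sigma> \<tau> \<Longrightarrow> C z = v \<sigma> \<tau>"
      and line: "z \<in> ball (fst x) r2 \<Longrightarrow> z \<in> seg ?e \<longleftrightarrow> lft ?e z = 0"
         "z \<in> ball (fst x) r2 \<Longrightarrow> z \<in> seg ?f \<longleftrightarrow> lft ?f z = 0"
      for \<sigma> \<tau> z using v0 line0 by blast+
    have cv: "corner_value C e f (fst x) \<sigma> = v \<sigma> 1" if s: "\<sigma> \<in> {1, -1}" for \<sigma>
      unfolding corner_value_def
    proof (rule some_equality)
      show "\<exists>r>0. \<forall>z\<in>sector ?e ?f (fst x) r \<sigma> 1. C z = v \<sigma> 1" using v[OF s, of 1] r2 by blast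
      fix w assume "\<exists>r>0. \<forall>z\<in>sector ?e ?f (fst x) r \<sigma> 1. C z = w"
      then obtain r where r: "r > 0" "\<forall>z\<in>sector ?e ?f (fst x) r \<sigma> 1. C z = w" by blast
      have "min r r2 > 0" using r r2 by simp
      moreover have "lft ?e (fst x) = 0" "lft ?f (fst x) = 0" using c(4) lft_seg by blast+
      ultimately obtain z where "z \<in> ball (fst x) (min r r2)" "sgn (lft ?e z) = sgn \<sigma>" "sgn (lft ?f z) = sgn (1::real)"
        using sector_point[OF _ _ cross_transversal[OF c(2)]] by blast
      then have "z \<in> sector ?e ?f (fst x) r \<sigma> 1" "z \<in> sector ?e ?f (fst x) r2 \<sigma> 1"
        using s by (auto simp: sector_def sgn_if split: if_splits)
      then show "w = v \<sigma> 1" using r(2) v[OF s, of 1] by (metis insertI1)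
    qed
    have Ex: "local_triv C x q = - v (if lft ?e (fst q) > 0 then 1 else - 1) 1" for q
    proof -
      have "over x = e" "under x = f" using ov[of x] un[of x] only between by blast+
      then show ?thesis using between cv by (auto simp: local_triv_def)
    qed
    define r where "r = min r1 r2"
    have "\<exists>g. generic_near y (\<lambda>q. local_triv C x q = g + local_triv C y q)" if y: "y \<in> ball x r" for y
    proof -
      have y1: "y \<in> ball x r1" and y2: "fst y \<in> ball (fst x) r2" using y dist_fst_le[of x y] by (auto simp: r_def)
      have side_y: "side s x g" if "g \<in> L" "s \<in> {1,-1}" "side s y g" for g s by (rule side_near[OF r1 y1 that])
      have evball: "\<forall>\<^sub>F q in nhds y. fst q \<in> ball (fst x) r2"
        using y2 by (intro eventually_fst eventually_nhds_in_open) auto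
      show ?thesis
      proof (cases "\<exists>g\<in>L. side 1 y g")
        case False
        have "fst y \<notin> seg ?e"
        proof
          assume "fst y \<in> seg ?e"
          then have "side (-1) y e" using side_over[OF yX[OF y1] between(1)] False between(1) by blast
          then have "side (-1) x e" using side_y between(1) by blast
          then show False using only(2) between(1) c(1) by blast
        qed
        then have "lft ?e (fst y) \<noteq> 0" using line(1)[OF y2] by simp
        then have "\<forall>\<^sub>F q in nhds y. sgn (lft ?e (fst q)) = sgn (lft ?e (fst y))"
          by (intro eventually_fst lft_sign_near)
        then have "generic_near y (\<lambda>q. local_triv C x q = local_triv C x y + local_triv C y q)"
          unfolding generic_near_def
        proof eventually_elim
          case (elim q)
          have "local_triv C y q = 0" using False by (simp add: local_triv_def)
          moreover have "lft ?e (fst q) > 0 \<longleftrightarrow> lft ?e (fst y) > 0" using elim by (auto simp: sgn_if split: if_splits)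
          ultimately show ?case by (simp add: Ex)
        qed
        then show ?thesis by blast
      next
        case True
        then have ye: "side 1 y e" using side_y[of _ 1] only(1) by auto
        have oy: "over y = e" using ov[OF ye] side_y[of _ 1] only(1) by blast
        have y_e: "fst y \<in> seg ?e" using ye seg_projectI unfolding side_def by blast
        show ?thesis
        proof (cases "\<exists>g\<in>L. side (-1) y g")
          case True
          then have yf: "side (-1) y f" using side_y[of _ "-1"] only(2) by auto
          have uy: "under y = f" using un[OF yf] side_y[of _ "-1"] only(2) by blast
          have "fst y \<in> seg ?f" using yf seg_projectI unfolding side_def by blast
          then have "fst y = fst x" using y_e c(4) by blast
          then have "local_triv C y q = local_triv C x q" for q
            using oy uy cv between ye yf unfolding Ex by (auto simp: local_triv_def)
          then have "generic_near y (\<lambda>q. local_triv C x q = 0 + local_triv C y q)" by (simp add: generic_near_def)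
          then show ?thesis by blast
        next
          case False
          have Ey: "local_triv C y q = - C (fst q)" for q
            using False ye between(1) by (auto simp: local_triv_def)
          have "fst y \<notin> seg ?f"
          proof
            assume "fst y \<in> seg ?f"
            then have "side 1 y f" using side_over[OF yX[OF y1] between(3)] False between(3) by blast
            then show False using side_y[of f 1] only(1) between(3) c(1) by blast
          qed
          then have nz: "lft ?f (fst y) \<noteq> 0" using line(2)[OF y2] by simp
          define \<tau> :: real where "\<tau> = sgn (lft ?f (fst y))"
          have \<tau>: "\<tau> \<in> {1, -1}" using nz by (auto simp: \<tau>_def sgn_if)
          \<comment> \<open>The left factor does not depend on the side \<sigma> of the upper
            strand: for \<tau> = -1 this is the crossing relation.\<close>
          have g: "- v \<sigma> 1 = (- v 1 1 + v 1 \<tau>) + - v \<sigma> \<tau>" if \<sigma>: "\<sigma> \<in> {1, -1}" for \<sigma>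
          proof -
            have "v 1 (-1) = v 1 1 - v (-1) 1 + v (-1) (-1)" using rel by (metis diff_add_cancel)
            then have eq: "- v 1 1 + v 1 (-1) = - v (-1) 1 + v (-1) (-1)" by (simp only: group_normal)
            consider "\<tau> = 1" | "\<tau> = -1" "\<sigma> = 1" | "\<tau> = -1" "\<sigma> = -1" using \<tau> \<sigma> by blast
            then show ?thesis
            proof cases
              case 1 then show ?thesis by simp
            next
              case 2 then show ?thesis by (simp only: group_normal)
            next
              case 3 then show ?thesis unfolding 3 eq by (simp only: group_normal)
            qed
          qed
          have "\<forall>\<^sub>F q in nhds y. sgn (lft ?f (fst q)) = sgn (lft ?f (fst y))"
            using nz by (intro eventually_fst lft_sign_near)
          with evball have "generic_near y (\<lambda>q. local_triv C x q = (- v 1 1 + v 1 \<tau>) + local_triv C y q)"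
            unfolding generic_near_def
          proof eventually_elim
            case (elim q)
            show ?case
            proof
              assume q: "fst q \<notin> K"
              define \<sigma> :: real where "\<sigma> = (if lft ?e (fst q) > 0 then 1 else - 1)"
              have "lft ?e (fst q) \<noteq> 0" using q elim(1) line(1) seg_K between(1) by blast
              then have "fst q \<in> sector ?e ?f (fst x) r2 \<sigma> \<tau>"
                using elim nz unfolding sector_def \<sigma>_def \<tau>_def by (auto simp: sgn_if split: if_splits)
              then have "C (fst q) = v \<sigma> \<tau>" using v[of \<sigma> \<tau>] \<tau> by (auto simp: \<sigma>_def)
              then show "local_triv C x q = (- v 1 1 + v 1 \<tau>) + local_triv C y q"
                using g[of \<sigma>] unfolding Ex Ey by (simp add: \<sigma>_def)
            qed
          qed
          then show ?thesis by blast
        qed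
      qed
    qed
    moreover have "r > 0" using r1pos r2 by (simp add: r_def)
    ultimately show ?thesis by blast
  qed
  then obtain r where "r > 0" "\<forall>y\<in>ball x r. \<exists>g. generic_near y (\<lambda>q. local_triv C x q = g + local_triv C y q)" by blast
  then show ?thesis by (auto simp: eventually_nhds_metric dist_commute intro!: exI[of _ r])
qed

definition flat_of :: "(complex \<Rightarrow> 'g::group_add) \<Rightarrow> space \<Rightarrow> space \<Rightarrow> 'g" where
  "flat_of C x y = (SOME g. generic_near y (\<lambda>q. local_triv C x q = g + local_triv C y q))"

lemma flat_of_eqI:
  assumes "generic_near y (\<lambda>q. local_triv C x q = g + local_triv C y q)"
  shows "flat_of C x y = g"
  unfolding flat_of_def using assms
  by (rule some_equality[where P = "\<lambda>g. generic_near y (\<lambda>q. local_triv C x q = g + local_triv C y q)"])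
    (rule generic_near_unique[OF _ assms])

lemma flat_of_near:
  assumes C: "colouring D C" and x: "x \<in> X"
  shows "\<forall>\<^sub>F y in nhds x. generic_near y (\<lambda>q. local_triv C x q = flat_of C x y + local_triv C y q)"
  using local_triv_compatible[OF assms] by eventually_elim (auto dest: flat_of_eqI)

lemma generic_near_near: "generic_near y P \<Longrightarrow> \<forall>\<^sub>F p in nhds y. generic_near p P"
  unfolding generic_near_def by (simp add: eventually_eventually)

lemma flat_flat_of:
  assumes C: "colouring D C"
  shows "flat X (flat_of C)"
  unfolding flat_def
proof
  fix x assume x: "x \<in> X"
  have "\<forall>\<^sub>F y in nhds x. y \<in> X" using x by (simp add: eventually_nhds_in_open)
  with flat_of_near[OF C x] show "\<forall>\<^sub>F y in nhds x. \<forall>\<^sub>F p in nhds y. flat_of C x p = flat_of C x y + flat_of C y p"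
  proof eventually_elim
    case (elim y)
    from flat_of_near[OF C elim(2)] generic_near_near[OF elim(1)] show ?case
    proof eventually_elim
      case (elim p)
      show ?case
      proof (rule flat_of_eqI)
        from elim show "generic_near p (\<lambda>q. local_triv C x q = flat_of C x y + flat_of C y p + local_triv C p q)"
          unfolding generic_near_def by eventually_elim (auto simp: add.assoc)
      qed
    qed
  qed
qed

text \<open>\<Phi> acts as a common trivialisation over \<open>S\<close>; comparing every
  \<open>local_triv C x\<close> with it yields the frame.\<close>

lemma frame_flat_of:
  assumes C: "colouring D C" and S: "open S" "S \<subseteq> X"
    and F: "\<And>x. x \<in> S \<Longrightarrow> generic_near x (\<lambda>q. \<Phi> q = F x + local_triv C x q)"
  shows "frame (flat_of C) F S"
  unfolding frame_def
proof
  fix x assume x: "x \<in> S"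
  have "\<forall>\<^sub>F y in nhds x. y \<in> S" using x S(1) by (simp add: eventually_nhds_in_open)
  moreover have "\<forall>\<^sub>F y in nhds x. generic_near y (\<lambda>q. local_triv C x q = flat_of C x y + local_triv C y q)"
    using x S by (intro flat_of_near[OF C]) auto
  moreover note generic_near_near[OF F[OF x]]
  ultimately show "\<forall>\<^sub>F p in nhds x. F p = F x + flat_of C x p"
  proof eventually_elim
    case (elim y)
    have "generic_near y (\<lambda>q. \<Phi> q = F x + flat_of C x y + local_triv C y q)"
      using elim(2,3) unfolding generic_near_def by eventually_elim (auto simp: add.assoc)
    from generic_near_unique[OF F[OF elim(1)] this] show ?case .
  qed
qed

lemma no_side_generic: "fst x \<notin> K \<Longrightarrow> e \<in> L \<Longrightarrow> \<not> side s x e"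
  using seg_projectI seg_K unfolding side_def by blast

lemma no_side_cap:
  assumes "s \<in> {1, -1}" "x \<in> cap s" "e \<in> L"
  shows "\<not> side s x e"
proof
  assume "side s x e"
  then obtain h where "s * h > s * snd x" "(fst x, h) \<in> carrier_of L"
    using assms(3) by (auto simp: side_def carrier_of_def)
  then show False using heights[of "(fst x, h)"] assms(1,2) by (auto simp: cap_def)
qed

text \<open>The loop defining the colour runs through three places where the bundle has an explicit
  frame: the upper cap, the complement of the cylinder over the curve, and the lower cap. The
  outcome is \<open>C z\<close> up to a right factor independent of \<open>z\<close>, which a gauge
  change at one point removes.\<close>

lemma colouring_realised_gauge:
  assumes C: "colouring D C"
  shows "\<exists>\<gamma>. flat X (\<lambda>x p. - \<gamma> x + flat_of C x p + \<gamma> p) \<and>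
    (\<forall>z. z \<notin> K \<longrightarrow> colour (\<lambda>x p. - \<gamma> x + flat_of C x p + \<gamma> p) H z = C z)"
proof -
  let ?f = "flat_of C"
  note fl = flat_flat_of[OF C]
  have open_cap: "open (cap s)" for s unfolding cap_def by (intro open_Collect_less continuous_intros)
  have top: "frame ?f (\<lambda>_. 0) (cap 1)"
    by (rule frame_flat_of[OF C open_cap cap_subset, where \<Phi> = "\<lambda>_. 0"])
      (use no_side_cap[of 1] in \<open>auto simp: local_triv_def generic_near_def\<close>)
  have "open {q :: space. fst q \<in> - K}"
    using open_vimage[of "- K" "fst :: space \<Rightarrow> complex"] continuous_on_fst[OF continuous_on_id[of UNIV]]
    by (simp add: vimage_def open_Compl)
  then have mid: "frame ?f (\<lambda>_. 0) {q. fst q \<in> - K}"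
    by (rule frame_flat_of[OF C, where \<Phi> = "\<lambda>_. 0"])
      (use generic_in_X no_side_generic in \<open>auto simp: local_triv_def generic_near_def\<close>)
  \<comment> \<open>In the lower cap everything is compared with going down, that is with
    \<open>- C\<close>. Under a strand \<open>local_triv\<close> already is \<open>- C\<close>;
    elsewhere it is 0 and \<open>F\<close> makes up the difference.\<close>
  define F where "F = (\<lambda>x. if \<exists>e\<in>L. side 1 x e then 0 else - C (fst x))"
  have bot: "frame ?f F (cap (-1))"
  proof (rule frame_flat_of[OF C open_cap cap_subset, where \<Phi> = "\<lambda>q. - C (fst q)"])
    fix x assume x: "x \<in> cap (-1)"
    note nb = no_side_cap[OF _ x]
    show "generic_near x (\<lambda>q. - C (fst q) = F x + local_triv C x q)"
    proof (cases "\<exists>e\<in>L. side 1 x e")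
      case True
      then show ?thesis using nb by (auto simp: generic_near_def F_def local_triv_def)
    next
      case False
      have "x \<in> X" using x cap_subset[of "-1"] by auto
      have "fst x \<notin> K"
      proof
        assume "fst x \<in> K"
        then obtain e where "e \<in> L" "fst x \<in> seg (project_edge e)" by (auto simp: K_def carrier_of_def strands_eq)
        then show False using side_over[OF \<open>x \<in> X\<close>] False nb by blast
      qed
      then have "\<forall>\<^sub>F w in nhds (fst x). C w = C (fst x)" using C unfolding colouring_def K_def by blast
      from eventually_fst[OF this] show ?thesis
        unfolding generic_near_def by eventually_elim (use False in \<open>auto simp: F_def local_triv_def\<close>)
    qed
  qed auto
  have col: "colour ?f H z = C z + F (0, - H)" if z: "z \<notin> K" for z
  proof -
    note s = colour_segments[OF z]
    have "closed_segment (0, H) (z, H) \<subseteq> cap 1"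
      using H0 convex_cap[of 1] by (intro closed_segment_subset) (auto simp: cap_def)
    then have 1: "hol ?f (0, H) (z, H) = 0"
      using hol_eq[OF fl s(1) frame_subset[OF top]] by simp
    have "closed_segment (z, H) (z, - H) \<subseteq> {q. fst q \<in> - K}"
    proof -
      have "convex ({z} \<times> (UNIV :: real set))" by (intro convex_Times) auto
      then have "closed_segment (z, H) (z, - H) \<subseteq> {z} \<times> UNIV" by (intro closed_segment_subset) auto
      then show ?thesis using z by auto
    qed
    then have 2: "hol ?f (z, H) (z, - H) = 0"
      using hol_eq[OF fl s(2) frame_subset[OF mid]] by simp
    have "closed_segment (z, - H) (0, - H) \<subseteq> cap (-1)"
      using H0 convex_cap[of "-1"] by (intro closed_segment_subset) (auto simp: cap_def)
    then have "hol ?f (z, - H) (0, - H) = - F (z, - H) + F (0, - H)"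
      using hol_eq[OF fl s(3) frame_subset[OF bot]] by simp
    moreover have "F (z, - H) = - C z" using no_side_generic[of "(z, - H)"] z by (auto simp: F_def)
    ultimately show ?thesis using 1 2 by (simp add: colour_def)
  qed
  define \<gamma> where "\<gamma> = (\<lambda>p :: space. if p = (0, - H) then - F (0, - H) else 0)"
  define f where "f = (\<lambda>x p. - \<gamma> x + ?f x p + \<gamma> p)"
  have rel: "\<forall>\<^sub>F p in nhds x. f x p = - \<gamma> x + ?f x p + \<gamma> p" for x by (simp add: f_def)
  \<comment> \<open>The two base points must be distinct, so that the change at
    \<open>(0, - H)\<close> leaves \<open>(0, H)\<close> alone. As the link is nonempty,
    \<open>H0\<close> is nonnegative.\<close>
  have "H \<noteq> 0"
  proof -
    obtain a b where "(a, b) \<in> L" using link by (auto simp: oriented_link_def closed_polygons_def)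
    then have "a \<in> carrier_of L" by (force simp: carrier_of_def seg_def)
    then show ?thesis using heights H0 by fastforce
  qed
  then have "colour f H z = C z" if "z \<notin> K" for z
    using colour_gauge[OF fl rel that] col[OF that] by (simp add: \<gamma>_def group_normal del: add_uminus_conv_diff)
  moreover have "flat X f" by (rule flat_gauge[OF fl rel open_X])
  ultimately show ?thesis unfolding f_def by blast
qed

lemma colouring_realised:
  assumes "colouring D C"
  shows "\<exists>f. flat X f \<and> (\<forall>z. z \<notin> K \<longrightarrow> colour f H z = C z)"
  using colouring_realised_gauge[OF assms] by blast

end

section \<open>Winding of integer-valued flat structures around an edge\<close>

definition det3 :: "space \<Rightarrow> space \<Rightarrow> space \<Rightarrow> real" where
  "det3 u v w = Im (cnj (fst u) * fst v) * snd w + Im (cnj (fst v) * fst w) * snd u + Im (cnj (fst w) * fst u) * snd v"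

lemma det3_add: "det3 (a + b) v w = det3 a v w + det3 b v w"
  "det3 u (a + b) w = det3 u a w + det3 u b w" "det3 u v (a + b) = det3 u v a + det3 u v b"
  by (simp_all add: det3_def algebra_simps)

lemma det3_diff: "det3 (a - b) v w = det3 a v w - det3 b v w"
  "det3 u (a - b) w = det3 u a w - det3 u b w" "det3 u v (a - b) = det3 u v a - det3 u v b"
  by (simp_all add: det3_def algebra_simps)

lemma det3_scaleR: "det3 (k *\<^sub>R a) v w = k * det3 a v w"
  "det3 u (k *\<^sub>R a) w = k * det3 u a w" "det3 u v (k *\<^sub>R a) = k * det3 u v a"
  by (simp_all add: det3_def algebra_simps)

lemma det3_same [simp]: "det3 a a w = 0" "det3 a v a = 0" "det3 u a a = 0"
  by (simp_all add: det3_def algebra_simps)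

lemma det3_swap: "det3 u w v = - det3 u v w" "det3 v u w = - det3 u v w"
  by (simp_all add: det3_def algebra_simps)

lemma continuous_det3 [continuous_intros]:
  assumes "continuous F a" "continuous F b" "continuous F c"
  shows "continuous F (\<lambda>x. det3 (a x) (b x) (c x))"
  unfolding det3_def by (intro continuous_intros bounded_linear.continuous[OF bounded_linear_Im] assms)

lemma cramer3: "det3 u v w *\<^sub>R d = det3 d v w *\<^sub>R u + det3 u d w *\<^sub>R v + det3 u v d *\<^sub>R w"
  unfolding det3_def by (intro prod_eqI complex_eqI) (simp_all add: algebra_simps)

text \<open>A Pluecker relation. In \<open>transverse_change\<close> it gives the determinant of the
  change of transverse coordinates, which is therefore positive.\<close>

lemma det3_exchange: "det3 u v w' * det3 u v' w - det3 u v' v * det3 u w w' = det3 u v w * det3 u v' w'"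
proof -
  have "det3 u v w * det3 u v' w' = det3 u (det3 u v w *\<^sub>R v') w'" by (simp add: det3_scaleR)
  also have "\<dots> = det3 u v' w * det3 u v w' + det3 u v v' * det3 u w w'"
    unfolding cramer3[of u v w v'] by (simp add: det3_add det3_scaleR)
  finally show ?thesis using det3_swap(1)[of u v' v] by simp
qed

text \<open>\<open>\<theta>\<close> is a polar angle of \<open>\<pi>\<close> whose jumps are \<open>2\<pi>f\<close>. If \<open>\<pi>\<close> is a projection along an edge, the existence
  of \<open>\<theta>\<close> means that the integral cocycle \<open>f\<close> takes the value \<open>\<plusminus> 1\<close>, with a sign that only depends on the
  orientation of the edge, on the meridians of the edge. In this form the condition passes through homeomorphisms.\<close>

definition angle_function :: "(space \<Rightarrow> space \<Rightarrow> int) \<Rightarrow> space set \<Rightarrow> (space \<Rightarrow> complex) \<Rightarrow> (space \<Rightarrow> real) \<Rightarrow> bool" where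
  "angle_function f V \<pi> \<theta> \<longleftrightarrow> (\<forall>p\<in>V. \<pi> p \<noteq> 0 \<longrightarrow> \<pi> p = rcis (cmod (\<pi> p)) (\<theta> p) \<and>
     ((\<lambda>q. \<theta> q - 2 * pi * of_int (f p q)) \<longlongrightarrow> \<theta> p) (nhds p))"

text \<open>By Cramer's rule these are the coordinates of \<open>p - x\<close> along
  \<open>v\<close> and \<open>w\<close>, up to the factor \<open>det3 u v w\<close>: the projection
  along \<open>u\<close>, with the line through \<open>x\<close> as its zero set.\<close>

definition transverse :: "space \<Rightarrow> space \<Rightarrow> space \<Rightarrow> space \<Rightarrow> space \<Rightarrow> complex" where
  "transverse u v w x p = Complex (det3 u (p - x) w) (det3 u v (p - x))"

text \<open>One positively oriented complement \<open>v\<close>, \<open>w\<close> is enough: another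
  one changes the projection by an orientation preserving linear map
  (\<open>transverse_change\<close>).\<close>

definition winds :: "(space \<Rightarrow> space \<Rightarrow> int) \<Rightarrow> space edge \<Rightarrow> space \<Rightarrow> bool" where
  "winds f e x \<longleftrightarrow> (\<exists>v w V \<theta>. det3 (snd e - fst e) v w > 0 \<and> open V \<and> x \<in> V \<and>
     angle_function f V (transverse (snd e - fst e) v w x) \<theta>)"

lemma isCont_transverse: "isCont (transverse u v w x) p"
  unfolding transverse_def Complex_eq by (intro continuous_intros)

lemma angle_function_subset: "angle_function f V \<pi> \<theta> \<Longrightarrow> V' \<subseteq> V \<Longrightarrow> angle_function f V' \<pi> \<theta>"
  unfolding angle_function_def by blast

lemma rcis_cmod_mult:
  assumes "z = rcis (cmod z) a" "c = rcis (cmod c) b"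
  shows "z * c = rcis (cmod (z * c)) (a + b)"
  by (subst assms(1), subst assms(2)) (simp add: rcis_mult norm_mult)

lemma angle_function_cmult:
  assumes "angle_function f V \<pi> \<theta>" "c \<noteq> 0"
  shows "angle_function f V (\<lambda>p. \<pi> p * c) (\<lambda>p. \<theta> p + Arg c)"
  unfolding angle_function_def
proof (intro ballI impI conjI)
  fix p assume p: "p \<in> V" "\<pi> p * c \<noteq> 0"
  then have *: "\<pi> p = rcis (cmod (\<pi> p)) (\<theta> p)" "((\<lambda>q. \<theta> q - 2 * pi * of_int (f p q)) \<longlongrightarrow> \<theta> p) (nhds p)"
    using assms(1) unfolding angle_function_def by auto
  show "\<pi> p * c = rcis (cmod (\<pi> p * c)) (\<theta> p + Arg c)"
    by (rule rcis_cmod_mult[OF *(1)]) (simp add: rcis_cmod_Arg)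
  have "((\<lambda>q. \<theta> q - 2 * pi * of_int (f p q) + Arg c) \<longlongrightarrow> \<theta> p + Arg c) (nhds p)"
    by (intro tendsto_intros *(2))
  then show "((\<lambda>q. \<theta> q + Arg c - 2 * pi * of_int (f p q)) \<longlongrightarrow> \<theta> p + Arg c) (nhds p)"
    by (simp add: algebra_simps)
qed

text \<open>Where the ratio of the two maps avoids the nonpositive real axis, \<open>Arg\<close>
  gives a continuous angle from one to the other; adding it turns a polar angle of
  \<open>\<pi>\<close> into one of \<open>\<pi>'\<close>.\<close>

lemma angle_function_homotopic:
  assumes "angle_function f V \<pi> \<theta>"
    and cont: "\<And>p. p \<in> V \<Longrightarrow> \<pi> p \<noteq> 0 \<Longrightarrow> isCont \<pi> p \<and> isCont \<pi>' p"
    and ratio: "\<And>p. p \<in> V \<Longrightarrow> \<pi> p \<noteq> 0 \<Longrightarrow> \<pi>' p / \<pi> p \<notin> \<real>\<^sub>\<le>\<^sub>0"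
    and zero: "\<And>p. p \<in> V \<Longrightarrow> \<pi> p = 0 \<Longrightarrow> \<pi>' p = 0"
  shows "angle_function f V \<pi>' (\<lambda>p. \<theta> p + Arg (\<pi>' p / \<pi> p))"
  unfolding angle_function_def
proof (intro ballI impI conjI)
  fix p assume p: "p \<in> V" "\<pi>' p \<noteq> 0"
  then have nz: "\<pi> p \<noteq> 0" using zero by blast
  then have *: "\<pi> p = rcis (cmod (\<pi> p)) (\<theta> p)" "((\<lambda>q. \<theta> q - 2 * pi * of_int (f p q)) \<longlongrightarrow> \<theta> p) (nhds p)"
    using assms(1) p(1) unfolding angle_function_def by auto
  have "\<pi> p * (\<pi>' p / \<pi> p) = rcis (cmod (\<pi> p * (\<pi>' p / \<pi> p))) (\<theta> p + Arg (\<pi>' p / \<pi> p))"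
    by (rule rcis_cmod_mult[OF *(1)]) (simp add: rcis_cmod_Arg)
  then show "\<pi>' p = rcis (cmod (\<pi>' p)) (\<theta> p + Arg (\<pi>' p / \<pi> p))" using nz by simp
  have "isCont (\<lambda>p. \<pi>' p / \<pi> p) p" using cont[OF p(1) nz] nz by (intro continuous_intros) auto
  then have "isCont (\<lambda>p. Arg (\<pi>' p / \<pi> p)) p"
    using isCont_o2[where g = Arg and f = "\<lambda>p. \<pi>' p / \<pi> p"] continuous_at_Arg[OF ratio[OF p(1) nz]] by blast
  then have "((\<lambda>q. Arg (\<pi>' q / \<pi> q)) \<longlongrightarrow> Arg (\<pi>' p / \<pi> p)) (nhds p)"
    unfolding isCont_def using tendsto_at_iff_tendsto_nhds[of "\<lambda>p. Arg (\<pi>' p / \<pi> p)" p] by blast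
  from tendsto_add[OF *(2) this]
  show "((\<lambda>q. \<theta> q + Arg (\<pi>' q / \<pi> q) - 2 * pi * of_int (f p q)) \<longlongrightarrow> \<theta> p + Arg (\<pi>' p / \<pi> p)) (nhds p)"
    by (simp add: algebra_simps)
qed

lemma angle_function_pullback:
  assumes "angle_function f V \<pi> \<theta>" "\<And>x. isCont h x"
  shows "angle_function (\<lambda>p q. f (h p) (h q)) (h -` V) (\<lambda>p. \<pi> (h p)) (\<lambda>p. \<theta> (h p))"
  unfolding angle_function_def
proof (intro ballI impI conjI)
  fix p assume p: "p \<in> h -` V" "\<pi> (h p) \<noteq> 0"
  then have *: "\<pi> (h p) = rcis (cmod (\<pi> (h p))) (\<theta> (h p))"
    "((\<lambda>q. \<theta> q - 2 * pi * of_int (f (h p) q)) \<longlongrightarrow> \<theta> (h p)) (nhds (h p))"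
    using assms(1) unfolding angle_function_def by auto
  show "\<pi> (h p) = rcis (cmod (\<pi> (h p))) (\<theta> (h p))" by (rule *)
  show "((\<lambda>q. \<theta> (h q) - 2 * pi * of_int (f (h p) (h q))) \<longlongrightarrow> \<theta> (h p)) (nhds p)"
    using filterlim_compose[OF *(2), of h "nhds p"] assms(2)[of p]
    unfolding isCont_def tendsto_at_iff_tendsto_nhds by simp
qed

text \<open>Writing a real linear map of the plane as \<open>z \<mapsto> a z + b \<bar>z\<close>, it preserves orientation iff
  \<open>\<bar>b\<bar> < \<bar>a\<bar>\<close>, and then it is homotopic to multiplication by \<open>a\<close>.\<close>

lemma angle_function_linear:
  assumes ang: "angle_function f V \<pi> \<theta>" and cont: "\<And>p. isCont \<pi> p"
    and det: "k * n - l * m > 0"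
    and \<pi>': "\<And>p. \<pi>' p = Complex (k * Re (\<pi> p) + m * Im (\<pi> p)) (l * Re (\<pi> p) + n * Im (\<pi> p))"
  shows "\<exists>\<theta>'. angle_function f V \<pi>' \<theta>'"
proof -
  define a where "a = Complex ((k + n) / 2) ((l - m) / 2)"
  define b where "b = Complex ((k - n) / 2) ((l + m) / 2)"
  have ab: "(cmod a)\<^sup>2 - (cmod b)\<^sup>2 = k * n - l * m"
    unfolding a_def b_def cmod_power2 by (simp add: power2_eq_square field_simps)
  have lin: "\<pi>' p = a * \<pi> p + b * cnj (\<pi> p)" for p
    unfolding \<pi>' a_def b_def complex_eq_iff by (simp add: field_simps)
  have lt: "cmod b < cmod a" using ab det by (metis diff_gt_0_iff_gt norm_ge_zero power_less_imp_less_base)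
  then have a: "a \<noteq> 0" by auto
  have "angle_function f V (\<lambda>p. \<pi> p + b / a * cnj (\<pi> p)) (\<lambda>p. \<theta> p + Arg ((\<pi> p + b / a * cnj (\<pi> p)) / \<pi> p))"
  proof (rule angle_function_homotopic[OF ang])
    fix p assume p: "\<pi> p \<noteq> 0"
    show "isCont \<pi> p \<and> isCont (\<lambda>p. \<pi> p + b / a * cnj (\<pi> p)) p" using cont[of p] by (intro conjI continuous_intros)
    have "cmod (b / a * cnj (\<pi> p) / \<pi> p) < 1" using lt a p by (simp add: norm_mult norm_divide)
    then have "\<bar>Re (b / a * cnj (\<pi> p) / \<pi> p)\<bar> < 1" using abs_Re_le_cmod by (metis le_less_trans)
    moreover have "(\<pi> p + b / a * cnj (\<pi> p)) / \<pi> p = 1 + b / a * cnj (\<pi> p) / \<pi> p" using p by (simp add: field_simps)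
    ultimately have "Re ((\<pi> p + b / a * cnj (\<pi> p)) / \<pi> p) > 0" by simp
    then show "(\<pi> p + b / a * cnj (\<pi> p)) / \<pi> p \<notin> \<real>\<^sub>\<le>\<^sub>0" using complex_nonpos_Reals_iff by force
  qed simp
  from angle_function_cmult[OF this a] 
  have "\<exists>\<theta>'. angle_function f V (\<lambda>p. (\<pi> p + b / a * cnj (\<pi> p)) * a) \<theta>'" by blast
  moreover have "\<pi>' = (\<lambda>p. (\<pi> p + b / a * cnj (\<pi> p)) * a)" using a by (simp add: lin fun_eq_iff distrib_right)
  ultimately show ?thesis by simp
qed

lemma transverse_change:
  assumes "angle_function f V (transverse u v w x) \<theta>" "det3 u v w > 0" "det3 u v' w' > 0"
  shows "\<exists>\<theta>'. angle_function f V (transverse u v' w' x) \<theta>'"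
proof (rule angle_function_linear[OF assms(1) isCont_transverse])
  let ?\<Delta> = "det3 u v w"
  let ?k = "det3 u v w' / ?\<Delta>" and ?m = "det3 u w w' / ?\<Delta>" and ?l = "det3 u v' v / ?\<Delta>" and ?n = "det3 u v' w / ?\<Delta>"
  have "?k * ?n - ?l * ?m = (det3 u v w * det3 u v' w') / (?\<Delta> * ?\<Delta>)"
    by (simp only: det3_exchange[of u v w' v' w, symmetric] diff_divide_distrib times_divide_times_eq)
  also have "\<dots> > 0" using assms by simp
  finally show "?k * ?n - ?l * ?m > 0" .
  fix p
  let ?d = "p - x"
  have "?\<Delta> * det3 u ?d w' = det3 u (?\<Delta> *\<^sub>R ?d) w'" by (simp add: det3_scaleR)
  also have "\<dots> = det3 u ?d w * det3 u v w' + det3 u v ?d * det3 u w w'"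
    unfolding cramer3[of u v w ?d] by (simp add: det3_add det3_scaleR)
  finally have 1: "det3 u ?d w' = (det3 u ?d w * det3 u v w' + det3 u v ?d * det3 u w w') / ?\<Delta>"
    using assms(2) by (simp add: field_simps)
  have "?\<Delta> * det3 u v' ?d = det3 u v' (?\<Delta> *\<^sub>R ?d)" by (simp add: det3_scaleR)
  also have "\<dots> = det3 u ?d w * det3 u v' v + det3 u v ?d * det3 u v' w"
    unfolding cramer3[of u v w ?d] by (simp add: det3_add det3_scaleR)
  finally have 2: "det3 u v' ?d = (det3 u ?d w * det3 u v' v + det3 u v ?d * det3 u v' w) / ?\<Delta>"
    using assms(2) by (simp add: field_simps)
  show "transverse u v' w' x p = Complex (?k * Re (transverse u v w x p) + ?m * Im (transverse u v w x p))
      (?l * Re (transverse u v w x p) + ?n * Im (transverse u v w x p))"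
    by (simp add: transverse_def 1 2 add_divide_distrib mult.commute)
qed

text \<open>The origin of the transverse coordinates may slide along the line of the edge and the
  direction may be rescaled. This lets the edges of a triangle be measured from its apex and from
  the midpoint of its base.\<close>

lemma windsD:
  assumes "winds f e x" "snd e - fst e = k *\<^sub>R u" "k > 0" "x - x' = t *\<^sub>R u" "det3 u v w > 0"
  shows "\<exists>V \<theta>. open V \<and> x \<in> V \<and> angle_function f V (transverse u v w x') \<theta>"
proof -
  obtain v0 w0 V \<theta> where *: "det3 (snd e - fst e) v0 w0 > 0" "open V" "x \<in> V"
    "angle_function f V (transverse (snd e - fst e) v0 w0 x) \<theta>" using assms(1) unfolding winds_def by blast
  have "det3 (snd e - fst e) v w > 0" using assms by (simp add: det3_scaleR)
  then obtain \<theta>' where "angle_function f V (transverse (snd e - fst e) v w x) \<theta>'"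
    using transverse_change[OF *(4,1)] by blast
  from angle_function_cmult[OF this, of "of_real (1 / k)"]
  have "angle_function f V (\<lambda>p. transverse (snd e - fst e) v w x p * of_real (1 / k)) (\<lambda>p. \<theta>' p + Arg (of_real (1 / k)))"
    using assms(3) by simp
  moreover have "transverse (snd e - fst e) v w x p * of_real (1 / k) = transverse u v w x' p" for p
  proof -
    have "p - x = (p - x') - t *\<^sub>R u" using assms(4) by (simp add: algebra_simps)
    then have "det3 u (p - x) w = det3 u (p - x') w" "det3 u v (p - x) = det3 u v (p - x')"
      by (simp_all only: det3_diff(2,3) det3_scaleR det3_same mult_zero_right diff_zero)
    then show ?thesis using assms(2,3) by (simp add: transverse_def det3_scaleR complex_eq_iff)
  qed
  ultimately show ?thesis using * by auto
qed

lemma windsI: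
  assumes "angle_function f V (transverse u v w x') \<theta>" "open V" "x \<in> V"
    and "snd e - fst e = k *\<^sub>R u" "k > 0" "x - x' = t *\<^sub>R u" "det3 u v w > 0"
  shows "winds f e x"
proof -
  have "angle_function f V (\<lambda>p. transverse u v w x' p * of_real k) (\<lambda>p. \<theta> p + Arg (of_real k))"
    using angle_function_cmult[OF assms(1), of "of_real k"] assms(5) by simp
  moreover have "transverse u v w x' p * of_real k = transverse (snd e - fst e) v w x p" for p
  proof -
    have "p - x = (p - x') - t *\<^sub>R u" using assms(6) by (simp add: algebra_simps)
    then have "det3 u (p - x) w = det3 u (p - x') w" "det3 u v (p - x) = det3 u v (p - x')"
      by (simp_all only: det3_diff(2,3) det3_scaleR det3_same mult_zero_right diff_zero)
    then show ?thesis using assms(4) by (simp add: transverse_def det3_scaleR complex_eq_iff)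
  qed
  moreover have "det3 (snd e - fst e) v w > 0" using assms by (simp add: det3_scaleR)
  ultimately show ?thesis unfolding winds_def using assms(2,3) by (simp only:) blast
qed

text \<open>A piecewise linear homeomorphism bends edges, so finitely many points of each edge are
  exempt: ends, and points that correspond to corners.\<close>

definition winds_link :: "(space \<Rightarrow> space \<Rightarrow> int) \<Rightarrow> link \<Rightarrow> bool" where
  "winds_link f L \<longleftrightarrow> (\<forall>e\<in>L. \<exists>Z. finite Z \<and> (\<forall>x\<in>seg e - Z. winds f e x))"

section \<open>A triangle move is realised by a homeomorphism\<close>

text \<open>A tent function. With \<open>a = y + \<eta> * T\<close> and
  \<open>b = (1 + \<eta>) * T - y\<close> it is the distance by which \<open>y\<close> moves when
  the interval from \<open>- \<eta> * T\<close> to \<open>(1 + \<eta>) * T\<close> is stretched so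
  that 0 goes to \<open>T\<close> and the ends stay. The slopes \<open>1 / \<eta>\<close> and
  \<open>- 1 / (1 + \<eta>)\<close> exceed -1, so the motion is monotone.\<close>

definition bump :: "real \<Rightarrow> real \<Rightarrow> real \<Rightarrow> real" where
  "bump \<eta> a b = max 0 (min (a / \<eta>) (b / (1 + \<eta>)))"

lemma bump_zero:
  assumes "\<eta> > 0" "a \<le> 0 \<or> b \<le> 0"
  shows "bump \<eta> a b = 0"
proof -
  have "a / \<eta> \<le> 0 \<or> b / (1 + \<eta>) \<le> 0" using assms by (simp add: divide_le_0_iff)
  then show ?thesis unfolding bump_def by linarith
qed

text \<open>The reflection of that interval which swaps 0 and \<open>T\<close> also swaps the two
  arguments, and it conjugates the motion to its inverse; hence the inverse is a shift by the same
  formula with swapped arguments.\<close>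

lemma bump_inverse:
  assumes "\<eta> > 0"
  shows "bump \<eta> (b - bump \<eta> a b) (a + bump \<eta> a b) = bump \<eta> a b"
proof -
  let ?c = "bump \<eta> a b"
  consider "a \<le> 0 \<or> b \<le> 0" | "a > 0" "b > 0" "a * (1 + \<eta>) \<le> b * \<eta>" | "a > 0" "b > 0" "b * \<eta> \<le> a * (1 + \<eta>)"
    by linarith
  then show ?thesis
  proof cases
    case 1
    then have c: "?c = 0" by (rule bump_zero[OF assms])
    show ?thesis unfolding c using bump_zero[OF assms, of b a] 1 by auto
  next
    case 2
    define q where "q = a / \<eta>"
    have a: "a = \<eta> * q" and q: "q > 0" using 2 assms by (simp_all add: q_def)
    have "\<eta> * (q * (1 + \<eta>)) \<le> \<eta> * b" using 2(3) by (simp add: a mult.assoc mult.commute[of b])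
    then have b: "q * (1 + \<eta>) \<le> b" using assms by simp
    have "q \<le> b / (1 + \<eta>)" using b assms by (simp add: pos_le_divide_eq)
    then have c: "?c = q" unfolding bump_def q_def[symmetric] using q by linarith
    have "q * \<eta> \<le> b - q" using b by (simp add: algebra_simps)
    then have 1: "q \<le> (b - q) / \<eta>" using assms by (simp add: pos_le_divide_eq)
    have "a + q = q * (1 + \<eta>)" by (simp add: a algebra_simps)
    then have "(a + q) / (1 + \<eta>) = q" using assms by simp
    then have "bump \<eta> (b - q) (a + q) = q" unfolding bump_def using 1 q by linarith
    then show ?thesis by (simp only: c)
  next
    case 3
    define q where "q = b / (1 + \<eta>)"
    have b: "b = q * (1 + \<eta>)" and q: "q > 0" using 3 assms by (simp_all add: q_def)
    have "(1 + \<eta>) * (q * \<eta>) \<le> (1 + \<eta>) * a" using 3(3) by (simp add: b mult.assoc mult.commute[of a]) (simp add: algebra_simps)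
    then have a: "q * \<eta> \<le> a" using assms by simp
    have "q \<le> a / \<eta>" using a assms by (simp add: pos_le_divide_eq)
    then have c: "?c = q" unfolding bump_def q_def[symmetric] using q by linarith
    have "q * (1 + \<eta>) \<le> a + q" using a by (simp add: algebra_simps)
    then have 1: "q \<le> (a + q) / (1 + \<eta>)" using assms by (simp add: pos_le_divide_eq)
    have "b - q = q * \<eta>" by (simp add: b algebra_simps)
    then have "(b - q) / \<eta> = q" using assms by simp
    then have "bump \<eta> (b - q) (a + q) = q" unfolding bump_def using 1 q by linarith
    then show ?thesis by (simp only: c)
  qed
qed

text \<open>The motion is increasing and takes 0 to \<open>T\<close>. This keeps points on their
  side of the edge, which is what \<open>winds_pullback\<close> needs in the plane of the
  triangle.\<close>

lemma bump_sign:
  assumes "\<eta> > 0" "T > 0"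
  shows "sgn (y + bump \<eta> (y + \<eta> * T) ((1 + \<eta>) * T - y) - T) = sgn y"
proof -
  consider "y > 0" | "y = 0" | "y < 0" by linarith
  then show ?thesis
  proof cases
    case 1
    have "y + bump \<eta> (y + \<eta> * T) ((1 + \<eta>) * T - y) > T"
    proof -
      have "T - y < (y + \<eta> * T) / \<eta>" using 1 assms by (simp add: field_simps add_pos_pos)
      moreover have "T - y < ((1 + \<eta>) * T - y) / (1 + \<eta>)" using 1 assms by (simp add: field_simps)
      ultimately show ?thesis unfolding bump_def by linarith
    qed
    then show ?thesis using 1 by simp
  next
    case 2
    then show ?thesis using assms by (simp add: bump_def)
  next
    case 3
    have "(y + \<eta> * T) / \<eta> = y / \<eta> + T" using assms by (simp add: add_divide_distrib)
    moreover have "y / \<eta> < 0" using 3 assms by (simp add: divide_neg_pos)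
    ultimately have "(y + \<eta> * T) / \<eta> < T - y" using 3 by linarith
    moreover have "0 < T - y" using 3 assms by simp
    ultimately have "bump \<eta> (y + \<eta> * T) ((1 + \<eta>) * T - y) < T - y" unfolding bump_def by linarith
    then show ?thesis using 3 by simp
  qed
qed

text \<open>Supplies affine coordinates in which \<open>A\<close>, \<open>B\<close>,
  \<open>C\<close> are (-1,0,0), (1,0,0), (0,1,0): the origin is the midpoint of the edge, the
  second axis the median, the third an outward vector \<open>N\<close> of the right
  orientation.\<close>

locale triangle_frame =
  fixes A B C N :: space
  assumes N: "det3 ((1/2) *\<^sub>R (B - A)) (C - (1/2) *\<^sub>R (A + B)) N > 0"
begin

definition "P = (1/2) *\<^sub>R (A + B)"
definition "u = (1/2) *\<^sub>R (B - A)"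
definition "v = C - P"
definition "\<Delta> = det3 u v N"

lemma \<Delta>: "\<Delta> > 0" using N by (simp add: \<Delta>_def u_def v_def P_def)

definition "cs p = det3 (p - P) v N / \<Delta>"
definition "cy p = det3 u (p - P) N / \<Delta>"
definition "cr p = det3 u v (p - P) / \<Delta>"

lemma coords: "p = P + cs p *\<^sub>R u + cy p *\<^sub>R v + cr p *\<^sub>R N"
proof -
  have "\<Delta> *\<^sub>R (p - P) = \<Delta> *\<^sub>R (cs p *\<^sub>R u + cy p *\<^sub>R v + cr p *\<^sub>R N)"
    unfolding \<Delta>_def cramer3[of u v N "p - P"] using \<Delta>
    by (simp add: cs_def cy_def cr_def \<Delta>_def scaleR_add_right)
  then have "p - P = cs p *\<^sub>R u + cy p *\<^sub>R v + cr p *\<^sub>R N" using \<Delta> by simp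
  then show ?thesis by (simp add: algebra_simps)
qed

lemma coords_eq:
  "cs (P + s *\<^sub>R u + y *\<^sub>R v + r *\<^sub>R N) = s" "cy (P + s *\<^sub>R u + y *\<^sub>R v + r *\<^sub>R N) = y"
  "cr (P + s *\<^sub>R u + y *\<^sub>R v + r *\<^sub>R N) = r"
  using \<Delta> unfolding cs_def cy_def cr_def by (simp_all add: det3_add det3_scaleR \<Delta>_def add.assoc)

lemma coords_add:
  "cs (p + k *\<^sub>R v) = cs p" "cy (p + k *\<^sub>R v) = cy p + k" "cr (p + k *\<^sub>R v) = cr p"
proof -
  have "p + k *\<^sub>R v = P + cs p *\<^sub>R u + (cy p + k) *\<^sub>R v + cr p *\<^sub>R N"
    by (subst coords[of p]) (simp add: algebra_simps)
  then show "cs (p + k *\<^sub>R v) = cs p" "cy (p + k *\<^sub>R v) = cy p + k" "cr (p + k *\<^sub>R v) = cr p"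
    by (simp_all only: coords_eq)
qed

lemma AB: "A = P + (-1) *\<^sub>R u" "B = P + 1 *\<^sub>R u" "C = P + 1 *\<^sub>R v"
proof -
  have "P - u = (1/2 + 1/2) *\<^sub>R A" "P + u = (1/2 + 1/2) *\<^sub>R B"
    unfolding P_def u_def scaleR_add_left scaleR_add_right scaleR_diff_right by simp_all
  then show "A = P + (-1) *\<^sub>R u" "B = P + 1 *\<^sub>R u" "C = P + 1 *\<^sub>R v" by (simp_all add: v_def)
qed

lemma triangle_mem:
  assumes "0 \<le> y" "y \<le> 1 - \<bar>s\<bar>"
  shows "P + s *\<^sub>R u + y *\<^sub>R v \<in> convex hull {A, B, C}"
proof -
  have "P + s *\<^sub>R u + y *\<^sub>R v = ((1 - y - s) / 2) *\<^sub>R A + ((1 - y + s) / 2) *\<^sub>R B + y *\<^sub>R C"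
  proof -
    have "((1 - y - s) / 2) *\<^sub>R (P + (-1) *\<^sub>R u) + ((1 - y + s) / 2) *\<^sub>R (P + 1 *\<^sub>R u) + y *\<^sub>R (P + 1 *\<^sub>R v)
      = ((1 - y - s) / 2 + (1 - y + s) / 2 + y) *\<^sub>R P + ((1 - y + s) / 2 - (1 - y - s) / 2) *\<^sub>R u + y *\<^sub>R v"
      by (simp add: algebra_simps)
    also have "\<dots> = P + s *\<^sub>R u + y *\<^sub>R v" by (simp add: field_simps)
    finally show ?thesis using AB by simp
  qed
  moreover have "0 \<le> (1 - y - s) / 2" "0 \<le> (1 - y + s) / 2" "(1 - y - s) / 2 + (1 - y + s) / 2 + y = 1"
    using assms by (auto simp: field_simps)
  ultimately show ?thesis using assms(1) unfolding convex_hull_3 by blast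
qed

end

locale triangle = triangle_frame +
  fixes \<eta> \<kappa> :: real
  assumes \<eta>: "\<eta> > 0" and \<kappa>: "\<kappa> > 0"
begin

text \<open>The height of the triangle over the point of the base, tapering off out of the plane
  with slope \<kappa>. Small \<eta> and large \<kappa> make the support \<open>S\<close> of the
  motion cling to the triangle.\<close>

definition "T p = 1 - \<bar>cs p\<bar> - \<kappa> * \<bar>cr p\<bar>"

definition "hh p = p + bump \<eta> (cy p + \<eta> * T p) ((1 + \<eta>) * T p - cy p) *\<^sub>R v"
definition "hi p = p - bump \<eta> ((1 + \<eta>) * T p - cy p) (cy p + \<eta> * T p) *\<^sub>R v"

lemma T_add [simp]: "T (p + k *\<^sub>R v) = T p" by (simp add: T_def coords_add)

lemma hi_hh [simp]: "hi (hh p) = p"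
proof -
  let ?b = "bump \<eta> (cy p + \<eta> * T p) ((1 + \<eta>) * T p - cy p)"
  have "cy (hh p) = cy p + ?b" "T (hh p) = T p" by (simp_all add: hh_def coords_add)
  then have "hi (hh p) = hh p - bump \<eta> ((1 + \<eta>) * T p - cy p - ?b) (cy p + \<eta> * T p + ?b) *\<^sub>R v"
    unfolding hi_def by (simp add: algebra_simps)
  then show ?thesis using bump_inverse[OF \<eta>] by (simp add: hh_def)
qed

lemma hh_hi [simp]: "hh (hi p) = p"
proof -
  let ?b = "bump \<eta> ((1 + \<eta>) * T p - cy p) (cy p + \<eta> * T p)"
  have "hi p = p + (- ?b) *\<^sub>R v" by (simp add: hi_def)
  then have 1: "cy (hi p) = cy p - ?b" and 2: "T (hi p) = T p" by (simp_all add: coords_add del: scaleR_minus_left)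
  have "hh (hi p) = hi p + bump \<eta> (cy p + \<eta> * T p - ?b) ((1 + \<eta>) * T p - cy p + ?b) *\<^sub>R v"
    unfolding hh_def[of "hi p"] 1 2 by (simp add: algebra_simps)
  then show ?thesis using bump_inverse[OF \<eta>] by (simp add: hi_def)
qed

lemma continuous_coords [continuous_intros]: "isCont cs p" "isCont cy p" "isCont cr p"
  unfolding cs_def[abs_def] cy_def[abs_def] cr_def[abs_def] using \<Delta> by (auto intro!: continuous_intros)

lemma isCont_T [continuous_intros]: "isCont T p"
  unfolding T_def[abs_def] by (intro continuous_intros)

lemma isCont_hh: "isCont hh p" and isCont_hi: "isCont hi p"
  unfolding hh_def[abs_def] hi_def[abs_def] bump_def using \<eta> by (auto intro!: continuous_intros)

definition "S = {p. 0 \<le> T p \<and> - \<eta> * T p \<le> cy p \<and> cy p \<le> (1 + \<eta>) * T p}"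

lemma outside_S:
  assumes "p \<notin> S"
  shows "hh p = p" "hi p = p"
proof -
  have "cy p + \<eta> * T p \<le> 0 \<or> (1 + \<eta>) * T p - cy p \<le> 0"
  proof (rule ccontr)
    assume "\<not> ?thesis"
    then have *: "cy p + \<eta> * T p > 0" "(1 + \<eta>) * T p - cy p > 0" by auto
    then have "(1 + 2 * \<eta>) * T p > 0" by (simp add: algebra_simps)
    then have "T p > 0" using \<eta> by (simp add: zero_less_mult_iff)
    then show False using assms * by (auto simp: S_def)
  qed
  then show "hh p = p" "hi p = p" using bump_zero[OF \<eta>] by (auto simp: hh_def hi_def)
qed

lemma closed_S: "closed S"
proof -
  have c: "continuous_on UNIV T" "continuous_on UNIV cy"
    using isCont_T continuous_coords continuous_at_imp_continuous_on by blast+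
  show ?thesis unfolding S_def by (intro closed_Collect_conj closed_Collect_le continuous_intros c)
qed

lemma S_bounds:
  assumes "p \<in> S"
  shows "\<bar>cs p\<bar> \<le> 1" "\<bar>cr p\<bar> \<le> 1 / \<kappa>" "- \<eta> \<le> cy p" "cy p \<le> 1 - \<bar>cs p\<bar> + \<eta>" "T p \<le> 1"
proof -
  have T: "0 \<le> T p" "- \<eta> * T p \<le> cy p" "cy p \<le> (1 + \<eta>) * T p" using assms by (auto simp: S_def)
  have kr: "0 \<le> \<kappa> * \<bar>cr p\<bar>" using \<kappa> by simp
  show 1: "\<bar>cs p\<bar> \<le> 1" and 2: "T p \<le> 1" using T(1) kr unfolding T_def by linarith+
  have "\<kappa> * \<bar>cr p\<bar> \<le> 1" using T(1) unfolding T_def by linarith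
  then show "\<bar>cr p\<bar> \<le> 1 / \<kappa>" using \<kappa> by (simp add: field_simps)
  have "\<eta> * T p \<le> \<eta>" using 2 \<eta> by simp
  then show "- \<eta> \<le> cy p" "cy p \<le> 1 - \<bar>cs p\<bar> + \<eta>" using T kr by (simp_all add: algebra_simps) (simp_all add: T_def)
qed

lemma bounded_S: "\<exists>b. \<forall>p. norm p > b \<longrightarrow> p \<notin> S"
proof -
  define b where "b = norm P + norm u + (1 + \<eta>) * norm v + 1 / \<kappa> * norm N"
  have "norm p \<le> b" if p: "p \<in> S" for p
  proof -
    note s = S_bounds[OF p]
    have tri: "norm (P + x + y + z) \<le> norm P + norm x + norm y + norm z" for x y z
      using norm_triangle_ineq[of "P + x + y" z] norm_triangle_ineq[of "P + x" y] norm_triangle_ineq[of P x] by linarith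
    have "norm p \<le> norm P + norm (cs p *\<^sub>R u) + norm (cy p *\<^sub>R v) + norm (cr p *\<^sub>R N)"
      using tri[of "cs p *\<^sub>R u" "cy p *\<^sub>R v" "cr p *\<^sub>R N"] by (simp only: coords[symmetric])
    also have "\<dots> \<le> b"
      unfolding b_def norm_scaleR using s \<eta> by (intro add_mono mult_right_mono) (auto simp: mult_left_le_one_le)
    finally show ?thesis .
  qed
  then show ?thesis by (metis not_less)
qed

lemma hh_on_edge:
  assumes "\<bar>s\<bar> \<le> 1"
  shows "hh (P + s *\<^sub>R u) = P + s *\<^sub>R u + (1 - \<bar>s\<bar>) *\<^sub>R v"
proof -
  have c: "cs (P + s *\<^sub>R u) = s" "cy (P + s *\<^sub>R u) = 0" "cr (P + s *\<^sub>R u) = 0"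
    using coords_eq[of s 0 0] by simp_all
  have "bump \<eta> (\<eta> * (1 - \<bar>s\<bar>)) ((1 + \<eta>) * (1 - \<bar>s\<bar>)) = 1 - \<bar>s\<bar>"
    using assms \<eta> by (simp add: bump_def)
  then show ?thesis by (simp add: hh_def T_def c)
qed

lemma edge_param: "closed_segment A B = (\<lambda>s. P + s *\<^sub>R u) ` {-1..1}"
proof -
  have A: "A = P + (-1) *\<^sub>R u" and B: "B = P + 1 *\<^sub>R u" using AB by auto
  have "(1 - t) *\<^sub>R A + t *\<^sub>R B = P + (2 * t - 1) *\<^sub>R u" for t
  proof -
    have "(1 - t) *\<^sub>R (P + (-1) *\<^sub>R u) + t *\<^sub>R (P + 1 *\<^sub>R u) = P + (2 * t - 1) *\<^sub>R u"
    proof -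
      have "(2 * t - 1) *\<^sub>R u = t *\<^sub>R u + t *\<^sub>R u - u"
        by (simp only: scaleR_diff_left mult_2 scaleR_add_left scaleR_one)
      then show ?thesis by (simp add: algebra_simps)
    qed
    then show ?thesis using A B by simp
  qed
  then have "closed_segment A B = (\<lambda>t. P + (2 * t - 1) *\<^sub>R u) ` {0..1}"
    unfolding closed_segment_def by auto
  also have "\<dots> = (\<lambda>s. P + s *\<^sub>R u) ` ((\<lambda>t. 2 * t - 1) ` {0..1})" by (simp add: image_image)
  also have "(\<lambda>t. 2 * t - 1) ` {0..1::real} = {-1..1}" by (simp add: image_affinity_atLeastAtMost_diff)
  finally show ?thesis .
qed

lemma left_edge_param: "closed_segment A C = (\<lambda>s. P + s *\<^sub>R u + (1 - \<bar>s\<bar>) *\<^sub>R v) ` {-1..0}"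
proof -
  have A: "A = P + (-1) *\<^sub>R u" and C: "C = P + 1 *\<^sub>R v" using AB by auto
  have "(1 - t) *\<^sub>R A + t *\<^sub>R C = P + (t - 1) *\<^sub>R u + t *\<^sub>R v" for t
  proof -
    have "(1 - t) *\<^sub>R (P + (-1) *\<^sub>R u) + t *\<^sub>R (P + 1 *\<^sub>R v) = P + (t - 1) *\<^sub>R u + t *\<^sub>R v"
      by (simp add: algebra_simps)
    then show ?thesis using A C by simp
  qed
  then have "closed_segment A C = (\<lambda>t. P + (t - 1) *\<^sub>R u + t *\<^sub>R v) ` {0..1}"
    unfolding closed_segment_def by auto
  also have "\<dots> = (\<lambda>s. P + s *\<^sub>R u + (1 - \<bar>s\<bar>) *\<^sub>R v) ` ((\<lambda>t. t - 1) ` {0..1})"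
    unfolding image_image by (rule image_cong) auto
  also have "(\<lambda>t. t - 1) ` {0..1::real} = {-1..0}" by simp
  finally show ?thesis .
qed

lemma right_edge_param: "closed_segment C B = (\<lambda>s. P + s *\<^sub>R u + (1 - \<bar>s\<bar>) *\<^sub>R v) ` {0..1}"
proof -
  have B: "B = P + 1 *\<^sub>R u" and C: "C = P + 1 *\<^sub>R v" using AB by auto
  have "(1 - t) *\<^sub>R C + t *\<^sub>R B = P + t *\<^sub>R u + (1 - \<bar>t\<bar>) *\<^sub>R v" if "t \<in> {0..1}" for t
  proof -
    have "(1 - t) *\<^sub>R (P + 1 *\<^sub>R v) + t *\<^sub>R (P + 1 *\<^sub>R u) = P + t *\<^sub>R u + (1 - \<bar>t\<bar>) *\<^sub>R v"
      using that by (simp add: algebra_simps)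
    then show ?thesis using B C by simp
  qed
  then show ?thesis unfolding closed_segment_image_interval by (rule image_cong[OF refl])
qed

lemma hh_edge: "hh ` closed_segment A B = closed_segment A C \<union> closed_segment C B"
proof -
  have "hh ` closed_segment A B = (\<lambda>s. P + s *\<^sub>R u + (1 - \<bar>s\<bar>) *\<^sub>R v) ` {-1..1}"
    unfolding edge_param image_image by (rule image_cong) (auto simp: hh_on_edge)
  also have "{-1..1::real} = {-1..0} \<union> {0..1}" by auto
  finally show ?thesis by (simp add: image_Un left_edge_param right_edge_param)
qed

lemma hh_ends: "hh A = A" "hh B = B"
  using hh_on_edge[of "-1"] hh_on_edge[of 1] AB by simp_all

end

text \<open>The motion keeps the coordinate out of the plane and, within the plane, the side of the
  edge. Hence the transverse positions before and after are never opposite to each other.\<close>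

lemma same_half_ratio:
  assumes "r = 0 \<Longrightarrow> sgn a = sgn b" "Complex b r \<noteq> 0"
  shows "Complex a r / Complex b r \<notin> \<real>\<^sub>\<le>\<^sub>0"
proof
  assume "Complex a r / Complex b r \<in> \<real>\<^sub>\<le>\<^sub>0"
  then obtain k where k: "k \<le> 0" "Complex a r / Complex b r = of_real k" by (auto elim: nonpos_Reals_cases)
  then have "Complex a r = of_real k * Complex b r" using assms(2) by (simp add: field_simps)
  then have eq: "a = k * b" "r = k * r" by (auto simp: complex_eq_iff)
  have "r = 0" using eq(2) k(1) by (cases "r = 0") auto
  then have "b \<noteq> 0" "sgn a = sgn b" using assms by (auto simp: complex_eq_iff)
  then show False using eq(1) k(1) by (auto simp: sgn_if split: if_splits) (auto simp: mult_le_0_iff zero_less_mult_iff)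
qed

context triangle_frame
begin

text \<open>The support of the motion while its parameters are still free; they can be fixed only
  after comparison with all the other edges of the link.\<close>

definition "S\<^sub>0 \<eta> \<kappa> = {p. 0 \<le> 1 - \<bar>cs p\<bar> - \<kappa> * \<bar>cr p\<bar> \<and> - \<eta> * (1 - \<bar>cs p\<bar> - \<kappa> * \<bar>cr p\<bar>) \<le> cy p
   \<and> cy p \<le> (1 + \<eta>) * (1 - \<bar>cs p\<bar> - \<kappa> * \<bar>cr p\<bar>)}"

text \<open>The support is uniformly close to the triangle: dropping the component along
  \<open>N\<close> and truncating the one along \<open>v\<close> moves a point by less than
  \<open>\<epsilon> * (norm v + norm N + 1)\<close>, which is the distance \<open>d\<close> from the
  triangle to the compact set.\<close>

lemma far_segment:
  assumes K: "compact K" "K \<inter> convex hull {A, B, C} = {}"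
  shows "\<exists>\<epsilon>>0. \<forall>\<eta> \<kappa>. 0 < \<eta> \<longrightarrow> \<eta> < \<epsilon> \<longrightarrow> \<kappa> > 1 / \<epsilon> \<longrightarrow> K \<inter> S\<^sub>0 \<eta> \<kappa> = {}"
proof -
  have "compact (convex hull {A, B, C})" by (simp add: finite_imp_compact_convex_hull)
  then obtain d where d: "d > 0" "\<forall>x\<in>K. \<forall>y\<in>convex hull {A, B, C}. d \<le> dist x y"
    using separate_compact_closed[OF K(1) compact_imp_closed K(2)] by auto
  define \<epsilon> where "\<epsilon> = d / (norm v + norm N + 1)"
  have pos: "norm v + norm N + 1 > 0" by (simp add: add_nonneg_pos)
  have \<epsilon>: "\<epsilon> > 0" using d pos by (simp add: \<epsilon>_def)
  have "K \<inter> S\<^sub>0 \<eta> \<kappa> = {}" if \<eta>: "0 < \<eta>" "\<eta> < \<epsilon>" and \<kappa>: "\<kappa> > 1 / \<epsilon>" for \<eta> \<kappa>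
  proof (rule ccontr)
    assume "K \<inter> S\<^sub>0 \<eta> \<kappa> \<noteq> {}"
    then obtain p where p: "p \<in> K" "p \<in> S\<^sub>0 \<eta> \<kappa>" by blast
    have \<kappa>0: "\<kappa> > 0" proof -
      have "1 / \<epsilon> > 0" using \<epsilon> by simp
      then show ?thesis using \<kappa> by linarith
    qed
    define T where "T = 1 - \<bar>cs p\<bar> - \<kappa> * \<bar>cr p\<bar>"
    have T: "0 \<le> T" "- \<eta> * T \<le> cy p" "cy p \<le> (1 + \<eta>) * T" using p(2) by (auto simp: S\<^sub>0_def T_def)
    have kr: "0 \<le> \<kappa> * \<bar>cr p\<bar>" using \<kappa>0 by simp
    have T1: "T \<le> 1 - \<bar>cs p\<bar>" "T \<le> 1" using kr by (auto simp: T_def)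
    have "\<kappa> * \<bar>cr p\<bar> \<le> 1" using T(1) by (simp add: T_def)
    then have "\<bar>cr p\<bar> \<le> 1 / \<kappa>" using \<kappa>0 by (simp add: pos_le_divide_eq mult.commute)
    also have "1 / \<kappa> < \<epsilon>"
    proof -
      have "1 < \<kappa> * \<epsilon>" using \<kappa> \<epsilon> by (simp add: pos_divide_less_eq)
      then show ?thesis using \<kappa>0 by (simp add: pos_divide_less_eq mult.commute)
    qed
    finally have r: "\<bar>cr p\<bar> < \<epsilon>" .
    have \<eta>T: "\<eta> * T \<le> \<eta>" using T1(2) \<eta> by simp
    define y where "y = max 0 (min (cy p) (1 - \<bar>cs p\<bar>))"
    define q where "q = P + cs p *\<^sub>R u + y *\<^sub>R v"
    have q: "q \<in> convex hull {A, B, C}" unfolding q_def using T T1 by (intro triangle_mem) (auto simp: y_def)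
    have y: "\<bar>cy p - y\<bar> \<le> \<eta>"
    proof -
      have "cy p \<le> 1 - \<bar>cs p\<bar> + \<eta>" using T(3) \<eta>T T1 by (simp add: algebra_simps)
      moreover have "- \<eta> \<le> cy p" using T(2) \<eta>T by simp
      moreover have "0 \<le> 1 - \<bar>cs p\<bar>" using T T1 by linarith
      ultimately show ?thesis using \<eta> unfolding y_def by linarith
    qed
    have "p - q = (P + cs p *\<^sub>R u + cy p *\<^sub>R v + cr p *\<^sub>R N) - q"
      by (rule arg_cong[OF coords, of "\<lambda>x. x - q"])
    also have "\<dots> = (cy p - y) *\<^sub>R v + cr p *\<^sub>R N" unfolding q_def by (simp add: algebra_simps)
    finally have "dist p q \<le> norm ((cy p - y) *\<^sub>R v) + norm (cr p *\<^sub>R N)"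
      by (simp only: dist_norm norm_triangle_ineq)
    also have "\<dots> \<le> \<epsilon> * norm v + \<epsilon> * norm N"
      unfolding norm_scaleR using y r \<eta> by (intro add_mono mult_right_mono) auto
    also have "\<dots> < \<epsilon> * (norm v + norm N + 1)" using \<epsilon> by (simp add: algebra_simps)
    also have "\<dots> = d" using pos by (simp add: \<epsilon>_def)
    finally have "dist p q < d" .
    moreover have "d \<le> dist p q" using d(2) p(1) q by blast
    ultimately show False by simp
  qed
  then show ?thesis using \<epsilon> by blast
qed

lemma cs_ends: "cs A = - 1" "cs B = 1" "cy A = 0" "cy B = 0" "cr A = 0" "cr B = 0"
proof -
  have "A = P + (-1) *\<^sub>R u + 0 *\<^sub>R v + 0 *\<^sub>R N" "B = P + 1 *\<^sub>R u + 0 *\<^sub>R v + 0 *\<^sub>R N" using AB by simp_all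
  then show "cs A = - 1" "cs B = 1" "cy A = 0" "cy B = 0" "cr A = 0" "cr B = 0" by (metis coords_eq)+
qed

text \<open>An edge ending at \<open>Z\<close> has distance 0 from the triangle, so directions are
  compared with the cone of the support at \<open>Z\<close>. Along the edge the coordinates change
  linearly: \<open>c\<close> is the rate at which the triangle opens, \<open>y\<close> the rate
  along \<open>v\<close>, \<open>r\<close> the rate out of the plane.\<close>

lemma touching_segment:
  assumes Z: "Z \<in> {A, B}" and W: "W \<noteq> Z" and touch: "closed_segment Z W \<inter> convex hull {A, B, C} \<subseteq> {Z}"
  shows "\<exists>\<epsilon>>0. \<forall>\<eta> \<kappa>. 0 < \<eta> \<longrightarrow> \<eta> < \<epsilon> \<longrightarrow> \<kappa> > 1 / \<epsilon> \<longrightarrow> closed_segment Z W \<inter> S\<^sub>0 \<eta> \<kappa> \<subseteq> {Z}"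
proof -
  define a where "a = cs W - cs Z"
  define y where "y = cy W"
  define r where "r = cr W"
  define c where "c = - cs Z * a"
  have Zc: "cs Z = 1 \<or> cs Z = - 1" "cy Z = 0" "cr Z = 0" using Z cs_ends by auto
  have Zsq: "cs Z * cs Z = 1" using Zc by auto
  have point: "(1 - t) *\<^sub>R Z + t *\<^sub>R W = P + (cs Z + t * a) *\<^sub>R u + (t * y) *\<^sub>R v + (t * r) *\<^sub>R N" for t
  proof -
    have "Z = P + cs Z *\<^sub>R u" using coords[of Z] Zc by simp
    moreover have "W = P + cs W *\<^sub>R u + y *\<^sub>R v + r *\<^sub>R N" using coords[of W] by (simp add: y_def r_def)
    ultimately have "(1 - t) *\<^sub>R Z + t *\<^sub>R W = (1 - t) *\<^sub>R (P + cs Z *\<^sub>R u) + t *\<^sub>R (P + cs W *\<^sub>R u + y *\<^sub>R v + r *\<^sub>R N)" by simp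
    also have "\<dots> = P + (cs Z + t * a) *\<^sub>R u + (t * y) *\<^sub>R v + (t * r) *\<^sub>R N" by (simp add: a_def algebra_simps)
    finally show ?thesis .
  qed
  have abs_ge: "1 - t * c \<le> \<bar>cs Z + t * a\<bar>" for t
  proof -
    have "1 - t * c = cs Z * (cs Z + t * a)" using Zsq by (simp add: c_def algebra_simps)
    also have "\<dots> \<le> \<bar>cs Z\<bar> * \<bar>cs Z + t * a\<bar>" by (metis abs_ge_self abs_mult)
    also have "\<bar>cs Z\<bar> = 1" using Zc by auto
    finally show ?thesis by simp
  qed
  have abs_eq: "\<bar>cs Z + t * a\<bar> = 1 - t * c" if "t * c \<le> 1" for t
    using Zc(1) that by (auto simp: c_def)
  \<comment> \<open>An edge that stays in the plane and heads inwards must leave the angle at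
    \<open>Z\<close>, or it would enter the triangle.\<close>
  have escape: "\<not> (0 \<le> y \<and> y \<le> c)" if "r = 0" "c > 0"
  proof
    assume yc: "0 \<le> y \<and> y \<le> c"
    define t where "t = min 1 (1 / c)"
    have t: "0 < t" "t \<le> 1" "t * c \<le> 1" using that by (auto simp: t_def min_def field_simps)
    have "P + (cs Z + t * a) *\<^sub>R u + (t * y) *\<^sub>R v \<in> convex hull {A, B, C}"
      using t yc by (intro triangle_mem) (auto simp: abs_eq intro: mult_left_mono)
    moreover have "(1 - t) *\<^sub>R Z + t *\<^sub>R W \<in> closed_segment Z W" using t unfolding in_segment by (intro exI[of _ t]) simp
    ultimately have "(1 - t) *\<^sub>R Z + t *\<^sub>R W = Z" using touch point[of t] that(1) by auto
    then have "t *\<^sub>R (W - Z) = 0" by (simp add: algebra_simps)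
    then show False using t W by simp
  qed
  have nz: "r \<noteq> 0 \<or> c \<noteq> 0 \<or> y \<noteq> 0"
  proof (rule ccontr)
    assume "\<not> ?thesis"
    then have "r = 0" "a = 0" "y = 0" using Zc(1) by (auto simp: c_def)
    then have "W = Z" using coords[of W] coords[of Z] Zc by (simp add: a_def y_def r_def)
    then show False using W by simp
  qed
  \<comment> \<open>One threshold for each way of leaving the cone: a large \<kappa> beats a
    component out of the plane, an edge that does not head inwards never enters, and below the base
    or beyond the other side a small \<eta> leaves room.\<close>
  define \<epsilon> where "\<epsilon> = (if r \<noteq> 0 then \<bar>r\<bar> / (\<bar>c\<bar> + 1) else if c \<le> 0 then 1 else if y < 0 then - y / c else (y - c) / c)"
  have \<epsilon>: "\<epsilon> > 0" using escape by (auto simp: \<epsilon>_def not_le add_nonneg_pos divide_neg_pos)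
  have "t = 0" if \<eta>: "0 < \<eta>" "\<eta> < \<epsilon>" and \<kappa>: "\<kappa> > 1 / \<epsilon>" and t: "0 \<le> t" "t \<le> 1"
    and S: "(1 - t) *\<^sub>R Z + t *\<^sub>R W \<in> S\<^sub>0 \<eta> \<kappa>" for \<eta> \<kappa> t
  proof (rule ccontr)
    assume "t \<noteq> 0"
    then have t0: "t > 0" using t by simp
    define T where "T = 1 - \<bar>cs Z + t * a\<bar> - \<kappa> * \<bar>t * r\<bar>"
    have T: "0 \<le> T" "- \<eta> * T \<le> t * y" "t * y \<le> (1 + \<eta>) * T"
      using S unfolding S\<^sub>0_def point by (auto simp: coords_eq T_def)
    have "T \<le> t * c - \<kappa> * \<bar>t * r\<bar>" using abs_ge[of t] by (simp add: T_def)
    then have Tle: "T \<le> t * (c - \<kappa> * \<bar>r\<bar>)" using t by (simp add: abs_mult algebra_simps)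
    show False
    proof (cases "r = 0")
      case False
      then have "1 / \<epsilon> = (\<bar>c\<bar> + 1) / \<bar>r\<bar>" by (simp add: \<epsilon>_def)
      then have "\<kappa> * \<bar>r\<bar> > \<bar>c\<bar> + 1" using \<kappa> False by (simp add: pos_divide_less_eq)
      then have "t * (c - \<kappa> * \<bar>r\<bar>) < 0" using t0 by (simp add: mult_pos_neg)
      then show False using Tle T(1) by simp
    next
      case True
      then have Tc: "T \<le> t * c" using Tle by simp
      show False
      proof (cases "c \<le> 0")
        case True
        then have "t * c \<le> 0" using t0 by (simp add: mult_le_0_iff)
        then have "T = 0" "t * c = 0" using Tc T(1) by linarith+
        then have "t * y = 0" "c = 0" using T t0 by auto
        then show False using nz \<open>r = 0\<close> t0 by auto
      next
        case False
        then have c: "c > 0" by simp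
        have \<eta>Tc: "\<eta> * T \<le> t * (\<eta> * c)" using mult_left_mono[OF Tc, of \<eta>] \<eta> by (simp add: mult_ac)
        show False
        proof (cases "y < 0")
          case True
          then have "\<eta> < - y / c" using \<eta>(2) \<open>r = 0\<close> c by (simp add: \<epsilon>_def)
          then have "\<eta> * c < - y" using c by (simp only: pos_less_divide_eq)
          then have "\<eta> * c + y < 0" by simp
          then have "t * (\<eta> * c + y) < 0" using t0 by (simp add: mult_pos_neg)
          then show False using T(2) \<eta>Tc by (simp add: algebra_simps)
        next
          case False
          then have "\<eta> < (y - c) / c" using \<eta>(2) \<open>r = 0\<close> c by (simp add: \<epsilon>_def)
          then have "\<eta> * c < y - c" using c by (simp only: pos_less_divide_eq)
          then have "\<eta> * c + c - y < 0" by simp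
          then have "t * (\<eta> * c + c - y) < 0" using t0 by (simp add: mult_pos_neg)
          then show False using T(3) \<eta>Tc Tc by (simp add: algebra_simps)
        qed
      qed
    qed
  qed
  note t0 = this
  have "closed_segment Z W \<inter> S\<^sub>0 \<eta> \<kappa> \<subseteq> {Z}" if \<eta>\<kappa>: "0 < \<eta>" "\<eta> < \<epsilon>" "\<kappa> > 1 / \<epsilon>" for \<eta> \<kappa>
  proof
    fix x assume x: "x \<in> closed_segment Z W \<inter> S\<^sub>0 \<eta> \<kappa>"
    then have "x \<in> closed_segment Z W" by simp
    then obtain t where t: "0 \<le> t" "t \<le> 1" "x = (1 - t) *\<^sub>R Z + t *\<^sub>R W" by (auto simp only: in_segment)
    have "(1 - t) *\<^sub>R Z + t *\<^sub>R W \<in> S\<^sub>0 \<eta> \<kappa>" using x unfolding t(3)[symmetric] by simp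
    from t0[OF \<eta>\<kappa> t(1,2) this] have "x = Z" unfolding t(3) by simp
    then show "x \<in> {Z}" by simp
  qed
  then show ?thesis using \<epsilon> by blast
qed

lemma avoid_finite:
  assumes "finite F" and F: "\<And>f. f \<in> F \<Longrightarrow> seg f \<inter> convex hull {A, B, C} = {} \<or>
     (\<exists>Z W. Z \<in> {A, B} \<and> W \<noteq> Z \<and> seg f = closed_segment Z W \<and> seg f \<inter> convex hull {A, B, C} \<subseteq> {Z})"
  shows "\<exists>\<eta>>0. \<exists>\<kappa>>0. \<forall>f\<in>F. seg f \<inter> S\<^sub>0 \<eta> \<kappa> \<subseteq> {A, B}"
proof -
  have "\<exists>\<epsilon>>0. \<forall>\<eta> \<kappa>. 0 < \<eta> \<longrightarrow> \<eta> < \<epsilon> \<longrightarrow> \<kappa> > 1 / \<epsilon> \<longrightarrow> seg f \<inter> S\<^sub>0 \<eta> \<kappa> \<subseteq> {A, B}" if f: "f \<in> F" for f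
    using F[OF f]
  proof (elim disjE exE conjE)
    assume "seg f \<inter> convex hull {A, B, C} = {}"
    from far_segment[OF compact_seg this] show ?thesis by blast
  next
    fix Z W assume "Z \<in> {A, B}" "W \<noteq> Z" and s: "seg f = closed_segment Z W" and "seg f \<inter> convex hull {A, B, C} \<subseteq> {Z}"
    with touching_segment[of Z W] show ?thesis unfolding s by blast
  qed
  then obtain E where E: "\<And>f. f \<in> F \<Longrightarrow> E f > 0"
    "\<And>f \<eta> \<kappa>. f \<in> F \<Longrightarrow> 0 < \<eta> \<Longrightarrow> \<eta> < E f \<Longrightarrow> \<kappa> > 1 / E f \<Longrightarrow> seg f \<inter> S\<^sub>0 \<eta> \<kappa> \<subseteq> {A, B}" by metis
  define \<epsilon> where "\<epsilon> = Min (insert 1 (E ` F))"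
  have \<epsilon>: "\<epsilon> > 0" "\<And>f. f \<in> F \<Longrightarrow> \<epsilon> \<le> E f" unfolding \<epsilon>_def using E(1) assms(1) by (auto intro!: Min_le)
  have "seg f \<inter> S\<^sub>0 (\<epsilon> / 2) (2 / \<epsilon>) \<subseteq> {A, B}" if f: "f \<in> F" for f
  proof (rule E(2)[OF f])
    show "\<epsilon> / 2 < E f" using \<epsilon>(1) \<epsilon>(2)[OF f] by simp
    have "1 / E f \<le> 1 / \<epsilon>" using \<epsilon>(1) \<epsilon>(2)[OF f] by (simp add: frac_le)
    also have "\<dots> < 2 / \<epsilon>" using \<epsilon>(1) by (simp add: divide_strict_right_mono)
    finally show "1 / E f < 2 / \<epsilon>" .
  qed (use \<epsilon> in simp)
  then show ?thesis using \<epsilon>(1) by (intro exI[of _ "\<epsilon> / 2"] exI[of _ "2 / \<epsilon>"] conjI) auto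
qed

end

section \<open>Winding around the edges under the motion of the triangle\<close>

context triangle
begin

lemma S_eq: "S = S\<^sub>0 \<eta> \<kappa>"
  by (simp add: S_def S\<^sub>0_def T_def)

lemma transverse_base: "transverse u v N P p = of_real \<Delta> * Complex (cy p) (cr p)"
  using \<Delta> by (simp add: transverse_def cy_def cr_def complex_eq_iff \<Delta>_def)

lemma transverse_new:
  assumes "\<sigma> \<in> {1, -1}"
  shows "transverse (u - \<sigma> *\<^sub>R v) v N C q = of_real \<Delta> * Complex (cy q - 1 + \<sigma> * cs q) (cr q)"
proof -
  have q: "q - C = cs q *\<^sub>R u + (cy q - 1) *\<^sub>R v + cr q *\<^sub>R N"
  proof -
    have "q - C = (P + cs q *\<^sub>R u + cy q *\<^sub>R v + cr q *\<^sub>R N) - (P + 1 *\<^sub>R v)" using coords[of q] AB(3) by metis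
    then show ?thesis by (simp add: algebra_simps)
  qed
  have "det3 (u - \<sigma> *\<^sub>R v) (q - C) N = \<Delta> * (cy q - 1 + \<sigma> * cs q)"
    unfolding q by (simp add: det3_add det3_diff det3_scaleR \<Delta>_def algebra_simps) (simp add: det3_swap(2)[of v u])
  moreover have "det3 (u - \<sigma> *\<^sub>R v) v (q - C) = \<Delta> * cr q"
    unfolding q by (simp add: det3_add det3_diff det3_scaleR \<Delta>_def algebra_simps)
  ultimately show ?thesis by (simp add: transverse_def complex_eq_iff)
qed

lemma sign_hh:
  assumes "cr p = 0" "\<bar>cs p\<bar> < 1"
  shows "sgn (cy (hh p) - 1 + \<bar>cs p\<bar>) = sgn (cy p)"
proof -
  have "T p = 1 - \<bar>cs p\<bar>" using assms by (simp add: T_def)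
  moreover have "cy (hh p) = cy p + bump \<eta> (cy p + \<eta> * T p) ((1 + \<eta>) * T p - cy p)" by (simp add: hh_def coords_add)
  ultimately have "cy (hh p) - 1 + \<bar>cs p\<bar> = cy p + bump \<eta> (cy p + \<eta> * T p) ((1 + \<eta>) * T p - cy p) - T p" "T p > 0"
    using assms by simp_all
  then show ?thesis using bump_sign[OF \<eta>, of "T p" "cy p"] by (simp only:)
qed

lemma hh_coords [simp]: "cs (hh p) = cs p" "cr (hh p) = cr p"
  by (simp_all add: hh_def coords_add)

lemma new_edge:
  assumes s: "s \<noteq> 0" "\<bar>s\<bar> < 1"
  defines "e \<equiv> if s < 0 then (A, C) else (C, B)"
  shows "snd e - fst e = 1 *\<^sub>R (u - sgn s *\<^sub>R v)" "hh (P + s *\<^sub>R u) - C = s *\<^sub>R (u - sgn s *\<^sub>R v)"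
    "det3 (u - sgn s *\<^sub>R v) v N > 0"
proof -
  have C: "C = P + 1 *\<^sub>R v" by (rule AB(3))
  show "snd e - fst e = 1 *\<^sub>R (u - sgn s *\<^sub>R v)"
  proof (cases "s < 0")
    case True
    have "(P + 1 *\<^sub>R v) - (P + (-1) *\<^sub>R u) = u + v" by simp
    then have "C - A = u + v" using AB(1,3) by metis
    then show ?thesis using True by (simp add: e_def)
  next
    case False
    have "(P + 1 *\<^sub>R u) - (P + 1 *\<^sub>R v) = u - v" by simp
    then have "B - C = u - v" using AB(2,3) by metis
    then show ?thesis using False s by (simp add: e_def)
  qed
  have "hh (P + s *\<^sub>R u) - (P + 1 *\<^sub>R v) = s *\<^sub>R u - \<bar>s\<bar> *\<^sub>R v"
    using s by (simp add: hh_on_edge algebra_simps)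
  then show "hh (P + s *\<^sub>R u) - C = s *\<^sub>R (u - sgn s *\<^sub>R v)"
    using C by (simp add: algebra_simps abs_sgn)
  have "det3 (u - sgn s *\<^sub>R v) v N = \<Delta>" by (simp add: det3_diff det3_scaleR \<Delta>_def)
  then show "det3 (u - sgn s *\<^sub>R v) v N > 0" using \<Delta> by simp
qed

lemma old_edge: "B - A = 2 *\<^sub>R u" by (simp add: u_def)

text \<open>Over either half of the base the motion is a shift along \<open>v\<close>. The
  transverse coordinates of the old and the new edge share the component out of the plane, and in
  the plane the shift preserves the side, so the two projections are homotopic away from the edge
  and polar angles carry over in both directions.\<close>

lemma winds_pullback:
  assumes s: "s \<noteq> 0" "\<bar>s\<bar> < 1"
  shows "winds f (if s < 0 then (A, C) else (C, B)) (hh (P + s *\<^sub>R u)) \<Longrightarrow>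
      winds (\<lambda>x p. f (hh x) (hh p)) (A, B) (P + s *\<^sub>R u)"
    and "winds f (A, B) (P + s *\<^sub>R u) \<Longrightarrow>
      winds (\<lambda>x p. f (hi x) (hi p)) (if s < 0 then (A, C) else (C, B)) (hh (P + s *\<^sub>R u))"
proof -
  let ?x = "P + s *\<^sub>R u" and ?e = "if s < 0 then (A, C) else (C, B)"
  define \<sigma> where "\<sigma> = sgn s"
  have \<sigma>: "\<sigma> \<in> {1, -1}" using s by (auto simp: \<sigma>_def sgn_if)
  note ne = new_edge[OF s]
  \<comment> \<open>The slab over one half of the base, where the broken line is straight.\<close>
  define W where "W = {p. 0 < \<sigma> * cs p \<and> \<sigma> * cs p < 1}"
  have xc: "cs ?x = s" using coords_eq(1)[of s 0 0] by simp
  have c: "continuous_on UNIV cs"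
    using continuous_coords continuous_at_imp_continuous_on by blast
  have W: "open W" unfolding W_def by (intro open_Collect_conj open_Collect_less continuous_intros c)
  have xW: "?x \<in> W" "hh ?x \<in> W" using s by (auto simp: W_def xc \<sigma>_def sgn_if)
  have abs: "\<bar>cs p\<bar> = \<sigma> * cs p" "\<bar>cs p\<bar> < 1" if "p \<in> W" for p using that \<sigma> by (auto simp: W_def)
  let ?old = "transverse u v N P" and ?new = "transverse (u - \<sigma> *\<^sub>R v) v N C"
  have old: "?old p = of_real \<Delta> * Complex (cy p) (cr p)" for p by (rule transverse_base)
  have new: "?new (hh p) = of_real \<Delta> * Complex (cy (hh p) - 1 + \<bar>cs p\<bar>) (cr p)" if "p \<in> W" for p
    using transverse_new[OF \<sigma>, of "hh p"] abs[OF that] by simp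
  have sg: "sgn (cy (hh p) - 1 + \<bar>cs p\<bar>) = sgn (cy p)" if "p \<in> W" "cr p = 0" for p
    using sign_hh[OF that(2) abs(2)[OF that(1)]] .
  have zero: "?old p = 0 \<longleftrightarrow> ?new (hh p) = 0" if "p \<in> W" for p
    using sg[OF that] \<Delta> unfolding old new[OF that] by (auto simp: complex_eq_iff sgn_0_0)
  have ratio: "?old p / ?new (hh p) \<notin> \<real>\<^sub>\<le>\<^sub>0" if p: "p \<in> W" "?new (hh p) \<noteq> 0" for p
    using same_half_ratio[of "cr p" "cy p" "cy (hh p) - 1 + \<bar>cs p\<bar>"] sg[OF p(1)] p \<Delta> unfolding old new[OF p(1)] by simp
  have ratio': "?new (hh p) / ?old p \<notin> \<real>\<^sub>\<le>\<^sub>0" if p: "p \<in> W" "?old p \<noteq> 0" for p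
    using same_half_ratio[of "cr p" "cy (hh p) - 1 + \<bar>cs p\<bar>" "cy p"] sg[OF p(1)] p \<Delta> unfolding old new[OF p(1)] by simp
  have det: "det3 u v N > 0" using \<Delta> by (simp add: \<Delta>_def)
  have BA: "snd (A, B) - fst (A, B) = 2 *\<^sub>R u" using old_edge by simp
  have xP: "?x - P = s *\<^sub>R u" by simp
  have vim: "open (h -` V)" if "\<And>p. isCont h p" "open V" for h :: "space \<Rightarrow> space" and V
    using that by (intro open_vimage continuous_at_imp_continuous_on) auto
  {
    assume "winds f ?e (hh ?x)"
    from windsD[OF this ne(1) _ ne(2,3)]
    obtain V \<theta> where V: "open V" "hh ?x \<in> V" "angle_function f V ?new \<theta>"
      unfolding \<sigma>_def by auto
    have "angle_function (\<lambda>x p. f (hh x) (hh p)) (hh -` V \<inter> W) (\<lambda>p. ?new (hh p)) (\<lambda>p. \<theta> (hh p))"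
      by (rule angle_function_subset[OF angle_function_pullback[OF V(3) isCont_hh]]) simp
    then have "angle_function (\<lambda>x p. f (hh x) (hh p)) (hh -` V \<inter> W) ?old (\<lambda>p. \<theta> (hh p) + Arg (?old p / ?new (hh p)))"
    proof (rule angle_function_homotopic)
      fix p show "isCont (\<lambda>p. ?new (hh p)) p \<and> isCont ?old p"
        using isCont_o2[OF isCont_hh isCont_transverse] isCont_transverse by blast
    qed (use ratio zero in auto)
    from windsI[OF this open_Int[OF vim[OF isCont_hh V(1)] W] _ BA _ xP det]
    show "winds (\<lambda>x p. f (hh x) (hh p)) (A, B) ?x" using V xW by simp
  }
  {
    assume "winds f (A, B) ?x"
    from windsD[OF this BA _ xP det] obtain V \<theta> where V: "open V" "?x \<in> V" "angle_function f V ?old \<theta>" by auto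
    have inW: "hi q \<in> W" if "q \<in> W" for q using that hh_coords(1)[of "hi q"] by (simp add: W_def)
    have "angle_function (\<lambda>x p. f (hi x) (hi p)) (hi -` V \<inter> W) (\<lambda>p. ?old (hi p)) (\<lambda>p. \<theta> (hi p))"
      by (rule angle_function_subset[OF angle_function_pullback[OF V(3) isCont_hi]]) simp
    then have "angle_function (\<lambda>x p. f (hi x) (hi p)) (hi -` V \<inter> W) ?new (\<lambda>p. \<theta> (hi p) + Arg (?new p / ?old (hi p)))"
    proof (rule angle_function_homotopic)
      fix p show "isCont (\<lambda>p. ?old (hi p)) p \<and> isCont ?new p"
        using isCont_o2[OF isCont_hi isCont_transverse] isCont_transverse by blast
    next
      fix p assume p: "p \<in> hi -` V \<inter> W" "?old (hi p) \<noteq> 0"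
      show "?new p / ?old (hi p) \<notin> \<real>\<^sub>\<le>\<^sub>0" using ratio'[OF inW p(2), of] p by auto
    next
      fix p assume p: "p \<in> hi -` V \<inter> W" "?old (hi p) = 0"
      then show "?new p = 0" using zero[OF inW[of p]] by auto
    qed
    from windsI[OF this open_Int[OF vim[OF isCont_hi V(1)] W] _ ne(1)[folded \<sigma>_def] _ ne(2)[folded \<sigma>_def] ne(3)[folded \<sigma>_def]]
    show "winds (\<lambda>x p. f (hi x) (hi p)) ?e (hh ?x)" using V xW by simp
  }
qed

end

text \<open>An isotopy is recorded by its end map alone. The inverse and both directions of the
  winding condition are included, which makes the relation symmetric.\<close>

definition isotopic_by :: "link \<Rightarrow> link \<Rightarrow> (space \<Rightarrow> space) \<Rightarrow> (space \<Rightarrow> space) \<Rightarrow> bool" where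
  "isotopic_by L L' h h' \<longleftrightarrow> (\<forall>x. isCont h x) \<and> (\<forall>x. isCont h' x) \<and> (\<forall>p. h' (h p) = p) \<and> (\<forall>p. h (h' p) = p) \<and>
     h ` carrier_of L = carrier_of L' \<and> (\<exists>b. \<forall>p. norm p > b \<longrightarrow> h p = p) \<and>
     (\<forall>f. winds_link f L' \<longrightarrow> winds_link (\<lambda>x p. f (h x) (h p)) L) \<and>
     (\<forall>f. winds_link f L \<longrightarrow> winds_link (\<lambda>x p. f (h' x) (h' p)) L')"

lemma isotopic_byD:
  assumes "isotopic_by L L' h h'"
  shows "isCont h x" "isCont h' x" "h' (h p) = p" "h (h' p) = p" "h ` carrier_of L = carrier_of L'"
    "\<exists>b. \<forall>p. norm p > b \<longrightarrow> h p = p" "winds_link f L' \<Longrightarrow> winds_link (\<lambda>x p. f (h x) (h p)) L"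
    "winds_link f L \<Longrightarrow> winds_link (\<lambda>x p. f (h' x) (h' p)) L'"
  using assms unfolding isotopic_by_def by (simp_all del: split_paired_All split_paired_Ex)

lemma isotopic_by_refl: "isotopic_by L L id id"
  unfolding isotopic_by_def id_apply by (intro conjI allI) (simp_all add: id_def)

lemma isotopic_by_sym:
  assumes "isotopic_by L L' h h'"
  shows "isotopic_by L' L h' h"
proof -
  obtain b where b: "\<And>p. norm p > b \<Longrightarrow> h p = p" using assms unfolding isotopic_by_def by blast
  have inv: "\<And>p. h' (h p) = p" using assms unfolding isotopic_by_def by blast
  have "h' p = p" if "norm p > b" for p using b[OF that] inv[of p] by simp
  moreover have "h' ` carrier_of L' = carrier_of L"
  proof -
    have "carrier_of L' = h ` carrier_of L" using assms unfolding isotopic_by_def by blast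
    then show ?thesis using inv by (simp add: image_image)
  qed
  ultimately show ?thesis using assms unfolding isotopic_by_def by blast
qed

lemma isotopic_by_trans:
  assumes "isotopic_by L L' h h'" "isotopic_by L' L'' k k'"
  shows "isotopic_by L L'' (\<lambda>p. k (h p)) (\<lambda>p. h' (k' p))"
proof -
  note 1 = isotopic_byD[OF assms(1)] and 2 = isotopic_byD[OF assms(2)]
  obtain b where b: "\<And>p. norm p > b \<Longrightarrow> h p = p" using 1(6) by blast
  obtain c where c: "\<And>p. norm p > c \<Longrightarrow> k p = p" using 2(6) by blast
  show ?thesis
    unfolding isotopic_by_def
  proof (intro conjI allI impI)
    show "isCont (\<lambda>p. k (h p)) x" "isCont (\<lambda>p. h' (k' p)) x" for x
      using isCont_o2[OF 1(1) 2(1)] isCont_o2[OF 2(2) 1(2)] by blast+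
    show "(\<lambda>p. k (h p)) ` carrier_of L = carrier_of L''" unfolding 2(5)[symmetric] 1(5)[symmetric] by (simp add: image_image)
    show "\<exists>b. \<forall>p. norm p > b \<longrightarrow> k (h p) = p"
    proof (intro exI[of _ "max b c"] allI impI)
      fix p :: space assume "max b c < norm p"
      then show "k (h p) = p" using b[of p] c[of p] by simp
    qed
    show "winds_link f L'' \<Longrightarrow> winds_link (\<lambda>x p. f (k (h x)) (k (h p))) L" for f
      using 1(7)[OF 2(7)] .
    show "winds_link f L \<Longrightarrow> winds_link (\<lambda>x p. f (h' (k' x)) (h' (k' p))) L''" for f
      using 2(8)[OF 1(8)] .
  qed (simp_all add: 1(3,4) 2(3,4))
qed

lemma
  assumes "(A, B) \<in> L"
  shows carrier_of_replace: "carrier_of ((L - {(A, B)}) \<union> {(A, C), (C, B)}) = carrier_of (L - {(A, B)}) \<union> (closed_segment A C \<union> closed_segment C B)"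
    and carrier_of_split: "carrier_of L = carrier_of (L - {(A, B)}) \<union> closed_segment A B"
proof -
  have "carrier_of L = carrier_of ((L - {(A, B)}) \<union> {(A, B)})" using assms by (intro arg_cong[of _ _ carrier_of]) blast
  also have "\<dots> = carrier_of (L - {(A, B)}) \<union> closed_segment A B"
    unfolding carrier_of_def UN_Un by (simp add: seg_def)
  finally show "carrier_of L = carrier_of (L - {(A, B)}) \<union> closed_segment A B" .
  show "carrier_of ((L - {(A, B)}) \<union> {(A, C), (C, B)}) = carrier_of (L - {(A, B)}) \<union> (closed_segment A C \<union> closed_segment C B)"
    by (simp add: carrier_of_def seg_def Un_ac)
qed

lemma winds_cong_open:
  assumes "winds f e x" "open V" "x \<in> V" "\<And>p q. p \<in> V \<Longrightarrow> q \<in> V \<Longrightarrow> g p q = f p q"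
  shows "winds g e x"
proof -
  obtain v w V' \<theta> where *: "det3 (snd e - fst e) v w > 0" "open V'" "x \<in> V'"
    "angle_function f V' (transverse (snd e - fst e) v w x) \<theta>" using assms(1) unfolding winds_def by blast
  have "angle_function g (V' \<inter> V) (transverse (snd e - fst e) v w x) \<theta>"
    unfolding angle_function_def
  proof (intro ballI impI conjI)
    let ?\<pi> = "transverse (snd e - fst e) v w x"
    fix p assume p: "p \<in> V' \<inter> V" "?\<pi> p \<noteq> 0"
    then have a: "?\<pi> p = rcis (cmod (?\<pi> p)) (\<theta> p)" "((\<lambda>q. \<theta> q - 2 * pi * of_int (f p q)) \<longlongrightarrow> \<theta> p) (nhds p)"
      using *(4) unfolding angle_function_def by auto
    show "?\<pi> p = rcis (cmod (?\<pi> p)) (\<theta> p)" by (rule a)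
    have "\<forall>\<^sub>F q in nhds p. q \<in> V" using p assms(2) by (intro eventually_nhds_in_open) auto
    then have "\<forall>\<^sub>F q in nhds p. \<theta> q - 2 * pi * of_int (f p q) = \<theta> q - 2 * pi * of_int (g p q)"
      by eventually_elim (use p assms(4) in auto)
    from Lim_transform_eventually[OF a(2) this]
    show "((\<lambda>q. \<theta> q - 2 * pi * of_int (g p q)) \<longlongrightarrow> \<theta> p) (nhds p)" .
  qed
  then show ?thesis unfolding winds_def using * assms(2,3) by (meson IntI open_Int)
qed

lemma winds_parallel:
  assumes "winds f e x" "snd e' - fst e' = k *\<^sub>R (snd e - fst e)" "k > 0"
  shows "winds f e' x"
proof -
  obtain v w V \<theta> where *: "det3 (snd e - fst e) v w > 0" "open V" "x \<in> V"
    "angle_function f V (transverse (snd e - fst e) v w x) \<theta>" using assms(1) unfolding winds_def by blast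
  from windsI[OF *(4,2,3) assms(2,3), of 0] *(1) show ?thesis by simp
qed

lemma normal_vector:
  assumes "\<And>k. b \<noteq> k *\<^sub>R a" "a \<noteq> 0"
  shows "\<exists>N. det3 a b N > 0"
proof -
  \<comment> \<open>The cross product of \<open>a\<close> and \<open>b\<close>, so that
    \<open>det3 a b N\<close> is its squared norm.\<close>
  define N :: space where "N = (Complex (Im (fst a) * snd b - Im (fst b) * snd a) (Re (fst b) * snd a - Re (fst a) * snd b),
    Im (cnj (fst a) * fst b))"
  have eq: "det3 a b N = (Im (fst a) * snd b - Im (fst b) * snd a)\<^sup>2 + (Re (fst b) * snd a - Re (fst a) * snd b)\<^sup>2
    + (Re (fst a) * Im (fst b) - Im (fst a) * Re (fst b))\<^sup>2"
    by (simp add: det3_def N_def power2_eq_square algebra_simps)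
  have "det3 a b N \<noteq> 0"
  proof
    assume "det3 a b N = 0"
    then have z: "Im (fst a) * snd b = Im (fst b) * snd a" "Re (fst b) * snd a = Re (fst a) * snd b"
      "Re (fst a) * Im (fst b) = Im (fst a) * Re (fst b)"
      unfolding eq by (simp_all add: add_nonneg_eq_0_iff)
    consider "snd a \<noteq> 0" | "Re (fst a) \<noteq> 0" | "Im (fst a) \<noteq> 0"
      using assms(2) by (auto simp: prod_eq_iff complex_eq_iff)
    then show False
    proof cases
      case 1
      then have "b = (snd b / snd a) *\<^sub>R a" using z by (auto simp: prod_eq_iff complex_eq_iff field_simps)
      then show ?thesis using assms(1) by blast
    next
      case 2
      then have "b = (Re (fst b) / Re (fst a)) *\<^sub>R a" using z by (auto simp: prod_eq_iff complex_eq_iff field_simps)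
      then show ?thesis using assms(1) by blast
    next
      case 3
      then have "b = (Im (fst b) / Im (fst a)) *\<^sub>R a" using z by (auto simp: prod_eq_iff complex_eq_iff field_simps)
      then show ?thesis using assms(1) by blast
    qed
  qed
  moreover have "det3 a b N \<ge> 0" unfolding eq by simp
  ultimately show ?thesis by (metis less_eq_real_def)
qed

text \<open>If \<open>C\<close> lies on the line of \<open>A\<close> and \<open>B\<close>,
  embeddedness of the new link forces it between them and the identity serves. Otherwise every other
  edge meets the triangle at most in one of its own ends, and the support of the motion can be
  shrunk until the other edges stay fixed.\<close>

lemma delta_move_isotopic:
  assumes "delta_move L L'"
  shows "\<exists>h h'. isotopic_by L L' h h'"
proof -
  obtain A B C where link: "oriented_link L" "oriented_link L'" and edge: "(A, B) \<in> L"
    and hull: "convex hull {A, B, C} \<inter> carrier_of L = closed_segment A B"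
    and L': "L' = (L - {(A, B)}) \<union> {(A, C), (C, B)}"
    using assms unfolding delta_move_def by blast
  have nondeg: "a \<noteq> b" if "(a, b) \<in> E" "oriented_link E" for a b E
    using that unfolding oriented_link_def closed_polygons_def by blast
  have "A \<noteq> B" "A \<noteq> C" "C \<noteq> B"
    using nondeg[of A B L] nondeg[of A C L'] nondeg[of C B L'] edge link L' by blast+
  note ne = this
  have fin: "finite L" using link by (simp add: oriented_link_def closed_polygons_def)
  have disj: "seg e \<inter> seg f \<subseteq> ends e \<inter> ends f" if "e \<in> L" "f \<in> L" "e \<noteq> f" for e f
    using link(1) that unfolding oriented_link_def by blast
  show ?thesis
  proof (cases "\<exists>k. C - A = k *\<^sub>R (B - A)")
    case True
    then obtain k where k: "C - A = k *\<^sub>R (B - A)" by blast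
    have "seg (A, C) \<inter> seg (C, B) \<subseteq> ends (A, C) \<inter> ends (C, B)"
      using link(2) L' ne unfolding oriented_link_def by blast
    then have sub: "closed_segment A C \<inter> closed_segment C B \<subseteq> {C}" using ne by (auto simp: seg_def ends_def)
    have C: "C = A + k *\<^sub>R (B - A)" using k by (simp add: algebra_simps)
    have "k \<noteq> 0" "k \<noteq> 1" using C ne by auto
    have "k > 0"
    proof (rule ccontr)
      assume "\<not> ?thesis"
      then have "k < 0" using \<open>k \<noteq> 0\<close> by simp
      define t where "t = k / (k - 1)"
      have t: "0 \<le> t" "t \<le> 1" "(1 - t) * k + t = 0" using \<open>k < 0\<close> by (auto simp: t_def field_simps)
      have "(1 - t) *\<^sub>R C + t *\<^sub>R B = A + ((1 - t) * k + t) *\<^sub>R (B - A)" unfolding C by (simp add: algebra_simps)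
      then have "A \<in> closed_segment C B" unfolding in_segment using t by (intro exI[of _ t]) simp
      then show False using sub ne by auto
    qed
    have "k < 1"
    proof (rule ccontr)
      assume "\<not> ?thesis"
      then have "k > 1" using \<open>k \<noteq> 1\<close> by simp
      define t where "t = 1 / k"
      have t: "0 \<le> t" "t \<le> 1" "t * k = 1" using \<open>k > 1\<close> by (auto simp: t_def)
      have "(1 - t) *\<^sub>R A + t *\<^sub>R C = A + (t * k) *\<^sub>R (B - A)" unfolding C by (simp add: algebra_simps)
      then have "B \<in> closed_segment A C" unfolding in_segment using t by (intro exI[of _ t]) simp
      then show False using sub ne by auto
    qed
    have CinAB: "C \<in> closed_segment A B"
      unfolding in_segment using \<open>k > 0\<close> \<open>k < 1\<close> by (intro exI[of _ k]) (simp add: C algebra_simps)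
    have seg_eq: "closed_segment A C \<union> closed_segment C B = closed_segment A B"
      using Un_closed_segment[OF CinAB] by simp
    have dir: "C - A = k *\<^sub>R (B - A)" "B - C = (1 - k) *\<^sub>R (B - A)" using C by (simp_all add: algebra_simps)
    have same: "carrier_of L = carrier_of L'" using carrier_of_replace[OF edge, of C] carrier_of_split[OF edge] seg_eq L' by simp
    have "isotopic_by L L' (\<lambda>p. p) (\<lambda>p. p)"
      unfolding isotopic_by_def
    proof (intro conjI allI impI)
      show "winds_link f L'" if w: "winds_link f L" for f
        unfolding winds_link_def
      proof
        fix e assume e: "e \<in> L'"
        obtain Z where Z: "finite Z" "\<forall>x\<in>closed_segment A B - Z. winds f (A, B) x"
          using w edge unfolding winds_link_def seg_def by fastforce
        consider "e \<in> L" | "e = (A, C)" | "e = (C, B)" using e L' by blast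
        then show "\<exists>Z. finite Z \<and> (\<forall>x\<in>seg e - Z. winds f e x)"
        proof cases
          case 1 then show ?thesis using w unfolding winds_link_def by blast
        next
          case 2
          have "winds f e x" if "x \<in> seg e - Z" for x
            by (rule winds_parallel[OF _ _ \<open>k > 0\<close>, of f "(A, B)"]) (use that Z(2) seg_eq 2 dir in \<open>auto simp: seg_def\<close>)
          then show ?thesis using Z(1) by blast
        next
          case 3
          have "winds f e x" if "x \<in> seg e - Z" for x
            by (rule winds_parallel[of f "(A, B)" x e "1 - k"]) (use that Z(2) seg_eq 3 dir \<open>k < 1\<close> in \<open>auto simp: seg_def\<close>)
          then show ?thesis using Z(1) by blast
        qed
      qed
      show "winds_link f L" if w: "winds_link f L'" for f
        unfolding winds_link_def
      proof
        fix e assume e: "e \<in> L"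
        show "\<exists>Z. finite Z \<and> (\<forall>x\<in>seg e - Z. winds f e x)"
        proof (cases "e = (A, B)")
          case False
          then show ?thesis using e w L' unfolding winds_link_def by blast
        next
          case True
          obtain Z1 where Z1: "finite Z1" "\<forall>x\<in>closed_segment A C - Z1. winds f (A, C) x"
            using w L' unfolding winds_link_def seg_def by fastforce
          obtain Z2 where Z2: "finite Z2" "\<forall>x\<in>closed_segment C B - Z2. winds f (C, B) x"
            using w L' unfolding winds_link_def seg_def by fastforce
          have inv: "B - A = (1 / k) *\<^sub>R (C - A)" "B - A = (1 / (1 - k)) *\<^sub>R (B - C)"
            unfolding dir using \<open>k > 0\<close> \<open>k < 1\<close> by simp_all
          have "winds f e x" if x: "x \<in> seg e - (Z1 \<union> Z2)" for x
          proof -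
            have "x \<in> closed_segment A C - Z1 \<or> x \<in> closed_segment C B - Z2" using x seg_eq True by (auto simp: seg_def)
            then show ?thesis
            proof
              assume "x \<in> closed_segment A C - Z1"
              then show ?thesis using Z1(2) True inv(1) \<open>k > 0\<close> by (intro winds_parallel[of f "(A, C)" x e "1 / k"]) auto
            next
              assume "x \<in> closed_segment C B - Z2"
              then show ?thesis using Z2(2) True inv(2) \<open>k < 1\<close> by (intro winds_parallel[of f "(C, B)" x e "1 / (1 - k)"]) auto
            qed
          qed
          then show ?thesis using Z1(1) Z2(1) by blast
        qed
      qed
    qed (simp_all add: same)
    then show ?thesis by blast
  next
    case False
    define a where "a = (1/2) *\<^sub>R (B - A)"
    define b where "b = C - (1/2) *\<^sub>R (A + B)"
    have "a \<noteq> 0" using ne by (simp add: a_def)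
    moreover have "b \<noteq> k *\<^sub>R a" for k
    proof
      assume "b = k *\<^sub>R a"
      then have "C - A = b + a" by (simp add: a_def b_def algebra_simps) (simp add: scaleR_add_left[symmetric] flip: scaleR_add_left)
      also have "\<dots> = ((k + 1) / 2) *\<^sub>R (B - A)" unfolding \<open>b = k *\<^sub>R a\<close> a_def by (simp add: algebra_simps add_divide_distrib)
      finally show False using False by blast
    qed
    ultimately obtain N where N: "det3 a b N > 0" using normal_vector by metis
    have touch: "seg f \<inter> convex hull {A, B, C} = {} \<or>
     (\<exists>Z W. Z \<in> {A, B} \<and> W \<noteq> Z \<and> seg f = closed_segment Z W \<and> seg f \<inter> convex hull {A, B, C} \<subseteq> {Z})"
      if f: "f \<in> L - {(A, B)}" for f
    proof -
      obtain c d where cd: "f = (c, d)" by (cases f)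
      have cdne: "c \<noteq> d" using nondeg[of c d L] f cd link by auto
      have "seg f \<inter> convex hull {A, B, C} \<subseteq> seg f \<inter> seg (A, B)"
        using hull f by (auto simp: carrier_of_def seg_def)
      also have "\<dots> \<subseteq> ends f \<inter> ends (A, B)" using disj[of f "(A, B)"] f edge by auto
      finally have sub: "seg f \<inter> convex hull {A, B, C} \<subseteq> {c, d} \<inter> {A, B}" by (simp add: ends_def cd)
      \<comment> \<open>The reversed edge would cover the old one, and its midpoint would be a
        common point that is no endpoint.\<close>
      have "\<not> (c \<in> {A, B} \<and> d \<in> {A, B})"
      proof
        assume "c \<in> {A, B} \<and> d \<in> {A, B}"
        then have "c = B" "d = A" using cdne f cd by auto
        then have "seg f = closed_segment A B" by (simp add: seg_def cd closed_segment_commute)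
        moreover have "midpoint A B \<in> closed_segment A B" by simp
        ultimately have "midpoint A B \<in> seg f \<inter> seg (A, B)" by (simp only: seg_def fst_conv snd_conv Int_absorb)
        then have "midpoint A B \<in> ends (A, B)" using disj[of f "(A, B)"] f edge by blast
        then show False using ne by (simp add: ends_def midpoint_eq_endpoint)
      qed
      then show ?thesis
      proof (cases "seg f \<inter> convex hull {A, B, C} = {}")
        case False
        then obtain Z where Z: "Z \<in> seg f \<inter> convex hull {A, B, C}" by blast
        then have ZAB: "Z \<in> {A, B}" and Zcd: "Z = c \<or> Z = d" using sub by blast+
        obtain W where W: "W \<noteq> Z" "seg f = closed_segment Z W" "{c, d} = {Z, W}"
          using Zcd
        proof
          assume "Z = c" then show ?thesis using that[of d] cdne by (simp add: seg_def cd)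
        next
          assume "Z = d" then show ?thesis using that[of c] cdne by (simp add: seg_def cd closed_segment_commute insert_commute)
        qed
        have "W \<notin> {A, B}" using \<open>\<not> (c \<in> {A, B} \<and> d \<in> {A, B})\<close> ZAB W(3) by blast
        then have "seg f \<inter> convex hull {A, B, C} \<subseteq> {Z}" using sub W(3) by blast
        then show ?thesis using ZAB W by blast
      qed simp
    qed
    interpret triangle_frame A B C N by unfold_locales (use N in \<open>simp add: a_def b_def\<close>)
    have "\<exists>\<eta>>0. \<exists>\<kappa>>0. \<forall>f\<in>L - {(A, B)}. seg f \<inter> S\<^sub>0 \<eta> \<kappa> \<subseteq> {A, B}"
    proof (rule avoid_finite)
      show "finite (L - {(A, B)})" using fin by (rule finite_Diff)
    qed (rule touch)
    then obtain \<eta> \<kappa> where \<eta>\<kappa>: "\<eta> > 0" "\<kappa> > 0" and avoid: "\<forall>f\<in>L - {(A, B)}. seg f \<inter> S\<^sub>0 \<eta> \<kappa> \<subseteq> {A, B}"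
      by (elim exE conjE)
    interpret triangle A B C N \<eta> \<kappa> by unfold_locales (rule \<eta>\<kappa>)+
    have fixed: "x \<in> S \<Longrightarrow> x \<in> {A, B}" if "f \<in> L - {(A, B)}" "x \<in> seg f" for f x
      using avoid that unfolding S_eq by blast
    have fix_seg: "hh x = x" if "f \<in> L - {(A, B)}" "x \<in> seg f" for f x
      using fixed[OF that] outside_S[of x] hh_ends by blast
    have carrier: "hh ` carrier_of L = carrier_of L'"
    proof -
      have "hh ` carrier_of (L - {(A, B)}) = id ` carrier_of (L - {(A, B)})"
        by (rule image_cong[OF refl]) (use fix_seg in \<open>force simp: carrier_of_def\<close>)
      then show ?thesis using carrier_of_replace[OF edge, of C] carrier_of_split[OF edge] hh_edge L' by (simp add: image_Un)
    qed
    obtain r where r: "\<And>p. norm p > r \<Longrightarrow> p \<notin> S" using bounded_S by blast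
    have away: "open (- S)" using closed_S by (simp add: open_Compl)
    have rest: "winds (\<lambda>x p. f (hh x) (hh p)) e x" "winds (\<lambda>x p. f (hi x) (hi p)) e x"
      if "winds f e x" "e \<in> L - {(A, B)}" "x \<in> seg e - {A, B}" for f e x
    proof -
      have x: "x \<in> - S" using fixed that by blast
      show "winds (\<lambda>x p. f (hh x) (hh p)) e x" "winds (\<lambda>x p. f (hi x) (hi p)) e x"
        by (rule winds_cong_open[OF that(1) away x], simp add: outside_S)+
    qed
    have edge_pts: "\<exists>s. s \<noteq> 0 \<and> \<bar>s\<bar> < 1 \<and> x = P + s *\<^sub>R u" if "x \<in> closed_segment A B - {A, B, P}" for x
    proof -
      have "x \<in> (\<lambda>s. P + s *\<^sub>R u) ` {-1..1}" using that unfolding edge_param by blast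
      then obtain s where s: "s \<in> {-1..1}" "x = P + s *\<^sub>R u" by blast
      moreover have "s \<noteq> 0" "s \<noteq> 1" "s \<noteq> -1" using that s(2) AB by auto
      ultimately show ?thesis by (intro exI[of _ s]) auto
    qed
    have "isotopic_by L L' hh hi"
      unfolding isotopic_by_def
    proof (intro conjI allI impI)
      show "\<exists>b. \<forall>p. norm p > b \<longrightarrow> hh p = p" using r outside_S by blast
      show "winds_link (\<lambda>x p. f (hh x) (hh p)) L" if w: "winds_link f L'" for f
        unfolding winds_link_def
      proof
        fix e assume e: "e \<in> L"
        show "\<exists>Z. finite Z \<and> (\<forall>x\<in>seg e - Z. winds (\<lambda>x p. f (hh x) (hh p)) e x)"
        proof (cases "e = (A, B)")
          case False
          then obtain Z where "finite Z" "\<forall>x\<in>seg e - Z. winds f e x" using e w L' unfolding winds_link_def by blast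
          then show ?thesis using rest(1) e False by (intro exI[of _ "Z \<union> {A, B}"]) auto
        next
          case True
          obtain Z1 where Z1: "finite Z1" "\<forall>x\<in>closed_segment A C - Z1. winds f (A, C) x"
            using w L' unfolding winds_link_def seg_def by fastforce
          obtain Z2 where Z2: "finite Z2" "\<forall>x\<in>closed_segment C B - Z2. winds f (C, B) x"
            using w L' unfolding winds_link_def seg_def by fastforce
          \<comment> \<open>The ends, the midpoint, whose image is the corner \<open>C\<close>, and
            the preimages of the exceptions on the two new edges.\<close>
          define Z where "Z = {A, B, P} \<union> hi ` (Z1 \<union> Z2)"
          have "winds (\<lambda>x p. f (hh x) (hh p)) (A, B) x" if x: "x \<in> closed_segment A B - Z" for x
          proof -
            obtain s where s: "s \<noteq> 0" "\<bar>s\<bar> < 1" "x = P + s *\<^sub>R u" using edge_pts[of x] x by (auto simp: Z_def)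
            have nz: "hh x \<notin> Z1 \<union> Z2"
            proof
              assume "hh x \<in> Z1 \<union> Z2"
              then have "hi (hh x) \<in> Z" unfolding Z_def by blast
              then show False using x by simp
            qed
            have hx: "hh x = P + s *\<^sub>R u + (1 - \<bar>s\<bar>) *\<^sub>R v" unfolding s(3) using s by (intro hh_on_edge) simp
            have "winds f (if s < 0 then (A, C) else (C, B)) (hh x)"
            proof (cases "s < 0")
              case True
              then have "hh x \<in> closed_segment A C" unfolding left_edge_param hx using s by auto
              then show ?thesis using True Z1(2) nz by simp
            next
              case False
              then have "hh x \<in> closed_segment C B" unfolding right_edge_param hx using s by auto
              then show ?thesis using False Z2(2) nz by simp
            qed
            then show ?thesis unfolding s(3) by (rule winds_pullback(1)[OF s(1,2)])
          qed
          then show ?thesis using True Z1(1) Z2(1) by (intro exI[of _ Z]) (auto simp: Z_def seg_def)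
        qed
      qed
      show "winds_link (\<lambda>x p. f (hi x) (hi p)) L'" if w: "winds_link f L" for f
        unfolding winds_link_def
      proof
        fix e assume e: "e \<in> L'"
        obtain Z where Z: "finite Z" "\<forall>x\<in>closed_segment A B - Z. winds f (A, B) x"
          using w edge unfolding winds_link_def seg_def by fastforce
        have new: "winds (\<lambda>x p. f (hi x) (hi p)) (if s < 0 then (A, C) else (C, B)) (P + s *\<^sub>R u + (1 - \<bar>s\<bar>) *\<^sub>R v)"
          if s: "s \<noteq> 0" "\<bar>s\<bar> < 1" and nz: "P + s *\<^sub>R u + (1 - \<bar>s\<bar>) *\<^sub>R v \<notin> hh ` Z" for s
        proof -
          have hx: "hh (P + s *\<^sub>R u) = P + s *\<^sub>R u + (1 - \<bar>s\<bar>) *\<^sub>R v" using s by (intro hh_on_edge) simp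
          have "P + s *\<^sub>R u \<in> closed_segment A B" unfolding edge_param using s by (intro imageI) (simp add: abs_less_iff)
          moreover have "P + s *\<^sub>R u \<notin> Z" using nz hx by force
          ultimately show ?thesis using winds_pullback(2)[OF s, of f] Z(2) hx by auto
        qed
        consider "e \<in> L - {(A, B)}" | "e = (A, C)" | "e = (C, B)" using e L' by blast
        then show "\<exists>Z. finite Z \<and> (\<forall>x\<in>seg e - Z. winds (\<lambda>x p. f (hi x) (hi p)) e x)"
        proof cases
          case 1
          then obtain Z where "finite Z" "\<forall>x\<in>seg e - Z. winds f e x" using w unfolding winds_link_def by blast
          then show ?thesis using rest(2) 1 by (intro exI[of _ "Z \<union> {A, B}"]) auto
        next
          case 2
          have "winds (\<lambda>x p. f (hi x) (hi p)) e x" if x: "x \<in> seg e - ({A, C} \<union> hh ` Z)" for x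
          proof -
            obtain s where s: "s \<in> {-1..0}" "x = P + s *\<^sub>R u + (1 - \<bar>s\<bar>) *\<^sub>R v"
              using x 2 unfolding seg_def by (auto simp: left_edge_param)
            have "s \<noteq> 0" "s \<noteq> -1" using x s(2) AB by auto
            then have "s < 0" "\<bar>s\<bar> < 1" using s by auto
            then show ?thesis using new[of s] x s(2) 2 by auto
          qed
          then show ?thesis using Z(1) by (intro exI[of _ "{A, C} \<union> hh ` Z"]) auto
        next
          case 3
          have "winds (\<lambda>x p. f (hi x) (hi p)) e x" if x: "x \<in> seg e - ({B, C} \<union> hh ` Z)" for x
          proof -
            obtain s where s: "s \<in> {0..1}" "x = P + s *\<^sub>R u + (1 - \<bar>s\<bar>) *\<^sub>R v"
              using x 3 unfolding seg_def by (auto simp: right_edge_param)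
            have "s \<noteq> 0" "s \<noteq> 1" using x s(2) AB by auto
            then have "\<not> s < 0" "s \<noteq> 0" "\<bar>s\<bar> < 1" using s by auto
            then show ?thesis using new[of s] x s(2) 3 by auto
          qed
          then show ?thesis using Z(1) by (intro exI[of _ "{B, C} \<union> hh ` Z"]) auto
        qed
      qed
    qed (simp_all add: isCont_hh isCont_hi carrier)
    then show ?thesis by blast
  qed
qed

theorem same_oriented_link_isotopic:
  assumes "same_oriented_link L L'"
  shows "\<exists>h h'. isotopic_by L L' h h'"
proof -
  have "equivclp delta_move L L'" using assms by (simp add: same_oriented_link_def)
  then show ?thesis
  proof (induction rule: equivclp_induct)
    case base
    then show ?case using isotopic_by_refl by blast
  next
    case (step M M')
    then obtain h h' where "isotopic_by L M h h'" by blast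
    moreover from step(2) obtain k k' where "isotopic_by M M' k k'"
      using delta_move_isotopic isotopic_by_sym by metis
    ultimately show ?case using isotopic_by_trans by blast
  qed
qed

section \<open>The number of regions\<close>

lemma side_point:
  fixes \<sigma> :: real
  assumes "fst e \<noteq> snd e" "lft e p = 0" "r > 0"
  shows "\<exists>z\<in>ball p r. sgn (lft e z) = sgn \<sigma>"
proof -
  define d where "d = snd e - fst e"
  have d: "d \<noteq> 0" using assms(1) by (simp add: d_def)
  define k where "k = r / 2 / cmod d"
  have k: "k > 0" using d assms(3) by (simp add: k_def)
  have "p + (sgn \<sigma> * k) *\<^sub>R (\<i> * d) \<in> ball p r"
  proof -
    have "cmod ((sgn \<sigma> * k) *\<^sub>R (\<i> * d)) \<le> k * cmod d" using k by (simp add: norm_mult abs_mult sgn_if)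
    also have "\<dots> < r" using d assms(3) by (simp add: k_def)
    finally show ?thesis by (simp add: dist_norm)
  qed
  moreover have "lft e (p + (sgn \<sigma> * k) *\<^sub>R (\<i> * d)) = sgn \<sigma> * k * (cmod d)\<^sup>2"
    unfolding lft_add assms(2) d_def[symmetric] by (simp add: cmod_power2) (simp add: power2_eq_square algebra_simps)
  then have "sgn (lft e (p + (sgn \<sigma> * k) *\<^sub>R (\<i> * d))) = sgn \<sigma>" using k d by (simp add: sgn_mult)
  ultimately show ?thesis by blast
qed

text \<open>Euler's formula is obtained by drawing the diagram piece by piece; the smallest piece is
  a straight arc that touches what is already drawn at most in its ends.\<close>

locale arc_attached =
  fixes K :: "complex set" and e :: "complex edge"
  assumes closed: "closed K" and meets: "K \<inter> seg e \<subseteq> ends e" and nondegenerate: "fst e \<noteq> snd e"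
begin

abbreviation cc :: "complex \<Rightarrow> complex \<Rightarrow> bool" where "cc \<equiv> connected_component (- (K \<union> seg e))"

lemma good_radius:
  assumes "p \<in> seg e - ends e"
  shows "\<exists>r>0. ball p r \<inter> K = {} \<and> (\<forall>z\<in>ball p r. z \<in> seg e \<longleftrightarrow> lft e z = 0)"
proof -
  obtain r1 where r1: "r1 > 0" "\<forall>z\<in>ball p r1. z \<in> seg e \<longleftrightarrow> lft e z = 0" using seg_near_interior assms by blast
  have "p \<in> - K" "open (- K)" using assms meets closed by auto
  then obtain r2 where r2: "r2 > 0" "ball p r2 \<subseteq> - K" using open_contains_ball by blast
  show ?thesis using r1 r2 by (intro exI[of _ "min r1 r2"]) auto
qed

text \<open>One can travel along the arc without changing sides. The relation is an equivalence and
  holds locally on the open arc, so connectedness yields \<open>same_sides_interior\<close>.\<close>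

definition same_sides :: "complex \<Rightarrow> complex \<Rightarrow> bool" where
  "same_sides p q \<longleftrightarrow> (\<exists>r>0. \<forall>z\<in>ball p r. \<forall>w\<in>ball q r. lft e z \<noteq> 0 \<longrightarrow> sgn (lft e z) = sgn (lft e w) \<longrightarrow> cc z w)"

lemma segment_cc: "closed_segment z w \<inter> (K \<union> seg e) = {} \<Longrightarrow> cc z w"
  by (rule connected_component_of_subset[of "closed_segment z w"])
    (auto intro!: connected_componentI[of "closed_segment z w"])

lemma same_sides_near:
  assumes "p \<in> seg e - ends e" "r > 0" "ball p r \<inter> K = {}" "q \<in> ball p r"
  shows "same_sides p q"
proof -
  define r' where "r' = r - dist p q"
  have r': "r' > 0" "r' \<le> r" using assms(4) by (auto simp: r'_def)
  have sub: "ball q r' \<subseteq> ball p r"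
  proof
    fix w assume "w \<in> ball q r'"
    then show "w \<in> ball p r" using dist_triangle[of p w q] by (simp add: r'_def)
  qed
  have "cc z w" if "z \<in> ball p r'" "w \<in> ball q r'" "lft e z \<noteq> 0" "sgn (lft e z) = sgn (lft e w)" for z w
  proof (rule segment_cc)
    have "z \<in> ball p r" "w \<in> ball p r" using that sub r' by auto
    then have "closed_segment z w \<subseteq> ball p r" by (simp add: closed_segment_subset)
    then show "closed_segment z w \<inter> (K \<union> seg e) = {}"
      using assms(3) same_side_segment[OF that(4,3)] by blast
  qed
  then show ?thesis unfolding same_sides_def using r'(1) by blast
qed

lemma same_sides_interior:
  assumes "p \<in> seg e - ends e" "q \<in> seg e - ends e"
  shows "same_sides p q"
proof (rule connected_equivalence_relation[of "seg e - ends e", OF _ assms])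
  have "seg e - ends e = open_segment (fst e) (snd e)" by (simp add: seg_def ends_def open_segment_def)
  then show "connected (seg e - ends e)" by (simp add: convex_connected convex_open_segment)
  show "same_sides y x" if xy: "same_sides x y" for x y
  proof -
    obtain r where r: "r > 0" "\<forall>z\<in>ball x r. \<forall>w\<in>ball y r. lft e z \<noteq> 0 \<longrightarrow> sgn (lft e z) = sgn (lft e w) \<longrightarrow> cc z w"
      using xy unfolding same_sides_def by blast
    have "cc z w" if "z \<in> ball y r" "w \<in> ball x r" "lft e z \<noteq> 0" "sgn (lft e z) = sgn (lft e w)" for z w
    proof -
      have "lft e w \<noteq> 0" using that(3,4) by (metis sgn_0_0)
      then have "cc w z" using r(2) that by metis
      then show ?thesis by (rule connected_component_sym)
    qed
    then show ?thesis unfolding same_sides_def using r(1) by blast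
  qed
  show "same_sides x z" if xyz: "same_sides x y" "same_sides y z" "y \<in> seg e - ends e" for x y z
  proof -
    obtain r where r: "r > 0" "\<forall>z\<in>ball x r. \<forall>w\<in>ball y r. lft e z \<noteq> 0 \<longrightarrow> sgn (lft e z) = sgn (lft e w) \<longrightarrow> cc z w"
      using xyz(1) unfolding same_sides_def by blast
    obtain s where s: "s > 0" "\<forall>u\<in>ball y s. \<forall>w\<in>ball z s. lft e u \<noteq> 0 \<longrightarrow> sgn (lft e u) = sgn (lft e w) \<longrightarrow> cc u w"
      using xyz(2) unfolding same_sides_def by blast
    define t where "t = min r s"
    have "cc u w" if u: "u \<in> ball x t" "w \<in> ball z t" "lft e u \<noteq> 0" "sgn (lft e u) = sgn (lft e w)" for u w
    proof -
      obtain v where v: "v \<in> ball y t" "sgn (lft e v) = sgn (lft e u)"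
        using side_point[OF nondegenerate lft_seg, of y t "lft e u"] xyz(3) r(1) s(1) by (auto simp: t_def)
      have "lft e v \<noteq> 0" using v(2) u(3) by (metis sgn_0_0)
      then have "cc v w" using s(2) v u by (simp add: t_def)
      moreover have "cc u v" using r(2) v u by (simp add: t_def)
      ultimately show ?thesis by (rule connected_component_trans[rotated])
    qed
    then show ?thesis unfolding same_sides_def using r(1) s(1) by (intro exI[of _ t]) (auto simp: t_def)
  qed
  show "\<exists>T. openin (top_of_set (seg e - ends e)) T \<and> a \<in> T \<and> (\<forall>x\<in>T. same_sides a x)" if a: "a \<in> seg e - ends e" for a
  proof -
    obtain r where r: "r > 0" "ball a r \<inter> K = {}" using good_radius[OF a] by blast
    show ?thesis
      by (rule exI[of _ "(seg e - ends e) \<inter> ball a r"])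
        (use a r same_sides_near[OF a r] in \<open>auto simp: openin_open_Int\<close>)
  qed
qed

definition left_point :: "complex \<Rightarrow> bool" where
  "left_point z \<longleftrightarrow> (\<exists>p\<in>seg e - ends e. \<exists>r>0. ball p r \<inter> K = {} \<and> z \<in> ball p r \<and> lft e z > 0)"

definition right_point :: "complex \<Rightarrow> bool" where
  "right_point z \<longleftrightarrow> (\<exists>p\<in>seg e - ends e. \<exists>r>0. ball p r \<inter> K = {} \<and> z \<in> ball p r \<and> lft e z < 0)"

lemma near_connected:
  assumes p: "p \<in> seg e - ends e" "ball p r \<inter> K = {}" "z \<in> ball p r"
    and q: "q \<in> seg e - ends e" "ball q s \<inter> K = {}" "w \<in> ball q s"
    and sgn: "lft e z \<noteq> 0" "sgn (lft e z) = sgn (lft e w)"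
  shows "cc z w"
proof -
  obtain t where t: "t > 0" "\<forall>z\<in>ball p t. \<forall>w\<in>ball q t. lft e z \<noteq> 0 \<longrightarrow> sgn (lft e z) = sgn (lft e w) \<longrightarrow> cc z w"
    using same_sides_interior[OF p(1) q(1)] unfolding same_sides_def by blast
  have rs: "r > 0" "s > 0" using p(3) q(3) by (auto intro: le_less_trans[OF zero_le_dist])
  have 1: "\<exists>z'\<in>ball p t. cc z z' \<and> sgn (lft e z') = sgn (lft e z)"
    if p: "p \<in> seg e - ends e" "ball p r \<inter> K = {}" "z \<in> ball p r" "lft e z \<noteq> 0" "r > 0" for p z r
  proof -
    obtain z' where z': "z' \<in> ball p (min r t)" "sgn (lft e z') = sgn (lft e z)"
      using side_point[OF nondegenerate lft_seg, of p "min r t" "lft e z"] p t(1) by auto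
    have "closed_segment z z' \<subseteq> ball p r" using p z' by (simp add: closed_segment_subset)
    then have "cc z z'" using segment_cc[of z z'] p(2) same_side_segment[of e z z'] z'(2) p(4) by auto
    then show ?thesis using z' by auto
  qed
  obtain z' where z': "z' \<in> ball p t" "cc z z'" "sgn (lft e z') = sgn (lft e z)" using 1[OF p sgn(1) rs(1)] by blast
  have w0: "lft e w \<noteq> 0" using sgn by (metis sgn_0_0)
  obtain w' where w': "w' \<in> ball q t" "cc w w'" "sgn (lft e w') = sgn (lft e w)" using 1[OF q w0 rs(2)] by blast
  have "lft e z' \<noteq> 0" using z'(3) sgn(1) by (metis sgn_0_0)
  then have "cc z' w'" using t(2) z' w' sgn by simp
  then show ?thesis using z'(2) w'(2) connected_component_trans connected_component_sym by metis
qed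

lemma left_points_connected: "left_point z \<Longrightarrow> left_point w \<Longrightarrow> cc z w"
  and right_points_connected: "right_point z \<Longrightarrow> right_point w \<Longrightarrow> cc z w"
  unfolding left_point_def right_point_def using near_connected by auto

lemma points_exist: "\<exists>z w. left_point z \<and> right_point w"
proof -
  have "midpoint (fst e) (snd e) \<in> seg e - ends e"
    using nondegenerate by (auto simp: seg_def ends_def midpoint_eq_endpoint)
  then obtain p r where p: "p \<in> seg e - ends e" "r > 0" "ball p r \<inter> K = {}" using good_radius by blast
  obtain z where z: "z \<in> ball p r" "sgn (lft e z) = sgn 1" using side_point[OF nondegenerate lft_seg, of p r 1] p by auto
  obtain w where w: "w \<in> ball p r" "sgn (lft e w) = sgn (-1)" using side_point[OF nondegenerate lft_seg, of p r "-1"] p by auto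
  have "lft e z > 0" "lft e w < 0" using z(2) w(2) by (simp_all add: sgn_if split: if_splits)
  then show ?thesis using p z w unfolding left_point_def right_point_def by blast
qed

text \<open>Only the component \<open>U\<close> containing the open segment changes: every component of \<open>U - seg e\<close>
  accumulates somewhere on that segment, hence contains one of its two sides.\<close>

lemma card_components:
  assumes fin: "finite (components (- K))" and z: "left_point z" and w: "right_point w"
  shows "finite (components (- (K \<union> seg e)))"
    "card (components (- (K \<union> seg e))) = card (components (- K)) + (if cc z w then 0 else 1)"
proof -
  define S where "S = seg e - K"
  define Q where "Q = - (K \<union> seg e)"
  define CL CR where "CL = connected_component_set Q z" and "CR = connected_component_set Q w"
  have M: "seg e - ends e = open_segment (fst e) (snd e)" by (simp add: seg_def ends_def open_segment_def)
  have "connected S"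
  proof (rule connected_intermediate_closure[of "open_segment (fst e) (snd e)"])
    show "open_segment (fst e) (snd e) \<subseteq> S" using meets unfolding M[symmetric] S_def by blast
    show "S \<subseteq> closure (open_segment (fst e) (snd e))" using nondegenerate by (auto simp: S_def seg_def)
  qed (simp add: convex_connected convex_open_segment)
  moreover have MS: "seg e - ends e \<subseteq> S" using meets by (auto simp: S_def)
  moreover have "seg e - ends e \<noteq> {}" using nondegenerate unfolding M by (simp add: open_segment_eq_empty)
  ultimately obtain U where U: "U \<in> components (- K)" "S \<subseteq> U"
    using exists_component_superset[of S "- K"] by (auto simp: S_def)
  have Q_eq: "Q = - K - S" by (auto simp: Q_def S_def)
  have open_Q: "open Q" unfolding Q_def using closed by (intro open_Compl closed_Un) simp_all
  have UK: "U \<subseteq> - K" "connected U" using U(1) in_components_subset in_components_connected by blast+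
  have ball_U: "ball p r \<subseteq> U" if "p \<in> seg e - ends e" "r > 0" "ball p r \<inter> K = {}" for p r
  proof (rule components_maximal[OF U(1)])
    have "p \<in> U \<inter> ball p r" using that MS U(2) by auto
    then show "U \<inter> ball p r \<noteq> {}" by blast
  qed (use that in auto)
  have zU: "z \<in> U" "w \<in> U" using z w ball_U unfolding left_point_def right_point_def by blast+
  have "z \<notin> seg e" "w \<notin> seg e" using z w lft_seg[of _ e] unfolding left_point_def right_point_def by force+
  then have zQ: "z \<in> Q" "w \<in> Q" using zU UK by (auto simp: Q_def)
  have comp_LR: "CL \<in> components Q" "CR \<in> components Q" using zQ unfolding CL_def CR_def by (auto simp: components_def)
  have other: "V \<in> components Q" if V: "V \<in> components (- K)" "V \<noteq> U" for V
  proof -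
    have "V \<inter> U = {}" using components_nonoverlap[OF V(1) U(1)] V(2) by simp
    then have "V \<subseteq> Q" using in_components_subset[OF V(1)] U(2) by (auto simp: Q_eq)
    then show ?thesis
      using V(1) unfolding in_components_maximal by (metis Diff_subset Q_eq subset_trans)
  qed
  have sub: "C \<in> (components (- K) - {U}) \<union> {CL, CR}" if C: "C \<in> components Q" for C
  proof -
    have CQ: "C \<subseteq> Q" "connected C" "C \<noteq> {}" using C in_components_subset in_components_connected in_components_nonempty by blast+
    then obtain V where V: "V \<in> components (- K)" "C \<subseteq> V"
      using exists_component_superset[of C "- K"] by (auto simp: Q_eq)
    show ?thesis
    proof (cases "V = U")
      case False
      then have "V \<in> components Q" using other V by blast
      then have "C = V" using components_nonoverlap[OF C] V(2) CQ(3) by blast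
      then show ?thesis using V(1) False by blast
    next
      case True
      have "U \<inter> frontier C \<noteq> {}"
      proof (rule connected_Int_frontier[OF UK(2)])
        show "U \<inter> C \<noteq> {}" using V(2) CQ(3) True by blast
        show "U - C \<noteq> {}" using MS U(2) \<open>seg e - ends e \<noteq> {}\<close> CQ(1) by (auto simp: Q_eq)
      qed
      then obtain p where p: "p \<in> U" "p \<in> frontier C" by blast
      have "p \<notin> Q"
      proof
        assume pQ: "p \<in> Q"
        then obtain r where r: "r > 0" "ball p r \<subseteq> Q" using open_Q open_contains_ball by blast
        have "p \<in> closure C" using p(2) by (simp add: frontier_def)
        then obtain q where q: "q \<in> C" "dist q p < r" using r(1) closure_approachable by blast
        then have "ball p r \<inter> C \<noteq> {}" by (auto simp: dist_commute)
        then have "ball p r \<subseteq> C" using components_maximal[OF C _ r(2)] by auto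
        then have "p \<in> interior C" using r(1) by (meson centre_in_ball interior_maximal open_ball subset_iff)
        then show False using p(2) by (simp add: frontier_def)
      qed
      then have pS: "p \<in> S" using p(1) UK(1) by (auto simp: Q_eq)
      then have "p \<in> - K" "open (- K)" using closed by (auto simp: S_def)
      then obtain r where r: "r > 0" "ball p r \<inter> K = {}" using open_contains_ball by (metis disjoint_eq_subset_Compl)
      have "p \<in> closure C" using p(2) by (simp add: frontier_def)
      then obtain q0 where q0: "q0 \<in> C" "dist q0 p < r" using r(1) closure_approachable by blast
      have "open C" using C open_Q open_components by blast
      then obtain \<rho> where \<rho>: "\<rho> > 0" "ball q0 \<rho> \<subseteq> C \<inter> ball p r"
        using q0 by (metis Int_iff dist_commute mem_ball open_Int open_ball open_contains_ball)
      obtain q where q: "q \<in> C \<inter> ball p r" "lft e q \<noteq> 0"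
      proof (cases "lft e q0 = 0")
        case True
        obtain q where "q \<in> ball q0 \<rho>" "sgn (lft e q) = sgn 1" using side_point[OF nondegenerate True \<rho>(1)] by blast
        moreover from this have "q \<in> C \<inter> ball p r" using \<rho>(2) by blast
        moreover have "lft e q \<noteq> 0" using calculation(2) by auto
        ultimately show ?thesis using that[of q] by blast
      next
        case False
        have "q0 \<in> C \<inter> ball p r" using q0 by (simp add: dist_commute)
        then show ?thesis using that False by blast
      qed
      have "p \<in> closure (seg e - ends e)" using pS nondegenerate unfolding M by (simp add: S_def seg_def)
      then obtain p' where p': "p' \<in> seg e - ends e" "dist p' p < r" using r(1) closure_approachable by blast
      define s where "s = r - dist p p'"
      have s: "s > 0" "ball p' s \<subseteq> ball p r"
      proof -
        show "s > 0" using p'(2) by (simp add: s_def dist_commute)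
        show "ball p' s \<subseteq> ball p r"
        proof
          fix w assume "w \<in> ball p' s"
          then show "w \<in> ball p r" using dist_triangle[of p w p'] by (simp add: s_def)
        qed
      qed
      obtain q' where q': "q' \<in> ball p' s" "sgn (lft e q') = sgn (lft e q)"
        using side_point[OF nondegenerate lft_seg s(1), of p' "lft e q"] p' by auto
      have "closed_segment q q' \<subseteq> ball p r" using q q' s by (intro closed_segment_subset) auto
      then have "cc q q'" using r(2) same_side_segment[of e q q'] q'(2) q(2) by (intro segment_cc) auto
      have "left_point q' \<or> right_point q'"
        using q' q(2) p'(1) s r(2) unfolding left_point_def right_point_def
        by (metis disjoint_iff linorder_neqE_linordered_idom sgn_0_0 subset_iff)
      then have "cc q' z \<or> cc q' w"
        using left_points_connected[OF _ z] right_points_connected[OF _ w] by blast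
      then have "cc q z \<or> cc q w" using \<open>cc q q'\<close> connected_component_trans by metis
      moreover have "C = connected_component_set Q q"
        using C q(1) by (metis IntD1 components_iff connected_component_eq)
      ultimately have "C = CL \<or> C = CR"
        unfolding CL_def CR_def Q_def[symmetric] by (metis connected_component_eq mem_Collect_eq)
      then show ?thesis by blast
    qed
  qed
  have eq: "components Q = (components (- K) - {U}) \<union> {CL, CR}" using other sub comp_LR by blast
  have new: "CL \<notin> components (- K)" "CR \<notin> components (- K)"
  proof -
    have "z \<in> CL" "w \<in> CR" using zQ by (auto simp: CL_def CR_def)
    moreover have "CL \<noteq> U" "CR \<noteq> U"
      using comp_LR in_components_subset MS U(2) \<open>seg e - ends e \<noteq> {}\<close> unfolding Q_eq by blast+
    ultimately show "CL \<notin> components (- K)" "CR \<notin> components (- K)"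
      using components_nonoverlap[OF _ U(1)] zU by blast+
  qed
  have "CL = CR \<longleftrightarrow> cc z w" unfolding CL_def CR_def Q_def[symmetric] using zQ by (simp add: connected_component_eq_eq)
  moreover have "finite (components (- K) - {U})" "card (components (- K) - {U}) + 1 = card (components (- K))"
    using fin card_Suc_Diff1[OF fin U(1)] by simp_all
  ultimately show "finite (components (- (K \<union> seg e)))"
    "card (components (- (K \<union> seg e))) = card (components (- K)) + (if cc z w then 0 else 1)"
    using new unfolding Q_def[symmetric] eq by auto
qed

text \<open>On the prolongation of the arc just beyond its free end lies a point \<open>c\<close> of
  the complement that can be reached straight from both sides.\<close>

lemma free_end_cc:
  assumes "snd e \<notin> K" and z: "left_point z" and w: "right_point w"
  shows "cc z w"
proof -
  obtain a b where ab: "e = (a, b)" by (cases e)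
  have ne: "a \<noteq> b" and b: "b \<in> - K" using nondegenerate assms(1) by (simp_all add: ab)
  obtain r where r: "r > 0" "ball b r \<inter> K = {}"
    using b closed open_contains_ball[of "- K"] by (metis disjoint_eq_subset_Compl open_Compl)
  define k where "k = r / 2 / cmod (b - a)"
  have k: "k > 0" using ne r(1) by (simp add: k_def)
  define c where "c = b + k *\<^sub>R (b - a)"
  have cb: "c \<in> ball b r" using ne r(1) by (simp add: c_def dist_norm k_def)
  have c0: "lft e c = 0" by (simp add: c_def lft_def ab algebra_simps)
  have c_seg: "c \<notin> seg e"
  proof
    assume "c \<in> seg e"
    then obtain t where t: "t \<le> 1" "c = (1 - t) *\<^sub>R a + t *\<^sub>R b" by (auto simp: seg_def ab in_segment)
    then have "(1 + k - t) *\<^sub>R (b - a) = 0" unfolding c_def by (simp add: algebra_simps)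
    then show False using ne t(1) k by simp
  qed
  have "b \<in> closure (seg e - ends e)"
    using ne by (simp add: seg_def ends_def ab flip: open_segment_def)
  then obtain p where p: "p \<in> seg e - ends e" "dist p b < r" using r(1) closure_approachable by blast
  define s where "s = r - dist b p"
  have s: "s > 0" "ball p s \<subseteq> ball b r"
  proof -
    show "s > 0" using p(2) by (simp add: s_def dist_commute)
    show "ball p s \<subseteq> ball b r"
    proof
      fix w assume "w \<in> ball p s"
      then show "w \<in> ball b r" using dist_triangle[of b w p] by (simp add: s_def)
    qed
  qed
  have to_c: "cc q c" if q: "q \<in> ball p s" "lft e q \<noteq> 0" for q
  proof (rule segment_cc)
    have "x \<notin> seg e" if x: "x \<in> closed_segment q c" for x
    proof -
      obtain u where u: "x = (1 - u) *\<^sub>R q + u *\<^sub>R c" using x by (auto simp: in_segment)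
      have "lft e x = (1 - u) * lft e q + u * lft e c" unfolding u by (simp add: lft_def algebra_simps)
      then have "lft e x = (1 - u) * lft e q" using c0 by simp
      then have "lft e x = 0 \<Longrightarrow> x = c" using u q(2) by auto
      then show ?thesis using lft_seg[of x e] c_seg by blast
    qed
    moreover have "closed_segment q c \<subseteq> ball b r" using q(1) s cb by (intro closed_segment_subset) auto
    ultimately show "closed_segment q c \<inter> (K \<union> seg e) = {}" using r(2) by blast
  qed
  have pK: "ball p s \<inter> K = {}" using s r(2) by blast
  obtain z' where z': "z' \<in> ball p s" "sgn (lft e z') = sgn 1"
    using side_point[OF nondegenerate lft_seg s(1), of p 1] p by auto
  obtain w' where w': "w' \<in> ball p s" "sgn (lft e w') = sgn (-1)"
    using side_point[OF nondegenerate lft_seg s(1), of p "-1"] p by auto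
  have sg: "lft e z' > 0" "lft e w' < 0" using z'(2) w'(2) by (simp_all add: sgn_if split: if_splits)
  then have "left_point z'" "right_point w'" using z' w' p pK s(1) unfolding left_point_def right_point_def by blast+
  then have "cc z z'" "cc w' w" using left_points_connected[OF z] right_points_connected[OF _ w] by blast+
  moreover have "cc z' c" "cc w' c" using to_c z' w' sg by auto
  ultimately show ?thesis using connected_component_trans connected_component_sym by metis
qed

text \<open>An arc in \<open>K\<close> between the ends completes \<open>e\<close> to a Jordan
  curve. Its inside and its outside both accumulate at a point of the open segment, where all points
  off the curve are left or right points.\<close>

lemma closed_loop_cc:
  assumes "path_connected K" "ends e \<subseteq> K" and z: "left_point z" and w: "right_point w"
  shows "\<not> cc z w"
proof
  assume zw: "cc z w"
  have "fst e \<in> K" "snd e \<in> K" using assms(2) by (auto simp: ends_def)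
  then obtain g where g: "arc g" "path_image g \<subseteq> K" "pathstart g = snd e" "pathfinish g = fst e"
    using assms(1) nondegenerate unfolding path_connected_arcwise by metis
  define J where "J = path_image (g +++ linepath (fst e) (snd e))"
  have J: "J = path_image g \<union> seg e" using g by (simp add: J_def path_image_join seg_def)
  have "simple_path (g +++ linepath (fst e) (snd e))"
  proof (rule simple_path_join_loop)
    show "path_image g \<inter> path_image (linepath (fst e) (snd e)) \<subseteq> {pathstart g, pathstart (linepath (fst e) (snd e))}"
      using g meets by (auto simp: seg_def ends_def)
  qed (use g nondegenerate in \<open>auto intro: arc_linepath\<close>)
  moreover have "pathfinish (g +++ linepath (fst e) (snd e)) = pathstart (g +++ linepath (fst e) (snd e))" using g by simp
  ultimately have Jordan: "frontier (inside J) = J" "frontier (outside J) = J" "inside J \<inter> outside J = {}"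
    using Jordan_inside_outside unfolding J_def by blast+
  have "midpoint (fst e) (snd e) \<in> seg e - ends e"
    using nondegenerate by (auto simp: seg_def ends_def midpoint_eq_endpoint)
  then obtain p where p: "p \<in> seg e - ends e" by blast
  obtain r where r: "r > 0" "ball p r \<inter> K = {}" "\<forall>z\<in>ball p r. z \<in> seg e \<longleftrightarrow> lft e z = 0"
    using good_radius[OF p] by blast
  have side: "left_point u \<or> right_point u" if u: "u \<in> ball p r" "u \<notin> J" for u
  proof -
    have "lft e u \<noteq> 0" using u r(3) J by blast
    then show ?thesis using p r u(1) unfolding left_point_def right_point_def by (metis linorder_neqE_linordered_idom)
  qed
  have any: "cc u v" if "left_point u \<or> right_point u" "left_point v \<or> right_point v" for u v
  proof -
    have "cc x z" if "left_point x \<or> right_point x" for x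
      using that left_points_connected[OF _ z] right_points_connected[OF _ w] zw
        connected_component_trans connected_component_sym by metis
    then show ?thesis using that connected_component_trans connected_component_sym by metis
  qed
  have near: "\<exists>u. u \<in> ball p r \<and> u \<in> I" if "frontier I = J" for I
  proof -
    have "p \<in> closure I" using p J that by (auto simp: frontier_def)
    then show ?thesis using r(1) closure_approachable[of p I] by (auto simp: dist_commute)
  qed
  obtain u v where u: "u \<in> ball p r" "u \<in> inside J" and v: "v \<in> ball p r" "v \<in> outside J"
    using near[OF Jordan(1)] near[OF Jordan(2)] by blast
  have "u \<notin> J" "v \<notin> J" using u v inside_no_overlap[of J] outside_no_overlap[of J] by blast+
  then have "cc u v" using any side u(1) v(1) by blast
  then have "connected_component (- J) u v" by (rule connected_component_of_subset) (use J g(2) in blast)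
  then have "v \<in> inside J" using inside_same_component[of J u v] u(2) by blast
  then show False using v(2) Jordan(3) by blast
qed

end

lemma seg_reverse: "seg (b, a) = seg (a, b)"
  by (simp add: seg_def closed_segment_commute)

text \<open>With one contact nothing gets separated; with two contacts one component is cut in two.
  Both cases are one formula in the number of contacts.\<close>

lemma add_arc:
  fixes K :: "complex set"
  assumes K: "closed K" "path_connected K" and e: "K \<inter> seg (a, b) \<subseteq> {a, b}" "a \<noteq> b" "K \<inter> seg (a, b) \<noteq> {}"
    and fin: "finite (components (- K))"
  shows "finite (components (- (K \<union> seg (a, b)))) \<and>
    card (components (- (K \<union> seg (a, b)))) + 1 = card (components (- K)) + card (K \<inter> seg (a, b))"
proof -
  have main: "finite (components (- (K \<union> seg (a, b)))) \<and>
    card (components (- (K \<union> seg (a, b)))) + 1 = card (components (- K)) + card (K \<inter> seg (a, b))"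
    if meet: "K \<inter> seg (a, b) = {a, b} \<or> K \<inter> seg (a, b) = {a}" and ne: "a \<noteq> b" for a b
  proof -
    interpret arc_attached K "(a, b)" by unfold_locales (use K(1) meet ne in \<open>auto simp: ends_def\<close>)
    obtain z w where zw: "left_point z" "right_point w" using points_exist by blast
    have in_seg: "a \<in> seg (a, b)" "b \<in> seg (a, b)" by (simp_all add: seg_def)
    have "cc z w \<longleftrightarrow> b \<notin> K"
      using closed_loop_cc[OF K(2) _ zw] free_end_cc[OF _ zw] meet by (auto simp: ends_def)
    moreover have "card (K \<inter> seg (a, b)) = (if b \<in> K then 2 else 1)"
      using meet
    proof
      assume m: "K \<inter> seg (a, b) = {a, b}"
      then have "b \<in> K" by blast
      then show ?thesis unfolding m using ne by simp
    next
      assume m: "K \<inter> seg (a, b) = {a}"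
      then have "b \<notin> K" using ne in_seg by (metis Int_iff singletonD)
      then show ?thesis unfolding m by simp
    qed
    ultimately show ?thesis using card_components[OF fin zw] by simp
  qed
  consider "K \<inter> seg (a, b) = {a, b} \<or> K \<inter> seg (a, b) = {a}" | "K \<inter> seg (a, b) = {b}" using e(1,3) by blast
  then show ?thesis
  proof cases
    case 2
    then show ?thesis using main[of b a] e(2) unfolding seg_reverse[of a b] by simp
  qed (rule main[OF _ e(2)])
qed

text \<open>Induction on the contacts inside the segment: it is cut at one of them and the halves
  are added one after the other. The point of the cut counts as a contact of both halves, which
  balances the second \<open>+ 1\<close>.\<close>

lemma add_segment:
  fixes K :: "complex set"
  assumes "closed K" "path_connected K" "finite (K \<inter> seg (a, b))" "a \<noteq> b" "K \<inter> seg (a, b) \<noteq> {}"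
    and "finite (components (- K))"
  shows "finite (components (- (K \<union> seg (a, b)))) \<and>
    card (components (- (K \<union> seg (a, b)))) + 1 = card (components (- K)) + card (K \<inter> seg (a, b))"
  using assms
proof (induction "card (K \<inter> seg (a, b) - {a, b})" arbitrary: K a b rule: less_induct)
  case less
  show ?case
  proof (cases "K \<inter> seg (a, b) \<subseteq> {a, b}")
    case True
    then show ?thesis using add_arc less.prems by blast
  next
    case False
    then obtain c where c: "c \<in> K" "c \<in> seg (a, b)" "c \<noteq> a" "c \<noteq> b" by blast
    have un: "seg (a, b) = seg (a, c) \<union> seg (c, b)" using c(2) Un_closed_segment[of c a b] by (simp add: seg_def)
    have int: "seg (a, c) \<inter> seg (c, b) = {c}" using c(2) Int_closed_segment[of c a b] by (simp add: seg_def)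
    have ends: "a \<in> seg (a, c)" "b \<in> seg (c, b)" "c \<in> seg (a, c)" "c \<in> seg (c, b)" by (simp_all add: seg_def)
    have fin: "finite (K \<inter> seg (a, c))" "finite (K \<inter> seg (c, b))" using less.prems(3) by (auto simp: un Int_Un_distrib)
    have out: "a \<notin> seg (c, b)" "b \<notin> seg (a, c)" using int ends c(3,4) by (metis Int_iff singletonD)+
    have "card (K \<inter> seg (a, c) - {a, c}) < card (K \<inter> seg (a, b) - {a, b})"
    proof (rule psubset_card_mono)
      have "K \<inter> seg (a, c) - {a, c} \<subseteq> K \<inter> seg (a, b) - {a, b}" using un out by blast
      moreover have "c \<in> K \<inter> seg (a, b) - {a, b}" using c by blast
      ultimately show "K \<inter> seg (a, c) - {a, c} \<subset> K \<inter> seg (a, b) - {a, b}" by blast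
    qed (use less.prems(3) in simp)
    then have 1: "finite (components (- (K \<union> seg (a, c)))) \<and>
      card (components (- (K \<union> seg (a, c)))) + 1 = card (components (- K)) + card (K \<inter> seg (a, c))"
      using less.prems c ends fin by (intro less.hyps) auto
    have K2: "(K \<union> seg (a, c)) \<inter> seg (c, b) = K \<inter> seg (c, b)" using int c(1) by auto
    have "card (K \<inter> seg (c, b) - {c, b}) < card (K \<inter> seg (a, b) - {a, b})"
    proof (rule psubset_card_mono)
      have "K \<inter> seg (c, b) - {c, b} \<subseteq> K \<inter> seg (a, b) - {a, b}" using un out by blast
      moreover have "c \<in> K \<inter> seg (a, b) - {a, b}" using c by blast
      ultimately show "K \<inter> seg (c, b) - {c, b} \<subset> K \<inter> seg (a, b) - {a, b}" by blast
    qed (use less.prems(3) in simp)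
    then have 2: "finite (components (- ((K \<union> seg (a, c)) \<union> seg (c, b)))) \<and>
      card (components (- ((K \<union> seg (a, c)) \<union> seg (c, b)))) + 1 =
        card (components (- (K \<union> seg (a, c)))) + card ((K \<union> seg (a, c)) \<inter> seg (c, b))"
    proof (intro less.hyps)
      show "path_connected (K \<union> seg (a, c))"
        using less.prems(2) c(1) ends(3) by (intro path_connected_Un) (auto simp: seg_def)
      show "closed (K \<union> seg (a, c))" using less.prems(1) by (intro closed_Un) auto
    qed (use K2 fin 1 c ends in auto)
    have "card (K \<inter> seg (a, b)) + card {c} = card (K \<inter> seg (a, c)) + card (K \<inter> seg (c, b))"
    proof -
      have "K \<inter> seg (a, b) = (K \<inter> seg (a, c)) \<union> (K \<inter> seg (c, b))" by (auto simp: un)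
      moreover have "(K \<inter> seg (a, c)) \<inter> (K \<inter> seg (c, b)) = {c}" using int c(1) by auto
      ultimately show ?thesis using card_Un_Int[OF fin] by simp
    qed
    moreover have "(K \<union> seg (a, c)) \<union> seg (c, b) = K \<union> seg (a, b)" by (auto simp: un)
    ultimately show ?thesis using 1 2 K2 by simp
  qed
qed

section \<open>Euler's formula for the strands of a diagram\<close>

definition meeting :: "complex edge set \<Rightarrow> (complex edge \<times> complex edge) set" where
  "meeting E = {(e, f). e \<in> E \<and> f \<in> E \<and> e \<noteq> f \<and> seg e \<inter> seg f \<noteq> {}}"

lemma carrier_of_insert: "carrier_of (insert e E) = carrier_of E \<union> seg e"
  by (auto simp: carrier_of_def)

lemma infinite_seg: "fst e \<noteq> snd e \<Longrightarrow> infinite (seg e)" for e :: "complex edge"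
  by (simp add: seg_def)

context projected_link begin

lemma polygons: "closed_polygons (strands D)"
  using link_diagram unfolding link_diagram_def by blast

lemma strand_nondegenerate: "e \<in> strands D \<Longrightarrow> fst e \<noteq> snd e"
  using polygons unfolding closed_polygons_def by (cases e) auto

lemma strand_next: "e \<in> strands D \<Longrightarrow> \<exists>!c. (snd e, c) \<in> strands D"
  and strand_prev: "e \<in> strands D \<Longrightarrow> \<exists>!c. (c, fst e) \<in> strands D"
  using polygons unfolding closed_polygons_def by (cases e; auto)+

lemma same_fst: "e \<in> strands D \<Longrightarrow> f \<in> strands D \<Longrightarrow> fst e = fst f \<Longrightarrow> e = f"
  using strand_prev[of e] strand_next by (metis prod.collapse snd_conv)

lemma same_snd: "e \<in> strands D \<Longrightarrow> f \<in> strands D \<Longrightarrow> snd e = snd f \<Longrightarrow> e = f"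
  using strand_next[of e] strand_prev by (metis prod.collapse fst_conv)

text \<open>Strands that do not cross meet only in common ends; two common ends would make their
  carriers equal, hence an infinite set would consist of endpoints.\<close>

lemma strands_meet_once:
  assumes "(e, f) \<in> meeting (strands D)"
  shows "\<exists>p. seg e \<inter> seg f = {p}"
proof -
  have e: "e \<in> strands D" "f \<in> strands D" "e \<noteq> f" "seg e \<inter> seg f \<noteq> {}" using assms by (auto simp: meeting_def)
  show ?thesis
  proof (cases "cross e f")
    case False
    then have sub: "seg e \<inter> seg f \<subseteq> ends e \<inter> ends f" using strand_pair e by blast
    have "ends e \<inter> ends f \<noteq> ends e"
    proof
      assume "ends e \<inter> ends f = ends e"
      then have "fst e \<in> {fst f, snd f}" "snd e \<in> {fst f, snd f}" unfolding ends_def by blast+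
      then have "f = e \<or> f = (snd e, fst e)" using strand_nondegenerate[OF e(1)] by (auto simp: prod_eq_iff)
      then have "seg f = seg e" using seg_reverse[of "snd e" "fst e"] by (metis prod.collapse)
      then have "finite (seg e)" using sub finite_subset[of "seg e" "ends e"] by (simp add: ends_def)
      then show False using infinite_seg strand_nondegenerate e(1) by blast
    qed
    then have "\<exists>p. ends e \<inter> ends f \<subseteq> {p}" by (auto simp: ends_def)
    then show ?thesis using sub e(4) by (metis subset_singleton_iff subset_trans)
  qed (auto simp: cross_def)
qed

text \<open>Two strands meet either at a crossing or as neighbours in a polygon, and there are as
  many pairs of neighbours as strands. The factors 2 come from ordered pairs; a polygon with two
  strands, where predecessor and successor coincide, is impossible.\<close>

lemma card_meeting: "card (meeting (strands D)) = 2 * card (crossings D) + 2 * card (strands D)"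
proof -
  define E where "E = strands D"
  define N where "N = {(e, f). e \<in> E \<and> f \<in> E \<and> snd e = fst f}"
  have fE: "finite E" by (simp add: E_def)
  have crossE: "crossings D \<subseteq> {(e, f). e \<in> E \<and> f \<in> E \<and> cross e f}"
    and cross1: "\<And>e f. e \<in> E \<Longrightarrow> f \<in> E \<Longrightarrow> cross e f \<Longrightarrow> ((e, f) \<in> crossings D) \<noteq> ((f, e) \<in> crossings D)"
    using link_diagram unfolding link_diagram_def E_def by blast+
  have end_seg: "fst e \<in> seg e" "snd e \<in> seg e" for e :: "complex edge" by (simp_all add: seg_def)
  have ndg: "fst e \<noteq> snd e" if "e \<in> E" for e using that strand_nondegenerate by (simp add: E_def)
  have cross_ends: "snd e \<noteq> fst f" "fst e \<noteq> snd f" if ef: "cross e f" for e f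
  proof -
    obtain p where p: "seg e \<inter> seg f = {p}" "p \<notin> ends e \<union> ends f" using ef by (auto simp: cross_def)
    then have "seg e \<inter> seg f \<inter> ends e = {}" by auto
    moreover have "fst e \<in> seg e \<inter> ends e" "snd e \<in> seg e \<inter> ends e" using end_seg by (auto simp: ends_def)
    ultimately show "snd e \<noteq> fst f" "fst e \<noteq> snd f" using end_seg[of f] by auto
  qed
  have cross_sym: "cross f e" if "cross e f" for e f using that by (auto simp: cross_def)
  have cross_ne: "e \<noteq> f" if "cross e f" for e f using that end_seg[of e] by (auto simp: cross_def ends_def)
  have NN: False if "(e, f) \<in> N" "(f, e) \<in> N" for e f
  proof -
    have "f = (snd e, fst e)" using that by (cases f) (auto simp: N_def)
    then have "seg f = seg e" using seg_reverse[of "snd e" "fst e"] by simp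
    moreover have "e \<noteq> f" using that ndg[of e] by (auto simp: N_def)
    moreover have "seg e \<noteq> {}" using end_seg by blast
    ultimately have "(e, f) \<in> meeting (strands D)" using that by (auto simp: N_def meeting_def E_def)
    then show False using strands_meet_once infinite_seg ndg \<open>seg f = seg e\<close> that(1)
      by (metis (mono_tags, lifting) N_def Int_absorb case_prodD finite.emptyI finite_insert mem_Collect_eq)
  qed
  have "meeting E = (crossings D \<union> (crossings D)\<inverse>) \<union> (N \<union> N\<inverse>)"
  proof (intro equalityI subrelI)
    fix e f assume ef: "(e, f) \<in> meeting E"
    then have e: "e \<in> E" "f \<in> E" "e \<noteq> f" "seg e \<inter> seg f \<noteq> {}" by (auto simp: meeting_def)
    show "(e, f) \<in> (crossings D \<union> (crossings D)\<inverse>) \<union> (N \<union> N\<inverse>)"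
    proof (cases "cross e f")
      case True
      then show ?thesis using cross1 e by blast
    next
      case False
      then have "seg e \<inter> seg f \<subseteq> ends e \<inter> ends f" using strand_pair e unfolding E_def by blast
      then have "ends e \<inter> ends f \<noteq> {}" using e(4) by blast
      then have "snd e = fst f \<or> fst e = snd f" using same_fst same_snd e unfolding ends_def E_def by blast
      then show ?thesis using e by (auto simp: N_def)
    qed
  next
    fix e f assume "(e, f) \<in> (crossings D \<union> (crossings D)\<inverse>) \<union> (N \<union> N\<inverse>)"
    then have "(e, f) \<in> crossings D \<or> (f, e) \<in> crossings D \<or> (e, f) \<in> N \<or> (f, e) \<in> N" by blast
    then have "e \<in> E \<and> f \<in> E \<and> cross e f \<or> e \<in> E \<and> f \<in> E \<and> (snd e = fst f \<or> fst e = snd f)"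
      using crossE cross_sym[of f e] by (auto simp: N_def)
    then consider "e \<in> E" "f \<in> E" "cross e f" | "e \<in> E" "f \<in> E" "snd e = fst f \<or> fst e = snd f" by blast
    then show "(e, f) \<in> meeting E"
    proof cases
      case 1
      then show ?thesis using cross_ne by (auto simp: meeting_def cross_def)
    next
      case 2
      then have "e \<noteq> f" using ndg[of e] by auto
      then show ?thesis using 2 end_seg[of e] end_seg[of f] by (auto simp: meeting_def)
    qed
  qed
  moreover have fin: "finite (crossings D)" "finite N"
    using finite_subset[OF crossE] finite_subset[of N "E \<times> E"] fE finite_subset[of "crossings D" "E \<times> E"] crossE
    by (auto simp: N_def)
  moreover have "crossings D \<inter> (crossings D)\<inverse> = {}" using crossE cross1 by blast
  moreover have "N \<inter> N\<inverse> = {}" using NN by blast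
  moreover have "(crossings D \<union> (crossings D)\<inverse>) \<inter> (N \<union> N\<inverse>) = {}"
    using crossE cross_ends by (fastforce simp: N_def)
  ultimately have "card (meeting E) = 2 * card (crossings D) + 2 * card N"
    by (simp add: card_Un_disjoint)
  moreover have "card N = card E"
  proof -
    have "inj_on fst N" by (rule inj_onI) (use same_fst in \<open>fastforce simp: N_def E_def\<close>)
    moreover have "fst ` N = E"
    proof (intro equalityI subsetI)
      fix e assume e: "e \<in> E"
      then obtain c where "(snd e, c) \<in> E" using strand_next unfolding E_def by blast
      then have "(e, (snd e, c)) \<in> N" using e by (auto simp: N_def)
      then show "e \<in> fst ` N" by force
    qed (auto simp: N_def)
    ultimately show ?thesis using card_image by metis
  qed
  ultimately show ?thesis by (simp add: E_def)
qed

text \<open>Euler's formula with contacts of strands in place of vertices, doubled since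
  \<open>meeting\<close> consists of ordered pairs.\<close>

definition planar :: "complex edge set \<Rightarrow> bool" where
  "planar E \<longleftrightarrow> path_connected (carrier_of E) \<and> finite (components (- carrier_of E)) \<and>
     2 * card (components (- carrier_of E)) + 2 * card E = 4 + card (meeting E)"

lemma planar_single:
  assumes e: "e \<in> strands D"
  shows "planar {e}"
proof -
  obtain a b where ab: "e = (a, b)" by (cases e)
  have ne: "a \<noteq> b" using strand_nondegenerate[OF e] by (simp add: ab)
  have "connected (- {a})" by (rule connected_punctured_universe) simp
  moreover have "b \<in> - {a}" using ne by simp
  ultimately have c: "components (- {a}) = {- {a}}" unfolding components_eq_sing_iff by blast
  have i: "{a} \<inter> seg (a, b) = {a}" by (simp add: seg_def)
  have "{a} \<union> seg (a, b) = seg (a, b)" by (auto simp: seg_def)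
  then have "finite (components (- seg (a, b)))" "card (components (- seg (a, b))) = 1"
    using add_segment[of "{a}" a b] ne unfolding c i by simp_all
  moreover have "carrier_of {e} = seg (a, b)" by (simp add: carrier_of_def ab)
  moreover have "path_connected (seg (a, b))" by (simp add: seg_def)
  moreover have "meeting {e} = {}" by (auto simp: meeting_def)
  ultimately show ?thesis by (simp add: planar_def)
qed

text \<open>As no three strands meet, the points where \<open>e\<close> touches the part already
  drawn correspond one to one to the strands it meets there.\<close>

lemma planar_insert:
  assumes E: "E \<subseteq> strands D" "planar E" and e: "e \<in> strands D - E" "carrier_of E \<inter> seg e \<noteq> {}"
  shows "planar (insert e E)"
proof -
  define F where "F = {f \<in> E. seg f \<inter> seg e \<noteq> {}}"
  have fE: "finite E" using E(1) finite_subset finite_strands by blast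
  have F: "(f, e) \<in> meeting (strands D)" if "f \<in> F" for f using that E(1) e(1) by (auto simp: F_def meeting_def)
  have eq: "carrier_of E \<inter> seg e = (\<Union>f\<in>F. seg f \<inter> seg e)" by (auto simp: carrier_of_def F_def)
  have "card (\<Union>f\<in>F. seg f \<inter> seg e) = (\<Sum>f\<in>F. card (seg f \<inter> seg e))"
  proof (rule card_UN_disjoint)
    show "\<forall>f\<in>F. finite (seg f \<inter> seg e)" using strands_meet_once[OF F] by (metis finite.emptyI finite_insert)
    show "\<forall>f\<in>F. \<forall>g\<in>F. f \<noteq> g \<longrightarrow> (seg f \<inter> seg e) \<inter> (seg g \<inter> seg e) = {}"
    proof (intro ballI impI)
      fix f g assume "f \<in> F" "g \<in> F" "f \<noteq> g"
      then have "seg f \<inter> seg g \<inter> seg e = {}" using E(1) e(1) by (intro strand_triple) (auto simp: F_def)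
      then show "(seg f \<inter> seg e) \<inter> (seg g \<inter> seg e) = {}" by blast
    qed
  qed (use fE in \<open>simp add: F_def\<close>)
  also have "\<dots> = (\<Sum>f\<in>F. 1)" by (rule sum.cong) (use strands_meet_once[OF F] in force)+
  finally have cF: "card (carrier_of E \<inter> seg e) = card F" by (simp add: eq)
  have fin: "finite (carrier_of E \<inter> seg e)"
    unfolding eq
  proof (rule finite_UN_I)
    show "finite (seg f \<inter> seg e)" if "f \<in> F" for f using strands_meet_once[OF F[OF that]] by auto
  qed (use fE in \<open>simp add: F_def\<close>)
  obtain a b where ab: "e = (a, b)" by (cases e)
  have ne: "a \<noteq> b" using strand_nondegenerate[of e] e(1) by (simp add: ab)
  have clo: "closed (carrier_of E)" unfolding carrier_of_def using fE by (intro closed_UN) auto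
  have pl: "path_connected (carrier_of E)" "finite (components (- carrier_of E))"
    "2 * card (components (- carrier_of E)) + 2 * card E = 4 + card (meeting E)" using E(2) by (auto simp: planar_def)
  have new: "finite (components (- (carrier_of E \<union> seg e)))"
    "card (components (- (carrier_of E \<union> seg e))) + 1 = card (components (- carrier_of E)) + card F"
    using add_segment[OF clo pl(1) _ ne _ pl(2)] fin e(2) cF by (simp_all add: ab)
  have "meeting (insert e E) = meeting E \<union> ((\<lambda>f. (f, e)) ` F \<union> (\<lambda>f. (e, f)) ` F)"
    using e(1) by (auto simp: meeting_def F_def)
  moreover have "meeting E \<inter> ((\<lambda>f. (f, e)) ` F \<union> (\<lambda>f. (e, f)) ` F) = {}" using e(1) by (auto simp: meeting_def F_def)
  moreover have "(\<lambda>f. (f, e)) ` F \<inter> (\<lambda>f. (e, f)) ` F = {}" using e(1) by (auto simp: F_def)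
  moreover have "finite F" "finite (meeting E)" using fE finite_subset[of "meeting E" "E \<times> E"] by (auto simp: F_def meeting_def)
  ultimately have "card (meeting (insert e E)) = card (meeting E) + 2 * card F"
    by (simp add: card_Un_disjoint card_image inj_on_def)
  moreover have "path_connected (carrier_of E \<union> seg e)" using pl(1) e(2) by (intro path_connected_Un) (auto simp: seg_def)
  ultimately show ?thesis unfolding planar_def carrier_of_insert using new pl(3) fE e(1) by simp
qed

text \<open>Connectedness provides an order of drawing in which each new strand meets the earlier
  ones: otherwise the drawn and the remaining strands would split the curve into two closed parts.
  In the final formula the strands cancel and the crossings remain.\<close>

theorem card_regions:
  assumes "connected_diagram D"
  shows "finite (regions D)" "card (regions D) = card (crossings D) + 2"
proof -
  have "\<exists>E\<subseteq>strands D. card E = Suc k \<and> planar E" if "Suc k \<le> card (strands D)" for k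
    using that
  proof (induction k)
    case 0
    then obtain e where e: "e \<in> strands D" by (metis One_nat_def Suc_le_lessD card_gt_0_iff ex_in_conv)
    then show ?case using planar_single by (intro exI[of _ "{e}"]) auto
  next
    case (Suc k)
    then obtain E where E: "E \<subseteq> strands D" "card E = Suc k" "planar E" by auto
    have fE: "finite E" using E(1) finite_subset finite_strands by blast
    have "\<exists>e\<in>strands D - E. carrier_of E \<inter> seg e \<noteq> {}"
    proof (rule ccontr)
      assume none: "\<not> ?thesis"
      define K2 where "K2 = carrier_of (strands D - E)"
      have clo: "closed (carrier_of E)" "closed K2" unfolding carrier_of_def K2_def using fE by (auto intro!: closed_UN)
      have "carrier_of (strands D) = carrier_of E \<union> K2" using E(1) by (auto simp: carrier_of_def K2_def)
      moreover have "carrier_of E \<inter> K2 = {}" using none by (auto simp: K2_def carrier_of_def)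
      moreover have "carrier_of E \<noteq> {}"
      proof -
        have "E \<noteq> {}" using E(2) by auto
        then show ?thesis by (auto simp: carrier_of_def seg_def)
      qed
      moreover have "K2 \<noteq> {}"
      proof -
        have "E \<noteq> strands D" using E(2) Suc.prems by auto
        then have "strands D - E \<noteq> {}" using E(1) by blast
        then show ?thesis by (auto simp: carrier_of_def seg_def K2_def)
      qed
      ultimately show False
        using assms clo unfolding connected_diagram_def connected_closed by blast
    qed
    then obtain e where e: "e \<in> strands D - E" "carrier_of E \<inter> seg e \<noteq> {}" by blast
    then show ?case using planar_insert[OF E(1,3) e] E fE by (intro exI[of _ "insert e E"]) auto
  qed
  moreover have "card (strands D) \<noteq> 0" using polygons by (simp add: closed_polygons_def)
  ultimately obtain E where E: "E \<subseteq> strands D" "card E = card (strands D)" "planar E"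
    by (metis le_refl not0_implies_Suc)
  then have "E = strands D" using card_subset_eq[OF finite_strands] by blast
  then have "planar (strands D)" using E by simp
  then show "finite (regions D)" "card (regions D) = card (crossings D) + 2"
    using card_meeting by (auto simp: planar_def regions_def)
qed

end

section \<open>The index of a region\<close>

text \<open>Exempting finitely many points of each strand dispenses with vertices and crossings; the
  behaviour at the latter is derived in \<open>index_crossing\<close>. No value at infinity is
  prescribed.\<close>

definition index :: "diagram \<Rightarrow> (complex \<Rightarrow> int) \<Rightarrow> bool" where
  "index D k \<longleftrightarrow> (\<forall>z. z \<notin> carrier_of (strands D) \<longrightarrow> (\<forall>\<^sub>F w in nhds z. k w = k z)) \<and>
     (\<forall>e\<in>strands D. \<exists>Z. finite Z \<and> (\<forall>x\<in>seg e - Z. \<exists>r>0. \<forall>z\<in>ball x r \<inter> left_of e. \<forall>w\<in>ball x r \<inter> right_of e. k z = k w + 1))"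

text \<open>The signed angle under which the strand is seen from \<open>z\<close>; summed over
  closed polygons it gives \<open>2 * pi\<close> times the winding number.\<close>

definition angle_at :: "complex edge \<Rightarrow> complex \<Rightarrow> real" where
  "angle_at e z = Arg ((snd e - z) / (fst e - z))"

lemma Im_quotient: "Im ((snd e - z) / (fst e - z)) * (cmod (fst e - z))\<^sup>2 = lft e z"
proof (cases "z = fst e")
  case False
  have "Im ((snd e - z) / (fst e - z)) = Im ((snd e - z) * cnj (fst e - z)) / (cmod (fst e - z))\<^sup>2"
    by (subst complex_div_cnj) (simp del: times_complex.sel)
  then have "Im ((snd e - z) / (fst e - z)) * (cmod (fst e - z))\<^sup>2 = Im ((snd e - z) * cnj (fst e - z))"
    using False by simp
  then show ?thesis by (simp add: lft_def algebra_simps)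
qed (simp add: lft_def)

lemma quotient_nonpos:
  fixes z :: complex
  assumes "(snd e - z) / (fst e - z) \<in> \<real>\<^sub>\<le>\<^sub>0" "z \<noteq> fst e"
  shows "z \<in> seg e"
proof -
  obtain t where t: "t \<le> 0" "(snd e - z) / (fst e - z) = of_real t"
    using assms(1) by (elim nonpos_Reals_cases) auto
  have nz: "fst e - z \<noteq> 0" using assms(2) by simp
  from t(2) have "snd e - z = of_real t * (fst e - z)" by (simp only: nonzero_divide_eq_eq[OF nz])
  then have "(1 - t) *\<^sub>R z = snd e - t *\<^sub>R fst e" by (simp add: scaleR_conv_of_real algebra_simps)
  then have "(1 / (1 - t)) *\<^sub>R ((1 - t) *\<^sub>R z) = (1 / (1 - t)) *\<^sub>R (snd e - t *\<^sub>R fst e)" by (rule arg_cong)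
  then have "z = (1 / (1 - t)) *\<^sub>R (snd e - t *\<^sub>R fst e)" using t(1) by simp
  also have "\<dots> = (1 - 1 / (1 - t)) *\<^sub>R fst e + (1 / (1 - t)) *\<^sub>R snd e"
    using t(1) by (simp add: field_simps scaleR_diff_right)
  finally show ?thesis unfolding seg_def in_segment using t(1) by (intro exI[of _ "1 / (1 - t)"]) auto
qed

lemma isCont_angle_at:
  assumes "z \<notin> seg e"
  shows "isCont (angle_at e) z"
proof -
  have z: "z \<noteq> fst e" using assms by (auto simp: seg_def)
  have "isCont (\<lambda>z. (snd e - z) / (fst e - z)) z" using z by (intro continuous_intros) auto
  moreover have "(snd e - z) / (fst e - z) \<notin> \<real>\<^sub>\<le>\<^sub>0" using quotient_nonpos assms z by blast
  ultimately show ?thesis unfolding angle_at_def by (rule isCont_o2[OF _ continuous_at_Arg])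
qed

lemma quotient_on_seg:
  fixes z :: complex
  assumes "z \<in> seg e" "z \<notin> ends e"
  shows "- ((snd e - z) / (fst e - z)) \<notin> \<real>\<^sub>\<le>\<^sub>0"
proof -
  obtain t where t: "0 \<le> t" "t \<le> 1" "z = (1 - t) *\<^sub>R fst e + t *\<^sub>R snd e" using assms(1) by (auto simp: seg_def in_segment)
  have "t \<noteq> 0" "t \<noteq> 1" using t(3) assms(2) by (auto simp: ends_def)
  then have t01: "0 < t" "t < 1" using t by auto
  define d where "d = snd e - fst e"
  have d: "d \<noteq> 0"
  proof
    assume "d = 0"
    then have "z = fst e" using t(3) by (simp add: d_def algebra_simps)
    then show False using assms(2) by (simp add: ends_def)
  qed
  have eq: "snd e - z = of_real (1 - t) * d" "fst e - z = - (of_real t * d)"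
    using t(3) by (simp_all add: d_def scaleR_conv_of_real algebra_simps)
  then have nz: "fst e - z \<noteq> 0" using d t01 by simp
  have "snd e - z = - of_real ((1 - t) / t) * (fst e - z)" unfolding eq using t01 by simp
  then have "(snd e - z) / (fst e - z) = - of_real ((1 - t) / t)" by (simp only: nonzero_divide_eq_eq[OF nz])
  then have "- ((snd e - z) / (fst e - z)) = of_real ((1 - t) / t)" by simp
  moreover have "(1 - t) / t > 0" using t01 by simp
  ultimately show ?thesis by (metis nonpos_Reals_of_real_iff not_le)
qed

text \<open>The quotient meets the branch cut of \<open>Arg\<close> exactly on the strand. Its
  negative does not, so the first summand is continuous there and the second shows the jump by a
  full turn.\<close>

lemma angle_at_jump:
  assumes "lft e z \<noteq> 0"
  shows "angle_at e z = Arg (- ((snd e - z) / (fst e - z))) + (if lft e z > 0 then pi else - pi)"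
proof -
  define \<zeta> where "\<zeta> = (snd e - z) / (fst e - z)"
  have *: "Im \<zeta> * (cmod (fst e - z))\<^sup>2 = lft e z" unfolding \<zeta>_def by (rule Im_quotient)
  then have "Im \<zeta> \<noteq> 0" using assms by auto
  moreover have "Im \<zeta> > 0 \<longleftrightarrow> lft e z > 0" using * assms by (metis zero_le_power2 less_eq_real_def mult_eq_0_iff zero_less_mult_pos2 zero_less_mult_iff)
  moreover have "Arg (- \<zeta>) = (if Arg \<zeta> \<le> 0 then Arg \<zeta> + pi else Arg \<zeta> - pi)" using \<open>Im \<zeta> \<noteq> 0\<close> by (intro Arg_minus) auto
  moreover have "Im \<zeta> > 0 \<longleftrightarrow> \<not> Arg \<zeta> \<le> 0" using \<open>Im \<zeta> \<noteq> 0\<close> Arg_lt_pi[of \<zeta>] Arg_less_0[of \<zeta>] by linarith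
  ultimately show ?thesis unfolding angle_at_def \<zeta>_def[symmetric] by auto
qed

lemma integral_close:
  assumes "a = 2 * pi * of_int m" "b = 2 * pi * of_int n" "\<bar>a - b - 2 * pi * of_int j\<bar> < 2 * pi"
  shows "m = n + j"
proof -
  have "a - b - 2 * pi * of_int j = 2 * pi * of_int (m - n - j)" using assms by (simp add: algebra_simps)
  then have "2 * pi * \<bar>of_int (m - n - j)\<bar> < 2 * pi * (1 :: real)" using assms(3) by (simp add: abs_mult)
  then have "\<bar>real_of_int (m - n - j)\<bar> < 1" by (subst (asm) mult_less_cancel_left_pos) auto
  then show ?thesis by linarith
qed

context projected_link begin

definition special :: "complex edge \<Rightarrow> complex set" where
  "special e = ends e \<union> (\<Union>f\<in>strands D - {e}. seg e \<inter> seg f)"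

lemma finite_special: "e \<in> strands D \<Longrightarrow> finite (special e)"
proof -
  assume e: "e \<in> strands D"
  have "finite (seg e \<inter> seg f)" if "f \<in> strands D - {e}" for f
  proof (cases "seg e \<inter> seg f = {}")
    case False
    then have "(e, f) \<in> meeting (strands D)" using e that by (auto simp: meeting_def)
    then show ?thesis using strands_meet_once by (metis finite.emptyI finite_insert)
  qed simp
  then have "finite (\<Union>f\<in>strands D - {e}. seg e \<inter> seg f)" by (intro finite_UN_I) auto
  then show ?thesis by (simp only: special_def ends_def finite_Un finite.intros)
qed

lemma simple_point:
  assumes "e \<in> strands D" "z \<in> seg e - special e"
  shows "\<exists>r>0. (\<forall>w\<in>ball z r. w \<in> K \<longleftrightarrow> lft e w = 0) \<and> (\<forall>f\<in>strands D. f \<noteq> e \<longrightarrow> ball z r \<inter> seg f = {})"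
proof -
  obtain r1 where r1: "r1 > 0" "\<forall>w\<in>ball z r1. w \<in> seg e \<longleftrightarrow> lft e w = 0"
    using seg_near_interior[of z e] assms(2) unfolding special_def by blast
  define R where "R = (\<Union>f\<in>strands D - {e}. seg f)"
  have "closed R" unfolding R_def by (intro closed_UN) auto
  moreover have "z \<in> - R" using assms by (auto simp: R_def special_def)
  ultimately obtain r2 where r2: "r2 > 0" "ball z r2 \<subseteq> - R" using open_contains_ball by (metis open_Compl)
  have K: "K = seg e \<union> R" using assms(1) by (auto simp: K_def carrier_of_def R_def)
  show ?thesis
  proof (intro exI[of _ "min r1 r2"] conjI ballI impI)
    fix w assume "w \<in> ball z (min r1 r2)"
    then show "w \<in> K \<longleftrightarrow> lft e w = 0" using r1 r2 K by auto
  next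
    fix f assume "f \<in> strands D" "f \<noteq> e"
    then show "ball z (min r1 r2) \<inter> seg f = {}" using r2 by (auto simp: R_def)
  qed (use r1 r2 in auto)
qed

definition total_angle :: "complex \<Rightarrow> real" where
  "total_angle z = (\<Sum>e\<in>strands D. angle_at e z)"

text \<open>Every vertex is the start of one strand and the end of one strand, so the product of the
  quotients is 1 and their logarithms add up to a multiple of a full turn.\<close>

lemma total_angle_integral:
  assumes "z \<notin> K"
  shows "\<exists>n::int. total_angle z = 2 * pi * n"
proof -
  have ne: "fst e \<noteq> z" "snd e \<noteq> z" if "e \<in> strands D" for e
    using assms that by (auto simp: K_def carrier_of_def seg_def)
  have "bij_betw fst (strands D) (fst ` strands D)" "bij_betw snd (strands D) (snd ` strands D)"
    unfolding bij_betw_def inj_on_def using same_fst same_snd by blast+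
  moreover have "fst ` strands D = snd ` strands D"
  proof (intro equalityI subsetI)
    fix a assume "a \<in> fst ` strands D"
    then obtain e where "e \<in> strands D" "a = fst e" by blast
    then obtain c where "(c, a) \<in> strands D" using strand_prev by blast
    then show "a \<in> snd ` strands D" by force
  next
    fix a assume "a \<in> snd ` strands D"
    then obtain e where "e \<in> strands D" "a = snd e" by blast
    then obtain c where "(a, c) \<in> strands D" using strand_next by blast
    then show "a \<in> fst ` strands D" by force
  qed
  ultimately have same: "(\<Prod>e\<in>strands D. snd e - z) = (\<Prod>e\<in>strands D. fst e - z)"
    using prod.reindex_bij_betw[of fst "strands D" "fst ` strands D" "\<lambda>a. a - z"]
      prod.reindex_bij_betw[of snd "strands D" "snd ` strands D" "\<lambda>a. a - z"] by simp
  have "exp (\<Sum>e\<in>strands D. Ln ((snd e - z) / (fst e - z))) = (\<Prod>e\<in>strands D. (snd e - z) / (fst e - z))"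
    unfolding exp_sum[OF finite_strands] by (rule prod.cong) (use ne in auto)
  also have "\<dots> = 1" unfolding prod_dividef same using ne by simp
  finally have "\<exists>n::int. (\<Sum>e\<in>strands D. Ln ((snd e - z) / (fst e - z))) = (of_int (2 * n) * pi) * \<i>"
    unfolding exp_eq_1 by (auto simp: complex_eq_iff)
  then obtain n :: int where n: "(\<Sum>e\<in>strands D. Ln ((snd e - z) / (fst e - z))) = (of_int (2 * n) * pi) * \<i>" by blast
  have "total_angle z = Im (\<Sum>e\<in>strands D. Ln ((snd e - z) / (fst e - z)))"
    unfolding total_angle_def angle_at_def Im_sum by (rule sum.cong) (use ne in \<open>auto simp: Arg_eq_Im_Ln\<close>)
  then show ?thesis unfolding n by (intro exI[of _ n]) simp
qed

lemma index_exists: "\<exists>k. index D k"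
proof -
  define k where "k = (\<lambda>z. \<lfloor>total_angle z / (2 * pi)\<rfloor>)"
  have k: "total_angle z = 2 * pi * of_int (k z)" if "z \<notin> K" for z
    using total_angle_integral[OF that] by (auto simp: k_def)
  have "index D k"
    unfolding index_def
  proof (intro conjI allI impI ballI)
    fix z assume "z \<notin> carrier_of (strands D)"
    then have z: "z \<notin> K" by (simp add: K_def)
    then have "isCont total_angle z" unfolding total_angle_def
      by (intro continuous_intros isCont_angle_at) (auto simp: K_def carrier_of_def)
    then have "((total_angle \<longlongrightarrow> total_angle z) (nhds z))" unfolding isCont_def tendsto_at_iff_tendsto_nhds .
    from tendstoD[OF this, of "2 * pi"] have "\<forall>\<^sub>F w in nhds z. dist (total_angle w) (total_angle z) < 2 * pi" by simp
    moreover have "\<forall>\<^sub>F w in nhds z. w \<in> - K" using z by (intro eventually_nhds_in_open) (auto simp: open_Compl)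
    ultimately show "\<forall>\<^sub>F w in nhds z. k w = k z"
    proof eventually_elim
      case (elim w)
      then have "\<bar>total_angle w - total_angle z - 2 * pi * of_int 0\<bar> < 2 * pi" by (simp add: dist_real_def)
      from integral_close[OF k k this] elim z show ?case by simp
    qed
  next
    fix e assume e: "e \<in> strands D"
    have "\<exists>r>0. \<forall>z\<in>ball x r \<inter> left_of e. \<forall>w\<in>ball x r \<inter> right_of e. k z = k w + 1" if x: "x \<in> seg e - special e" for x
    proof -
      obtain r where r: "r > 0" "\<forall>w\<in>ball x r. w \<in> K \<longleftrightarrow> lft e w = 0"
        and others: "\<forall>f\<in>strands D. f \<noteq> e \<longrightarrow> ball x r \<inter> seg f = {}" using simple_point[OF e x] by blast
      \<comment> \<open>The total angle with the term of \<open>e\<close> replaced by its version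
        that is continuous across \<open>e\<close>.\<close>
      define G where "G = (\<lambda>z. (\<Sum>f\<in>strands D - {e}. angle_at f z) + Arg (- ((snd e - z) / (fst e - z))))"
      have xe: "x \<in> seg e" "x \<notin> ends e" using x by (auto simp: special_def)
      then have ne: "x \<noteq> fst e" by (auto simp: ends_def)
      have "isCont (\<lambda>z. Arg (- ((snd e - z) / (fst e - z)))) x"
      proof (rule isCont_o2[where g = Arg])
        show "isCont (\<lambda>z. - ((snd e - z) / (fst e - z))) x" using ne by (intro continuous_intros) auto
      qed (rule continuous_at_Arg[OF quotient_on_seg[OF xe]])
      then have "isCont G x" unfolding G_def
      proof (intro continuous_intros isCont_angle_at)
        show "x \<notin> seg f" if "f \<in> strands D - {e}" for f
          using others r(1) that by (metis DiffD1 DiffD2 centre_in_ball disjoint_iff singletonI)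
      qed
      then have "(G \<longlongrightarrow> G x) (nhds x)" unfolding isCont_def tendsto_at_iff_tendsto_nhds .
      from tendstoD[OF this, of pi] obtain s where s: "s > 0" "\<And>z. dist z x < s \<Longrightarrow> \<bar>G z - G x\<bar> < pi"
        unfolding eventually_nhds_metric by (auto simp: dist_real_def)
      have tot: "total_angle z = G z + (if lft e z > 0 then pi else - pi)" if "lft e z \<noteq> 0" for z
        unfolding total_angle_def G_def sum.remove[OF finite_strands e] angle_at_jump[OF that] by simp
      have "k z = k w + 1" if "z \<in> ball x (min r s) \<inter> left_of e" "w \<in> ball x (min r s) \<inter> right_of e" for z w
      proof -
        have zw: "lft e z > 0" "lft e w < 0" using that by (auto simp: left_of_eq right_of_eq)
        then have "z \<notin> K" "w \<notin> K" using that r by auto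
        moreover have "\<bar>G z - G w\<bar> < 2 * pi" using s(2)[of z] s(2)[of w] that by (auto simp: dist_commute)
        then have "\<bar>total_angle z - total_angle w - 2 * pi * of_int 1\<bar> < 2 * pi" using tot[of z] tot[of w] zw by simp
        ultimately show ?thesis using integral_close[OF k k] by blast
      qed
      then show ?thesis using r s by (intro exI[of _ "min r s"]) auto
    qed
    then show "\<exists>Z. finite Z \<and> (\<forall>x\<in>seg e - Z. \<exists>r>0. \<forall>z\<in>ball x r \<inter> left_of e. \<forall>w\<in>ball x r \<inter> right_of e. k z = k w + 1)"
      using finite_special[OF e] by blast
  qed
  then show ?thesis by blast
qed

section \<open>The index near a crossing\<close>

lemma cross_point:
  assumes "cross e f" "p \<in> seg e \<inter> seg f"
  shows "p \<notin> ends e" "p \<notin> ends f" "seg e \<inter> seg f = {p}"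
proof -
  obtain q where q: "seg e \<inter> seg f = {q}" "q \<notin> ends e \<union> ends f" using assms(1) by (auto simp: cross_def)
  then have "p = q" using assms(2) by (metis singletonD)
  then show "p \<notin> ends e" "p \<notin> ends f" "seg e \<inter> seg f = {p}" using q by auto
qed

lemma crossing_strands:
  assumes "(e, f) \<in> crossings D"
  shows "e \<in> strands D" "f \<in> strands D" "e \<noteq> f" "cross e f"
proof -
  have *: "crossings D \<subseteq> {(e, f). e \<in> strands D \<and> f \<in> strands D \<and> cross e f}"
    using link_diagram unfolding link_diagram_def by blast
  show c: "e \<in> strands D" "f \<in> strands D" "cross e f" using assms * by blast+
  obtain p where p: "seg e \<inter> seg f = {p}" "p \<notin> ends e" using c(3) by (auto simp: cross_def)
  show "e \<noteq> f"
  proof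
    assume "e = f"
    then have "fst e \<in> seg e \<inter> seg f" by (simp add: seg_def)
    then show False using p by (auto simp: ends_def)
  qed
qed

lemma sector_eq:
  "sector e f p r 1 (-1) = ball p r \<inter> (left_of e \<inter> right_of f)"
  "sector e f p r 1 1 = ball p r \<inter> (left_of e \<inter> left_of f)"
  "sector e f p r (-1) 1 = ball p r \<inter> (right_of e \<inter> left_of f)"
  "sector e f p r (-1) (-1) = ball p r \<inter> (right_of e \<inter> right_of f)"
  by (auto simp: sector_def left_of_eq right_of_eq)

lemma crossing_neighbourhood:
  assumes c: "(e, f) \<in> crossings D" and p: "p \<in> seg e \<inter> seg f"
  shows "\<exists>r>0. \<forall>w\<in>ball p r. w \<in> K \<longleftrightarrow> lft e w = 0 \<or> lft f w = 0"
proof -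
  note cs = crossing_strands[OF c]
  have ends: "p \<notin> ends e" "p \<notin> ends f" "seg e \<inter> seg f = {p}" using cross_point[OF cs(4) p] by blast+
  obtain r1 where r1: "r1 > 0" "\<forall>w\<in>ball p r1. w \<in> seg e \<longleftrightarrow> lft e w = 0" using seg_near_interior p ends by blast
  obtain r2 where r2: "r2 > 0" "\<forall>w\<in>ball p r2. w \<in> seg f \<longleftrightarrow> lft f w = 0" using seg_near_interior p ends by blast
  define R where "R = (\<Union>g\<in>strands D - {e, f}. seg g)"
  have "closed R" unfolding R_def by (intro closed_UN) auto
  moreover have "p \<in> - R" using strand_triple[OF cs(1,2) _ cs(3)] p by (auto simp: R_def)
  ultimately obtain r3 where r3: "r3 > 0" "ball p r3 \<subseteq> - R" using open_contains_ball by (metis open_Compl)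
  have "K = seg e \<union> seg f \<union> R" using cs by (auto simp: K_def carrier_of_def R_def)
  then show ?thesis using r1 r2 r3 by (intro exI[of _ "min r1 (min r2 r3)"]) auto
qed

lemma sector_nonempty:
  assumes c: "(e, f) \<in> crossings D" and p: "p \<in> seg e \<inter> seg f" and "\<sigma> \<in> {1, -1}" "\<tau> \<in> {1, -1}" "r > 0"
  shows "sector e f p r \<sigma> \<tau> \<noteq> {}"
proof -
  obtain z where "z \<in> ball p r" "sgn (lft e z) = sgn \<sigma>" "sgn (lft f z) = sgn \<tau>"
    using sector_point[OF lft_seg lft_seg cross_transversal[OF crossing_strands(4)[OF c]]] p assms(5) by blast
  then have "z \<in> sector e f p r \<sigma> \<tau>" using assms(3,4) by (auto simp: sector_def sgn_if split: if_splits)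
  then show ?thesis by blast
qed

text \<open>The two sectors on one side of \<open>f\<close> are separated by a half of \<open>e\<close>, which contains points
  where the index is known to jump.\<close>

lemma sector_jump:
  assumes k: "index D k" and e: "e \<in> strands D" and p: "p \<in> seg e" "p \<notin> ends e" "lft f p = 0"
    and t: "Im (cnj (snd e - fst e) * (snd f - fst f)) \<noteq> 0" and \<tau>: "\<tau> \<in> {1, -1}" and "r > 0"
  shows "\<exists>z w. z \<in> sector e f p r 1 \<tau> \<and> w \<in> sector e f p r (-1) \<tau> \<and> k z = k w + 1"
proof -
  obtain Z where Z: "finite Z" "\<And>x. x \<in> seg e - Z \<Longrightarrow> \<exists>r>0. \<forall>z\<in>ball x r \<inter> left_of e. \<forall>w\<in>ball x r \<inter> right_of e. k z = k w + 1"
    using k e unfolding index_def by blast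
  have ne: "fst e \<noteq> snd e" using strand_nondegenerate e by blast
  obtain r1 where r1: "r1 > 0" "\<forall>w\<in>ball p r1. w \<in> seg e \<longleftrightarrow> lft e w = 0" using seg_near_interior[OF p(1,2)] by blast
  define \<rho> where "\<rho> = min r r1"
  have \<rho>: "\<rho> > 0" using r1 \<open>r > 0\<close> by (simp add: \<rho>_def)
  define d where "d = snd e - fst e"
  \<comment> \<open>The sign for which the half of \<open>e\<close> leaving \<open>p\<close> in
    direction \<open>c * d\<close> lies on side \<tau> of \<open>f\<close>. It contains infinitely
    many points, so one avoids the exceptions \<open>Z\<close>.\<close>
  define c where "c = \<tau> * sgn (Im (cnj (snd f - fst f) * d))"
  have sw: "Im (cnj (snd f - fst f) * d) \<noteq> 0" using t by (simp add: d_def algebra_simps)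
  then have c: "c = 1 \<or> c = -1" using \<tau> by (auto simp: c_def sgn_if)
  define pt where "pt = (\<lambda>s. p + (c * s) *\<^sub>R d)"
  define I where "I = {0<..<\<rho> / cmod d}"
  have d0: "d \<noteq> 0" using ne by (simp add: d_def)
  then have "infinite I" using \<rho> by (simp add: I_def infinite_Ioo)
  moreover have "inj_on pt I" using d0 c by (auto simp: inj_on_def pt_def)
  ultimately have "infinite (pt ` I)" by (simp add: finite_image_iff)
  then obtain s where s: "s \<in> I" "pt s \<notin> Z" using Z(1) by (metis finite_subset image_subsetI subsetI)
  define x where "x = pt s"
  have "dist p x < \<rho>" using s(1) d0 c by (auto simp: x_def pt_def dist_norm I_def pos_less_divide_eq abs_mult)
  then have xb: "x \<in> ball p \<rho>" by simp
  have lx: "lft e x = 0" unfolding x_def pt_def lft_add d_def by (simp only: Im_cnj_scaleR lft_seg[OF p(1)] add_0)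
  have "lft f x = c * s * Im (cnj (snd f - fst f) * d)"
    unfolding x_def pt_def lft_add p(3) by (simp add: algebra_simps)
  then have "\<tau> * lft f x = (\<tau> * \<tau>) * (s * \<bar>Im (cnj (snd f - fst f) * d)\<bar>)" by (simp add: c_def abs_sgn mult_ac)
  then have fx: "\<tau> * lft f x > 0" using \<tau> sw s(1) by (auto simp: I_def)
  have "x \<in> seg e - Z" using xb lx r1 s(2) by (auto simp: \<rho>_def x_def)
  from Z(2)[OF this] obtain r2 where r2: "r2 > 0" "\<forall>z\<in>ball x r2 \<inter> left_of e. \<forall>w\<in>ball x r2 \<inter> right_of e. k z = k w + 1" by blast
  have "open {w. \<tau> * lft f w > 0}" by (intro open_Collect_less continuous_intros)
  then have "open (ball p \<rho> \<inter> {w. \<tau> * lft f w > 0})" by (intro open_Int) auto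
  then obtain r3 where r3: "r3 > 0" "ball x r3 \<subseteq> ball p \<rho> \<inter> {w. \<tau> * lft f w > 0}"
    using xb fx open_contains_ball by (metis (mono_tags, lifting) IntI mem_Collect_eq)
  have m: "min r2 r3 > 0" using r2 r3 by simp
  obtain z where z: "z \<in> ball x (min r2 r3)" "sgn (lft e z) = sgn 1" using side_point[OF ne lx m, of 1] by blast
  obtain w where w: "w \<in> ball x (min r2 r3)" "sgn (lft e w) = sgn (-1)" using side_point[OF ne lx m, of "-1"] by blast
  have sg: "lft e z > 0" "lft e w < 0" using z(2) w(2) by (simp_all add: sgn_if split: if_splits)
  have "z \<in> ball p \<rho> \<inter> {w. \<tau> * lft f w > 0}" "w \<in> ball p \<rho> \<inter> {w. \<tau> * lft f w > 0}" using z(1) w(1) r3 by auto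
  then have "z \<in> sector e f p r 1 \<tau>" "w \<in> sector e f p r (-1) \<tau>" using sg by (auto simp: sector_def \<rho>_def)
  moreover have "k z = k w + 1" using r2(2) z(1) w(1) sg by (auto simp: left_of_eq right_of_eq)
  ultimately show ?thesis by blast
qed

text \<open>Each of the two strands raises the index by 1 on its left, whatever the side of the
  other strand.\<close>

lemma index_crossing:
  assumes k: "index D k" and c: "(e, f) \<in> crossings D" and p: "p \<in> seg e \<inter> seg f"
  shows "\<exists>r>0. \<exists>n. \<forall>\<sigma>\<in>{1,-1}. \<forall>\<tau>\<in>{1,-1}. \<forall>z\<in>sector e f p r \<sigma> \<tau>. z \<notin> K \<and>
    k z = n + (if \<sigma> = 1 then 1 else 0) + (if \<tau> = 1 then 1 else 0)"
proof -
  note cs = crossing_strands[OF c]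
  have ends: "p \<notin> ends e" "p \<notin> ends f" using cross_point[OF cs(4) p] by blast+
  have pe: "p \<in> seg e" "p \<in> seg f" using p by blast+
  have pz: "lft e p = 0" "lft f p = 0" using p lft_seg by blast+
  obtain r where r: "r > 0" "\<forall>w\<in>ball p r. w \<in> K \<longleftrightarrow> lft e w = 0 \<or> lft f w = 0" using crossing_neighbourhood[OF c p] by blast
  have off: "sector e f p r \<sigma> \<tau> \<inter> K = {}" for \<sigma> \<tau> using r(2) by (auto simp: sector_def)
  have loc: "\<And>z. z \<notin> K \<Longrightarrow> \<forall>\<^sub>F w in nhds z. k w = k z" using k by (simp add: index_def K_def)
  have const: "k z = k w" if "\<sigma> \<in> {1, -1}" "\<tau> \<in> {1, -1}" "z \<in> sector e f p r \<sigma> \<tau>" "w \<in> sector e f p r \<sigma> \<tau>" for \<sigma> \<tau> z w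
    using locally_constant_on[OF loc convex_connected[OF convex_sector[OF that(1,2)]] off that(3,4)] .
  have t: "Im (cnj (snd e - fst e) * (snd f - fst f)) \<noteq> 0" by (rule cross_transversal[OF cs(4)])
  then have t': "Im (cnj (snd f - fst f) * (snd e - fst e)) \<noteq> 0" by (simp add: algebra_simps)
  have swap: "sector f e p r \<tau> \<sigma> = sector e f p r \<sigma> \<tau>" for \<sigma> \<tau> by (auto simp: sector_def)
  have je: "k z = k w + 1" if tau: "\<tau> \<in> {1, -1}" "z \<in> sector e f p r 1 \<tau>" "w \<in> sector e f p r (-1) \<tau>" for \<tau> z w
  proof -
    obtain z' w' where zw: "z' \<in> sector e f p r 1 \<tau>" "w' \<in> sector e f p r (-1) \<tau>" "k z' = k w' + 1"
      using sector_jump[OF k cs(1) pe(1) ends(1) pz(2) t tau(1) r(1)] by (elim exE conjE) (rule that)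
    have "k z = k z'" "k w = k w'" using const[OF _ tau(1) tau(2) zw(1)] const[OF _ tau(1) tau(3) zw(2)] by blast+
    then show ?thesis using zw(3) by simp
  qed
  have jf: "k z = k w + 1" if sig: "\<sigma> \<in> {1, -1}" "z \<in> sector e f p r \<sigma> 1" "w \<in> sector e f p r \<sigma> (-1)" for \<sigma> z w
  proof -
    obtain z' w' where zw: "z' \<in> sector e f p r \<sigma> 1" "w' \<in> sector e f p r \<sigma> (-1)" "k z' = k w' + 1"
      using sector_jump[OF k cs(2) pe(2) ends(2) pz(1) t' sig(1) r(1)] unfolding swap by (elim exE conjE) (rule that)
    have "k z = k z'" "k w = k w'" using const[OF sig(1) _ sig(2) zw(1)] const[OF sig(1) _ sig(3) zw(2)] by blast+
    then show ?thesis using zw(3) by simp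
  qed
  obtain d where d: "d \<in> sector e f p r (-1) (-1)" using sector_nonempty[OF c p _ _ r(1), of "-1" "-1"] by auto
  obtain c' where c': "c' \<in> sector e f p r (-1) 1" using sector_nonempty[OF c p _ _ r(1), of "-1" 1] by auto
  have "k z = k d + (if \<sigma> = 1 then 1 else 0) + (if \<tau> = 1 then 1 else 0)"
    if "\<sigma> \<in> {1, -1}" "\<tau> \<in> {1, -1}" "z \<in> sector e f p r \<sigma> \<tau>" for \<sigma> \<tau> z
  proof -
    have "\<sigma> = 1 \<or> \<sigma> = -1" "\<tau> = 1 \<or> \<tau> = -1" using that(1,2) by auto
    then consider "\<sigma> = 1" "\<tau> = 1" | "\<sigma> = 1" "\<tau> = -1" | "\<sigma> = -1" "\<tau> = 1" | "\<sigma> = -1" "\<tau> = -1" by blast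
    then show ?thesis
    proof cases
      case 1 then show ?thesis using je[of 1 z c'] jf[of "-1" c' d] that c' d by simp
    next
      case 2 then show ?thesis using je[of "-1" z d] that d by simp
    next
      case 3 then show ?thesis using jf[of "-1" z d] that d by simp
    next
      case 4 then show ?thesis using const[of "-1" "-1" z d] that d by simp
    qed
  qed
  moreover have "z \<notin> K" if "z \<in> sector e f p r \<sigma> \<tau>" for z \<sigma> \<tau> using off that by blast
  ultimately show ?thesis using r(1) by (intro exI[of _ r] exI[of _ "k d"] conjI ballI) simp_all
qed

text \<open>Both differences in the crossing relation are jumps across the over-strand, hence 1. So
  the index is itself a colouring, by integers, and can be realised and transported as such.\<close>

lemma index_colouring:
  assumes k: "index D k"
  shows "colouring D k"
  unfolding colouring_def
proof (intro conjI allI impI ballI)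
  fix z assume "z \<notin> carrier_of (strands D)"
  then show "\<forall>\<^sub>F w in nhds z. k w = k z" using k by (simp add: index_def)
next
  fix c assume c: "c \<in> crossings D"
  obtain e f where ef: "c = (e, f)" by (cases c)
  show "case c of (e, f) \<Rightarrow> \<forall>p\<in>seg e \<inter> seg f. \<exists>r>0.
        \<forall>a\<in>ball p r \<inter> (left_of e \<inter> right_of f). \<forall>b\<in>ball p r \<inter> (left_of e \<inter> left_of f).
        \<forall>c\<in>ball p r \<inter> (right_of e \<inter> left_of f). \<forall>d\<in>ball p r \<inter> (right_of e \<inter> right_of f).
          k a - k d = k b - k c"
    unfolding ef prod.case sector_eq[symmetric]
  proof
    fix p assume "p \<in> seg e \<inter> seg f"
    from index_crossing[OF k c[unfolded ef] this] obtain r n where r: "r > 0"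
      "\<forall>\<sigma>\<in>{1,-1}. \<forall>\<tau>\<in>{1,-1}. \<forall>z\<in>sector e f p r \<sigma> \<tau>. z \<notin> K \<and> k z = n + (if \<sigma> = 1 then 1 else 0) + (if \<tau> = 1 then 1 else 0)"
      by (elim exE conjE) (rule that)
    show "\<exists>r>0. \<forall>a\<in>sector e f p r 1 (-1). \<forall>b\<in>sector e f p r 1 1.
      \<forall>c\<in>sector e f p r (-1) 1. \<forall>d\<in>sector e f p r (-1) (-1). k a - k d = k b - k c"
      using r by (intro exI[of _ r]) auto
  qed
qed

end

section \<open>Flat structures realising the index\<close>

lemma isCont_nhds: "isCont f a \<Longrightarrow> (f \<longlongrightarrow> f a) (nhds a)"
  unfolding isCont_def tendsto_at_iff_tendsto_nhds .

lemma open_cylinder: "open {p :: space. fst p \<in> ball a r}"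
proof -
  have "{p :: space. fst p \<in> ball a r} = ball a r \<times> UNIV" by auto
  then show ?thesis by (simp add: open_Times)
qed

lemma rcis_cancel:
  assumes "z \<noteq> 0" "z = rcis (cmod z) a" "z = rcis (cmod z) b"
  shows "\<exists>n::int. a = b + 2 * pi * n"
proof -
  have "cis a = cis b" using assms by (metis mult_cancel_left norm_eq_zero of_real_eq_0_iff rcis_def)
  then have "cis (a - b) = 1" by (simp add: cis_divide[symmetric])
  then have "cos (a - b) = 1" by (metis cis.sel(1) one_complex.sel(1))
  then obtain n :: int where "a - b = n * (2 * pi)" using cos_one_2pi_int by auto
  then show ?thesis by (intro exI[of _ n]) (simp add: algebra_simps)
qed

lemma integral_unique:
  assumes "a = 2 * pi * of_int m" "\<bar>a - 2 * pi * of_int n\<bar> < 2 * pi"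
  shows "m = n"
  using integral_close[OF assms(1), of 0 0 n] assms(2) by simp

text \<open>Where a continuous branch \<phi> of the angle exists, the number of full turns by which
  \<theta> exceeds it is a frame for \<open>f\<close>.\<close>

lemma hol_angle:
  assumes f: "flat X f" and ang: "angle_function f V \<pi> \<theta>"
    and C: "convex C" "open C" "C \<subseteq> X" "C \<subseteq> V" "p \<in> C" "q \<in> C"
    and \<phi>: "\<And>p. p \<in> C \<Longrightarrow> isCont \<phi> p" "\<And>p. p \<in> C \<Longrightarrow> \<pi> p \<noteq> 0" "\<And>p. p \<in> C \<Longrightarrow> \<pi> p = rcis (cmod (\<pi> p)) (\<phi> p)"
  shows "2 * pi * hol f p q = (\<theta> q - \<phi> q) - (\<theta> p - \<phi> p)"
proof -
  have "\<exists>n::int. \<theta> x = \<phi> x + 2 * pi * n" if "x \<in> C" for x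
    using rcis_cancel[OF \<phi>(2)[OF that] _ \<phi>(3)[OF that]] ang \<phi>(2)[OF that] C(4) that unfolding angle_function_def by blast
  then obtain F :: "space \<Rightarrow> int" where F: "\<And>x. x \<in> C \<Longrightarrow> \<theta> x = \<phi> x + 2 * pi * F x" by metis
  have "frame f F C"
    unfolding frame_def
  proof
    fix x assume x: "x \<in> C"
    have "((\<lambda>q. \<theta> q - 2 * pi * of_int (f x q)) \<longlongrightarrow> \<theta> x) (nhds x)"
      using ang \<phi>(2)[OF x] C(4) x unfolding angle_function_def by blast
    from tendstoD[OF this, of pi] have 1: "\<forall>\<^sub>F q in nhds x. dist (\<theta> q - 2 * pi * of_int (f x q)) (\<theta> x) < pi" by simp
    have "(\<phi> \<longlongrightarrow> \<phi> x) (nhds x)" using \<phi>(1)[OF x] unfolding isCont_def tendsto_at_iff_tendsto_nhds .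
    from tendstoD[OF this, of pi] have 2: "\<forall>\<^sub>F q in nhds x. dist (\<phi> q) (\<phi> x) < pi" by simp
    have 3: "\<forall>\<^sub>F q in nhds x. q \<in> C" using x C(2) by (intro eventually_nhds_in_open)
    from 1 2 3 show "\<forall>\<^sub>F q in nhds x. F q = F x + f x q"
    proof eventually_elim
      case (elim q)
      have "\<bar>2 * pi * of_int (F q) - 2 * pi * of_int (F x + f x q)\<bar> < 2 * pi"
        using elim(1,2) unfolding F[OF elim(3)] F[OF x] dist_real_def by (simp add: algebra_simps abs_less_iff)
      from integral_unique[OF refl this] show ?case .
    qed
  qed
  moreover have sub: "closed_segment p q \<subseteq> C" using C by (simp add: closed_segment_subset)
  ultimately have "hol f p q = - F p + F q"
    using hol_eq[OF f _ frame_subset] C(3) by blast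
  then have "real_of_int (hol f p q) = F q - F p" by simp
  then show ?thesis unfolding F[OF C(5)] F[OF C(6)] by (simp add: right_diff_distrib)
qed

locale simple_edge_point = bounded_projected_link +
  fixes e :: "space edge" and x :: space and r\<^sub>0 :: real
  assumes e: "e \<in> L" and x: "x \<in> seg e" and r\<^sub>0: "r\<^sub>0 > 0"
    and alone: "\<And>f. f \<in> L \<Longrightarrow> f \<noteq> e \<Longrightarrow> ball (fst x) r\<^sub>0 \<inter> seg (project_edge f) = {}"
    and line: "\<And>z. z \<in> ball (fst x) r\<^sub>0 \<Longrightarrow> z \<in> seg (project_edge e) \<longleftrightarrow> lft (project_edge e) z = 0"
begin

definition d :: complex where "d = fst (snd e) - fst (fst e)"
definition \<kappa> :: real where "\<kappa> = snd (snd e) - snd (fst e)"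
definition left :: "complex \<Rightarrow> real" where "left z = lft (project_edge e) z"
text \<open>Proportional to the vertical distance from the plane that contains the edge and is level
  across it: zero on the edge, positive above it.\<close>

definition height :: "space \<Rightarrow> real" where
  "height p = (cmod d)\<^sup>2 * (snd p - snd x) - \<kappa> * Re (cnj d * (fst p - fst x))"
definition \<pi> :: "space \<Rightarrow> complex" where "\<pi> p = Complex (left (fst p)) (height p)"

lemma d: "d \<noteq> 0"
  using project_edge_nondegenerate[OF e] by (simp add: d_def project_edge_def)

lemma frame_vectors: "det3 (snd e - fst e) (\<i> * d, 0) (0, 1) > 0"
  using d by (auto simp: det3_def d_def[symmetric] complex_eq_iff not_sum_power2_lt_zero sum_power2_gt_zero_iff simp flip: power2_eq_square)

lemma transverse_eq: "transverse (snd e - fst e) (\<i> * d, 0) (0, 1) x = \<pi>"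
proof
  fix p :: space
  have "Im (cnj d * (fst x - fst (fst e))) = 0"
    using lft_seg[of "fst x" "project_edge e"] fst_seg[of e] x by (auto simp: lft_def project_edge_def d_def)
  then have "Im (cnj d * (fst p - fst x)) = left (fst p)"
    by (simp add: left_def lft_def project_edge_def d_def algebra_simps)
  then show "transverse (snd e - fst e) (\<i> * d, 0) (0, 1) x p = \<pi> p"
    unfolding \<pi>_def transverse_def det3_def height_def cmod_power2
    by (simp add: d_def[symmetric] \<kappa>_def[symmetric] power2_eq_square algebra_simps)
qed

lemma carrier_near:
  assumes "fst p \<in> ball (fst x) r\<^sub>0" "p \<in> carrier_of L"
  shows "p \<in> seg e" "left (fst p) = 0" "height p = 0"
proof -
  obtain f where f: "f \<in> L" "p \<in> seg f" using assms(2) by (auto simp: carrier_of_def)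
  then have "fst p \<in> seg (project_edge f)" using fst_seg[of f] by blast
  then show p: "p \<in> seg e" using alone[OF f(1)] assms(1) f(2) by blast
  then have "fst p \<in> seg (project_edge e)" using fst_seg[of e] by blast
  then show "left (fst p) = 0" unfolding left_def by (rule lft_seg)
  obtain s where s: "x = (1 - s) *\<^sub>R fst e + s *\<^sub>R snd e" using x by (auto simp: seg_def in_segment)
  obtain t where t: "p = (1 - t) *\<^sub>R fst e + t *\<^sub>R snd e" using p by (auto simp: seg_def in_segment)
  have "p - x = (t - s) *\<^sub>R (snd e - fst e)" unfolding s t by (simp add: algebra_simps)
  then have "fst p - fst x = (t - s) *\<^sub>R d" "snd p - snd x = (t - s) * \<kappa>"
    by (metis d_def fst_diff fst_scaleR, metis \<kappa>_def snd_diff snd_scaleR real_scaleR_def)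
  then show "height p = 0" unfolding height_def cmod_power2 \<open>fst p - fst x = _\<close> \<open>snd p - snd x = _\<close>
    by (simp add: power2_eq_square algebra_simps)
qed

lemma near_X: "fst p \<in> ball (fst x) r\<^sub>0 \<Longrightarrow> \<pi> p \<noteq> 0 \<Longrightarrow> p \<in> X"
  using carrier_near(2,3)[of p] unfolding X_def \<pi>_def by (auto simp: complex_eq_iff simp del: split_paired_All)

lemma height_up: "height (z, h + t) = height (z, h) + (cmod d)\<^sup>2 * t"
  by (simp add: height_def algebra_simps)

lemma isCont_left: "isCont (\<lambda>p :: space. left (fst p)) p"
  unfolding left_def lft_def by (intro continuous_intros bounded_linear.isCont[OF bounded_linear_Im])

lemma isCont_height: "isCont height p"
  unfolding height_def by (intro continuous_intros bounded_linear.isCont[OF bounded_linear_Re])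

lemma isCont_\<pi>: "isCont \<pi> p"
  unfolding \<pi>_def Complex_eq by (intro continuous_intros isCont_left isCont_height)

text \<open>The rectangle \<open>P w\<close>, \<open>P z\<close>, \<open>M z\<close>,
  \<open>M w\<close> encircles the edge, with \<open>P\<close> above and \<open>M\<close> below it.
  By \<open>hol_angle\<close> on the four convex parts above, left, below and right its holonomy is
  1, and vertical paths from its corners turn this holonomy into the difference of the
  colours.\<close>

lemma winds_jump:
  assumes f: "flat X f" and w: "winds f e x"
  shows "\<exists>r>0. \<forall>z\<in>ball (fst x) r \<inter> left_of (project_edge e). \<forall>w\<in>ball (fst x) r \<inter> right_of (project_edge e).
    colour f H z = colour f H w + 1"
proof -
  obtain V \<theta> where V: "open V" "x \<in> V" and ang: "angle_function f V \<pi> \<theta>"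
    using windsD[OF w, of 1 _ x 0, OF _ _ _ frame_vectors] unfolding transverse_eq by auto
  obtain \<epsilon> where \<epsilon>: "\<epsilon> > 0" "ball x \<epsilon> \<subseteq> V" using V open_contains_ball by blast
  define \<delta> where "\<delta> = min (\<epsilon> / 2) (H - H0)"
  have \<delta>: "\<delta> > 0" "\<delta> \<le> \<epsilon> / 2" "\<delta> \<le> H - H0" using \<epsilon> H0 by (simp_all add: \<delta>_def min_def)
  \<comment> \<open>The last bound beats the slope of the edge, so that over the whole disc
    \<open>P\<close> stays above and \<open>M\<close> below it.\<close>
  define r where "r = min (min r\<^sub>0 (\<epsilon> / 2)) (cmod d * \<delta> / 2 / (\<bar>\<kappa>\<bar> + 1))"
  have r: "r > 0" "r \<le> r\<^sub>0" "r \<le> \<epsilon> / 2" "r \<le> cmod d * \<delta> / 2 / (\<bar>\<kappa>\<bar> + 1)" using \<epsilon> r\<^sub>0 \<delta> d unfolding r_def by (simp, linarith+)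
  have slope: "\<bar>\<kappa> * Re (cnj d * (z - fst x))\<bar> < (cmod d)\<^sup>2 * (\<delta> / 2)" if "z \<in> ball (fst x) r" for z
  proof -
    have "\<bar>Re (cnj d * (z - fst x))\<bar> \<le> cmod d * cmod (z - fst x)"
      using abs_Re_le_cmod[of "cnj d * (z - fst x)"] by (simp add: norm_mult)
    then have "\<bar>\<kappa> * Re (cnj d * (z - fst x))\<bar> \<le> \<bar>\<kappa>\<bar> * (cmod d * cmod (z - fst x))"
      unfolding abs_mult by (intro mult_left_mono) auto
    also have "\<dots> \<le> (\<bar>\<kappa>\<bar> + 1) * (cmod d * cmod (z - fst x))" by (intro mult_right_mono) auto
    also have "\<dots> < (\<bar>\<kappa>\<bar> + 1) * (cmod d * (cmod d * \<delta> / 2 / (\<bar>\<kappa>\<bar> + 1)))"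
      using that r d by (intro mult_strict_left_mono) (auto simp: dist_norm norm_minus_commute)
    also have "\<dots> = (cmod d)\<^sup>2 * (\<delta> / 2)" by (simp add: power2_eq_square field_simps)
    finally show ?thesis .
  qed
  define C where "C = ball (fst x) r \<times> {snd x - \<delta> <..< snd x + \<delta>}"
  have C: "convex C" "open C" unfolding C_def by (auto intro!: convex_Times open_Times)
  have CV: "C \<subseteq> V"
  proof
    fix p assume p: "p \<in> C"
    have "dist x p \<le> dist (fst x) (fst p) + dist (snd x) (snd p)"
      by (simp add: dist_prod_def sqrt_sum_squares_le_sum_abs[of "dist (fst x) (fst p)" "dist (snd x) (snd p)", simplified])
    also have "\<dots> < \<epsilon>" using p r(3) \<delta>(2) by (auto simp: C_def dist_real_def)
    finally show "p \<in> V" using \<epsilon>(2) by auto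
  qed
  have fstC: "fst p \<in> ball (fst x) r\<^sub>0" if "p \<in> C" for p using that r(2) by (auto simp: C_def)
  have CX: "p \<in> X" if "p \<in> C" "\<pi> p \<noteq> 0" for p using near_X[OF fstC[OF that(1)] that(2)] .
  have lin: "left (fst ((1 - t) *\<^sub>R p + t *\<^sub>R q)) = (1 - t) * left (fst p) + t * left (fst q)"
    "height ((1 - t) *\<^sub>R p + t *\<^sub>R q) = (1 - t) * height p + t * height q" for t p q
    by (simp_all add: left_def lft_def height_def algebra_simps)
  have half: "convex (C \<inter> {p. s * left (fst p) > 0})" "convex (C \<inter> {p. s * height p > 0})"
    "open (C \<inter> {p. s * left (fst p) > 0})" "open (C \<inter> {p. s * height p > 0})" for s :: real
  proof -
    have conv: "convex {p. g p > 0}" if "\<And>t p q. g ((1 - t) *\<^sub>R p + t *\<^sub>R q) = (1 - t) * g p + t * g q" for g :: "space \<Rightarrow> real"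
      unfolding convex_alt
    proof (intro ballI allI impI)
      fix p q and t :: real assume "p \<in> {p. g p > 0}" "q \<in> {p. g p > 0}" "0 \<le> t \<and> t \<le> 1"
      then have "(1 - t) * g p + t * g q > 0"
        by (cases "t = 0") (auto intro!: add_nonneg_pos)
      then show "(1 - t) *\<^sub>R p + t *\<^sub>R q \<in> {p. g p > 0}" by (simp add: that)
    qed
    show "convex (C \<inter> {p. s * left (fst p) > 0})" "convex (C \<inter> {p. s * height p > 0})"
      by (intro convex_Int C(1) conv; simp only: lin; simp add: algebra_simps)+
    show "open (C \<inter> {p. s * left (fst p) > 0})" "open (C \<inter> {p. s * height p > 0})"
      using C(2) isCont_left isCont_height
      by (auto intro!: open_Int open_Collect_less continuous_intros continuous_at_imp_continuous_on)
  qed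
  define P M where "P = (\<lambda>z :: complex. (z, snd x + \<delta> / 2))" and "M = (\<lambda>z :: complex. (z, snd x - \<delta> / 2))"
  have PM: "P z \<in> C" "M z \<in> C" "height (P z) > 0" "height (M z) < 0" if "z \<in> ball (fst x) r" for z
    using that \<delta>(1) slope[OF that] by (auto simp: P_def M_def C_def height_def abs_less_iff)
  have heightsC: "\<bar>snd p\<bar> < H" if "p \<in> C" for p
  proof -
    have "x \<in> carrier_of L" using e x by (auto simp: carrier_of_def)
    then show ?thesis using heights[of x] that \<delta>(3) by (auto simp: C_def abs_le_iff abs_less_iff)
  qed
  have "colour f H z = colour f H w + 1"
    if z: "z \<in> ball (fst x) r" "left z > 0" and w: "w \<in> ball (fst x) r" "left w < 0" for z w
  proof -
    note pm = PM[OF z(1)] PM[OF w(1)]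
    have fsts [simp]: "fst (P z) = z" "fst (M z) = z" "fst (P w) = w" "fst (M w) = w" by (simp_all add: P_def M_def)
    have nz: "\<pi> p \<noteq> 0" if "left (fst p) \<noteq> 0 \<or> height p \<noteq> 0" for p using that by (auto simp: \<pi>_def complex_eq_iff)
    have Arg_cont: "isCont (\<lambda>p. Arg (\<pi> p)) p" if "height p \<noteq> 0 \<or> left (fst p) > 0" for p
      by (rule isCont_o2[OF isCont_\<pi>], rule continuous_at_Arg) (use that in \<open>auto simp: \<pi>_def complex_nonpos_Reals_iff\<close>)
    \<comment> \<open>The part to the right of the edge contains the branch cut of
      \<open>Arg\<close>; there the angle is measured from the opposite direction.\<close>
    have Arg_cont': "isCont (\<lambda>p. Arg (- \<pi> p) + pi) p" if "left (fst p) < 0" for p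
      by (intro continuous_intros isCont_o2[where g = Arg and f = "\<lambda>p. - \<pi> p"] isCont_\<pi> continuous_at_Arg)
        (use that in \<open>auto simp: \<pi>_def complex_nonpos_Reals_iff\<close>)
    have rc: "\<pi> p = rcis (cmod (\<pi> p)) (Arg (\<pi> p))" for p by (simp add: rcis_cmod_Arg)
    have rc': "\<pi> p = rcis (cmod (\<pi> p)) (Arg (- \<pi> p) + pi)" for p
    proof -
      have "\<pi> p = - rcis (cmod (- \<pi> p)) (Arg (- \<pi> p))" by (simp only: rcis_cmod_Arg minus_minus)
      also have "\<dots> = rcis (cmod (\<pi> p)) (Arg (- \<pi> p) + pi)" by (simp add: rcis_def cis.ctr complex_eq_iff)
      finally show ?thesis .
    qed
    have h1: "2 * pi * hol f (P w) (P z) = (\<theta> (P z) - Arg (\<pi> (P z))) - (\<theta> (P w) - Arg (\<pi> (P w)))"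
      by (rule hol_angle[OF f ang half(2)[of 1] half(4)[of 1]]) (use CV CX nz pm Arg_cont rc in auto)
    have h2: "2 * pi * hol f (P z) (M z) = (\<theta> (M z) - Arg (\<pi> (M z))) - (\<theta> (P z) - Arg (\<pi> (P z)))"
      by (rule hol_angle[OF f ang half(1)[of 1] half(3)[of 1]]) (use CV CX nz pm z Arg_cont rc in auto)
    have h3: "2 * pi * hol f (M z) (M w) = (\<theta> (M w) - Arg (\<pi> (M w))) - (\<theta> (M z) - Arg (\<pi> (M z)))"
      by (rule hol_angle[OF f ang half(2)[of "-1"] half(4)[of "-1"]]) (use CV CX nz pm Arg_cont rc in auto)
    have h4: "2 * pi * hol f (P w) (M w) = (\<theta> (M w) - (Arg (- \<pi> (M w)) + pi)) - (\<theta> (P w) - (Arg (- \<pi> (P w)) + pi))"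
      by (rule hol_angle[OF f ang half(1)[of "-1"] half(3)[of "-1"]]) (use CV CX nz pm w Arg_cont' rc' in auto)
    \<comment> \<open>The two branches agree at \<open>P w\<close> and differ by a full turn at
      \<open>M w\<close>; this is the origin of the 1.\<close>
    have A: "Arg (- \<pi> (P w)) = Arg (\<pi> (P w)) - pi" "Arg (- \<pi> (M w)) = Arg (\<pi> (M w)) + pi"
      using Arg_minus[OF nz, of "P w"] Arg_minus[OF nz, of "M w"] pm Arg_lt_pi[of "\<pi> (P w)"] Arg_less_0[of "\<pi> (M w)"]
      by (auto simp: \<pi>_def)
    have "2 * pi * (hol f (P w) (P z) + hol f (P z) (M z) + hol f (M z) (M w) - hol f (P w) (M w)) = 2 * pi * of_int 1"
      using h1 h2 h3 h4 A by (simp add: algebra_simps)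
    then have loop: "hol f (P w) (P z) + hol f (P z) (M z) + hol f (M z) (M w) - hol f (P w) (M w) = 1" 
      by (intro integral_unique[OF refl]) simp
    have generic: "y \<notin> K" if "y \<in> ball (fst x) r" "left y \<noteq> 0" for y
    proof
      assume "y \<in> K"
      then obtain h where "(y, h) \<in> carrier_of L" by (auto simp: K_eq)
      then show False using carrier_near(2)[of "(y, h)"] that r(2) by simp
    qed
    have adj: "adjacent 1 (P w) (P z)" "adjacent (-1) (M z) (M w)" "adjacent (-1) (P z) (M z)" "adjacent (-1) (P w) (M w)"
    proof -
      have up: "p + (0, s * t) \<in> X" if "p \<in> C" "s * height p > 0" "t \<ge> 0" "s \<in> {1, -1}" for p and s t :: real
      proof (rule near_X)
        show "fst (p + (0, s * t)) \<in> ball (fst x) r\<^sub>0" using fstC[OF that(1)] by simp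
        have "s * height (p + (0, s * t)) = s * height p + (s * s) * ((cmod d)\<^sup>2 * t)"
          using height_up[of "fst p" "snd p" "s * t"] by (cases p) (simp add: algebra_simps)
        moreover have "s * s = 1" using that(4) by auto
        then have "(s * s) * ((cmod d)\<^sup>2 * t) \<ge> 0" using that(3) by simp
        ultimately have "s * height (p + (0, s * t)) > 0" using that(2) by linarith
        then show "\<pi> (p + (0, s * t)) \<noteq> 0" by (intro nz) auto
      qed
      have in_half: "closed_segment p q \<subseteq> C \<inter> {p. s * height p > 0}"
        if "p \<in> C" "q \<in> C" "s * height p > 0" "s * height q > 0" for p q and s :: real
        using that half(2)[of s] by (intro closed_segment_subset) auto
      show "adjacent 1 (P w) (P z)" unfolding adjacent_def
        using in_half[of "P w" "P z" 1] pm up[of _ 1] by force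
      show "adjacent (-1) (M z) (M w)" unfolding adjacent_def
        using in_half[of "M z" "M w" "-1"] pm up[of _ "-1"] by force
      have line: "adjacent (-1) (P y) (M y)" if y: "y \<in> ball (fst x) r" "left y \<noteq> 0" for y
        unfolding adjacent_def
      proof (intro ballI allI impI)
        fix p and t :: real assume "p \<in> closed_segment (P y) (M y)"
        then obtain u where "p = (1 - u) *\<^sub>R P y + u *\<^sub>R M y" by (auto simp: in_segment)
        then have "fst p = y" by (simp add: P_def M_def algebra_simps)
        then show "p + (0, - 1 * t) \<in> X" using generic[OF y] by (intro generic_in_X) simp
      qed
      show "adjacent (-1) (P z) (M z)" "adjacent (-1) (P w) (M w)" using line z w by auto
    qed
    have v: "vertical f H 1 (P w) = hol f (P w) (P z) + vertical f H 1 (P z)"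
      "vertical f H (-1) (M z) = hol f (M z) (M w) + vertical f H (-1) (M w)"
      "vertical f H (-1) (P z) = hol f (P z) (M z) + vertical f H (-1) (M z)"
      "vertical f H (-1) (P w) = hol f (P w) (M w) + vertical f H (-1) (M w)"
      by (intro vertical_adjacent[OF f] adj; use heightsC[OF pm(1)] heightsC[OF pm(2)] heightsC[OF pm(5)] heightsC[OF pm(6)] in \<open>simp add: abs_less_iff\<close>)+
    show ?thesis
      using colour_vertical[OF f, of "P z"] colour_vertical[OF f, of "P w"] generic[OF z(1)] generic[OF w(1)] z(2) w(2) v loop by simp
  qed
  then show ?thesis using r(1) by (intro exI[of _ r]) (auto simp: left_of_eq right_of_eq left_def)
qed

lemma \<pi>_nonzero_side:
  assumes "fst p \<in> ball (fst x) r\<^sub>0" "\<pi> p \<noteq> 0" "f \<in> L" "s \<in> {1, -1}"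
  shows "side s p f \<longleftrightarrow> f = e \<and> left (fst p) = 0 \<and> s * height p < 0"
proof
  assume "side s p f"
  then obtain h where h: "s * h > s * snd p" "(fst p, h) \<in> seg f" unfolding side_def by blast
  then have "(fst p, h) \<in> carrier_of L" using assms(3) by (auto simp: carrier_of_def)
  then have *: "left (fst p) = 0" "height (fst p, h) = 0" using carrier_near[of "(fst p, h)"] assms(1) by auto
  have "f = e"
  proof (rule ccontr)
    assume "f \<noteq> e"
    then show False using alone[OF assms(3)] assms(1) seg_projectI[OF h(2)] by blast
  qed
  moreover have "height p = - ((cmod d)\<^sup>2 * (h - snd p))"
    using height_up[of "fst p" "snd p" "h - snd p"] *(2) by simp
  from arg_cong[OF this, of "\<lambda>y. s * y"] have "s * height p = - ((cmod d)\<^sup>2 * (s * h - s * snd p))" by (simp add: algebra_simps)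
  then have "s * height p < 0" using h(1) d by simp
  ultimately show "f = e \<and> left (fst p) = 0 \<and> s * height p < 0" using *(1) by blast
next
  assume *: "f = e \<and> left (fst p) = 0 \<and> s * height p < 0"
  then have "fst p \<in> seg (project_edge e)" using line[OF assms(1)] by (simp add: left_def)
  then obtain h where h: "(fst p, h) \<in> seg e" using fst_seg[of e] by force
  then have "(fst p, h) \<in> carrier_of L" using e by (auto simp: carrier_of_def)
  then have "height (fst p, h) = 0" using carrier_near[of "(fst p, h)"] assms(1) by auto
  then have "height p = - ((cmod d)\<^sup>2 * (h - snd p))"
    using height_up[of "fst p" "snd p" "h - snd p"] by simp
  from arg_cong[OF this, of "\<lambda>y. s * y"] have "s * height p = - ((cmod d)\<^sup>2 * (s * h - s * snd p))" by (simp add: algebra_simps)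
  then have "(cmod d)\<^sup>2 * (s * h - s * snd p) > 0" using * by simp
  then have "s * h > s * snd p" using d by (simp add: zero_less_mult_iff)
  then show "side s p f" using h * unfolding side_def by blast
qed

text \<open>The half-plane hanging vertically below the edge: off the edge, these are the points
  near \<open>x\<close> that have a strand above them.\<close>

definition curtain :: "space \<Rightarrow> bool" where
  "curtain p \<longleftrightarrow> left (fst p) = 0 \<and> height p < 0"

lemma local_triv_curtain:
  fixes k :: "complex \<Rightarrow> int"
  assumes "fst p \<in> ball (fst x) r\<^sub>0" "\<pi> p \<noteq> 0"
  shows "local_triv k p y = (if curtain p then - k (fst y) else 0)"
  using \<pi>_nonzero_side[OF assms, of _ 1] \<pi>_nonzero_side[OF assms, of _ "-1"] e
  by (auto simp: local_triv_def curtain_def)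

text \<open>On the curtain below the edge the angle is measured from the right; there \<open>flat_of k\<close> records
  the value of \<open>k\<close> on the side towards which the curtain is left.\<close>

lemma index_winds:
  assumes k: "\<And>z. z \<in> ball (fst x) r\<^sub>0 \<Longrightarrow> left z > 0 \<Longrightarrow> k z = n + 1" "\<And>z. z \<in> ball (fst x) r\<^sub>0 \<Longrightarrow> left z < 0 \<Longrightarrow> k z = n"
  shows "winds (flat_of k) e x"
proof -
  define V where "V = {p :: space. fst p \<in> ball (fst x) r\<^sub>0}"
  have V: "open V" "x \<in> V" using open_cylinder r\<^sub>0 by (auto simp: V_def simp del: mem_ball)
  \<comment> \<open>A quarter turn moves the branch cut of \<open>Arg\<close> onto the
    curtain.\<close>
  define \<zeta> where "\<zeta> = (\<lambda>p. - \<i> * \<pi> p)"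
  have \<zeta>: "Re (\<zeta> p) = height p" "Im (\<zeta> p) = - left (fst p)" for p by (simp_all add: \<zeta>_def \<pi>_def)
  have cont_\<zeta>: "isCont \<zeta> p" for p unfolding \<zeta>_def by (intro continuous_intros isCont_\<pi>)
  \<comment> \<open>The summand \<open>pi / 2\<close> undoes the quarter turn. From a point of the
    curtain \<open>flat_of k\<close> takes the values \<open>- n\<close> to the right,
    \<open>- (n + 1)\<close> to the left and 0 within the curtain, so on the curtain the angle is
    shifted by \<open>n\<close> turns.\<close>
  define \<theta> where "\<theta> = (\<lambda>p. Arg (\<zeta> p) + pi / 2 + (if curtain p then 2 * pi * of_int n else 0))"
  have ev_h: "\<forall>\<^sub>F q in nhds p. height q < 0" if "height p < 0" for p
    using isCont_height[of p] that unfolding isCont_def tendsto_at_iff_tendsto_nhds by (rule order_tendstoD)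
  have ev_V: "\<forall>\<^sub>F q in nhds p. q \<in> V" if "p \<in> V" for p using V(1) that by (intro eventually_nhds_in_open)
  have triv: "local_triv k p y = (if curtain p then - k (fst y) else 0)" if "p \<in> V" "\<pi> p \<noteq> 0" for p y
    using local_triv_curtain that by (simp add: V_def)
  have generic_side: "generic_near q (\<lambda>y. local_triv k p y = g + local_triv k q y)"
    if "\<forall>\<^sub>F y in nhds q. left (fst y) \<noteq> 0 \<longrightarrow> local_triv k p y = g + local_triv k q y" "q \<in> V" for p q g
  proof -
    from that(1) ev_V[OF that(2)] have "\<forall>\<^sub>F y in nhds q. fst y \<notin> K \<longrightarrow> local_triv k p y = g + local_triv k q y"
    proof eventually_elim
      case (elim y)
      have "left (fst y) \<noteq> 0" if "fst y \<notin> K"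
      proof
        assume "left (fst y) = 0"
        then have "fst y \<in> seg (project_edge e)" using line elim(2) by (simp add: V_def left_def)
        then show False using seg_K[OF e] that by blast
      qed
      then show ?case using elim(1) by blast
    qed
    then show ?thesis by (simp add: generic_near_def)
  qed
  have "angle_function (flat_of k) V \<pi> \<theta>"
    unfolding angle_function_def
  proof (intro ballI impI conjI)
    fix p assume p: "p \<in> V" "\<pi> p \<noteq> 0"
    have "\<pi> p = \<i> * \<zeta> p" by (simp add: \<zeta>_def)
    also have "\<dots> = \<i> * rcis (cmod (\<zeta> p)) (Arg (\<zeta> p))" by (simp only: rcis_cmod_Arg)
    also have "\<dots> = rcis (cmod (\<pi> p)) (\<theta> p)"
    proof -
      have "cis (\<theta> p) = cis (Arg (\<zeta> p) + pi / 2)"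
        by (simp add: \<theta>_def flip: cis_mult)
      then show ?thesis unfolding rcis_def by (simp add: \<zeta>_def norm_mult flip: cis_mult)
    qed
    finally show "\<pi> p = rcis (cmod (\<pi> p)) (\<theta> p)" .
    have nz: "\<forall>\<^sub>F q in nhds p. \<pi> q \<noteq> 0"
      using tendsto_imp_eventually_ne[of \<pi> "\<pi> p" "nhds p" 0] isCont_\<pi>[of p] p(2)
      unfolding isCont_def tendsto_at_iff_tendsto_nhds by blast
    show "((\<lambda>q. \<theta> q - 2 * pi * of_int (flat_of k p q)) \<longlongrightarrow> \<theta> p) (nhds p)"
    proof (cases "curtain p")
      case False
      then have slit: "\<zeta> p \<notin> \<real>\<^sub>\<le>\<^sub>0" using p(2) unfolding complex_nonpos_Reals_iff \<zeta> curtain_def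
        by (auto simp: \<pi>_def complex_eq_iff)
      have off: "\<forall>\<^sub>F q in nhds p. \<not> curtain q"
      proof -
        have "open (- \<real>\<^sub>\<le>\<^sub>0 :: complex set)" by (simp add: open_Compl closed_nonpos_Reals_complex)
        then have "\<forall>\<^sub>F q in nhds p. \<zeta> q \<in> - \<real>\<^sub>\<le>\<^sub>0"
          using cont_\<zeta>[of p] slit unfolding isCont_def tendsto_at_iff_tendsto_nhds by (intro topological_tendstoD) auto
        then show ?thesis by eventually_elim (auto simp: complex_nonpos_Reals_iff \<zeta> curtain_def)
      qed
      have "((\<lambda>q. Arg (\<zeta> q) + pi / 2) \<longlongrightarrow> Arg (\<zeta> p) + pi / 2) (nhds p)"
      proof -
        have "isCont (\<lambda>q. Arg (\<zeta> q) + pi / 2) p"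
          by (intro continuous_intros isCont_o2[OF cont_\<zeta>] continuous_at_Arg slit)
        from isCont_nhds[OF this] show ?thesis .
      qed
      moreover have "\<forall>\<^sub>F q in nhds p. Arg (\<zeta> q) + pi / 2 = \<theta> q - 2 * pi * of_int (flat_of k p q)"
        using off nz ev_V[OF p(1)]
      proof eventually_elim
        case (elim q)
        have "flat_of k p q = 0"
          by (rule flat_of_eqI, rule generic_side) (use triv[OF p] triv[OF elim(3,2)] False elim in auto)
        then show ?case using elim(1) by (simp add: \<theta>_def)
      qed
      ultimately show ?thesis using False unfolding \<theta>_def[THEN fun_cong, of p]
        by (auto intro: Lim_transform_eventually)
    next
      case True
      then have h: "height p < 0" "left (fst p) = 0" by (auto simp: curtain_def)
      then have slit: "- \<zeta> p \<notin> \<real>\<^sub>\<le>\<^sub>0" by (simp add: complex_nonpos_Reals_iff \<zeta>)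
      have "((\<lambda>q. Arg (- \<zeta> q) + (3 * pi / 2 + 2 * pi * of_int n)) \<longlongrightarrow> Arg (- \<zeta> p) + (3 * pi / 2 + 2 * pi * of_int n)) (nhds p)"
      proof -
        have "isCont (\<lambda>q. Arg (- \<zeta> q) + (3 * pi / 2 + 2 * pi * of_int n)) p"
          by (intro continuous_intros isCont_o2[where f = "\<lambda>q. - \<zeta> q" and g = Arg] cont_\<zeta> continuous_at_Arg slit)
        from isCont_nhds[OF this] show ?thesis .
      qed
      moreover have "\<forall>\<^sub>F q in nhds p. Arg (- \<zeta> q) + (3 * pi / 2 + 2 * pi * of_int n) = \<theta> q - 2 * pi * of_int (flat_of k p q)"
        using ev_h[OF h(1)] nz ev_V[OF p(1)]
      proof eventually_elim
        case (elim q)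
        have \<zeta>0: "\<zeta> q \<noteq> 0" using elim(2) by (simp add: \<zeta>_def)
        note Arg_minus_q = Arg_minus[OF \<zeta>0] and signs = Arg_lt_pi[of "\<zeta> q"] Arg_less_0[of "\<zeta> q"] Arg_eq_pi[of "\<zeta> q"]
        have ev_left: "\<forall>\<^sub>F y in nhds q. sgn (left (fst y)) = sgn (left (fst q))" if "left (fst q) \<noteq> 0"
          using that eventually_fst[of "\<lambda>z. sgn (left z) = sgn (left (fst q))" q] lft_sign_near by (simp add: left_def)
        have fl: "flat_of k p q = - m" if m: "left (fst q) \<noteq> 0" "\<And>z. z \<in> ball (fst x) r\<^sub>0 \<Longrightarrow> sgn (left z) = sgn (left (fst q)) \<Longrightarrow> k z = m" for m
        proof (rule flat_of_eqI, rule generic_side)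
          have nc: "\<not> curtain q" using m(1) by (simp add: curtain_def)
          show "\<forall>\<^sub>F y in nhds q. left (fst y) \<noteq> 0 \<longrightarrow> local_triv k p y = - m + local_triv k q y"
            using ev_left[OF m(1)] ev_V[OF elim(3)]
            by eventually_elim (use triv[OF p] triv[OF elim(3,2)] True nc m(2) in \<open>auto simp: V_def\<close>)
        qed (rule elim(3))
        consider "left (fst q) = 0" | "left (fst q) > 0" | "left (fst q) < 0" by linarith
        then show ?case
        proof cases
          case 1
          then have cq: "curtain q" using elim(1) by (simp add: curtain_def)
          have "flat_of k p q = 0"
            by (rule flat_of_eqI, rule generic_side) (use triv[OF p] triv[OF elim(3,2)] True cq elim in auto)
          moreover have "Arg (\<zeta> q) = pi" using signs(3) 1 elim(1) by (simp add: \<zeta>)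
          ultimately show ?thesis using cq Arg_minus_q by (simp add: \<theta>_def not_le)
        next
          case 2
          have eq: "flat_of k p q = - (n + 1)" using 2 k(1) by (intro fl) (auto simp: sgn_if split: if_splits)
          have "Arg (\<zeta> q) \<le> 0" using signs(1,2) 2 by (auto simp: \<zeta>)
          moreover have "\<not> curtain q" using 2 by (simp add: curtain_def)
          ultimately show ?thesis unfolding eq using Arg_minus_q by (simp add: \<theta>_def algebra_simps)
        next
          case 3
          have "flat_of k p q = - n" using 3 k(2) by (intro fl) (auto simp: sgn_if split: if_splits)
          moreover have "Arg (\<zeta> q) > 0" using signs(1) 3 by (simp add: \<zeta>)
          moreover have "\<not> curtain q" using 3 by (simp add: curtain_def)
          ultimately show ?thesis using Arg_minus_q by (simp add: \<theta>_def algebra_simps)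
        qed
      qed
      moreover have "Arg (- \<zeta> p) + (3 * pi / 2 + 2 * pi * of_int n) = \<theta> p"
      proof -
        have "\<zeta> p \<noteq> 0" using p(2) by (simp add: \<zeta>_def)
        moreover have "Arg (\<zeta> p) = pi" using h by (simp add: Arg_eq_pi \<zeta>)
        ultimately show ?thesis using Arg_minus[of "\<zeta> p"] True by (simp add: \<theta>_def not_le)
      qed
      ultimately show ?thesis by (auto intro: Lim_transform_eventually)
    qed
  qed
  then have "angle_function (flat_of k) V (transverse (snd e - fst e) (\<i> * d, 0) (0, 1) x) \<theta>"
    unfolding transverse_eq .
  then show ?thesis unfolding winds_def using frame_vectors V by blast
qed

text \<open>An integral change of framing alters the angle by full turns: \<theta> is replaced by
  \<open>\<theta> + 2 * pi * \<gamma>\<close> and the projection is kept.\<close>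

lemma winds_gauge:
  assumes w: "winds f1 e x" and rel: "\<And>y. y \<in> X \<Longrightarrow> \<forall>\<^sub>F p in nhds y. f2 y p = - \<gamma> y + f1 y p + \<gamma> p"
  shows "winds f2 e x"
proof -
  obtain V \<theta> where V: "open V" "x \<in> V" and ang: "angle_function f1 V \<pi> \<theta>"
    using windsD[OF w, of 1 _ x 0, OF _ _ _ frame_vectors] unfolding transverse_eq by auto
  define V' where "V' = V \<inter> {p :: space. fst p \<in> ball (fst x) r\<^sub>0}"
  have V': "open V'" "x \<in> V'" using open_cylinder r\<^sub>0 V by (auto simp: V'_def simp del: mem_ball intro!: open_Int)
  have "angle_function f2 V' \<pi> (\<lambda>p. \<theta> p + 2 * pi * of_int (\<gamma> p))"
    unfolding angle_function_def
  proof (intro ballI impI conjI)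
    fix p assume p: "p \<in> V'" "\<pi> p \<noteq> 0"
    then have *: "\<pi> p = rcis (cmod (\<pi> p)) (\<theta> p)" "((\<lambda>q. \<theta> q - 2 * pi * of_int (f1 p q)) \<longlongrightarrow> \<theta> p) (nhds p)"
      using ang unfolding angle_function_def by (auto simp: V'_def)
    have "cis (\<theta> p + 2 * pi * of_int (\<gamma> p)) = cis (\<theta> p)" by (simp flip: cis_mult)
    then show "\<pi> p = rcis (cmod (\<pi> p)) (\<theta> p + 2 * pi * of_int (\<gamma> p))" using *(1) by (simp add: rcis_def)
    have "p \<in> X" using near_X p by (simp add: V'_def)
    from rel[OF this] have "\<forall>\<^sub>F q in nhds p. \<theta> q - 2 * pi * of_int (f1 p q) + 2 * pi * of_int (\<gamma> p) =
        \<theta> q + 2 * pi * of_int (\<gamma> q) - 2 * pi * of_int (f2 p q)"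
    proof eventually_elim
      case (elim q)
      show ?case unfolding elim by (simp add: algebra_simps)
    qed
    moreover have "((\<lambda>q. \<theta> q - 2 * pi * of_int (f1 p q) + 2 * pi * of_int (\<gamma> p)) \<longlongrightarrow> \<theta> p + 2 * pi * of_int (\<gamma> p)) (nhds p)"
      by (intro tendsto_intros *(2))
    ultimately show "((\<lambda>q. \<theta> q + 2 * pi * of_int (\<gamma> q) - 2 * pi * of_int (f2 p q)) \<longlongrightarrow> \<theta> p + 2 * pi * of_int (\<gamma> p)) (nhds p)"
      by (rule Lim_transform_eventually[rotated])
  qed
  then have "angle_function f2 V' (transverse (snd e - fst e) (\<i> * d, 0) (0, 1) x) (\<lambda>p. \<theta> p + 2 * pi * of_int (\<gamma> p))"
    unfolding transverse_eq .
  then show ?thesis unfolding winds_def using frame_vectors V' by blast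
qed

end

section \<open>From winding to the index and back\<close>

context bounded_projected_link begin

lemma simple_edge_pointI:
  assumes e: "e \<in> L" and x: "x \<in> seg e" "fst x \<notin> special (project_edge e)"
  shows "\<exists>r0>0. \<forall>r. 0 < r \<longrightarrow> r \<le> r0 \<longrightarrow> simple_edge_point L D H0 H e x r"
proof -
  have es: "project_edge e \<in> strands D" using e by (simp add: strands_eq)
  have xs: "fst x \<in> seg (project_edge e) - special (project_edge e)" using x fst_seg[of e] by blast
  obtain r1 where r1: "r1 > 0" "\<forall>f\<in>strands D. f \<noteq> project_edge e \<longrightarrow> ball (fst x) r1 \<inter> seg f = {}"
    using simple_point[OF es xs] by blast
  obtain r2 where r2: "r2 > 0" "\<forall>z\<in>ball (fst x) r2. z \<in> seg (project_edge e) \<longleftrightarrow> lft (project_edge e) z = 0"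
    using seg_near_interior[of "fst x" "project_edge e"] xs unfolding special_def by blast
  have "simple_edge_point L D H0 H e x r" if r: "0 < r" "r \<le> min r1 r2" for r
  proof unfold_locales
    fix f assume f: "f \<in> L" "f \<noteq> e"
    then have "project_edge f \<noteq> project_edge e" using inj e by (auto dest: inj_onD)
    then have "ball (fst x) r1 \<inter> seg (project_edge f) = {}" using r1(2) f(1) by (simp add: strands_eq)
    moreover have "ball (fst x) r \<subseteq> ball (fst x) r1" using r(2) by (intro subset_ball) simp
    ultimately show "ball (fst x) r \<inter> seg (project_edge f) = {}" by blast
  qed (use e x(1) r r2 in auto)
  then show ?thesis using r1(1) r2(1) by (intro exI[of _ "min r1 r2"]) auto
qed

lemma finite_over:
  assumes "e \<in> L" "finite Z"
  shows "finite {x \<in> seg e. fst x \<in> Z}"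
proof (rule finite_imageD)
  show "finite (fst ` {x \<in> seg e. fst x \<in> Z})" using assms(2) by (rule finite_subset[rotated]) blast
  show "inj_on fst {x \<in> seg e. fst x \<in> Z}"
    using seg_height_unique[OF project_edge_nondegenerate[OF assms(1)]] by (auto simp: inj_on_def)
qed

lemma winds_index:
  assumes f: "flat X f" and w: "winds_link f L"
  shows "index D (colour f H)"
  unfolding index_def
proof (intro conjI allI impI ballI)
  fix z assume "z \<notin> carrier_of (strands D)"
  then show "\<forall>\<^sub>F w in nhds z. colour f H w = colour f H z"
    using colour_colouring[OF f] by (simp add: colouring_def)
next
  fix s assume s: "s \<in> strands D"
  then obtain e where es: "e \<in> L" "s = project_edge e" by (auto simp: strands_eq)
  obtain Z where Z: "finite Z" "\<forall>x\<in>seg e - Z. winds f e x" using w es(1) unfolding winds_link_def by blast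
  show "\<exists>Z. finite Z \<and> (\<forall>x\<in>seg s - Z. \<exists>r>0. \<forall>z\<in>ball x r \<inter> left_of s. \<forall>w\<in>ball x r \<inter> right_of s. colour f H z = colour f H w + 1)"
  proof (intro exI[of _ "special s \<union> fst ` Z"] conjI ballI)
    show "finite (special s \<union> fst ` Z)" using Z(1) finite_special[OF s] by simp
    fix z assume z: "z \<in> seg s - (special s \<union> fst ` Z)"
    then obtain x where xz: "x \<in> seg e" "z = fst x" using fst_seg[of e] es(2) by blast
    then have xx: "fst x \<notin> special (project_edge e)" "x \<notin> Z" using z es(2) by auto
    obtain r where "simple_edge_point L D H0 H e x r" using simple_edge_pointI[OF es(1) xz(1) xx(1)] by blast
    then interpret simple_edge_point L D H0 H e x r .
    show "\<exists>r>0. \<forall>y\<in>ball z r \<inter> left_of s. \<forall>w\<in>ball z r \<inter> right_of s. colour f H y = colour f H w + 1"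
      using winds_jump[OF f] Z(2) xz xx(2) es(2) by auto
  qed
qed

text \<open>The model \<open>flat_of k\<close> winds by \<open>index_winds\<close>; by
  \<open>colour_injective\<close> any flat structure with the same colours differs from it by gauge
  transformations, which do not affect winding.\<close>

lemma index_winds_link:
  assumes k: "index D k" and f: "flat X f" "\<And>z. z \<notin> K \<Longrightarrow> colour f H z = k z"
  shows "winds_link f L"
  unfolding winds_link_def
proof
  fix e assume e: "e \<in> L"
  define s where "s = project_edge e"
  have s: "s \<in> strands D" using e by (simp add: s_def strands_eq)
  obtain Z where Z: "finite Z" "\<forall>x\<in>seg s - Z. \<exists>r>0. \<forall>z\<in>ball x r \<inter> left_of s. \<forall>w\<in>ball x r \<inter> right_of s. k z = k w + 1"
    using k s unfolding index_def by blast
  obtain \<gamma>0 where \<gamma>0: "flat X (\<lambda>x p. - \<gamma>0 x + flat_of k x p + \<gamma>0 p)"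
    "\<forall>z. z \<notin> K \<longrightarrow> colour (\<lambda>x p. - \<gamma>0 x + flat_of k x p + \<gamma>0 p) H z = k z"
    using colouring_realised_gauge[OF index_colouring[OF k]] by blast
  obtain \<gamma>1 where \<gamma>1: "\<forall>x\<in>X. \<forall>\<^sub>F p in nhds x. f x p = - \<gamma>1 x + (- \<gamma>0 x + flat_of k x p + \<gamma>0 p) + \<gamma>1 p"
    using colour_injective[OF \<gamma>0(1) f(1)] \<gamma>0(2) f(2) by auto
  show "\<exists>Z. finite Z \<and> (\<forall>x\<in>seg e - Z. winds f e x)"
  proof (intro exI conjI ballI)
    show "finite {x \<in> seg e. fst x \<in> special s \<union> Z}" using Z(1) finite_special[OF s] by (intro finite_over[OF e]) auto
    fix x assume x: "x \<in> seg e - {x \<in> seg e. fst x \<in> special s \<union> Z}"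
    then have xe: "x \<in> seg e" "fst x \<notin> special (project_edge e)" "fst x \<in> seg s - Z"
      using fst_seg[of e] by (auto simp: s_def)
    obtain r0 where r0: "r0 > 0" "\<forall>r. 0 < r \<longrightarrow> r \<le> r0 \<longrightarrow> simple_edge_point L D H0 H e x r"
      using simple_edge_pointI[OF e xe(1,2)] by blast
    obtain r1 where r1: "r1 > 0" "\<forall>z\<in>ball (fst x) r1 \<inter> left_of s. \<forall>w\<in>ball (fst x) r1 \<inter> right_of s. k z = k w + 1"
      using Z(2) xe(3) by blast
    define r where "r = min r0 r1"
    have r: "r > 0" "r \<le> r0" "r \<le> r1" using r0(1) r1(1) by (auto simp: r_def)
    then interpret simple_edge_point L D H0 H e x r using r0(2) by blast
    have ne: "fst s \<noteq> snd s" using strand_nondegenerate[OF s] .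
    have l0: "lft s (fst x) = 0" using lft_seg xe(3) by blast
    obtain a where a: "a \<in> ball (fst x) r" "sgn (lft s a) = sgn 1" using side_point[OF ne l0 r(1), of 1] by blast
    obtain b where b: "b \<in> ball (fst x) r" "sgn (lft s b) = sgn (-1)" using side_point[OF ne l0 r(1), of "-1"] by blast
    have jump: "k z = k w + 1" if "z \<in> ball (fst x) r" "w \<in> ball (fst x) r" "lft s z > 0" "lft s w < 0" for z w
      using r1(2) that r(3) by (auto simp: left_of_eq right_of_eq)
    have ab: "lft s a > 0" "lft s b < 0" using a(2) b(2) by (simp_all add: sgn_if split: if_splits)
    have "winds (flat_of k) e x"
    proof (rule index_winds)
      show "k z = k b + 1" if "z \<in> ball (fst x) r" "left z > 0" for z
        using jump[OF that(1) b(1) _ ab(2)] that(2) by (simp add: left_def s_def)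
      show "k z = k b" if "z \<in> ball (fst x) r" "left z < 0" for z
        using jump[OF a(1) that(1) ab(1)] jump[OF a(1) b(1) ab] that(2) by (simp add: left_def s_def)
    qed
    moreover have "\<forall>\<^sub>F p in nhds y. f y p = - (\<gamma>0 y + \<gamma>1 y) + flat_of k y p + (\<gamma>0 p + \<gamma>1 p)" if "y \<in> X" for y
      using bspec[OF \<gamma>1 that] by eventually_elim simp
    ultimately show "winds f e x" by (rule winds_gauge)
  qed
qed

end

section \<open>Transporting colourings along an isotopy\<close>

text \<open>One flat structure in space shows \<open>C'\<close> on the second diagram and, pulled
  back along \<open>h\<close>, shows \<open>C\<close> on the first. Being a relation, it ignores
  values on the curves.\<close>

definition carried :: "link \<Rightarrow> diagram \<Rightarrow> diagram \<Rightarrow> (space \<Rightarrow> space) \<Rightarrow> real \<Rightarrow> (complex \<Rightarrow> 'g::group_add) \<Rightarrow> (complex \<Rightarrow> 'g) \<Rightarrow> bool" where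
  "carried L' D D' h H C C' \<longleftrightarrow> (\<exists>f. flat (- carrier_of L') f \<and>
     (\<forall>z. z \<notin> carrier_of (strands D') \<longrightarrow> colour f H z = C' z) \<and>
     (\<forall>z. z \<notin> carrier_of (strands D) \<longrightarrow> colour (\<lambda>x p. f (h x) (h p)) H z = C z))"

lemma (in bounded_projected_link) colour_hom:
  assumes "flat X f" "\<And>a b. \<phi> (a + b) = \<phi> a + \<phi> b" "z \<notin> K"
  shows "colour (\<lambda>x p. \<phi> (f x p)) H z = \<phi> (colour f H z)"
  unfolding colour_def
  using hol_hom[OF assms(1,2) colour_segments(1)[OF assms(3)]] hol_hom[OF assms(1,2) colour_segments(2)[OF assms(3)]]
    hol_hom[OF assms(1,2) colour_segments(3)[OF assms(3)]] by (simp only: assms(2))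

lemma (in projected_link) index_cong:
  assumes k: "index D k" and eq: "\<And>z. z \<notin> K \<Longrightarrow> k' z = k z"
  shows "index D k'"
  unfolding index_def
proof (intro conjI allI impI ballI)
  fix z assume "z \<notin> carrier_of (strands D)"
  then have z: "z \<notin> K" by (simp add: K_def)
  then have "\<forall>\<^sub>F w in nhds z. k w = k z" using k by (simp add: index_def K_def)
  moreover have "\<forall>\<^sub>F w in nhds z. w \<in> - K" using z by (intro eventually_nhds_in_open) (auto simp: open_Compl)
  ultimately show "\<forall>\<^sub>F w in nhds z. k' w = k' z" by eventually_elim (use eq z in auto)
next
  fix e assume e: "e \<in> strands D"
  obtain Z where Z: "finite Z" "\<forall>x\<in>seg e - Z. \<exists>r>0. \<forall>z\<in>ball x r \<inter> left_of e. \<forall>w\<in>ball x r \<inter> right_of e. k z = k w + 1"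
    using k e unfolding index_def by blast
  show "\<exists>Z. finite Z \<and> (\<forall>x\<in>seg e - Z. \<exists>r>0. \<forall>z\<in>ball x r \<inter> left_of e. \<forall>w\<in>ball x r \<inter> right_of e. k' z = k' w + 1)"
  proof (intro exI[of _ "Z \<union> special e"] conjI ballI)
    show "finite (Z \<union> special e)" using Z(1) finite_special[OF e] by simp
    fix x assume x: "x \<in> seg e - (Z \<union> special e)"
    obtain r1 where r1: "r1 > 0" "\<forall>z\<in>ball x r1 \<inter> left_of e. \<forall>w\<in>ball x r1 \<inter> right_of e. k z = k w + 1" using Z(2) x by blast
    obtain r2 where r2: "r2 > 0" "\<forall>w\<in>ball x r2. w \<in> K \<longleftrightarrow> lft e w = 0" using simple_point[OF e, of x] x by blast
    have "k' z = k' w + 1" if "z \<in> ball x (min r1 r2) \<inter> left_of e" "w \<in> ball x (min r1 r2) \<inter> right_of e" for z w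
    proof -
      have "z \<notin> K" "w \<notin> K" using that r2(2) by (auto simp: left_of_eq right_of_eq)
      then show ?thesis using r1(2) that by (simp add: eq)
    qed
    then show "\<exists>r>0. \<forall>z\<in>ball x r \<inter> left_of e. \<forall>w\<in>ball x r \<inter> right_of e. k' z = k' w + 1"
      using r1(1) r2(1) by (intro exI[of _ "min r1 r2"]) auto
  qed
qed

locale isotopic_diagrams = A: bounded_projected_link L D H0 H + B: bounded_projected_link L' D' H0 H
  for L D L' D' H0 H +
  fixes h h' :: "space \<Rightarrow> space"
  assumes iso: "isotopic_by L L' h h'" and fixed: "h (0, H) = (0, H)" "h (0, - H) = (0, - H)"
begin

abbreviation corresponds :: "(complex \<Rightarrow> 'g::group_add) \<Rightarrow> (complex \<Rightarrow> 'g) \<Rightarrow> bool" where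
  "corresponds \<equiv> carried L' D D' h H"

lemma inv: "h' (h p) = p" "h (h' p) = p" and cont: "isCont h p" "isCont h' p"
  using isotopic_byD[OF iso] by blast+

lemma image: "h ` A.X \<subseteq> B.X" "h' ` B.X \<subseteq> A.X"
proof -
  have c: "h ` carrier_of L = carrier_of L'" by (rule isotopic_byD(5)[OF iso])
  have "h p \<in> carrier_of L' \<Longrightarrow> p \<in> carrier_of L" for p unfolding c[symmetric] using inv(1) by (metis imageE)
  then show "h ` A.X \<subseteq> B.X" unfolding A.X_def B.X_def by blast
  have "h' p \<in> carrier_of L \<Longrightarrow> p \<in> carrier_of L'" for p unfolding c[symmetric] using inv(2) by (metis imageI)
  then show "h' ` B.X \<subseteq> A.X" unfolding A.X_def B.X_def by blast
qed

lemma reverse: "isotopic_diagrams L' D' L D H0 H h' h"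
proof (unfold_locales)
  show "isotopic_by L' L h' h" by (rule isotopic_by_sym[OF iso])
  show "h' (0, H) = (0, H)" "h' (0, - H) = (0, - H)" using fixed inv(1) by metis+
qed

lemma carried_reverse: "carried L D' D h' H C' C \<longleftrightarrow> carried L' D D' h H C C'"
proof
  assume "carried L D' D h' H C' C"
  then obtain f where f: "flat A.X f" "\<forall>z. z \<notin> A.K \<longrightarrow> colour f H z = C z"
    "\<forall>z. z \<notin> B.K \<longrightarrow> colour (\<lambda>x p. f (h' x) (h' p)) H z = C' z"
    unfolding carried_def A.X_def A.K_def B.K_def by blast
  have "flat B.X (\<lambda>x p. f (h' x) (h' p))" by (rule flat_pullback[OF f(1) image(2) cont(2)])
  then show "carried L' D D' h H C C'"
    unfolding carried_def using f(2,3)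
    by (intro exI[of _ "\<lambda>x p. f (h' x) (h' p)"]) (simp add: inv B.X_def A.K_def B.K_def)
next
  assume "carried L' D D' h H C C'"
  then obtain f where f: "flat B.X f" "\<forall>z. z \<notin> B.K \<longrightarrow> colour f H z = C' z"
    "\<forall>z. z \<notin> A.K \<longrightarrow> colour (\<lambda>x p. f (h x) (h p)) H z = C z"
    unfolding carried_def B.X_def A.K_def B.K_def by blast
  have "flat A.X (\<lambda>x p. f (h x) (h p))" by (rule flat_pullback[OF f(1) image(1) cont(1)])
  then show "carried L D' D h' H C' C"
    unfolding carried_def using f(2,3)
    by (intro exI[of _ "\<lambda>x p. f (h x) (h p)"]) (simp add: inv A.X_def A.K_def B.K_def)
qed

lemma corresponds_exists:
  assumes "colouring D C"
  shows "\<exists>C'. colouring D' C' \<and> corresponds C C'"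
proof -
  obtain f where f: "flat A.X f" "\<forall>z. z \<notin> A.K \<longrightarrow> colour f H z = C z" using A.colouring_realised[OF assms] by blast
  let ?f = "\<lambda>x p. f (h' x) (h' p)"
  have fl: "flat B.X ?f" by (rule flat_pullback[OF f(1) image(2) cont(2)])
  have "corresponds C (colour ?f H)"
    unfolding carried_def using f(2) fl by (intro exI[of _ ?f]) (simp add: inv B.X_def A.K_def)
  then show ?thesis using B.colour_colouring[OF fl] by blast
qed

text \<open>The gauge transformation between the two pullbacks is trivial at the base points;
  \<open>h\<close> fixes these, so after moving it to the other link it leaves the colours
  unchanged.\<close>

lemma corresponds_unique:
  assumes "corresponds C C1" "corresponds C C2" "z \<notin> B.K"
  shows "C1 z = C2 z"
proof -
  obtain f1 where f1: "flat B.X f1" "\<forall>z. z \<notin> B.K \<longrightarrow> colour f1 H z = C1 z"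
    "\<forall>z. z \<notin> A.K \<longrightarrow> colour (\<lambda>x p. f1 (h x) (h p)) H z = C z"
    using assms(1) unfolding carried_def B.X_def A.K_def B.K_def by blast
  obtain f2 where f2: "flat B.X f2" "\<forall>z. z \<notin> B.K \<longrightarrow> colour f2 H z = C2 z"
    "\<forall>z. z \<notin> A.K \<longrightarrow> colour (\<lambda>x p. f2 (h x) (h p)) H z = C z"
    using assms(2) unfolding carried_def B.X_def A.K_def B.K_def by blast
  obtain \<gamma> where \<gamma>: "\<forall>x\<in>A.X. \<forall>\<^sub>F p in nhds x. f2 (h x) (h p) = - \<gamma> x + f1 (h x) (h p) + \<gamma> p"
    "\<gamma> (0, H) = 0" "\<gamma> (0, - H) = 0"
    using A.colour_injective[OF flat_pullback[OF f1(1) image(1) cont(1)] flat_pullback[OF f2(1) image(1) cont(1)]]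
      f1(3) f2(3) by auto
  have "\<forall>\<^sub>F p in nhds x. f2 x p = - \<gamma> (h' x) + f1 x p + \<gamma> (h' p)" if x: "x \<in> B.X" for x
  proof -
    have "h' x \<in> A.X" using image(2) x by blast
    from eventually_compose_filterlim[OF bspec[OF \<gamma>(1) this] isCont_nhds[OF cont(2)]]
    have "\<forall>\<^sub>F p in nhds x. f2 (h (h' x)) (h (h' p)) = - \<gamma> (h' x) + f1 (h (h' x)) (h (h' p)) + \<gamma> (h' p)" .
    then show ?thesis by (simp add: inv)
  qed
  from B.colour_gauge[OF f1(1) this assms(3)]
  have "colour f2 H z = - \<gamma> (h' (0, H)) + colour f1 H z + \<gamma> (h' (0, - H))" .
  moreover have "h' (0, H) = (0, H)" "h' (0, - H) = (0, - H)" using fixed inv(1) by metis+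
  ultimately show ?thesis using f1(2) f2(2) assms(3) \<gamma>(2,3) by simp
qed

lemma corresponds_hom:
  assumes "corresponds C C'" and \<phi>: "\<And>a b. \<phi> (a + b) = \<phi> a + \<phi> b"
  shows "corresponds (\<lambda>z. \<phi> (C z)) (\<lambda>z. \<phi> (C' z))"
proof -
  obtain f where f: "flat B.X f" "\<forall>z. z \<notin> B.K \<longrightarrow> colour f H z = C' z"
    "\<forall>z. z \<notin> A.K \<longrightarrow> colour (\<lambda>x p. f (h x) (h p)) H z = C z"
    using assms(1) unfolding carried_def B.X_def A.K_def B.K_def by blast
  have "flat B.X (\<lambda>x p. \<phi> (f x p))" by (rule flat_hom[OF f(1) \<phi>])
  moreover have "colour (\<lambda>x p. \<phi> (f x p)) H z = \<phi> (C' z)" if "z \<notin> B.K" for z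
    using B.colour_hom[OF f(1) \<phi> that] f(2) that by simp
  moreover have "colour (\<lambda>x p. \<phi> (f (h x) (h p))) H z = \<phi> (C z)" if "z \<notin> A.K" for z
    using A.colour_hom[OF flat_pullback[OF f(1) image(1) cont(1)] \<phi> that] f(3) that by simp
  ultimately show ?thesis unfolding carried_def by (intro exI[of _ "\<lambda>x p. \<phi> (f x p)"]) (simp add: A.K_def B.K_def B.X_def)
qed

text \<open>Among integer colourings the index is singled out by the winding condition, which lives
  in space and therefore passes through \<open>h\<close>.\<close>

lemma corresponds_index:
  assumes "corresponds k k'" "index D k"
  shows "index D' k'"
proof -
  obtain f where f: "flat B.X f" "\<forall>z. z \<notin> B.K \<longrightarrow> colour f H z = k' z"
    "\<forall>z. z \<notin> A.K \<longrightarrow> colour (\<lambda>x p. f (h x) (h p)) H z = k z"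
    using assms(1) unfolding carried_def B.X_def A.K_def B.K_def by blast
  have "winds_link (\<lambda>x p. f (h x) (h p)) L"
    by (rule A.index_winds_link[OF assms(2) flat_pullback[OF f(1) image(1) cont(1)]]) (use f(3) in blast)
  from isotopic_byD(8)[OF iso this] have "winds_link f L'" by (simp add: inv)
  from B.winds_index[OF f(1) this] show ?thesis by (rule B.index_cong) (use f(2) in simp)
qed

end

lemma isotopic_diagrams_exist:
  assumes "is_diagram_of D L" "is_diagram_of D' L'" "same_oriented_link L L'"
  shows "\<exists>H0 H h h'. isotopic_diagrams L D L' D' H0 H h h'"
proof -
  obtain h h' where iso: "isotopic_by L L' h h'" using same_oriented_link_isotopic[OF assms(3)] by blast
  interpret A: projected_link L D by unfold_locales (rule assms(1))
  interpret B: projected_link L' D' by unfold_locales (rule assms(2))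
  have bounded: "bounded (carrier_of E)" if "finite E" for E :: link
    unfolding carrier_of_def using that by (intro bounded_UN) (auto simp: seg_def bounded_closed_segment)
  have "bounded (carrier_of L \<union> carrier_of L')" using bounded by simp
  then obtain H0 where H0: "\<And>p. p \<in> carrier_of L \<union> carrier_of L' \<Longrightarrow> norm p \<le> H0" unfolding bounded_iff by blast
  have snd_le: "\<bar>snd p\<bar> \<le> norm p" for p :: space
    using norm_snd_le[of "snd p" "fst p"] by simp
  obtain b where b: "\<And>p. norm p > b \<Longrightarrow> h p = p" using isotopic_byD(6)[OF iso] by blast
  \<comment> \<open>Above both links and outside the region moved by \<open>h\<close>, so that the
    base points are fixed.\<close>
  define H where "H = max (max H0 b) 0 + 1"
  have "isotopic_diagrams L D L' D' H0 H h h'"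
  proof unfold_locales
    show "\<bar>snd p\<bar> \<le> H0" if "p \<in> carrier_of L" for p using H0[of p] that snd_le[of p] by simp
    show "\<bar>snd p\<bar> \<le> H0" if "p \<in> carrier_of L'" for p using H0[of p] that snd_le[of p] by simp
    show "h (0, H) = (0, H)" "h (0, - H) = (0, - H)" by (rule b, simp add: norm_Pair H_def)+
  qed (use iso in \<open>auto simp: H_def\<close>)
  then show ?thesis by blast
qed

section \<open>A module containing all finitely presented modules\<close>

text \<open>A presentation \<open>(n, m, M)\<close> has \<open>n\<close> relations between \<open>m\<close> generators.\<close>

type_synonym 'r presentation = "nat \<times> nat \<times> (nat \<Rightarrow> nat \<Rightarrow> 'r)"

text \<open>Only the coordinates below the number of generators matter, so infinite vectors can
  represent the elements of a cokernel.\<close>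

definition relator :: "'r::comm_ring_1 presentation \<Rightarrow> (nat \<Rightarrow> 'r) \<Rightarrow> bool" where
  "relator p v \<longleftrightarrow> (\<exists>q. \<forall>j<fst (snd p). v j = (\<Sum>i<fst p. q i * snd (snd p) i j))"

lemma relator_zero: "relator p (\<lambda>j. 0)"
  unfolding relator_def by (intro exI[of _ "\<lambda>_. 0"]) simp

lemma relator_add:
  assumes "relator p v" "relator p w"
  shows "relator p (\<lambda>j. v j + w j)"
proof -
  obtain q r where "\<forall>j<fst (snd p). v j = (\<Sum>i<fst p. q i * snd (snd p) i j)"
    "\<forall>j<fst (snd p). w j = (\<Sum>i<fst p. r i * snd (snd p) i j)" using assms unfolding relator_def by blast
  then show ?thesis unfolding relator_def by (intro exI[of _ "\<lambda>i. q i + r i"]) (simp add: distrib_right sum.distrib)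
qed

lemma relator_scale:
  assumes "relator p v"
  shows "relator p (\<lambda>j. c * v j)"
proof -
  obtain q where "\<forall>j<fst (snd p). v j = (\<Sum>i<fst p. q i * snd (snd p) i j)" using assms unfolding relator_def by blast
  then show ?thesis unfolding relator_def by (intro exI[of _ "\<lambda>i. c * q i"]) (simp add: sum_distrib_left mult.assoc)
qed

lemma relator_minus: "relator p (\<lambda>j. v j - w j) \<Longrightarrow> relator p (\<lambda>j. w j - v j)"
  using relator_scale[of p "\<lambda>j. v j - w j" "- 1"] by simp

lemma relator_trans:
  assumes "relator p (\<lambda>j. u j - v j)" "relator p (\<lambda>j. v j - w j)"
  shows "relator p (\<lambda>j. u j - w j)"
  using relator_add[OF assms] by simp

definition same_class :: "('r::comm_ring_1 presentation \<Rightarrow> nat \<Rightarrow> 'r) \<Rightarrow> ('r presentation \<Rightarrow> nat \<Rightarrow> 'r) \<Rightarrow> bool" where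
  "same_class f g \<longleftrightarrow> (\<forall>p. relator p (\<lambda>j. f p j - g p j))"

lemma equivp_same_class: "equivp same_class"
proof (rule equivpI)
  show "reflp same_class" by (auto simp: reflp_def same_class_def relator_zero)
  show "symp same_class" unfolding symp_def same_class_def using relator_minus by blast
  show "transp same_class" unfolding transp_def same_class_def using relator_trans by blast
qed

text \<open>The product of the modules given by all presentations: a single type carries the values of
  the colourings of all diagrams.\<close>

quotient_type (overloaded) 'r presented = "'r::comm_ring_1 presentation \<Rightarrow> nat \<Rightarrow> 'r" / same_class
  by (rule equivp_same_class)

instantiation presented :: (comm_ring_1) ab_group_add
begin

lift_definition zero_presented :: "'a presented" is "\<lambda>p j. 0" .

lift_definition plus_presented :: "'a presented \<Rightarrow> 'a presented \<Rightarrow> 'a presented" is "\<lambda>f g p j. f p j + g p j"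
  unfolding same_class_def
proof
  fix f f' g g' :: "'a presentation \<Rightarrow> nat \<Rightarrow> 'a" and p
  assume "\<forall>p. relator p (\<lambda>j. f p j - f' p j)" "\<forall>p. relator p (\<lambda>j. g p j - g' p j)"
  then have "relator p (\<lambda>j. (f p j - f' p j) + (g p j - g' p j))" by (intro relator_add) blast+
  then show "relator p (\<lambda>j. f p j + g p j - (f' p j + g' p j))" by (simp add: algebra_simps)
qed

lift_definition uminus_presented :: "'a presented \<Rightarrow> 'a presented" is "\<lambda>f p j. - f p j"
  unfolding same_class_def using relator_minus by (simp add: relator_minus)

definition minus_presented :: "'a presented \<Rightarrow> 'a presented \<Rightarrow> 'a presented" where "minus_presented a b = a + - b"

instance
  by standard (unfold minus_presented_def, (transfer; simp add: same_class_def add_ac relator_zero)+)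

end

lift_definition smul :: "'r::comm_ring_1 \<Rightarrow> 'r presented \<Rightarrow> 'r presented" (infixr \<open>\<cdot>\<close> 75) is "\<lambda>c f p j. c * f p j"
  unfolding same_class_def right_diff_distrib[symmetric] by (intro allI relator_scale) blast

global_interpretation presented: Modules.module smul
  by standard (transfer; simp add: same_class_def algebra_simps relator_zero)+

text \<open>Inclusion of the factor of the product that is presented by \<open>p\<close>; its kernel
  consists of the relators (\<open>emb_eq_0_iff\<close>).\<close>

lift_definition emb :: "'r presentation \<Rightarrow> (nat \<Rightarrow> 'r::comm_ring_1) \<Rightarrow> 'r presented" is "\<lambda>p v q j. if q = p then v j else 0" .

text \<open>Coordinates taken from a chosen representative, hence meaningful only up to relators of
  \<open>p\<close>.\<close>

definition comp :: "'r presentation \<Rightarrow> 'r::comm_ring_1 presented \<Rightarrow> nat \<Rightarrow> 'r" where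
  "comp p a = rep_presented a p"

lemma emb_eq_iff: "emb p v = emb p w \<longleftrightarrow> relator p (\<lambda>j. v j - w j)"
proof transfer
  fix p :: "'a presentation" and v w
  show "same_class (\<lambda>q j. if q = p then v j else 0) (\<lambda>q j. if q = p then w j else 0) \<longleftrightarrow> relator p (\<lambda>j. v j - w j)"
  proof
    assume "same_class (\<lambda>q j. if q = p then v j else 0) (\<lambda>q j. if q = p then w j else 0)"
    then show "relator p (\<lambda>j. v j - w j)" unfolding same_class_def by (elim allE[of _ p]) simp
  next
    assume *: "relator p (\<lambda>j. v j - w j)"
    show "same_class (\<lambda>q j. if q = p then v j else 0) (\<lambda>q j. if q = p then w j else 0)"
      unfolding same_class_def
    proof
      fix q show "relator q (\<lambda>j. (if q = p then v j else 0) - (if q = p then w j else 0))"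
        using * by (cases "q = p") (simp_all add: relator_zero)
    qed
  qed
qed

lemma same_class_eqI: "f = g \<Longrightarrow> same_class f g"
  using equivp_reflp[OF equivp_same_class] by blast

lemma emb_0: "emb p (\<lambda>j. 0) = 0"
  by transfer (rule same_class_eqI, auto simp: fun_eq_iff)

lemma emb_eq_0_iff: "emb p v = 0 \<longleftrightarrow> relator p v"
  using emb_eq_iff[of p v "\<lambda>j. 0"] by (simp add: emb_0)

lemma emb_add: "emb p (\<lambda>j. v j + w j) = emb p v + emb p w"
  by transfer (rule same_class_eqI, auto simp: fun_eq_iff)

lemma emb_smul: "emb p (\<lambda>j. c * v j) = c \<cdot> emb p v"
  by transfer (rule same_class_eqI, auto simp: fun_eq_iff)

lemma emb_sum: "emb p (\<lambda>j. \<Sum>i\<in>I. v i j) = (\<Sum>i\<in>I. emb p (v i))"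
proof (induction I rule: infinite_finite_induct)
  case (insert x F)
  then show ?case using emb_add[of p "v x" "\<lambda>j. \<Sum>i\<in>F. v i j"] by simp
qed (simp_all add: emb_0)

lemma relator_comp_abs: "relator p (\<lambda>j. comp p (abs_presented f) j - f p j)"
proof -
  have "same_class (rep_presented (abs_presented f)) f"
    using Quotient3_rep_abs[OF Quotient3_presented, of f] equivp_reflp[OF equivp_same_class] by metis
  then show ?thesis unfolding same_class_def comp_def by (rule spec)
qed

text \<open>Projection to one factor, kept as an endomorphism of the whole product so that it can be
  applied to colourings without changing their type.\<close>

definition proj :: "'r presentation \<Rightarrow> 'r::comm_ring_1 presented \<Rightarrow> 'r presented" where
  "proj p a = emb p (comp p a)"

lemma abs_rep: "abs_presented (rep_presented a) = a"
  by (rule Quotient3_abs_rep[OF Quotient3_presented])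

lemma proj_abs: "proj p (abs_presented f) = emb p (f p)"
  unfolding proj_def emb_eq_iff by (rule relator_comp_abs)

lemma proj_emb: "proj p (emb p v) = emb p v"
proof -
  have "proj p (emb p v) = emb p ((\<lambda>q j. if q = p then v j else 0) p)"
    by (subst emb.abs_eq) (rule proj_abs)
  then show ?thesis by simp
qed

lemma proj_add: "proj p (a + b) = proj p a + proj p b"
proof -
  have "a + b = abs_presented (\<lambda>p j. rep_presented a p j + rep_presented b p j)"
    using plus_presented.abs_eq[of "rep_presented a" "rep_presented b"] by (simp add: abs_rep)
  then show ?thesis by (simp add: proj_abs emb_add) (simp add: proj_def comp_def)
qed

lemma proj_smul: "proj p (c \<cdot> a) = c \<cdot> proj p a"
proof -
  have "c \<cdot> a = abs_presented (\<lambda>p j. c * rep_presented a p j)"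
    using smul.abs_eq[of c "rep_presented a"] by (simp add: abs_rep)
  then show ?thesis by (simp add: proj_abs emb_smul) (simp add: proj_def comp_def)
qed

definition linear_map :: "('r::comm_ring_1 presented \<Rightarrow> 'r presented) \<Rightarrow> bool" where
  "linear_map \<phi> \<longleftrightarrow> (\<forall>a b. \<phi> (a + b) = \<phi> a + \<phi> b) \<and> (\<forall>c a. \<phi> (c \<cdot> a) = c \<cdot> \<phi> a)"

lemma linear_proj: "linear_map (proj p)"
  by (simp add: linear_map_def proj_add proj_smul)

text \<open>The homomorphism of presented modules with matrix \<open>V\<close>, zero on the other
  factors. It respects classes if \<open>V\<close> takes relations of \<open>p\<close> to relators
  of \<open>q\<close> (\<open>induced_cong\<close>).\<close>

definition induced :: "'r presentation \<Rightarrow> 'r presentation \<Rightarrow> (nat \<Rightarrow> nat \<Rightarrow> 'r) \<Rightarrow> 'r::comm_ring_1 presented \<Rightarrow> 'r presented" where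
  "induced p q V a = emb q (\<lambda>j. \<Sum>i<fst (snd p). comp p a i * V i j)"

lemma induced_cong:
  assumes V: "\<And>k. k < fst p \<Longrightarrow> relator q (\<lambda>j. \<Sum>i<fst (snd p). snd (snd p) k i * V i j)"
    and vw: "emb p v = emb p w"
  shows "emb q (\<lambda>j. \<Sum>i<fst (snd p). v i * V i j) = emb q (\<lambda>j. \<Sum>i<fst (snd p). w i * V i j)"
proof -
  obtain r where r: "\<forall>i<fst (snd p). v i - w i = (\<Sum>k<fst p. r k * snd (snd p) k i)"
    using vw unfolding emb_eq_iff relator_def by blast
  have "(\<Sum>i<fst (snd p). v i * V i j) - (\<Sum>i<fst (snd p). w i * V i j)
      = (\<Sum>k<fst p. r k * (\<Sum>i<fst (snd p). snd (snd p) k i * V i j))" for j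
  proof -
    have "(\<Sum>i<fst (snd p). v i * V i j) - (\<Sum>i<fst (snd p). w i * V i j) = (\<Sum>i<fst (snd p). (v i - w i) * V i j)"
      by (simp add: sum_subtractf left_diff_distrib)
    also have "\<dots> = (\<Sum>i<fst (snd p). \<Sum>k<fst p. r k * (snd (snd p) k i * V i j))"
      using r by (simp add: sum_distrib_right mult.assoc)
    also have "\<dots> = (\<Sum>k<fst p. r k * (\<Sum>i<fst (snd p). snd (snd p) k i * V i j))"
      by (subst sum.swap) (simp add: sum_distrib_left)
    finally show ?thesis .
  qed
  moreover have "emb q (\<lambda>j. \<Sum>k<fst p. r k * (\<Sum>i<fst (snd p). snd (snd p) k i * V i j)) = 0"
  proof -
    have "emb q (\<lambda>j. \<Sum>k<fst p. r k * (\<Sum>i<fst (snd p). snd (snd p) k i * V i j))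
        = (\<Sum>k<fst p. emb q (\<lambda>j. r k * (\<Sum>i<fst (snd p). snd (snd p) k i * V i j)))" by (rule emb_sum)
    also have "\<dots> = 0" by (rule sum.neutral) (use V in \<open>auto simp: emb_eq_0_iff intro: relator_scale\<close>)
    finally show ?thesis .
  qed
  ultimately show ?thesis unfolding emb_eq_iff by (simp add: emb_eq_0_iff)
qed

lemma linear_induced:
  assumes V: "\<And>k. k < fst p \<Longrightarrow> relator q (\<lambda>j. \<Sum>i<fst (snd p). snd (snd p) k i * V i j)"
  shows "linear_map (induced p q V)"
  unfolding linear_map_def
proof (intro conjI allI)
  fix a b
  have "emb p (comp p (a + b)) = emb p (\<lambda>i. comp p a i + comp p b i)"
    unfolding emb_add using proj_add[of p a b] by (simp add: proj_def)
  from induced_cong[OF V this] show "induced p q V (a + b) = induced p q V a + induced p q V b"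
    by (simp add: induced_def distrib_right sum.distrib emb_add)
next
  fix c a
  have "emb p (comp p (c \<cdot> a)) = emb p (\<lambda>i. c * comp p a i)"
    unfolding emb_smul using proj_smul[of p c a] by (simp add: proj_def)
  from induced_cong[OF V this] show "induced p q V (c \<cdot> a) = c \<cdot> induced p q V a"
    by (simp add: induced_def mult.assoc flip: sum_distrib_left emb_smul)
qed

lemma induced_emb:
  assumes V: "\<And>k. k < fst p \<Longrightarrow> relator q (\<lambda>j. \<Sum>i<fst (snd p). snd (snd p) k i * V i j)"
  shows "induced p q V (emb p v) = emb q (\<lambda>j. \<Sum>i<fst (snd p). v i * V i j)"
  unfolding induced_def by (rule induced_cong[OF V]) (use proj_emb[of p v] in \<open>simp_all add: proj_def\<close>)

section \<open>The affine group\<close>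

lemma laurent_monom_mult: "laurent_monom a b * laurent_monom c d = laurent_monom (a + c) (b + d)"
  by (simp add: laurent_monom_def mult_single)

lemma laurent_monom_0: "laurent_monom 0 0 = 1"
  by (simp add: laurent_monom_def zero_prod_def[symmetric] flip: single_one)

text \<open>\<open>Affine a k\<close> is the map \<open>v \<mapsto> (xy)\<^sup>k v + a\<close>; the sum of two such maps is their composition.\<close>

datatype affine = Affine (translation: "laurent presented") (degree: int)

instantiation affine :: group_add
begin

definition zero_affine :: affine where "zero_affine = Affine 0 0"

fun plus_affine :: "affine \<Rightarrow> affine \<Rightarrow> affine" where
  "plus_affine (Affine a k) (Affine b l) = Affine (a + laurent_monom k k \<cdot> b) (k + l)"

fun uminus_affine :: "affine \<Rightarrow> affine" where
  "uminus_affine (Affine a k) = Affine (- (laurent_monom (- k) (- k) \<cdot> a)) (- k)"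

definition minus_affine :: "affine \<Rightarrow> affine \<Rightarrow> affine" where "minus_affine a b = a + - b"

instance
proof
  fix a b c :: affine
  show "a + b + c = a + (b + c)"
    by (cases a; cases b; cases c) (simp add: presented.scale_right_distrib laurent_monom_mult add.assoc)
  show "0 + a = a" by (cases a) (simp add: zero_affine_def laurent_monom_0)
  show "- a + a = 0" by (cases a) (simp add: zero_affine_def)
  show "a + 0 = a" by (cases a) (simp add: zero_affine_def)
  show "a + - b = a - b" by (simp add: minus_affine_def)
qed

end

lemma degree_add: "degree (a + b) = degree a + degree b"
  by (cases a; cases b) simp

definition map_affine :: "(laurent presented \<Rightarrow> laurent presented) \<Rightarrow> affine \<Rightarrow> affine" where
  "map_affine \<phi> a = Affine (\<phi> (translation a)) (degree a)"

lemma map_affine_add: "linear_map \<phi> \<Longrightarrow> map_affine \<phi> (a + b) = map_affine \<phi> a + map_affine \<phi> b"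
  by (cases a; cases b) (simp add: map_affine_def linear_map_def)

text \<open>Multiplying the label of a region of index \<open>k\<close> by \<open>(-x)\<^sup>k\<close> turns the relation \<open>a + xb + xyc + yd = 0\<close> into
  the crossing relation of colourings by affine maps.\<close>

definition twist :: "int \<Rightarrow> laurent" where
  "twist k = (if even k then 1 else - 1) * laurent_monom k 0"

lemma twist_add: "twist (k + l) = twist k * twist l"
  by (auto simp: twist_def laurent_monom_mult[of k 0 l 0, simplified, symmetric])

lemma twist_0 [simp]: "twist 0 = 1"
  by (simp add: twist_def laurent_monom_0)

lemma twist_cancel [simp]: "twist k \<cdot> twist (- k) \<cdot> a = a" "twist (- k) \<cdot> twist k \<cdot> a = a"
  using twist_add[of k "- k"] twist_add[of "- k" k] by (simp_all add: mult.commute)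

definition alexander_relation :: "laurent presented \<Rightarrow> laurent presented \<Rightarrow> laurent presented \<Rightarrow> laurent presented \<Rightarrow> bool" where
  "alexander_relation a b c d \<longleftrightarrow> a + x_gen \<cdot> b + (x_gen * y_gen) \<cdot> c + y_gen \<cdot> d = 0"

lemma affine_diff: "Affine a k - Affine b l = Affine (a - laurent_monom (k - l) (k - l) \<cdot> b) (k - l)"
  by (simp add: minus_affine_def laurent_monom_mult)

text \<open>Corners \<open>a\<close>, \<open>b\<close>, \<open>c\<close>, \<open>d\<close> have
  index \<open>n + 1\<close>, \<open>n + 2\<close>, \<open>n + 1\<close>, \<open>n\<close>. Forming
  the quotient of two affine maps multiplies the second translation by \<open>xy\<close> here; as
  \<open>xy (-x)^n = - y (-x)^(n+1)\<close> and \<open>(-x)^(n+2) = - x (-x)^(n+1)\<close>,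
  everything has the factor \<open>(-x)^(n+1)\<close>, which is a unit.\<close>

lemma affine_relation:
  "Affine (twist (n + 1) \<cdot> a) (n + 1) - Affine (twist n \<cdot> d) n = Affine (twist (n + 1 + 1) \<cdot> b) (n + 1 + 1) - Affine (twist (n + 1) \<cdot> c) (n + 1)
    \<longleftrightarrow> alexander_relation a b c d"
proof -
  let ?g = "twist (n + 1)" and ?T = "laurent_monom 1 1"
  have T: "?T = x_gen * y_gen" by (simp add: laurent_monom_mult)
  have x: "twist 1 = - x_gen" by (simp add: twist_def)
  have "?T \<cdot> twist n \<cdot> d = ?g \<cdot> (- (y_gen \<cdot> d))"
    by (simp add: twist_add x T mult_ac flip: presented.scale_minus_left)
  moreover have "twist (n + 1 + 1) \<cdot> b = ?g \<cdot> (- (x_gen \<cdot> b))"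
    unfolding twist_add[of "n + 1" 1] x by (simp add: mult_ac flip: presented.scale_minus_left)
  moreover have "?T \<cdot> ?g \<cdot> c = ?g \<cdot> ((x_gen * y_gen) \<cdot> c)" by (simp add: T mult_ac)
  ultimately have "Affine (?g \<cdot> a) (n + 1) - Affine (twist n \<cdot> d) n = Affine (twist (n + 1 + 1) \<cdot> b) (n + 1 + 1) - Affine (?g \<cdot> c) (n + 1)
    \<longleftrightarrow> ?g \<cdot> (a + y_gen \<cdot> d) = ?g \<cdot> (- (x_gen \<cdot> b) - (x_gen * y_gen) \<cdot> c)"
    by (simp add: affine_diff presented.scale_right_distrib presented.scale_right_diff_distrib)
  also have "\<dots> \<longleftrightarrow> a + y_gen \<cdot> d = - (x_gen \<cdot> b) - (x_gen * y_gen) \<cdot> c"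
    using twist_cancel(2)[of "n + 1"] by metis
  also have "\<dots> \<longleftrightarrow> alexander_relation a b c d"
    by (auto simp: alexander_relation_def algebra_simps eq_neg_iff_add_eq_0 simp del: presented.scale_scale)
  finally show ?thesis .
qed

section \<open>Common divisors of maximal minors\<close>

hide_const (open) Determinants.det Finite_Cartesian_Product.row
  Finite_Cartesian_Product.mat Finite_Cartesian_Product.vec Finite_Cartesian_Product.transpose
no_notation vec_nth (infixl "$" 90)

text \<open>By Cauchy-Binet, a way to say that \<open>h\<close> divides all maximal minors.
  Quantifying over \<open>X\<close> instead of choosing columns makes multiplication of
  \<open>K\<close> by matrices on either side easy to handle.\<close>

definition max_minors_dvd :: "'a::comm_ring_1 mat \<Rightarrow> 'a \<Rightarrow> bool" where
  "max_minors_dvd K h \<longleftrightarrow> (\<forall>X\<in>carrier_mat (dim_col K) (dim_row K). h dvd det (K * X))"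

lemma max_minors_dvd_mult_left:
  fixes K :: "'a::comm_ring_1 mat"
  assumes "max_minors_dvd K h" "W \<in> carrier_mat (dim_row K) (dim_row K)"
  shows "max_minors_dvd (W * K) h"
  unfolding max_minors_dvd_def
proof
  fix X :: "'a mat" assume "X \<in> carrier_mat (dim_col (W * K)) (dim_row (W * K))"
  then have X: "X \<in> carrier_mat (dim_col K) (dim_row K)" using assms(2) by auto
  have K: "K \<in> carrier_mat (dim_row K) (dim_col K)" by simp
  have "det (W * K * X) = det W * det (K * X)"
    using assoc_mult_mat[OF assms(2) K X] det_mult[OF assms(2) mult_carrier_mat[OF K X]] by simp
  then show "h dvd det (W * K * X)" using assms(1) X by (simp add: max_minors_dvd_def)
qed

text \<open>Laplace expansion along the last row: each cofactor is a determinant of the same kind,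
  with a column removed from \<open>Y\<close>. At the end only \<open>M * Y\<close> is left.\<close>

lemma dvd_det_of_rows:
  assumes M: "M \<in> carrier_mat n m" and h: "max_minors_dvd M h"
    and "A \<in> carrier_mat (n + k) (n + k)" "Y \<in> carrier_mat m (n + k)"
    and "\<And>i j. i < n \<Longrightarrow> j < n + k \<Longrightarrow> A $$ (i, j) = (M * Y) $$ (i, j)"
  shows "h dvd det A"
  using assms(3-)
proof (induction k arbitrary: A Y)
  case 0
  then have "A = M * Y" using M by (intro eq_matI) auto
  then show ?case using h M 0 by (simp add: max_minors_dvd_def)
next
  case (Suc k)
  have "h dvd cofactor A (n + k) j" if j: "j < n + Suc k" for j
  proof -
    define Y' where "Y' = mat m (n + k) (\<lambda>(i, l). Y $$ (i, if l < j then l else Suc l))"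
    have "h dvd det (mat_delete A (n + k) j)"
    proof (rule Suc.IH)
      show "mat_delete A (n + k) j \<in> carrier_mat (n + k) (n + k)"
        using Suc.prems(1) by (simp add: mat_delete_def)
      show "Y' \<in> carrier_mat m (n + k)" by (simp add: Y'_def)
      fix i l assume il: "i < n" "l < n + k"
      have "mat_delete A (n + k) j $$ (i, l) = A $$ (i, if l < j then l else Suc l)"
        using Suc.prems(1) il by (auto simp: mat_delete_def)
      also have "\<dots> = (M * Y) $$ (i, if l < j then l else Suc l)"
        using Suc.prems(3) il by auto
      also have "\<dots> = (M * Y') $$ (i, l)"
        using M Suc.prems(2) il by (auto simp: scalar_prod_def Y'_def)
      finally show "mat_delete A (n + k) j $$ (i, l) = (M * Y') $$ (i, l)" .
    qed
    then show ?thesis by (simp add: cofactor_def)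
  qed
  then have "h dvd (\<Sum>j<n + Suc k. A $$ (n + k, j) * cofactor A (n + k) j)"
    by (intro dvd_sum) auto
  then show ?case using laplace_expansion_row[OF Suc.prems(1), of "n + k"] by simp
qed

lemma det_append_identity:
  fixes A :: "'a::comm_ring_1 mat"
  assumes A: "A \<in> carrier_mat n n"
  shows "det (four_block_mat A (0\<^sub>m n k) (0\<^sub>m k n) (1\<^sub>m k)) = det A"
proof (induction k)
  case 0
  have "four_block_mat A (0\<^sub>m n 0) (0\<^sub>m 0 n) (1\<^sub>m 0) = A" using A by (intro eq_matI) auto
  then show ?case by simp
next
  case (Suc k)
  let ?B = "four_block_mat A (0\<^sub>m n (Suc k)) (0\<^sub>m (Suc k) n) (1\<^sub>m (Suc k))"
  have B: "?B \<in> carrier_mat (n + Suc k) (n + Suc k)" using A by auto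
  have "det ?B = (\<Sum>j<n + Suc k. ?B $$ (n + k, j) * cofactor ?B (n + k) j)"
    by (rule laplace_expansion_row[OF B]) simp
  also have "\<dots> = (\<Sum>j<n + Suc k. if j = n + k then cofactor ?B (n + k) (n + k) else 0)"
    using A by (intro sum.cong) auto
  also have "\<dots> = cofactor ?B (n + k) (n + k)" by simp
  also have "\<dots> = det (mat_delete ?B (n + k) (n + k))"
    by (simp add: cofactor_def)
  also have "mat_delete ?B (n + k) (n + k) = four_block_mat A (0\<^sub>m n k) (0\<^sub>m k n) (1\<^sub>m k)"
    using A by (intro eq_matI) (auto simp: mat_delete_def)
  finally show ?case using Suc.IH by simp
qed

lemma arg_cong4: "a = a' \<Longrightarrow> b = b' \<Longrightarrow> c = c' \<Longrightarrow> d = d' \<Longrightarrow> f a b c d = f a' b' c' d'"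
  by simp

text \<open>A Tietze move: \<open>k\<close> new generators, each with a relation that expresses it
  by the old ones.\<close>

lemma max_minors_dvd_extend:
  fixes M :: "'a::comm_ring_1 mat"
  assumes M: "M \<in> carrier_mat n m" and P: "P \<in> carrier_mat k m"
  shows "max_minors_dvd (four_block_mat M (0\<^sub>m n k) P (1\<^sub>m k)) h \<longleftrightarrow> max_minors_dvd M h"
    (is "max_minors_dvd ?K h \<longleftrightarrow> _")
proof
  have dK: "dim_row ?K = n + k" "dim_col ?K = m + k" using M P by auto
  {
    assume h: "max_minors_dvd M h"
    show "max_minors_dvd ?K h"
      unfolding max_minors_dvd_def dK
    proof
      fix X :: "'a mat" assume X: "X \<in> carrier_mat (m + k) (n + k)"
      define Y where "Y = mat m (n + k) (\<lambda>(i, j). X $$ (i, j))"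
      show "h dvd det (?K * X)"
      proof (rule dvd_det_of_rows[OF M h])
        show "?K * X \<in> carrier_mat (n + k) (n + k)" using X dK by auto
        show "Y \<in> carrier_mat m (n + k)" by (simp add: Y_def)
        fix i j assume ij: "i < n" "j < n + k"
        have "(?K * X) $$ (i, j) = (\<Sum>l<m + k. ?K $$ (i, l) * X $$ (l, j))"
          using X dK ij by (simp add: scalar_prod_def atLeast0LessThan)
        also have "\<dots> = (\<Sum>l<m. ?K $$ (i, l) * X $$ (l, j))"
          using M P ij by (intro sum.mono_neutral_right) auto
        also have "\<dots> = (M * Y) $$ (i, j)"
          using M P ij by (simp add: scalar_prod_def atLeast0LessThan Y_def)
        finally show "(?K * X) $$ (i, j) = (M * Y) $$ (i, j)" .
      qed
    qed
  }
  {
    assume h: "max_minors_dvd ?K h"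
    show "max_minors_dvd M h"
      unfolding max_minors_dvd_def
    proof
      fix X :: "'a mat" assume "X \<in> carrier_mat (dim_col M) (dim_row M)"
      then have X: "X \<in> carrier_mat m n" using M by auto
      have PX: "P * X \<in> carrier_mat k n" using P X by simp
      \<comment> \<open>The lower left block is chosen to cancel \<open>P * X\<close>, so that the
        product becomes block diagonal with an identity block.\<close>
      let ?X = "four_block_mat X (0\<^sub>m m k) (- (P * X)) (1\<^sub>m k)"
      have "?K * ?X = four_block_mat (M * X + 0\<^sub>m n k * (- (P * X))) (M * 0\<^sub>m m k + 0\<^sub>m n k * 1\<^sub>m k)
          (P * X + 1\<^sub>m k * (- (P * X))) (P * 0\<^sub>m m k + 1\<^sub>m k * 1\<^sub>m k)"
        by (rule mult_four_block_mat[OF M _ P]) (use X P in auto)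
      also have "\<dots> = four_block_mat (M * X) (0\<^sub>m n k) (0\<^sub>m k n) (1\<^sub>m k)"
        using M X P PX by (intro arg_cong4[where f = four_block_mat]) (auto intro!: eq_matI)
      finally have "det (?K * ?X) = det (M * X)"
        using det_append_identity[of "M * X" n k] M X by simp
      moreover have "?X \<in> carrier_mat (dim_col ?K) (dim_row ?K)" using M P X by auto
      ultimately show "h dvd det (M * X)" using h by (metis max_minors_dvd_def)
    qed
  }
qed

text \<open>A repeated column makes the determinant 0. Otherwise all columns but two are chosen, and
  putting them in order costs a sign.\<close>

lemma dvd_det_select:
  fixes M :: "'a::comm_ring_1 mat"
  assumes M: "M \<in> carrier_mat n (n + 2)"
    and h: "\<And>p q. p < q \<Longrightarrow> q < n + 2 \<Longrightarrow> h dvd det (submatrix M UNIV (- {p, q}))"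
    and f: "\<And>i. i < n \<Longrightarrow> f i < n + 2"
  shows "h dvd det (mat n n (\<lambda>(i, j). M $$ (j, f i)))"
proof (cases "inj_on f {0..<n}")
  case False
  then obtain i j where ij: "i < n" "j < n" "i \<noteq> j" "f i = f j" by (auto simp: inj_on_def)
  have "det (mat n n (\<lambda>(i, j). M $$ (j, f i))) = 0"
    by (rule det_identical_rows[of _ n i j]) (use ij in \<open>auto simp: Matrix.row_def\<close>)
  then show ?thesis by simp
next
  case True
  define J where "J = f ` {0..<n}"
  have J: "J \<subseteq> {0..<n+2}" "finite J" "card J = n" using f True by (auto simp: J_def card_image)
  have "card ({0..<n+2} - J) = 2" using J by (simp add: card_Diff_subset)
  then obtain p q where pq: "{0..<n+2} - J = {p, q}" "p < q"
    by (metis card_2_iff insert_commute nat_neq_iff)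
  have "{0..<n+2} - {p, q} = J" using pq(1) J(1) by blast
  moreover have q: "q < n + 2" using pq by auto
  ultimately have J': "{j. j < n + 2 \<and> j \<in> - {p, q}} = J" by auto
  let ?S = "submatrix M UNIV (- {p, q})"
  have S: "?S \<in> carrier_mat n n" using J' J(3) M by (auto simp: dim_submatrix)
  \<comment> \<open>The position of column \<open>j\<close> among the columns that are kept, inverse
    to \<open>pick\<close>.\<close>
  define c where "c = (\<lambda>j. card {a \<in> - {p, q}. a < j})"
  have c: "pick (- {p, q}) (c j) = j" "c j < n" if "j \<in> J" for j
  proof -
    have "j \<in> - {p, q}" "j < n + 2" using that J' by auto
    then show "pick (- {p, q}) (c j) = j" unfolding c_def by (intro pick_card_in_set)
    have "{a \<in> - {p, q}. a < j} \<subset> J" using that J' by auto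
    then show "c j < n" using J(2,3) psubset_card_mono unfolding c_def by metis
  qed
  define \<pi> where "\<pi> = (\<lambda>i. if i < n then c (f i) else i)"
  have "inj_on \<pi> {0..<n}"
  proof (rule inj_onI)
    fix i j assume ij: "i \<in> {0..<n}" "j \<in> {0..<n}" "\<pi> i = \<pi> j"
    then have "c (f i) = c (f j)" by (simp add: \<pi>_def)
    then have "f i = f j" using c(1) ij J_def by (metis imageI)
    then show "i = j" using True ij by (auto simp: inj_on_def)
  qed
  moreover have "\<pi> ` {0..<n} \<subseteq> {0..<n}" using c(2) by (auto simp: \<pi>_def J_def)
  ultimately have "bij_betw \<pi> {0..<n} {0..<n}"
    by (simp add: bij_betw_def endo_inj_surj)
  then have \<pi>: "\<pi> permutes {0..<n}" by (rule bij_imp_permutes) (simp add: \<pi>_def)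
  have "mat n n (\<lambda>(i, j). M $$ (j, f i)) = mat n n (\<lambda>(i, j). transpose_mat ?S $$ (\<pi> i, j))"
  proof (rule eq_matI)
    fix i j assume "i < dim_row (mat n n (\<lambda>(i, j). transpose_mat ?S $$ (\<pi> i, j)))"
      "j < dim_col (mat n n (\<lambda>(i, j). transpose_mat ?S $$ (\<pi> i, j)))"
    then have ij: "i < n" "j < n" by auto
    have fi: "f i \<in> J" using ij by (auto simp: J_def)
    have "transpose_mat ?S $$ (\<pi> i, j) = ?S $$ (j, \<pi> i)" using S c(2)[OF fi] ij by (simp add: \<pi>_def)
    also have "\<dots> = M $$ (pick UNIV j, pick (- {p, q}) (\<pi> i))"
      by (rule submatrix_index) (use M J' J(3) ij c(2)[OF fi] in \<open>auto simp: \<pi>_def\<close>)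
    also have "\<dots> = M $$ (j, f i)" using c(1)[OF fi] ij by (simp add: pick_UNIV \<pi>_def)
    finally show "mat n n (\<lambda>(i, j). M $$ (j, f i)) $$ (i, j) = mat n n (\<lambda>(i, j). transpose_mat ?S $$ (\<pi> i, j)) $$ (i, j)"
      using ij by simp
  qed auto
  then have "det (mat n n (\<lambda>(i, j). M $$ (j, f i))) = of_int (sign \<pi>) * det ?S"
    using det_permute_rows[of "transpose_mat ?S" n \<pi>] S \<pi> det_transpose[OF S] by simp
  then show ?thesis using h[OF pq(2) q] by simp
qed

text \<open>A selection matrix \<open>X\<close> produces any single minor. Conversely the
  determinant is multilinear in the columns of \<open>M * X\<close>, which are combinations of
  columns of \<open>M\<close>, so it is a combination of determinants of chosen columns.\<close>

lemma max_minors_dvd_iff: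
  fixes M :: "'a::comm_ring_1 mat"
  assumes M: "M \<in> carrier_mat n (n + 2)"
  shows "max_minors_dvd M h \<longleftrightarrow> (\<forall>s\<in>two_column_minors M. h dvd s)"
proof
  assume h: "max_minors_dvd M h"
  show "\<forall>s\<in>two_column_minors M. h dvd s"
  proof
    fix s assume "s \<in> two_column_minors M"
    then obtain p q where pq: "p < q" "q < n + 2" and s: "s = det (submatrix M UNIV (- {p, q}))"
      using M by (auto simp: two_column_minors_def)
    let ?S = "submatrix M UNIV (- {p, q})"
    have "{j. j < n + 2 \<and> j \<in> - {p, q}} = {0..<n+2} - {p, q}" by auto
    then have card: "card {j. j < n + 2 \<and> j \<in> - {p, q}} = n" using pq by (simp add: card_Diff_subset)
    then have S: "?S \<in> carrier_mat n n" using M by (auto simp: dim_submatrix)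
    define X where "X = mat (n + 2) n (\<lambda>(i, j). if i = pick (- {p, q}) j then 1 else 0 :: 'a)"
    have "M * X = ?S"
    proof (rule eq_matI)
      fix i j assume "i < dim_row ?S" "j < dim_col ?S"
      then have ij: "i < n" "j < n" using S by auto
      have lt: "pick (- {p, q}) j < n + 2" using pick_le[of j "n + 2" "- {p, q}"] card ij by simp
      have "(M * X) $$ (i, j) = (\<Sum>l<n + 2. if l = pick (- {p, q}) j then M $$ (i, l) else 0)"
        using M ij by (simp add: scalar_prod_def atLeast0LessThan X_def if_distrib[of "\<lambda>x. _ * x"]
            del: sum.lessThan_Suc cong: if_cong)
      also have "\<dots> = M $$ (i, pick (- {p, q}) j)" using lt by (simp del: sum.lessThan_Suc)
      also have "\<dots> = ?S $$ (i, j)"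
        by (subst submatrix_index) (use M card ij in \<open>auto simp: pick_UNIV\<close>)
      finally show "(M * X) $$ (i, j) = ?S $$ (i, j)" .
    qed (use M S in \<open>auto simp: X_def\<close>)
    moreover have "h dvd det (M * X)" using h M by (simp add: max_minors_dvd_def X_def)
    ultimately show "h dvd s" using s by simp
  qed
next
  assume "\<forall>s\<in>two_column_minors M. h dvd s"
  then have h: "h dvd det (submatrix M UNIV (- {p, q}))" if "p < q" "q < n + 2" for p q
    using M that by (auto simp: two_column_minors_def)
  show "max_minors_dvd M h"
    unfolding max_minors_dvd_def
  proof
    fix X :: "'a mat" assume "X \<in> carrier_mat (dim_col M) (dim_row M)"
    then have X: "X \<in> carrier_mat (n + 2) n" using M by auto
    let ?S = "{0..<n + 2}"
    let ?a = "\<lambda>i k. X $$ (k, i) \<cdot>\<^sub>v Matrix.col M k"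
    have MX: "M * X \<in> carrier_mat n n" using M X by auto
    have "transpose_mat (M * X) = mat\<^sub>r n n (\<lambda>i. finsum_vec TYPE('a) n (?a i) ?S)"
    proof (rule eq_matI)
      fix i j assume "i < dim_row (mat\<^sub>r n n (\<lambda>i. finsum_vec TYPE('a) n (?a i) ?S))"
        "j < dim_col (mat\<^sub>r n n (\<lambda>i. finsum_vec TYPE('a) n (?a i) ?S))"
      then have ij: "i < n" "j < n" by auto
      have "finsum_vec TYPE('a) n (?a i) ?S $ j = (\<Sum>k\<in>?S. ?a i k $ j)"
        by (rule index_finsum_vec) (use M X ij in auto)
      also have "\<dots> = (M * X) $$ (j, i)"
        using M X ij by (auto simp: scalar_prod_def mult.commute intro!: sum.cong)
      finally show "transpose_mat (M * X) $$ (i, j) = mat\<^sub>r n n (\<lambda>i. finsum_vec TYPE('a) n (?a i) ?S) $$ (i, j)"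
        using ij MX M X by simp
    qed (use M X in auto)
    then have "det (M * X) = det (mat\<^sub>r n n (\<lambda>i. finsum_vec TYPE('a) n (?a i) ?S))"
      using det_transpose[OF MX] by simp
    also have "\<dots> = (\<Sum>f | (\<forall>i\<in>{0..<n}. f i \<in> ?S) \<and> (\<forall>i. i \<notin> {0..<n} \<longrightarrow> f i = i). det (mat\<^sub>r n n (\<lambda>i. ?a i (f i))))"
      by (rule det_linear_rows_sum) (use M X in auto)
    also have "h dvd \<dots>"
    proof (rule dvd_sum)
      fix f assume "f \<in> {f. (\<forall>i\<in>{0..<n}. f i \<in> ?S) \<and> (\<forall>i. i \<notin> {0..<n} \<longrightarrow> f i = i)}"
      then have f: "\<And>i. i < n \<Longrightarrow> f i < n + 2" by auto
      have "mat\<^sub>r n n (\<lambda>i. Matrix.col M (f i)) = mat n n (\<lambda>(i, j). M $$ (j, f i))"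
        using M f by (intro eq_matI) auto
      then have "h dvd det (mat\<^sub>r n n (\<lambda>i. Matrix.col M (f i)))"
        using dvd_det_select[OF M h f] by simp
      then show "h dvd det (mat\<^sub>r n n (\<lambda>i. ?a i (f i)))"
        by (subst det_rows_mul) (use M in auto)
    qed
    finally show "h dvd det (M * X)" .
  qed
qed

lemma max_minors_dvd_right_mult:
  fixes K :: "'a::comm_ring_1 mat"
  assumes "max_minors_dvd K h" "C \<in> carrier_mat (dim_col K) (dim_col K)"
  shows "max_minors_dvd (K * C) h"
  unfolding max_minors_dvd_def
proof
  fix X :: "'a mat" assume "X \<in> carrier_mat (dim_col (K * C)) (dim_row (K * C))"
  then have X: "X \<in> carrier_mat (dim_col K) (dim_row K)" using assms(2) by auto
  have K: "K \<in> carrier_mat (dim_row K) (dim_col K)" by simp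
  have "K * C * X = K * (C * X)" using assoc_mult_mat[OF K assms(2) X] .
  then show "h dvd det (K * C * X)" using assms X by (auto simp: max_minors_dvd_def)
qed

text \<open>
  Both block matrices present the module generated by the generators of both presentations, so
  that each is a multiple of the other.
\<close>

lemma max_minors_dvd_transfer:
  fixes M M' :: "'a::comm_ring_1 mat"
  assumes M: "M \<in> carrier_mat n m" and M': "M' \<in> carrier_mat n' m'"
    and P: "P \<in> carrier_mat m' m" and P': "P' \<in> carrier_mat m m'"
    and Q: "Q \<in> carrier_mat n' n" and Z: "Z \<in> carrier_mat m n"
    and MP: "M' * P = Q * M" and PP: "1\<^sub>m m - P' * P = Z * M"
    and size: "n + m' = n' + m"
    and h: "max_minors_dvd M h"
  shows "max_minors_dvd M' h"
proof -
  let ?K1 = "four_block_mat M (0\<^sub>m n m') (- P) (1\<^sub>m m')"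
  let ?J = "four_block_mat (0\<^sub>m m m') (1\<^sub>m m) (1\<^sub>m m') (0\<^sub>m m' m)"
  let ?W = "four_block_mat Q M' Z (- P')"
  let ?K2 = "four_block_mat M' (0\<^sub>m n' m) (- P') (1\<^sub>m m)"
  have "max_minors_dvd ?K1 h" using max_minors_dvd_extend[OF M, of "- P"] P h by simp
  moreover have W: "?W \<in> carrier_mat (n + m') (n + m')" using Q M' Z P' size by auto
  ultimately have "max_minors_dvd (?W * ?K1) h"
    using M P by (intro max_minors_dvd_mult_left) auto
  moreover have "?W * ?K1 = four_block_mat (0\<^sub>m n' m) M' (1\<^sub>m m) (- P')"
  proof -
    have "?W * ?K1 = four_block_mat (Q * M + M' * (- P)) (Q * 0\<^sub>m n m' + M' * 1\<^sub>m m')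
        (Z * M + (- P') * (- P)) (Z * 0\<^sub>m n m' + (- P') * 1\<^sub>m m')"
      by (rule mult_four_block_mat[OF Q M' Z _ M]) (use P P' in auto)
    moreover have "Q * M + M' * (- P) = 0\<^sub>m n' m"
      using MP[symmetric] M' P by (intro eq_matI) (auto simp: scalar_prod_def sum_negf)
    moreover have "Z * M + (- P') * (- P) = 1\<^sub>m m"
      using PP[symmetric] P P' by (intro eq_matI) (auto simp: scalar_prod_def sum_negf)
    moreover have "Q * 0\<^sub>m n m' + M' * 1\<^sub>m m' = M'" "Z * 0\<^sub>m n m' + (- P') * 1\<^sub>m m' = - P'"
      using Q M' Z P' by auto
    ultimately show ?thesis by simp
  qed
  ultimately have "max_minors_dvd (four_block_mat (0\<^sub>m n' m) M' (1\<^sub>m m) (- P')) h" by simp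
  then have "max_minors_dvd (four_block_mat (0\<^sub>m n' m) M' (1\<^sub>m m) (- P') * ?J) h"
    by (rule max_minors_dvd_right_mult) (use M' P' in auto)
  moreover have "four_block_mat (0\<^sub>m n' m) M' (1\<^sub>m m) (- P') * ?J =
    four_block_mat (0\<^sub>m n' m * 0\<^sub>m m m' + M' * 1\<^sub>m m') (0\<^sub>m n' m * 1\<^sub>m m + M' * 0\<^sub>m m' m)
     (1\<^sub>m m * 0\<^sub>m m m' + (- P') * 1\<^sub>m m') (1\<^sub>m m * 1\<^sub>m m + (- P') * 0\<^sub>m m' m)"
    by (rule mult_four_block_mat) (use M' P' in auto)
  moreover have "\<dots> = ?K2" using M' P' by auto
  ultimately have "max_minors_dvd ?K2 h" by simp
  then show ?thesis using max_minors_dvd_extend[OF M', of "- P'"] P' by simp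
qed

section \<open>Alexander colourings\<close>

definition alexander :: "diagram \<Rightarrow> (complex \<Rightarrow> laurent presented) \<Rightarrow> bool" where
  "alexander D c \<longleftrightarrow>
     (\<forall>z. z \<notin> carrier_of (strands D) \<longrightarrow> (\<forall>\<^sub>F w in nhds z. c w = c z)) \<and>
     (\<forall>(e, f)\<in>crossings D. \<forall>p\<in>seg e \<inter> seg f. \<exists>r>0.
        \<forall>z1\<in>sector e f p r 1 (-1). \<forall>z2\<in>sector e f p r 1 1. \<forall>z3\<in>sector e f p r (-1) 1. \<forall>z4\<in>sector e f p r (-1) (-1).
        alexander_relation (c z1) (c z2) (c z3) (c z4))"

lemma sector_mono: "r \<le> s \<Longrightarrow> sector e f p r \<sigma> \<tau> \<subseteq> sector e f p s \<sigma> \<tau>"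
  by (auto simp: sector_def)

text \<open>Replaces one condition on germs of the four sectors by another, when the implication is
  known only within a fixed radius, such as the one in which the index is known.\<close>

lemma sector_ball_mono:
  assumes "r > 0" and PQ: "\<And>a b c d. a \<in> sector e f p r 1 (-1) \<Longrightarrow> b \<in> sector e f p r 1 1 \<Longrightarrow>
      c \<in> sector e f p r (-1) 1 \<Longrightarrow> d \<in> sector e f p r (-1) (-1) \<Longrightarrow> P a b c d \<Longrightarrow> Q a b c d"
    and "\<exists>r>0. \<forall>a\<in>sector e f p r 1 (-1). \<forall>b\<in>sector e f p r 1 1. \<forall>c\<in>sector e f p r (-1) 1. \<forall>d\<in>sector e f p r (-1) (-1). P a b c d"
  shows "\<exists>r>0. \<forall>a\<in>sector e f p r 1 (-1). \<forall>b\<in>sector e f p r 1 1. \<forall>c\<in>sector e f p r (-1) 1. \<forall>d\<in>sector e f p r (-1) (-1). Q a b c d"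
proof -
  from assms(3) obtain s where s: "s > 0" "\<forall>a\<in>sector e f p s 1 (-1). \<forall>b\<in>sector e f p s 1 1. \<forall>c\<in>sector e f p s (-1) 1. \<forall>d\<in>sector e f p s (-1) (-1). P a b c d"
    by (elim exE conjE) (rule that)
  have sub: "z \<in> sector e f p r \<sigma> \<tau>" "z \<in> sector e f p s \<sigma> \<tau>" if "z \<in> sector e f p (min r s) \<sigma> \<tau>" for z \<sigma> \<tau>
    using that sector_mono[of "min r s" r] sector_mono[of "min r s" s] by (meson min.cobounded1 min.cobounded2 subsetD)+
  show ?thesis
  proof (intro exI[of _ "min r s"] conjI ballI)
    show "min r s > 0" using assms(1) s(1) by simp
    fix a b c d assume "a \<in> sector e f p (min r s) 1 (-1)" "b \<in> sector e f p (min r s) 1 1"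
      "c \<in> sector e f p (min r s) (-1) 1" "d \<in> sector e f p (min r s) (-1) (-1)"
    note m = sub[OF this(1)] sub[OF this(2)] sub[OF this(3)] sub[OF this(4)]
    have "P a b c d" using s(2) m(2,4,6,8) by blast
    then show "Q a b c d" by (rule PQ[OF m(1,3,5,7)])
  qed
qed

definition idx :: "complex set list \<Rightarrow> complex \<Rightarrow> nat" where
  "idx rs z = (THE j. j < length rs \<and> z \<in> rs ! j)"

context projected_link begin

lemma open_region: "R \<in> regions D \<Longrightarrow> open R"
  unfolding regions_def using open_components closed_K K_def by (metis open_Compl)

lemma region_subset: "R \<in> regions D \<Longrightarrow> R \<inter> K = {}"
  using in_components_subset unfolding regions_def K_def by blast

lemma regions_disjoint: "R \<in> regions D \<Longrightarrow> S \<in> regions D \<Longrightarrow> z \<in> R \<Longrightarrow> z \<in> S \<Longrightarrow> R = S"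
  using components_nonoverlap unfolding regions_def by blast

lemma connected_region: "R \<in> regions D \<Longrightarrow> connected R"
  unfolding regions_def by (rule in_components_connected)

lemma idx:
  assumes "distinct rs" "set rs = regions D" "z \<notin> K"
  shows "idx rs z < length rs" "z \<in> rs ! idx rs z" "\<And>j. j < length rs \<Longrightarrow> z \<in> rs ! j \<longleftrightarrow> j = idx rs z"
proof -
  have "z \<in> \<Union>(regions D)" using assms(3) unfolding regions_def K_def by simp
  then obtain R where "R \<in> set rs" "z \<in> R" using assms(2) by blast
  then obtain j where j: "j < length rs" "z \<in> rs ! j" by (metis in_set_conv_nth)
  have uniq: "i = j" if "i < length rs" "z \<in> rs ! i" for i
  proof -
    have "rs ! i = rs ! j" using regions_disjoint[of "rs ! i" "rs ! j" z] that j assms(2) nth_mem by metis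
    then show ?thesis using assms(1) that(1) j(1) by (simp add: nth_eq_iff_index_eq)
  qed
  then have eq: "idx rs z = j" unfolding idx_def using j by (intro the_equality) blast+
  show "idx rs z < length rs" "z \<in> rs ! idx rs z" unfolding eq by (fact j)+
  show "\<And>i. i < length rs \<Longrightarrow> z \<in> rs ! i \<longleftrightarrow> i = idx rs z" unfolding eq using uniq j(2) by blast
qed

definition good :: "complex edge \<Rightarrow> complex edge \<Rightarrow> complex \<Rightarrow> real \<Rightarrow> bool" where
  "good e f p r \<longleftrightarrow> r > 0 \<and> (\<forall>w\<in>ball p r. w \<in> K \<longleftrightarrow> lft e w = 0 \<or> lft f w = 0)"

lemma good_sector: "good e f p r \<Longrightarrow> sector e f p r \<sigma> \<tau> \<inter> K = {}"
  by (auto simp: good_def sector_def)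

text \<open>A small sector is connected and avoids the curve, so it lies in a region as soon as it
  meets it; hence one sample point decides.\<close>

lemma corner_iff:
  assumes c: "(e, f) \<in> crossings D" and p: "p \<in> seg e \<inter> seg f" and r: "good e f p r"
    and C: "\<And>r. ball p r \<inter> C = sector e f p r \<sigma> \<tau>" and \<sigma>: "\<sigma> \<in> {1, -1}" "\<tau> \<in> {1, -1}"
    and z: "z \<in> sector e f p r \<sigma> \<tau>" and R: "R \<in> regions D"
  shows "corner e f C R \<longleftrightarrow> z \<in> R"
proof -
  have whole: "sector e f p r \<sigma> \<tau> \<subseteq> R" if "y \<in> sector e f p r \<sigma> \<tau>" "y \<in> R" for y
    using components_maximal[of R "- K" "sector e f p r \<sigma> \<tau>"] R convex_connected[OF convex_sector[OF \<sigma>]] good_sector[OF r] that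
    unfolding regions_def K_def by blast
  show ?thesis
  proof
    assume "corner e f C R"
    then obtain p' s where s: "p' \<in> seg e \<inter> seg f" "s > 0" "ball p' s \<inter> C \<subseteq> R" unfolding corner_def by blast
    have "p' = p" using cross_point(3)[OF crossing_strands(4)[OF c] p] s(1) by blast
    then have sub: "sector e f p s \<sigma> \<tau> \<subseteq> R" using s(3) C by blast
    have "min r s > 0" using r s(2) by (simp add: good_def)
    then obtain y where "y \<in> sector e f p (min r s) \<sigma> \<tau>" using sector_nonempty[OF c p \<sigma>] by blast
    moreover have "sector e f p (min r s) \<sigma> \<tau> \<subseteq> sector e f p r \<sigma> \<tau>" "sector e f p (min r s) \<sigma> \<tau> \<subseteq> sector e f p s \<sigma> \<tau>"
      by (simp_all add: sector_mono)
    ultimately have "y \<in> sector e f p r \<sigma> \<tau>" "y \<in> R" using sub by blast+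
    then show "z \<in> R" using whole z by blast
  next
    assume "z \<in> R"
    then have "ball p r \<inter> C \<subseteq> R" using whole[OF z] C by blast
    then show "corner e f C R" using p r unfolding corner_def good_def by blast
  qed
qed

lemma pick_region:
  assumes "distinct rs" "set rs = regions D" "z \<notin> K"
  shows "(\<Sum>j<length rs. (q * of_bool (z \<in> rs ! j)) \<cdot> w j) = q \<cdot> w (idx rs z)"
proof -
  note i = idx[OF assms]
  have "(\<Sum>j<length rs. (q * of_bool (z \<in> rs ! j)) \<cdot> w j) = (\<Sum>j<length rs. if j = idx rs z then q \<cdot> w j else 0)"
    by (rule sum.cong) (use i(3) in auto)
  then show ?thesis using i(1) by simp
qed

text \<open>A region that occupies several corners collects several coefficients. Sorted by corners
  instead of regions, the sum has four terms, each with the label of the region of a sample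
  point.\<close>

lemma coefficient_sum:
  assumes c: "(e, f) \<in> crossings D" and p: "p \<in> seg e \<inter> seg f" and r: "good e f p r"
    and rs: "distinct rs" "set rs = regions D"
    and z: "z1 \<in> sector e f p r 1 (-1)" "z2 \<in> sector e f p r 1 1" "z3 \<in> sector e f p r (-1) 1" "z4 \<in> sector e f p r (-1) (-1)"
  shows "(\<Sum>j<length rs. coefficient (e, f) (rs ! j) \<cdot> w j) = 0 \<longleftrightarrow>
    alexander_relation (w (idx rs z1)) (w (idx rs z2)) (w (idx rs z3)) (w (idx rs z4))"
proof -
  have R: "rs ! j \<in> regions D" if "j < length rs" for j using rs(2) nth_mem that by blast
  note ci = corner_iff[OF c p r]
  have co: "coefficient (e, f) (rs ! j) = 1 * of_bool (z1 \<in> rs ! j) + x_gen * of_bool (z2 \<in> rs ! j)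
      + (x_gen * y_gen) * of_bool (z3 \<in> rs ! j) + y_gen * of_bool (z4 \<in> rs ! j)" if "j < length rs" for j
    unfolding coefficient_def prod.case
    using ci[OF sector_eq(1)[symmetric] _ _ z(1) R[OF that]] ci[OF sector_eq(2)[symmetric] _ _ z(2) R[OF that]]
      ci[OF sector_eq(3)[symmetric] _ _ z(3) R[OF that]] ci[OF sector_eq(4)[symmetric] _ _ z(4) R[OF that]] by simp
  have zK: "z1 \<notin> K" "z2 \<notin> K" "z3 \<notin> K" "z4 \<notin> K" using z good_sector[OF r] by blast+
  have "(\<Sum>j<length rs. coefficient (e, f) (rs ! j) \<cdot> w j) = 1 \<cdot> w (idx rs z1) + x_gen \<cdot> w (idx rs z2)
      + (x_gen * y_gen) \<cdot> w (idx rs z3) + y_gen \<cdot> w (idx rs z4)"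
    unfolding pick_region[OF rs zK(1), symmetric] pick_region[OF rs zK(2), symmetric]
      pick_region[OF rs zK(3), symmetric] pick_region[OF rs zK(4), symmetric]
    unfolding sum.distrib[symmetric]
    by (rule sum.cong) (simp_all only: co lessThan_iff presented.scale_left_distrib)
  then show ?thesis by (simp add: alexander_relation_def)
qed

lemma sectors_nonempty:
  assumes "(e, f) \<in> crossings D" "p \<in> seg e \<inter> seg f" "r > 0"
  obtains z1 z2 z3 z4 where "z1 \<in> sector e f p r 1 (-1)" "z2 \<in> sector e f p r 1 1"
    "z3 \<in> sector e f p r (-1) 1" "z4 \<in> sector e f p r (-1) (-1)"
  using sector_nonempty[OF assms(1,2) _ _ assms(3)] by (metis all_not_in_conv insertI1 insertI2)

lemma alexander_of_solution:
  assumes rs: "distinct rs" "set rs = regions D"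
    and w: "\<And>c. c \<in> crossings D \<Longrightarrow> (\<Sum>j<length rs. coefficient c (rs ! j) \<cdot> w j) = 0"
  shows "alexander D (\<lambda>z. w (idx rs z))"
  unfolding alexander_def
proof (intro conjI allI impI ballI)
  fix z assume "z \<notin> carrier_of (strands D)"
  then have z: "z \<notin> K" by (simp add: K_def)
  note i = idx[OF rs z]
  have "open (rs ! idx rs z)" "rs ! idx rs z \<inter> K = {}" using open_region region_subset i(1) rs(2) nth_mem by blast+
  then have "\<forall>\<^sub>F y in nhds z. y \<in> rs ! idx rs z \<and> y \<notin> K" using i(2) eventually_nhds by blast
  then show "\<forall>\<^sub>F y in nhds z. w (idx rs y) = w (idx rs z)"
  proof eventually_elim
    case (elim y)
    then show ?case using idx(3)[OF rs, of y "idx rs z"] i(1) by simp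
  qed
next
  fix c assume c: "c \<in> crossings D"
  obtain e f where ef: "c = (e, f)" by (cases c)
  show "case c of (e, f) \<Rightarrow> \<forall>p\<in>seg e \<inter> seg f. \<exists>r>0.
        \<forall>z1\<in>sector e f p r 1 (-1). \<forall>z2\<in>sector e f p r 1 1. \<forall>z3\<in>sector e f p r (-1) 1. \<forall>z4\<in>sector e f p r (-1) (-1).
        alexander_relation (w (idx rs z1)) (w (idx rs z2)) (w (idx rs z3)) (w (idx rs z4))"
    unfolding ef prod.case
  proof
    fix p assume p: "p \<in> seg e \<inter> seg f"
    obtain r where r: "good e f p r" using crossing_neighbourhood[OF c[unfolded ef] p] unfolding good_def by blast
    then show "\<exists>r>0. \<forall>z1\<in>sector e f p r 1 (-1). \<forall>z2\<in>sector e f p r 1 1. \<forall>z3\<in>sector e f p r (-1) 1. \<forall>z4\<in>sector e f p r (-1) (-1).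
        alexander_relation (w (idx rs z1)) (w (idx rs z2)) (w (idx rs z3)) (w (idx rs z4))"
      using coefficient_sum[OF c[unfolded ef] p r rs] w[OF c] unfolding ef good_def by blast
  qed
qed

lemma alexander_region:
  assumes a: "alexander D u" and rs: "distinct rs" "set rs = regions D" and z: "z \<notin> K"
  shows "u (SOME y. y \<in> rs ! idx rs z) = u z"
proof -
  note i = idx[OF rs z]
  have R: "rs ! idx rs z \<in> regions D" using i(1) rs(2) nth_mem by blast
  have "(SOME y. y \<in> rs ! idx rs z) \<in> rs ! idx rs z" using i(2) by (rule someI)
  then show ?thesis
    using locally_constant_on[OF _ connected_region[OF R] region_subset[OF R] _ i(2)] a
    unfolding alexander_def K_def by blast
qed

lemma solution_of_alexander:
  assumes a: "alexander D u" and rs: "distinct rs" "set rs = regions D" and c: "c \<in> crossings D"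
  shows "(\<Sum>j<length rs. coefficient c (rs ! j) \<cdot> u (SOME z. z \<in> rs ! j)) = 0"
proof -
  obtain e f where ef: "c = (e, f)" by (cases c)
  have cross: "cross e f" using crossing_strands(4) c ef by blast
  then obtain p where p: "p \<in> seg e \<inter> seg f" unfolding cross_def by blast
  obtain r where r: "good e f p r" using crossing_neighbourhood[OF c[unfolded ef] p] unfolding good_def by blast
  obtain s where s: "s > 0" "\<forall>z1\<in>sector e f p s 1 (-1). \<forall>z2\<in>sector e f p s 1 1. \<forall>z3\<in>sector e f p s (-1) 1. \<forall>z4\<in>sector e f p s (-1) (-1).
        alexander_relation (u z1) (u z2) (u z3) (u z4)"
    using a c p unfolding alexander_def ef by blast
  define t where "t = min r s"
  have t: "good e f p t" "t > 0" "t \<le> s" using r s(1) by (auto simp: good_def t_def)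
  obtain z1 z2 z3 z4 where z: "z1 \<in> sector e f p t 1 (-1)" "z2 \<in> sector e f p t 1 1"
    "z3 \<in> sector e f p t (-1) 1" "z4 \<in> sector e f p t (-1) (-1)"
    by (rule sectors_nonempty[OF c[unfolded ef] p t(2)])
  have rel: "alexander_relation (u z1) (u z2) (u z3) (u z4)" using s(2) z sector_mono[OF t(3)] by blast
  have "z1 \<notin> K" "z2 \<notin> K" "z3 \<notin> K" "z4 \<notin> K" using z good_sector[OF t(1)] by blast+
  then show ?thesis
    unfolding ef using coefficient_sum[OF c[unfolded ef] p t(1) rs z, of "\<lambda>j. u (SOME z. z \<in> rs ! j)"] rel by (simp add: alexander_region[OF a rs])
qed

text \<open>By \<open>index_crossing\<close> the degrees at the four corners follow the pattern of
  \<open>affine_relation\<close>, so the nonlinear and the linear crossing relation are equivalent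
  there.\<close>

lemma colouring_affine_iff:
  assumes k: "index D k" and C: "\<And>z. z \<notin> K \<Longrightarrow> C z = Affine (twist (k z) \<cdot> c z) (k z)"
  shows "colouring D C \<longleftrightarrow> alexander D c"
proof -
  have inj: "twist n \<cdot> a = twist n \<cdot> b \<longleftrightarrow> a = b" for n a b using twist_cancel(2)[of n] by metis
  have near: "(\<forall>\<^sub>F w in nhds z. C w = C z) \<longleftrightarrow> (\<forall>\<^sub>F w in nhds z. c w = c z)" if z: "z \<notin> K" for z
  proof -
    have 1: "\<forall>\<^sub>F w in nhds z. w \<in> - K" using z by (intro eventually_nhds_in_open) (auto simp: open_Compl)
    have "\<forall>\<^sub>F w in nhds z. k w = k z" using k z by (simp add: index_def K_def)
    with 1 have "\<forall>\<^sub>F w in nhds z. C w = C z \<longleftrightarrow> c w = c z"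
      by eventually_elim (use C z inj in auto)
    then show ?thesis by (rule eventually_cong) simp
  qed
  have corner: "(\<exists>r>0. \<forall>a\<in>sector e f p r 1 (-1). \<forall>b\<in>sector e f p r 1 1. \<forall>c\<in>sector e f p r (-1) 1. \<forall>d\<in>sector e f p r (-1) (-1).
        C a - C d = C b - C c) \<longleftrightarrow>
      (\<exists>r>0. \<forall>z1\<in>sector e f p r 1 (-1). \<forall>z2\<in>sector e f p r 1 1. \<forall>z3\<in>sector e f p r (-1) 1. \<forall>z4\<in>sector e f p r (-1) (-1).
        alexander_relation (c z1) (c z2) (c z3) (c z4))"
    if ef: "(e, f) \<in> crossings D" and p: "p \<in> seg e \<inter> seg f" for e f p
  proof -
    from index_crossing[OF k ef p] obtain r n where r: "r > 0" and n: "\<forall>\<sigma>\<in>{1,-1}. \<forall>\<tau>\<in>{1,-1}. \<forall>z\<in>sector e f p r \<sigma> \<tau>. z \<notin> K \<and>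
      k z = n + (if \<sigma> = 1 then 1 else 0) + (if \<tau> = 1 then 1 else 0)" by (elim exE conjE) (rule that)
    have val: "C z = Affine (twist (n + (if \<sigma> = 1 then 1 else 0) + (if \<tau> = 1 then 1 else 0)) \<cdot> c z) (n + (if \<sigma> = 1 then 1 else 0) + (if \<tau> = 1 then 1 else 0))"
      if "\<sigma> \<in> {1, -1}" "\<tau> \<in> {1, -1}" "z \<in> sector e f p r \<sigma> \<tau>" for \<sigma> \<tau> z
      using bspec[OF bspec[OF bspec[OF n that(1)] that(2)] that(3)] C by simp
    have eq: "C a - C d = C b - C c' \<longleftrightarrow> alexander_relation (c a) (c b) (c c') (c d)"
      if "a \<in> sector e f p r 1 (-1)" "b \<in> sector e f p r 1 1" "c' \<in> sector e f p r (-1) 1" "d \<in> sector e f p r (-1) (-1)" for a b c' d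
      using val[OF _ _ that(1)] val[OF _ _ that(2)] val[OF _ _ that(3)] val[OF _ _ that(4)] affine_relation[of n "c a" "c d" "c b" "c c'"]
      by simp
    show ?thesis
    proof
      assume *: "\<exists>r>0. \<forall>a\<in>sector e f p r 1 (-1). \<forall>b\<in>sector e f p r 1 1. \<forall>c\<in>sector e f p r (-1) 1. \<forall>d\<in>sector e f p r (-1) (-1).
        C a - C d = C b - C c"
      show "\<exists>r>0. \<forall>z1\<in>sector e f p r 1 (-1). \<forall>z2\<in>sector e f p r 1 1. \<forall>z3\<in>sector e f p r (-1) 1. \<forall>z4\<in>sector e f p r (-1) (-1).
        alexander_relation (c z1) (c z2) (c z3) (c z4)"
        by (rule sector_ball_mono[OF r _ *]) (rule eq[THEN iffD1])
    next
      assume *: "\<exists>r>0. \<forall>z1\<in>sector e f p r 1 (-1). \<forall>z2\<in>sector e f p r 1 1. \<forall>z3\<in>sector e f p r (-1) 1. \<forall>z4\<in>sector e f p r (-1) (-1).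
        alexander_relation (c z1) (c z2) (c z3) (c z4)"
      show "\<exists>r>0. \<forall>a\<in>sector e f p r 1 (-1). \<forall>b\<in>sector e f p r 1 1. \<forall>c\<in>sector e f p r (-1) 1. \<forall>d\<in>sector e f p r (-1) (-1).
        C a - C d = C b - C c"
        by (rule sector_ball_mono[OF r _ *]) (rule eq[THEN iffD2])
    qed
  qed
  show ?thesis
    unfolding colouring_def alexander_def sector_eq[symmetric]
  proof (intro conj_cong all_cong ball_cong refl)
    fix z assume "z \<notin> carrier_of (strands D)"
    then show "(\<forall>\<^sub>F w in nhds z. C w = C z) \<longleftrightarrow> (\<forall>\<^sub>F w in nhds z. c w = c z)" using near by (simp add: K_def)
  next
    fix x assume x: "x \<in> crossings D"
    obtain e f where ef: "x = (e, f)" by (cases x)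
    show "(case x of (e, f) \<Rightarrow> \<forall>p\<in>seg e \<inter> seg f. \<exists>r>0. \<forall>a\<in>sector e f p r 1 (-1). \<forall>b\<in>sector e f p r 1 1.
        \<forall>c\<in>sector e f p r (-1) 1. \<forall>d\<in>sector e f p r (-1) (-1). C a - C d = C b - C c) \<longleftrightarrow>
      (case x of (e, f) \<Rightarrow> \<forall>p\<in>seg e \<inter> seg f. \<exists>r>0. \<forall>z1\<in>sector e f p r 1 (-1). \<forall>z2\<in>sector e f p r 1 1.
        \<forall>z3\<in>sector e f p r (-1) 1. \<forall>z4\<in>sector e f p r (-1) (-1). alexander_relation (c z1) (c z2) (c z3) (c z4))"
      unfolding ef prod.case by (rule ball_cong[OF refl]) (rule corner[OF x[unfolded ef]])
  qed
qed

end

definition lift_colouring :: "(complex \<Rightarrow> int) \<Rightarrow> (complex \<Rightarrow> laurent presented) \<Rightarrow> complex \<Rightarrow> affine" where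
  "lift_colouring k c z = Affine (twist (k z) \<cdot> c z) (k z)"

definition unit :: "nat \<Rightarrow> nat \<Rightarrow> 'r::comm_ring_1" where
  "unit j i = of_bool (i = j)"

lemma sum_unit: "j < m \<Longrightarrow> (\<Sum>i<m. unit j i * a i) = a j" "j < m \<Longrightarrow> (\<Sum>i<m. a i * unit i j) = a j"
  by (simp_all add: unit_def of_bool_def if_distrib[of "\<lambda>x. x * _"] if_distrib[of "\<lambda>x. _ * x"] cong: if_cong)

section \<open>The correspondence of module-valued solutions\<close>

context isotopic_diagrams begin

lemma carried_cong:
  assumes "corresponds C C'" "\<And>z. z \<notin> A.K \<Longrightarrow> C1 z = C z" "\<And>z. z \<notin> B.K \<Longrightarrow> C1' z = C' z"
  shows "corresponds C1 C1'"
  using assms unfolding carried_def A.K_def B.K_def by metis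

definition matches :: "(complex \<Rightarrow> int) \<Rightarrow> (complex \<Rightarrow> int) \<Rightarrow> (complex \<Rightarrow> laurent presented) \<Rightarrow> (complex \<Rightarrow> laurent presented) \<Rightarrow> bool" where
  "matches k k' c c' \<longleftrightarrow> corresponds (lift_colouring k c) (lift_colouring k' c')"

text \<open>The affine colouring is transported. Taking degrees commutes with transport, so the
  degrees of the result are the index \<open>k'\<close>, and multiplication by \<open>twist\<close>
  can be undone.\<close>

lemma matches_exists:
  assumes k: "index D k" "corresponds k k'" and c: "alexander D c"
  shows "\<exists>c'. alexander D' c' \<and> matches k k' c c'"
proof -
  have "colouring D (lift_colouring k c)"
    using A.colouring_affine_iff[OF k(1), of "lift_colouring k c" c] c by (simp add: lift_colouring_def)
  then obtain C' where C': "colouring D' C'" "corresponds (lift_colouring k c) C'" using corresponds_exists by blast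
  have "corresponds (\<lambda>z. degree (lift_colouring k c z)) (\<lambda>z. degree (C' z))"
    by (rule corresponds_hom[OF C'(2) degree_add])
  then have "corresponds k (\<lambda>z. degree (C' z))" by (simp add: lift_colouring_def)
  then have deg: "degree (C' z) = k' z" if "z \<notin> B.K" for z using corresponds_unique[OF k(2) _ that] by simp
  define c' where "c' = (\<lambda>z. twist (- k' z) \<cdot> translation (C' z))"
  have eq: "C' z = lift_colouring k' c' z" if "z \<notin> B.K" for z
    using deg[OF that] by (cases "C' z") (simp add: lift_colouring_def c'_def del: presented.scale_scale)
  have "alexander D' c'"
    using B.colouring_affine_iff[OF corresponds_index[OF k(2,1)], of C' c'] C'(1) eq by (simp add: lift_colouring_def)
  moreover have "matches k k' c c'" unfolding matches_def by (rule carried_cong[OF C'(2)]) (simp_all add: eq)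
  ultimately show ?thesis by blast
qed

lemma matches_unique:
  assumes "matches k k' c c1" "matches k k' c c2" "z \<notin> B.K"
  shows "c1 z = c2 z"
proof -
  have "lift_colouring k' c1 z = lift_colouring k' c2 z" using corresponds_unique assms unfolding matches_def by blast
  then show ?thesis using twist_cancel(2)[of "k' z"] by (metis affine.inject lift_colouring_def)
qed

text \<open>Naturality: a linear map commutes with multiplication by \<open>xy\<close>, so it acts
  on the affine maps by a homomorphism.\<close>

lemma matches_map:
  assumes "matches k k' c c'" "linear_map \<phi>"
  shows "matches k k' (\<lambda>z. \<phi> (c z)) (\<lambda>z. \<phi> (c' z))"
  using corresponds_hom[OF assms(1)[unfolded matches_def] map_affine_add[OF assms(2)]] assms(2)
  by (simp add: matches_def lift_colouring_def[abs_def] map_affine_def linear_map_def)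

lemma matches_reverse: "isotopic_diagrams.matches D' L D H h' k' k c' c \<longleftrightarrow> matches k k' c c'"
proof -
  interpret R: isotopic_diagrams L' D' L D H0 H h' h by (rule reverse)
  show ?thesis unfolding R.matches_def matches_def by (rule carried_reverse)
qed

lemma matches_cong:
  assumes "matches k k' c c'" "\<And>z. z \<notin> B.K \<Longrightarrow> c1' z = c' z"
  shows "matches k k' c c1'"
  unfolding matches_def
  by (rule carried_cong[OF assms(1)[unfolded matches_def]]) (simp_all add: lift_colouring_def assms(2))

end

context projected_link begin

text \<open>The tautological solution: each region is labelled by its own generator, and the
  relations hold because they are the rows of the presentation.\<close>

lemma presentation_alexander:
  assumes rs: "distinct rs" "set rs = regions D" and cs: "set cs = crossings D"
  shows "alexander D (\<lambda>z. emb (length cs, length rs, \<lambda>i j. coefficient (cs ! i) (rs ! j)) (unit (idx rs z)))"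
proof (rule alexander_of_solution[OF rs, where w = "\<lambda>j. emb (length cs, length rs, \<lambda>i j. coefficient (cs ! i) (rs ! j)) (unit j)"])
  let ?p = "(length cs, length rs, \<lambda>i j. coefficient (cs ! i) (rs ! j))"
  fix c assume "c \<in> crossings D"
  then obtain i where i: "i < length cs" "c = cs ! i" using cs by (metis in_set_conv_nth)
  have "(\<Sum>j<length rs. coefficient c (rs ! j) \<cdot> emb ?p (unit j)) = emb ?p (\<lambda>l. \<Sum>j<length rs. coefficient c (rs ! j) * unit j l)"
    by (simp add: emb_sum emb_smul)
  also have "\<dots> = 0"
    unfolding emb_eq_0_iff relator_def using i by (intro exI[of _ "unit i"]) (simp add: sum_unit)
  finally show "(\<Sum>j<length rs. coefficient c (rs ! j) \<cdot> emb ?p (unit j)) = 0" .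
qed

lemma region_point:
  assumes rs: "distinct rs" "set rs = regions D" and j: "j < length rs"
  shows "(SOME z. z \<in> rs ! j) \<notin> K" "idx rs (SOME z. z \<in> rs ! j) = j"
proof -
  have R: "rs ! j \<in> regions D" using rs(2) j nth_mem by blast
  then have "rs ! j \<noteq> {}" unfolding regions_def by (rule in_components_nonempty)
  then have p: "(SOME z. z \<in> rs ! j) \<in> rs ! j" by (simp add: some_in_eq)
  then show K: "(SOME z. z \<in> rs ! j) \<notin> K" using region_subset[OF R] by blast
  show "idx rs (SOME z. z \<in> rs ! j) = j" using idx(3)[OF rs K j] p by simp
qed

end

context isotopic_diagrams begin

text \<open>The tautological solution \<open>u\<close> of \<open>D\<close> has a partner
  \<open>d'\<close> on \<open>D'\<close>, whose labels written in the generators of \<open>D\<close>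
  form the matrix \<open>V\<close>; the roles reversed, \<open>u'\<close> has the partner
  \<open>d\<close> with matrix \<open>W\<close>. Naturality under the linear map with matrix
  \<open>V\<close> shows that substituting \<open>V\<close> into \<open>W\<close> returns every
  generator of \<open>D\<close> modulo relations.\<close>

lemma minors_transfer:
  assumes M: "presentation_matrix D M" and M': "presentation_matrix D' M'"
    and size: "dim_row M + dim_col M' = dim_row M' + dim_col M"
    and dvd: "max_minors_dvd M g"
  shows "max_minors_dvd M' g"
proof -
  interpret R: isotopic_diagrams L' D' L D H0 H h' h by (rule reverse)
  obtain cs rs where cs: "set cs = crossings D" and rs: "distinct rs" "set rs = regions D"
    and M_eq: "M = mat (length cs) (length rs) (\<lambda>(i, j). coefficient (cs ! i) (rs ! j))"
    using M unfolding presentation_matrix_def by blast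
  obtain cs' rs' where cs': "set cs' = crossings D'" and rs': "distinct rs'" "set rs' = regions D'"
    and M'_eq: "M' = mat (length cs') (length rs') (\<lambda>(i, j). coefficient (cs' ! i) (rs' ! j))"
    using M' unfolding presentation_matrix_def by blast
  define n m n' m' where "n = length cs" and "m = length rs" and "n' = length cs'" and "m' = length rs'"
  define a where "a = (\<lambda>i j. coefficient (cs ! i) (rs ! j))"
  define a' where "a' = (\<lambda>i j. coefficient (cs' ! i) (rs' ! j))"
  define p p' where "p = (n, m, a)" and "p' = (n', m', a')"
  have pq: "fst p = n" "fst (snd p) = m" "snd (snd p) = a" "fst p' = n'" "fst (snd p') = m'" "snd (snd p') = a'"
    by (simp_all add: p_def p'_def)
  define u u' where "u = (\<lambda>z. emb p (unit (idx rs z)))" and "u' = (\<lambda>z. emb p' (unit (idx rs' z)))"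
  have u: "alexander D u" unfolding u_def p_def n_def m_def a_def by (rule A.presentation_alexander[OF rs cs])
  have u': "alexander D' u'" unfolding u'_def p'_def n'_def m'_def a'_def by (rule B.presentation_alexander[OF rs' cs'])
  obtain k where k: "index D k" using A.index_exists by blast
  obtain k' where kk': "corresponds k k'" using corresponds_exists[OF A.index_colouring[OF k]] by blast
  have k': "index D' k'" using corresponds_index[OF kk' k] .
  obtain d' where d': "alexander D' d'" "matches k k' u d'" using matches_exists[OF k kk' u] by blast
  obtain d where d: "alexander D d" "R.matches k' k u' d"
    using R.matches_exists[OF k' kk'[folded carried_reverse] u'] by blast
  define z z' where "z = (\<lambda>j. SOME y. y \<in> rs ! j)" and "z' = (\<lambda>j. SOME y. y \<in> rs' ! j)"
  have z: "z j \<notin> A.K" "idx rs (z j) = j" if "j < m" for j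
    using A.region_point[OF rs] that by (simp_all add: z_def m_def)
  have z': "z' j \<notin> B.K" "idx rs' (z' j) = j" if "j < m'" for j
    using B.region_point[OF rs'] that by (simp_all add: z'_def m'_def)
  define V W where "V = (\<lambda>j'. comp p (d' (z' j')))" and "W = (\<lambda>j. comp p' (d (z j)))"
  \<comment> \<open>\<open>u\<close> has its values in the factor of \<open>p\<close> and is
    unchanged by \<open>proj p\<close>; by naturality and uniqueness so is its partner
    \<open>d'\<close>, which therefore has coordinates with respect to \<open>p\<close>.\<close>
  have emb_V: "emb p (V j') = d' (z' j')" if "j' < m'" for j'
  proof -
    have "matches k k' u (\<lambda>z. proj p (d' z))"
      using matches_map[OF d'(2) linear_proj[of p]] by (simp add: u_def proj_emb)
    from matches_unique[OF this d'(2) z'(1)[OF that]] show ?thesis by (simp add: V_def proj_def)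
  qed
  have rows: "relator p (\<lambda>j. \<Sum>j'<m'. a' i' j' * V j' j)" if "i' < n'" for i'
  proof -
    have "cs' ! i' \<in> crossings D'" using that cs' nth_mem by (auto simp: n'_def)
    from B.solution_of_alexander[OF d'(1) rs' this]
    have "(\<Sum>j'<m'. a' i' j' \<cdot> d' (z' j')) = 0" by (simp add: a'_def m'_def z'_def)
    then have "emb p (\<lambda>j. \<Sum>j'<m'. a' i' j' * V j' j) = 0" by (simp add: emb_sum emb_smul emb_V)
    then show ?thesis by (simp only: emb_eq_0_iff)
  qed
  then have "\<forall>i'\<in>{..<n'}. \<exists>q. \<forall>j<m. (\<Sum>j'<m'. a' i' j' * V j' j) = (\<Sum>i<n. q i * a i j)"
    unfolding relator_def pq by blast
  from bchoice[OF this] obtain q where q: "\<And>i' j. i' < n' \<Longrightarrow> j < m \<Longrightarrow> (\<Sum>j'<m'. a' i' j' * V j' j) = (\<Sum>i<n. q i' i * a i j)"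
    by blast
  define \<phi> where "\<phi> = induced p' p V"
  have lin: "linear_map \<phi>" unfolding \<phi>_def by (rule linear_induced) (use rows in \<open>simp add: pq\<close>)
  have \<phi>_u': "\<phi> (u' y) = d' y" if y: "y \<notin> B.K" for y
  proof -
    note i = B.idx(1)[OF rs' y]
    have "\<phi> (u' y) = emb p (\<lambda>j. \<Sum>i<m'. unit (idx rs' y) i * V i j)"
      unfolding \<phi>_def u'_def by (subst induced_emb) (use rows in \<open>simp_all add: pq\<close>)
    also have "\<dots> = emb p (V (idx rs' y))" using i by (simp add: sum_unit m'_def)
    also have "\<dots> = d' y" using emb_V i B.alexander_region[OF d'(1) rs' y] by (simp add: m'_def z'_def)
    finally show ?thesis .
  qed
  \<comment> \<open>As \<phi> carries \<open>u'\<close> to \<open>d'\<close>, it carries the partner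
    \<open>d\<close> of \<open>u'\<close> to a partner of \<open>d'\<close>, and that is
    \<open>u\<close>.\<close>
  have \<phi>_d: "\<phi> (d y) = u y" if "y \<notin> A.K" for y
  proof -
    have "matches k k' d u'" using d(2) matches_reverse by blast
    from matches_map[OF this lin] have "matches k k' (\<lambda>z. \<phi> (d z)) d'"
      by (rule matches_cong) (simp add: \<phi>_u')
    then have "R.matches k' k d' (\<lambda>z. \<phi> (d z))" "R.matches k' k d' u" using d'(2) matches_reverse by blast+
    from R.matches_unique[OF this that] show ?thesis .
  qed
  have "relator p (\<lambda>l. unit j l - (\<Sum>i<m'. W j i * V i l))" if "j < m" for j
  proof -
    have "emb p (unit j) = emb p (\<lambda>l. \<Sum>i<m'. W j i * V i l)"
      using \<phi>_d[OF z(1)[OF that]] z(2)[OF that] by (simp add: \<phi>_def induced_def W_def u_def pq)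
    then show ?thesis by (simp only: emb_eq_iff)
  qed
  then have "\<forall>j\<in>{..<m}. \<exists>q. \<forall>l<m. unit j l - (\<Sum>i<m'. W j i * V i l) = (\<Sum>i<n. q i * a i l)"
    unfolding relator_def pq by blast
  from bchoice[OF this] obtain r where r: "\<And>j l. j < m \<Longrightarrow> l < m \<Longrightarrow> unit j l - (\<Sum>i<m'. W j i * V i l) = (\<Sum>i<n. r j i * a i l)"
    by blast
  let ?P = "mat m' m (\<lambda>(j', j). V j' j)" and ?P' = "mat m m' (\<lambda>(j, j'). W j j')"
  let ?Q = "mat n' n (\<lambda>(i', i). q i' i)" and ?Z = "mat m n (\<lambda>(j, i). r j i)"
  have M_mat: "M = mat n m (\<lambda>(i, j). a i j)" "M' = mat n' m' (\<lambda>(i, j). a' i j)"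
    unfolding M_eq M'_eq by (simp_all add: n_def m_def n'_def m'_def a_def a'_def)
  show ?thesis
  proof (rule max_minors_dvd_transfer[of M n m M' n' m' ?P ?P' ?Q ?Z])
    show "M' * ?P = ?Q * M"
      by (rule eq_matI) (auto simp: M_mat scalar_prod_def q atLeast0LessThan)
    show "1\<^sub>m m - ?P' * ?P = ?Z * M"
      by (rule eq_matI) (auto simp: M_mat scalar_prod_def r[symmetric] atLeast0LessThan unit_def)
    show "n + m' = n' + m" using size by (simp add: M_mat)
  qed (use dvd in \<open>simp_all add: M_mat\<close>)
qed

end

lemma (in projected_link) presentation_matrix_size:
  assumes "connected_diagram D" "presentation_matrix D M"
  shows "M \<in> carrier_mat (card (crossings D)) (card (crossings D) + 2)"
  using assms(2) card_regions[OF assms(1)] unfolding presentation_matrix_def by (auto simp: distinct_card[symmetric])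

lemma (in projected_link) presentation_matrix_exists:
  assumes "connected_diagram D"
  shows "\<exists>M. presentation_matrix D M"
proof -
  have "finite (crossings D)"
    by (rule finite_subset[of _ "strands D \<times> strands D"]) (use crossing_strands in auto)
  then obtain cs where "set cs = crossings D" "distinct cs" using finite_distinct_list by blast
  moreover obtain rs where "set rs = regions D" "distinct rs" using finite_distinct_list card_regions(1)[OF assms] by blast
  ultimately show ?thesis unfolding presentation_matrix_def by blast
qed

lemma is_gcd_of_cong:
  assumes "\<And>g. (\<forall>s\<in>S. g dvd s) \<longleftrightarrow> (\<forall>s\<in>T. g dvd s)"
  shows "is_gcd_of S = is_gcd_of T"
  using assms by (intro ext) (simp add: is_gcd_of_def)

theorem theorem2p6:
  fixes D D' :: diagram and L L' :: link
  assumes "is_diagram_of D L" and "is_diagram_of D' L'"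
    and "same_oriented_link L L'"
    and "connected_diagram D" and "connected_diagram D'"
  shows "\<exists>(l::int) (m::int) (\<epsilon>::laurent). \<epsilon> \<in> {1, -1} \<and>
    Delta D' = \<epsilon> * laurent_monom l m * Delta D"
proof -
  obtain H0 H h h' where "isotopic_diagrams L D L' D' H0 H h h'" using isotopic_diagrams_exist[OF assms(1-3)] by blast
  then interpret isotopic_diagrams L D L' D' H0 H h h' .
  interpret R: isotopic_diagrams L' D' L D H0 H h' h by (rule reverse)
  have eq: "is_gcd_of (two_column_minors M) = is_gcd_of (two_column_minors M')"
    if "presentation_matrix D M" "presentation_matrix D' M'" for M M'
  proof (rule is_gcd_of_cong)
    fix g
    note M = A.presentation_matrix_size[OF assms(4) that(1)] and M' = B.presentation_matrix_size[OF assms(5) that(2)]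
    have "max_minors_dvd M g \<longleftrightarrow> max_minors_dvd M' g"
      using minors_transfer[OF that] R.minors_transfer[OF that(2,1)] M M' by auto
    then show "(\<forall>s\<in>two_column_minors M. g dvd s) \<longleftrightarrow> (\<forall>s\<in>two_column_minors M'. g dvd s)"
      using max_minors_dvd_iff[OF M] max_minors_dvd_iff[OF M'] by blast
  qed
  \<comment> \<open>The matrices have the same common divisors of minors, so the two descriptions of
    a gcd coincide and the same element is chosen for both diagrams; the unit is 1.\<close>
  have "(\<exists>M. presentation_matrix D M \<and> is_gcd_of (two_column_minors M) g) \<longleftrightarrow>
      (\<exists>M. presentation_matrix D' M \<and> is_gcd_of (two_column_minors M) g)" for g
    using eq A.presentation_matrix_exists[OF assms(4)] B.presentation_matrix_exists[OF assms(5)] by metis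
  then have "Delta D' = 1 * laurent_monom 0 0 * Delta D" by (simp add: Delta_def laurent_monom_0)
  then show ?thesis by blast
qed

end
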